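(* Let $V$ be a $d$-dimensional vector space over a field $k$, let $x\in\operatorname{End}(V)$ be a nilpotent transformation of Jordan type $\lambda$, and let $\mu=(\mu_1,\ldots,\mu_n)$ and $\nu=(\nu_1,\ldots,\nu_m)$ be compositions of $d$. Let $T\in\mathcal{T}^{\mu}_\lambda$ and $T'\in\mathcal{T}^{\nu}_\lambda$ be semistandard tableaux, and let $C_{x,T}\subset\mathcal{F}^\mu_x$ and $C_{x,T'}\subset\mathcal{F}^\nu_x$ be the corresponding irreducible components. Then for generic $F\in C_{x,T}$ and $F'\in C_{x,T'}$ (that is, for $F$ in a suitable open dense subset of $C_{x,T}$ and $F'$ in a suitable open dense subset of $C_{x,T'}$), the relative position matrix $M(F,F')$ is the same as the matrix $M(T,T')$ that corresponds to the pair $(T,T')$ under the RSK correspondence.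
   Context: A composition of $d$ is a sequence $\mu=(\mu_1,\ldots,\mu_n)$ of positive integers with sum $d$. The variety of $n$-step flags of type $\mu$ is $\mathcal{F}^\mu=\{F=(0=F_0\subset F_1\subset\cdots\subset F_n=V)\mid \dim(F_i/F_{i-1})=\mu_i\}$, and $\mathcal{F}^\mu_x=\{F\in\mathcal{F}^\mu\mid x(F_i)\subset F_{i-1}\ \forall i\}$. The Jordan type of a nilpotent operator is the partition whose parts (row lengths of the Young diagram) are the sizes of the Jordan blocks in decreasing order. Semistandard tableaux: here a tableau is called semistandard if it is strictly increasing along rows and weakly increasing down columns. A tableau with entries in $\{1,\ldots,n\}$ has content $\mu=(\mu_1,\ldots,\mu_n)$ if the entry $i$ appears $\mu_i$ times. $\mathcal{T}^\mu_\lambda$ is the set of semistandard tableaux of shape $\lambda$ and content $\mu$. Components: for $F\in\mathcal{F}^\mu_x$, the Jordan types of the restrictions $x|_{F_1},x|_{F_2},\ldots,x|_{F_n}$ form an increasing sequence of Young diagrams; filling with $i$ the boxes added at step $i$ gives a tableau $t(F)\in\mathcal{T}^\mu_\lambda$. Set $\mathcal{F}_{x,T}=t^{-1}(T)$ and $C_{x,T}=\overline{\mathcal{F}_{x,T}}$. The $C_{x,T}$, $T\in\mathcal{T}^\mu_\lambda$, are the irreducible components of $\mathcal{F}^\mu_x$. Relative position: for $F\in\mathcal{F}^\mu$, $F'\in\mathcal{F}^\nu$, $M(F,F')$ is the matrix of nonnegative integers with entries $$M(F,F')_{ij}=\dim\left(\frac{F_i\cap F'_j}{F_i\cap F'_{j-1}+F_{i-1}\cap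 F'_j}\right);$$ it has row sums $\mu$ and column sums $\nu$. Matrices and arrays: a matrix $M$ of nonnegative integers with entry sum $d$ is identified with the two-rowed array $\omega=\begin{pmatrix}u(1)&\cdots&u(d)\\ w(1)&\cdots&w(d)\end{pmatrix}$ in which the column $\binom{i}{j}$ appears $M_{ji}$ times, ordered so that $u(1)\le\cdots\le u(d)$ and $w(k)\ge w(k+1)$ whenever $u(k)=u(k+1)$. RSK correspondence (the variant used here): starting from the empty tableau, insert $w(1),w(2),\ldots,w(d)$ successively by row bumping, with the convention that a new entry $z$ bumps the left-most entry of the row that is greater than or equal to $z$ (the bumped entry is then inserted in the next row in the same way; if no entry of the row is $\ge z$, then $z$ is added at the end of the row). In the recording tableau, the box added at the $k$-th step is filled with $u(k)$. This is a bijection from matrices of nonnegative integers to pairs of semistandard tableaux of the same shape, taking $\omega$ to (insertion tableau, recording tableau). $M(T,T')$ denotes the matrix (array) whose insertion tableau is $T$ and whose recording tableau is $T'$.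
   Formalization: The field k is assumed infinite (over a finite field the claim fails for k-rational flags, e.g. d=2, x=0, μ=ν=(1,1)), and "generic F and F'" is read with the open dense set of F' allowed to depend on F, as fixed open dense sets fail in the same example. *)

theory Defs
  imports "HOL-Analysis.Analysis"
begin

text \<open>
  The vector space \<open>V\<close> is a type \<open>'v\<close> with scalar multiplication
  \<open>smul :: 'k \<Rightarrow> 'v \<Rightarrow> 'v\<close>. A flag \<open>(F\<^sub>0, \<dots>, F\<^sub>n)\<close> is the list of its subspaces, \<open>F\<^sub>i = F ! i\<close>.
  Compositions, partitions and tableaux (lists of rows) are lists, hence \<open>\<mu>\<^sub>i = \<mu> ! (i - 1)\<close>.
\<close>

definition composition :: "nat \<Rightarrow> nat list \<Rightarrow> bool" where
  "composition d \<mu> \<longleftrightarrow> (\<forall>a\<in>set \<mu>. 0 < a) \<and> sum_list \<mu> = d"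

definition partition_shape :: "nat list \<Rightarrow> bool" where
  "partition_shape lam \<longleftrightarrow> (\<forall>a\<in>set lam. 0 < a) \<and> sorted_wrt (\<ge>) lam"

definition boxes :: "nat list \<Rightarrow> (nat \<times> nat) set" where
  "boxes lam = {(r, c). r < length lam \<and> c < lam ! r}"

text \<open>Strictly increasing along rows, weakly increasing down columns.\<close>

definition ssyt :: "nat list \<Rightarrow> nat list \<Rightarrow> nat list list set" where
  "ssyt lam \<mu> = {T. partition_shape lam \<and> map length T = lam
     \<and> (\<forall>(r, c)\<in>boxes lam. T ! r ! c \<in> {1..length \<mu>})
     \<and> (\<forall>r c. (r, c) \<in> boxes lam \<longrightarrow> (r, Suc c) \<in> boxes lam \<longrightarrow> T ! r ! c < T ! r ! Suc c)
     \<and> (\<forall>r c. (r, c) \<in> boxes lam \<longrightarrow> (Suc r, c) \<in> boxes lam \<longrightarrow> T ! r ! c \<le> T ! Suc r ! c)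
     \<and> (\<forall>i\<in>{1..length \<mu>}. count_list (concat T) i = \<mu> ! (i - 1))}"

definition nilpotent_endo :: "('k::field \<Rightarrow> 'v::ab_group_add \<Rightarrow> 'v) \<Rightarrow> ('v \<Rightarrow> 'v) \<Rightarrow> bool" where
  "nilpotent_endo smul x \<longleftrightarrow> Vector_Spaces.linear smul smul x \<and> (\<exists>N. \<forall>v. (x ^^ N) v = 0)"

text \<open>
  \<open>b\<close> is a Jordan basis of \<open>W\<close> for \<open>x\<close> restricted to \<open>W\<close>: its \<open>r\<close>-th row
  \<open>b r 0, \<dots>, b r (lam ! r - 1)\<close> spans a nilpotent Jordan block of size \<open>lam ! r\<close>.
\<close>

definition jordan_basis ::
    "('k::field \<Rightarrow> 'v::ab_group_add \<Rightarrow> 'v) \<Rightarrow> ('v \<Rightarrow> 'v) \<Rightarrow> 'v set \<Rightarrow> nat list \<Rightarrow> (nat \<Rightarrow> nat \<Rightarrow> 'v) \<Rightarrow> bool" where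
  "jordan_basis smul x W lam b \<longleftrightarrow>
     inj_on (\<lambda>(r, c). b r c) (boxes lam)
     \<and> \<not> module.dependent smul ((\<lambda>(r, c). b r c) ` boxes lam)
     \<and> module.span smul ((\<lambda>(r, c). b r c) ` boxes lam) = W
     \<and> (\<forall>(r, c)\<in>boxes lam. x (b r c) = (if c = 0 then 0 else b r (c - 1)))"

definition jordan_type ::
    "('k::field \<Rightarrow> 'v::ab_group_add \<Rightarrow> 'v) \<Rightarrow> ('v \<Rightarrow> 'v) \<Rightarrow> 'v set \<Rightarrow> nat list" where
  "jordan_type smul x W = (THE lam. partition_shape lam \<and> (\<exists>b. jordan_basis smul x W lam b))"

definition flags :: "('k::field \<Rightarrow> 'v::ab_group_add \<Rightarrow> 'v) \<Rightarrow> nat list \<Rightarrow> 'v set list set" where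
  "flags smul \<mu> = {F. length F = Suc (length \<mu>) \<and> F ! 0 = {0} \<and> F ! length \<mu> = UNIV
     \<and> (\<forall>i\<le>length \<mu>. module.subspace smul (F ! i))
     \<and> (\<forall>i\<in>{1..length \<mu>}. F ! (i - 1) \<subseteq> F ! i
          \<and> vector_space.dim smul (F ! i) = vector_space.dim smul (F ! (i - 1)) + \<mu> ! (i - 1))}"

definition spaltenstein ::
    "('k::field \<Rightarrow> 'v::ab_group_add \<Rightarrow> 'v) \<Rightarrow> ('v \<Rightarrow> 'v) \<Rightarrow> nat list \<Rightarrow> 'v set list set" where
  "spaltenstein smul x \<mu> =
     {F \<in> flags smul \<mu>. \<forall>i\<in>{1..length \<mu>}. x ` (F ! i) \<subseteq> F ! (i - 1)}"

text \<open>The box \<open>(r, c)\<close> is filled with the first step \<open>i\<close> at which it lies in the Jordan type of \<open>x\<close> on \<open>F\<^sub>i\<close>.\<close>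

definition flag_tableau ::
    "('k::field \<Rightarrow> 'v::ab_group_add \<Rightarrow> 'v) \<Rightarrow> ('v \<Rightarrow> 'v) \<Rightarrow> 'v set list \<Rightarrow> nat list list" where
  "flag_tableau smul x F =
     (let lam = jordan_type smul x (last F) in
      map (\<lambda>r. map (\<lambda>c. LEAST i. (r, c) \<in> boxes (jordan_type smul x (F ! i))) [0..<lam ! r])
        [0..<length lam])"

definition tableau_stratum ::
    "('k::field \<Rightarrow> 'v::ab_group_add \<Rightarrow> 'v) \<Rightarrow> ('v \<Rightarrow> 'v) \<Rightarrow> nat list \<Rightarrow> nat list list \<Rightarrow> 'v set list set" where
  "tableau_stratum smul x \<mu> T = {F \<in> spaltenstein smul x \<mu>. flag_tableau smul x F = T}"


text \<open>
  The Zariski topology on the flag variety, on \<open>'k\<close>-points: the flag variety is the homogeneous space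
  \<open>GL(V)/P\<close>, and it carries the quotient of the Zariski topology on the ordered bases (frames)
  of \<open>V\<close>, which form a \<open>GL(V)\<close>-torsor. Regular functions on frames are, up to powers of the
  determinant, the polynomials in the coordinates of the basis vectors; generating them by linear
  forms avoids choosing a basis of \<open>V\<close>.
\<close>

inductive polyfun :: "('k::field \<Rightarrow> 'v::ab_group_add \<Rightarrow> 'v) \<Rightarrow> nat \<Rightarrow> ('v list \<Rightarrow> 'k) \<Rightarrow> bool"
  for smul :: "'k::field \<Rightarrow> 'v::ab_group_add \<Rightarrow> 'v" and d :: nat where
  const: "polyfun smul d (\<lambda>vs. a)"
| coord: "Vector_Spaces.linear smul (*) \<phi> \<Longrightarrow> i < d \<Longrightarrow> polyfun smul d (\<lambda>vs. \<phi> (vs ! i))"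
| add: "polyfun smul d p \<Longrightarrow> polyfun smul d q \<Longrightarrow> polyfun smul d (\<lambda>vs. p vs + q vs)"
| mult: "polyfun smul d p \<Longrightarrow> polyfun smul d q \<Longrightarrow> polyfun smul d (\<lambda>vs. p vs * q vs)"

definition frames :: "('k::field \<Rightarrow> 'v::ab_group_add \<Rightarrow> 'v) \<Rightarrow> nat \<Rightarrow> 'v list set" where
  "frames smul d = {vs. length vs = d \<and> distinct vs
     \<and> \<not> module.dependent smul (set vs) \<and> module.span smul (set vs) = UNIV}"

definition frame_topology :: "('k::field \<Rightarrow> 'v::ab_group_add \<Rightarrow> 'v) \<Rightarrow> nat \<Rightarrow> 'v list topology" where
  "frame_topology smul d =
     topology_generated_by {{vs \<in> frames smul d. p vs \<noteq> 0} |p. polyfun smul d p}"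

definition frame_flag ::
    "('k::field \<Rightarrow> 'v::ab_group_add \<Rightarrow> 'v) \<Rightarrow> nat list \<Rightarrow> 'v list \<Rightarrow> 'v set list" where
  "frame_flag smul \<mu> vs =
     map (\<lambda>i. module.span smul (set (take (sum_list (take i \<mu>)) vs))) [0..<Suc (length \<mu>)]"

definition flag_topology ::
    "('k::field \<Rightarrow> 'v::ab_group_add \<Rightarrow> 'v) \<Rightarrow> nat list \<Rightarrow> 'v set list topology" where
  "flag_topology smul \<mu> = topology (\<lambda>S. S \<subseteq> flags smul \<mu> \<and>
     openin (frame_topology smul (sum_list \<mu>))
       {vs \<in> frames smul (sum_list \<mu>). frame_flag smul \<mu> vs \<in> S})"

lemma openin_flag_topology:
  "openin (flag_topology smul \<mu>) S \<longleftrightarrow> S \<subseteq> flags smul \<mu> \<and>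
     openin (frame_topology smul (sum_list \<mu>))
       {vs \<in> frames smul (sum_list \<mu>). frame_flag smul \<mu> vs \<in> S}"
proof -
  let ?X = "frame_topology smul (sum_list \<mu>)"
  let ?pre = "\<lambda>S. {vs \<in> frames smul (sum_list \<mu>). frame_flag smul \<mu> vs \<in> S}"
  have "istopology (\<lambda>S. S \<subseteq> flags smul \<mu> \<and> openin ?X (?pre S))"
    unfolding istopology_def
  proof (intro conjI allI impI)
    fix S T
    assume S: "S \<subseteq> flags smul \<mu> \<and> openin ?X (?pre S)" and T: "T \<subseteq> flags smul \<mu> \<and> openin ?X (?pre T)"
    have "?pre (S \<inter> T) = ?pre S \<inter> ?pre T" by auto
    then show "openin ?X (?pre (S \<inter> T))" using S T by (simp only:) blast
    show "S \<inter> T \<subseteq> flags smul \<mu>" using S by blast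
  next
    fix K
    assume K: "\<forall>S\<in>K. S \<subseteq> flags smul \<mu> \<and> openin ?X (?pre S)"
    have "?pre (\<Union>K) = \<Union>(?pre ` K)" by auto
    then show "openin ?X (?pre (\<Union>K))" using K by (simp only:) blast
    show "\<Union>K \<subseteq> flags smul \<mu>" using K by blast
  qed
  then show ?thesis
    by (simp add: flag_topology_def topology_inverse')
qed

definition component ::
    "('k::field \<Rightarrow> 'v::ab_group_add \<Rightarrow> 'v) \<Rightarrow> ('v \<Rightarrow> 'v) \<Rightarrow> nat list \<Rightarrow> nat list list \<Rightarrow> 'v set list set" where
  "component smul x \<mu> T =
     subtopology (flag_topology smul \<mu>) (spaltenstein smul x \<mu>) closure_of (tableau_stratum smul x \<mu> T)"

definition generically :: "'a topology \<Rightarrow> 'a set \<Rightarrow> ('a \<Rightarrow> bool) \<Rightarrow> bool" where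
  "generically X C P \<longleftrightarrow>
     (\<exists>U. openin (subtopology X C) U \<and> subtopology X C closure_of U = C \<and> (\<forall>F\<in>U. P F))"


text \<open>
  Matrices are indexed by \<open>{1..n} \<times> {1..m}\<close> and extended by \<open>0\<close>. In the relative position, the
  dimension of the quotient is the difference of the dimensions.
\<close>

definition rel_position ::
    "('k::field \<Rightarrow> 'v::ab_group_add \<Rightarrow> 'v) \<Rightarrow> 'v set list \<Rightarrow> 'v set list \<Rightarrow> nat \<Rightarrow> nat \<Rightarrow> nat" where
  "rel_position smul F F' i j =
     (if i \<in> {1..<length F} \<and> j \<in> {1..<length F'}
      then vector_space.dim smul (F ! i \<inter> F' ! j)
         - vector_space.dim smul {a + b |a b. a \<in> F ! i \<inter> F' ! (j - 1) \<and> b \<in> F ! (i - 1) \<inter> F' ! j}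
      else 0)"

text \<open>
  The columns \<open>(u, w)\<close> of the array of an \<open>n \<times> m\<close> matrix \<open>M\<close>: \<open>u\<close> is the column index of \<open>M\<close> and
  increases weakly; for equal \<open>u\<close>, the row index \<open>w\<close> decreases weakly.
\<close>

definition matrix_array :: "nat \<Rightarrow> nat \<Rightarrow> (nat \<Rightarrow> nat \<Rightarrow> nat) \<Rightarrow> (nat \<times> nat) list" where
  "matrix_array n m M =
     concat (map (\<lambda>u. concat (map (\<lambda>w. replicate (M w u) (u, w)) (rev [1..<Suc n]))) [1..<Suc m])"

text \<open>
  Row insertion of \<open>z\<close>, bumping the left-most entry \<open>\<ge> z\<close>;
  \<open>insertion_row\<close> is the index of the row in which the new box appears.
\<close>

fun row_insert :: "nat \<Rightarrow> nat list list \<Rightarrow> nat list list" where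
  "row_insert z [] = [[z]]"
| "row_insert z (R # Rs) =
     (case dropWhile (\<lambda>y. y < z) R of
        [] \<Rightarrow> (R @ [z]) # Rs
      | y # ys \<Rightarrow> (takeWhile (\<lambda>y. y < z) R @ z # ys) # row_insert y Rs)"

fun insertion_row :: "nat \<Rightarrow> nat list list \<Rightarrow> nat" where
  "insertion_row z [] = 0"
| "insertion_row z (R # Rs) =
     (case dropWhile (\<lambda>y. y < z) R of [] \<Rightarrow> 0 | y # ys \<Rightarrow> Suc (insertion_row y Rs))"

definition add_entry :: "nat \<Rightarrow> nat \<Rightarrow> nat list list \<Rightarrow> nat list list" where
  "add_entry r a Q = (if r < length Q then Q[r := Q ! r @ [a]] else Q @ [[a]])"

definition rsk :: "(nat \<times> nat) list \<Rightarrow> nat list list \<times> nat list list" where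
  "rsk \<omega> = foldl (\<lambda>(P, Q) (u, w). (row_insert w P, add_entry (insertion_row w P) u Q)) ([], []) \<omega>"

definition rsk_matrix :: "nat \<Rightarrow> nat \<Rightarrow> nat list list \<Rightarrow> nat list list \<Rightarrow> nat \<Rightarrow> nat \<Rightarrow> nat" where
  "rsk_matrix n m T T' =
     (THE M. (\<forall>i j. \<not> (i \<in> {1..n} \<and> j \<in> {1..m}) \<longrightarrow> M i j = 0) \<and> rsk (matrix_array n m M) = (T, T'))"

end

theory Submission
  imports Defs "HOL-Computational_Algebra.Polynomial"
begin

text \<open>
  Everything is expressed through column lengths. Columns are counted from \<open>0\<close>. For a subspace
  \<open>U\<close> that is stable under \<open>x\<close>, the number of Jordan blocks of size greater than \<open>c\<close> of \<open>x\<close> on \<open>U\<close>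
  is the dimension of \<open>x\<^sup>c (U \<inter> ker x\<^sup>c\<^sup>+\<^sup>1)\<close>; a tableau is recorded by the lengths of the
  columns of its subtableaux of entries \<open>\<le> i\<close>. A flag \<open>F\<close> with \<open>x F\<^sub>i \<subseteq> F\<^sub>i\<^sub>-\<^sub>1\<close> lies in
  the stratum of \<open>T\<close> if and only if both families of numbers agree (\<open>flag_tableau_iff\<close>).

  The core is a statement about a word \<open>w\<close> of length \<open>d\<close> with insertion tableau \<open>P\<close>. Let \<open>F\<close> be a
  flag in the stratum of \<open>P\<close>, and let \<open>F'\<close> be a complete flag such that the type of \<open>x\<close> on \<open>F'\<^sub>k\<close>
  is the shape of the insertion tableau of the first \<open>k\<close> letters. Then the dimension of \<open>F\<^sub>i \<inter> F'\<^sub>k\<close>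
  is at least the number of letters \<open>\<le> i\<close> among the first \<open>k\<close> (\<open>lower_bound\<close>), and some pair attains
  all these bounds at once (\<open>exists_generic_pair\<close>).

  Both parts are proved by removing the last letter \<open>z\<close>, that is, by passing from \<open>V\<close> to the
  hyperplane \<open>A = F'\<^sub>d\<^sub>-\<^sub>1\<close>. If \<open>F\<^sub>i\<close> is not contained in \<open>A\<close>, the types of \<open>F\<^sub>i\<close>
  and \<open>F\<^sub>i \<inter> A\<close> differ by one box, in the least column \<open>c\<close> such that \<open>F\<^sub>i \<inter> ker x\<^sup>c\<^sup>+\<^sup>1\<close> is not contained in \<open>A\<close>. Inequalities between
  the columns of \<open>P\<close> show that this column is never to the left of the column of the box by which
  the insertion of \<open>z\<close> enlarges the subtableau of entries \<open>\<le> i\<close> (\<open>flag_J_bound\<close>), and an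
  automorphism that commutes with \<open>x\<close> moves \<open>F\<close> to a flag for which the two columns agree
  (\<open>flag_general_position\<close>). For such a flag, \<open>F \<inter> A\<close> lies in the stratum of the tableau of the
  shortened word, and induction applies. For the existence of a minimal pair, the minimal pair on \<open>A\<close>
  is extended to \<open>V\<close> by one vector; this requires changing the value of \<open>x\<close> at this vector, but the new
  operator has the same type and is conjugate to \<open>x\<close>.

  To pass from a special flag to a generic one, and to impose several open conditions at once, any
  two flags of the same stratum are joined by a polynomial curve, almost all of whose points are
  flags of this stratum (\<open>connect\<close>): two flags differ by an automorphism \<open>h\<close> commuting with \<open>x\<close>,
  up to a change inside \<open>F\<^sub>n\<^sub>-\<^sub>1\<close>, and \<open>(1 - s) + s h\<close> is invertible for almost all \<open>s\<close>. Over an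
  infinite field, finitely many conditions that each hold for almost all \<open>s\<close> hold together for some
  \<open>s\<close>.

  For an array with insertion tableau \<open>T\<close> and recording tableau \<open>T'\<close>, a flag in the stratum of \<open>T'\<close>
  is refined to a complete flag of the above kind, block by block: within a block of equal upper
  entries the letters decrease weakly, so the new boxes move weakly to the left
  (\<open>refine_descending_block\<close>). Hence the dimension of \<open>F\<^sub>i \<inter> F'\<^sub>j\<close> is bounded below by the
  sum of the entries of the matrix in the rows \<open>\<le> i\<close> and the columns \<open>\<le> j\<close>, with equality for some
  pair of flags. Since these dimensions are upper semicontinuous and since the curves make the strata
  irreducible, equality holds for generic flags, and equality of all these dimensions is equality of
  the relative position with the matrix. The same two facts show that the array of a pair of tableaux
  is unique.
\<close>

section \<open>Row insertion, column by column\<close>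

text \<open>
  The length of column \<open>c\<close> of the subtableau of entries \<open>\<le> i\<close>. A tableau is determined by these
  numbers, and they are what the Jordan types of the members of a flag are compared with.
\<close>

definition col_upto :: "nat list list \<Rightarrow> nat \<Rightarrow> nat \<Rightarrow> nat" where
  "col_upto P i c = length (filter (\<lambda>R. c < length (filter (\<lambda>y. y \<le> i) R)) P)"

lemma col_upto_Nil [simp]: "col_upto [] i c = 0"
  by (simp add: col_upto_def)

lemma col_upto_Cons [simp]:
  "col_upto (R # Rs) i c = (if c < length (filter (\<lambda>y. y \<le> i) R) then 1 else 0) + col_upto Rs i c"
  by (simp add: col_upto_def)

definition below :: "nat list \<Rightarrow> nat list \<Rightarrow> bool" where
  "below R S \<longleftrightarrow> length S \<le> length R \<and> (\<forall>c<length S. R ! c \<le> S ! c)"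

text \<open>
  Semistandardness (rows strict, columns weak) in a form that follows the recursion of
  \<open>row_insert\<close> on the list of rows; \<open>tableau_nth\<close> is the version with indices.
\<close>

fun tableau :: "nat list list \<Rightarrow> bool" where
  "tableau [] = True"
| "tableau (R # Rs) = (R \<noteq> [] \<and> sorted_wrt (<) R \<and> (Rs \<noteq> [] \<longrightarrow> below R (hd Rs)) \<and> tableau Rs)"

lemma row_split [consumes 1]:
  assumes "sorted_wrt (<) (R::nat list)"
  obtains (last) "dropWhile (\<lambda>y. y < z) R = []" "\<forall>a\<in>set R. a < z"
  | (bump) A y B where "R = A @ y # B" "takeWhile (\<lambda>y. y < z) R = A" "dropWhile (\<lambda>y. y < z) R = y # B"
      "\<forall>a\<in>set A. a < z" "z \<le> y" "\<forall>b\<in>set B. y < b"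
proof (cases "dropWhile (\<lambda>y. y < z) R")
  case Nil
  then show ?thesis using last by (simp add: dropWhile_eq_Nil_conv)
next
  case (Cons y B)
  let ?A = "takeWhile (\<lambda>y. y < z) R"
  have R: "R = ?A @ y # B" using Cons takeWhile_dropWhile_id[of "\<lambda>y. y < z" R] by simp
  moreover have "\<forall>a\<in>set ?A. a < z" using set_takeWhileD by fast
  moreover have "z \<le> y" using Cons hd_dropWhile[of "\<lambda>y. y < z" R] by simp
  moreover have "\<forall>b\<in>set B. y < b" using assms by (subst (asm) R) (simp add: sorted_wrt_append)
  ultimately show ?thesis using bump Cons by blast
qed

lemma dropWhile_all [simp]: "\<forall>a\<in>set R. P a \<Longrightarrow> dropWhile P R = []"
  by (simp add: dropWhile_eq_Nil_conv)

lemma takeWhile_all [simp]: "\<forall>a\<in>set R. P a \<Longrightarrow> takeWhile P R = R"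
  by (simp add: takeWhile_eq_all_conv)

lemma filter_le_all: "\<forall>a\<in>set A. a < z \<Longrightarrow> z \<le> Suc i \<Longrightarrow> filter (\<lambda>y. y \<le> i) A = (A::nat list)"
  by (induction A) auto

lemma filter_le_none: "\<forall>a\<in>set A. i < a \<Longrightarrow> filter (\<lambda>y. y \<le> i) A = ([]::nat list)"
  by (induction A) auto

lemma filter_le_Suc:
  "sorted_wrt (<) R \<Longrightarrow> length (filter (\<lambda>y. y \<le> Suc i) (R::nat list)) \<le> Suc (length (filter (\<lambda>y. y \<le> i) R))"
proof (induction R)
  case (Cons a R)
  show ?case
  proof (cases "a = Suc i")
    case True
    then have "filter (\<lambda>y. y \<le> Suc i) R = []" using Cons.prems by (intro filter_le_none) auto
    then show ?thesis using True by simp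
  qed (use Cons in auto)
qed simp

lemma filter_less_eq: "length (filter (\<lambda>y. y \<le> i) (R::nat list)) \<le> length R" by simp

lemma less_length_filter_le:
  assumes "sorted_wrt (<) (T::nat list)"
  shows "c < length (filter (\<lambda>y. y \<le> i) T) \<longleftrightarrow> c < length T \<and> T ! c \<le> i"
  using assms
proof (induction T arbitrary: c)
  case (Cons a T)
  then show ?case
  proof (cases "a \<le> i")
    case False
    then have "filter (\<lambda>y. y \<le> i) T = []" using Cons.prems by (intro filter_le_none) auto
    moreover have "\<not> (a # T) ! c \<le> i" if "c < length (a # T)"
      using False Cons.prems that nth_mem[of c "a # T"] by (auto simp del: nth_mem)
    ultimately show ?thesis using False by auto
  next
    case True
    then show ?thesis using Cons by (cases c) auto
  qed
qed simp

text \<open>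
  Insertion of \<open>z \<le> i\<close> enlarges the subtableau of entries \<open>\<le> i\<close> by one box; this is its column.
  The box lies in the row where the bumping path leaves the subtableau, because the bumped
  entry is greater than \<open>i\<close> or absent.
\<close>

fun new_col :: "nat \<Rightarrow> nat list list \<Rightarrow> nat \<Rightarrow> nat" where
  "new_col z [] i = 0"
| "new_col z (R # Rs) i = (case dropWhile (\<lambda>y. y < z) R of [] \<Rightarrow> length R
     | y # ys \<Rightarrow> if y \<le> i then new_col y Rs i else length (takeWhile (\<lambda>y. y < z) R))"

lemma col_upto_row_insert_less:
  "tableau P \<Longrightarrow> i < z \<Longrightarrow> col_upto (row_insert z P) i c = col_upto P i c"
proof (induction P arbitrary: z)
  case (Cons R Rs)
  then have s: "sorted_wrt (<) R" and "tableau Rs" by auto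
  from s show ?case
    by (cases rule: row_split[of R z]) (use Cons in \<open>auto\<close>)
qed auto

text \<open>
  As long as the bumped entry is at most \<open>i\<close>, the number of entries \<open>\<le> i\<close> of its row is unchanged and
  the path goes on; below the row where it leaves the subtableau, only entries greater than \<open>i\<close> move.
\<close>

lemma col_upto_row_insert_ge:
  "tableau P \<Longrightarrow> z \<le> i \<Longrightarrow> col_upto (row_insert z P) i c = col_upto P i c + (if c = new_col z P i then 1 else 0)"
proof (induction P arbitrary: z)
  case (Cons R Rs)
  then have s: "sorted_wrt (<) R" and "tableau Rs" by auto
  from s show ?case
  proof (cases rule: row_split[of R z])
    case last
    then show ?thesis using filter_le_all[of R z i] \<open>z \<le> i\<close> by auto
  next
    case (bump A y B)
    show ?thesis
    proof (cases "y \<le> i")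
      case True
      then show ?thesis using bump Cons by auto
    next
      case False
      then have B: "filter (\<lambda>y. y \<le> i) B = []" using bump by (intro filter_le_none) auto
      have A: "filter (\<lambda>y. y \<le> i) A = A" using bump \<open>z \<le> i\<close> by (intro filter_le_all) auto
      from False have "i < y" by simp
      then show ?thesis using bump A B col_upto_row_insert_less[OF \<open>tableau Rs\<close> \<open>i < y\<close>] \<open>z \<le> i\<close> by auto
    qed
  qed
qed auto

lemma takeWhile_below:
  assumes "below (A @ y # B) S" "\<forall>a\<in>set A. a < y" "sorted_wrt (<) S"
  shows "length (takeWhile (\<lambda>a. a < y) S) \<le> length A"
proof (rule ccontr)
  let ?T = "takeWhile (\<lambda>a. a < y) S"
  assume "\<not> ?thesis"
  then have l: "length A < length ?T" by simp
  then have "?T ! length A \<in> set ?T" by (rule nth_mem)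
  moreover have "?T ! length A = S ! length A" using l by (rule takeWhile_nth)
  ultimately have "S ! length A < y" using set_takeWhileD by metis
  moreover have "y \<le> S ! length A"
    using assms(1) l length_takeWhile_le[of "\<lambda>a. a < y" S] unfolding below_def
    by (metis nth_append_length order_less_le_trans)
  ultimately show False by simp
qed

text \<open>
  The bumping path moves weakly to the left: an entry bumped from column \<open>p\<close> is at most the entry
  below it, hence it is inserted in a column \<open>\<le> p\<close> of the next row.
\<close>

lemma new_col_le_pos: "tableau (R # Rs) \<Longrightarrow> new_col z (R # Rs) i \<le> length (takeWhile (\<lambda>a. a < z) R)"
proof (induction Rs arbitrary: R z)
  case Nil
  then have "sorted_wrt (<) R" by simp
  then show ?case by (cases rule: row_split[of R z]) (auto simp: takeWhile_eq_all_conv[THEN iffD2])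
next
  case (Cons S Ss)
  then have "sorted_wrt (<) R" by auto
  then show ?case
  proof (cases rule: row_split[of R z])
    case last
    then show ?thesis by (auto simp: takeWhile_eq_all_conv[THEN iffD2])
  next
    case (bump A y B)
    have "length (takeWhile (\<lambda>a. a < y) S) \<le> length A"
      by (rule takeWhile_below[of A y B]) (use bump Cons.prems in auto)
    moreover have "new_col y (S # Ss) i \<le> length (takeWhile (\<lambda>a. a < y) S)"
      by (rule Cons.IH) (use Cons.prems in auto)
    ultimately show ?thesis using bump by auto
  qed
qed

lemma new_col_bumped_le:
  assumes "tableau ((A @ y # B) # Rs)" "\<forall>a\<in>set A. a < y"
  shows "new_col y Rs i \<le> length A"
proof (cases Rs)
  case (Cons S Ss)
  have "length (takeWhile (\<lambda>a. a < y) S) \<le> length A"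
    by (rule takeWhile_below[of A y B]) (use assms Cons in auto)
  then show ?thesis using new_col_le_pos[of S Ss y i] assms Cons by simp
qed simp

text \<open>
  In each row, the insertion adds at most one to the number of entries \<open>\<le> Suc i\<close>, and when it does,
  the row has no entry \<open>Suc i\<close> of its own; in any case there are at most one more of them afterwards
  than there were entries \<open>\<le> i\<close> before. Rows that contribute to column \<open>Suc c\<close> on the left therefore
  contribute to column \<open>c\<close> on the right.
\<close>

lemma col_upto_row_insert_Suc:
  "tableau P \<Longrightarrow> 0 < z \<Longrightarrow> col_upto (row_insert z P) (Suc i) (Suc c) \<le> col_upto P i c"
proof (induction P arbitrary: z)
  case (Cons R Rs)
  then have s: "sorted_wrt (<) R" and t: "tableau Rs" by auto
  note * = filter_le_Suc[OF s, of i]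
  from s show ?case
  proof (cases rule: row_split[of R z])
    case last
    \<comment> \<open>the rows below are unchanged\<close>
    have "col_upto Rs (Suc i) (Suc c) \<le> col_upto Rs i c"
      using t
    proof (induction Rs)
      case (Cons S Rs)
      then show ?case using filter_le_Suc[of S i] by (auto simp: le_Suc_eq)
    qed auto
    moreover have "length (filter (\<lambda>y. y \<le> Suc i) (R @ [z])) \<le> Suc (length (filter (\<lambda>y. y \<le> i) R))"
      using * filter_le_all[of R z i] last by (cases "z \<le> Suc i") auto
    ultimately show ?thesis using last by auto
  next
    case (bump A y B)
    have "length (filter (\<lambda>y. y \<le> Suc i) (A @ z # B)) \<le> Suc (length (filter (\<lambda>y. y \<le> i) R))"
    proof (cases "z \<le> Suc i \<and> \<not> y \<le> Suc i")
      case True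
      then have "filter (\<lambda>y. y \<le> Suc i) B = []" using bump by (intro filter_le_none) auto
      moreover have "filter (\<lambda>y. y \<le> Suc i) A = A" "filter (\<lambda>y. y \<le> i) A = A"
        using True bump by (auto intro!: filter_le_all)
      ultimately show ?thesis using True bump by auto
    next
      case False
      then show ?thesis using * bump by auto
    qed
    moreover have "col_upto (row_insert y Rs) (Suc i) (Suc c) \<le> col_upto Rs i c"
      using Cons.IH[of y] Cons.prems t bump by auto
    ultimately show ?thesis using bump by auto
  qed
qed auto

lemma new_col_antimono: "tableau P \<Longrightarrow> z \<le> i \<Longrightarrow> new_col z P (Suc i) \<le> new_col z P i"
proof (induction P arbitrary: z)
  case (Cons R Rs)
  then have s: "sorted_wrt (<) R" and t: "tableau Rs" by auto
  from s show ?case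
  proof (cases rule: row_split[of R z])
    case (bump A y B)
    then have "new_col y Rs (Suc i) \<le> length A"
      using new_col_bumped_le[of A y B Rs] Cons.prems by fastforce
    then show ?thesis using bump Cons t by auto
  qed auto
qed auto

lemma col_upto_eq_0:
  "tableau P \<Longrightarrow> (P \<noteq> [] \<Longrightarrow> length (filter (\<lambda>y. y \<le> i) (hd P)) \<le> c) \<Longrightarrow> col_upto P i c = 0"
proof (induction P)
  case (Cons R Rs)
  have "length (filter (\<lambda>y. y \<le> i) (hd Rs)) \<le> c" if "Rs \<noteq> []"
  proof (rule ccontr)
    let ?S = "hd Rs"
    assume n: "\<not> ?thesis"
    have sR: "sorted_wrt (<) R" and sS: "sorted_wrt (<) ?S" and bl: "below R ?S"
      using Cons.prems that by (auto simp: neq_Nil_conv)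
    have "c < length (filter (\<lambda>y. y \<le> i) ?S)" using n by simp
    then have "c < length ?S" "?S ! c \<le> i" by (simp_all only: less_length_filter_le[OF sS])
    then have "c < length R" "R ! c \<le> i" using bl by (auto simp: below_def intro: order.trans)
    then have "c < length (filter (\<lambda>y. y \<le> i) R)" by (simp only: less_length_filter_le[OF sR])
    then show False using Cons.prems(2) by simp
  qed
  then show ?case using Cons by auto
qed simp

text \<open>
  The case where the inserted letter \<open>Suc i\<close> is the new threshold. As long as it bumps other letters
  \<open>Suc i\<close>, each row ends its entries \<open>\<le> Suc i\<close> with one \<open>Suc i\<close>. In the row where it does not, the new
  box comes directly after the entries \<open>\<le> i\<close>, so none of them lies in column \<open>c\<close>, there or further
  down.
\<close>

lemma col_upto_row_insert_start:
  "tableau P \<Longrightarrow> new_col (Suc i) P (Suc i) \<le> c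
    \<Longrightarrow> col_upto (row_insert (Suc i) P) i c \<le> col_upto (row_insert (Suc i) P) (Suc i) (Suc c)"
proof (induction P)
  case Nil
  then show ?case by simp
next
  case (Cons R Rs)
  then have s: "sorted_wrt (<) R" and t: "tableau Rs" by auto
  have eq: "col_upto (row_insert (Suc i) (R # Rs)) i c = col_upto (R # Rs) i c"
    using Cons.prems by (intro col_upto_row_insert_less) auto
  from s show ?case
  proof (cases rule: row_split[of R "Suc i"])
    case last
    have "col_upto (R # Rs) i c = 0"
      by (rule col_upto_eq_0) (use Cons.prems last in \<open>auto intro: order.trans[OF filter_less_eq]\<close>)
    then show ?thesis using eq by simp
  next
    case (bump A y B)
    show ?thesis
    proof (cases "y = Suc i")
      case True
      have "filter (\<lambda>y. y \<le> i) B = []" "filter (\<lambda>y. y \<le> Suc i) B = []" using bump True by (auto intro!: filter_le_none)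
      moreover have "filter (\<lambda>y. y \<le> i) A = A" "filter (\<lambda>y. y \<le> Suc i) A = A" using bump by (auto intro!: filter_le_all)
      moreover have "col_upto (row_insert y Rs) i c \<le> col_upto (row_insert y Rs) (Suc i) (Suc c)"
        using Cons.IH t Cons.prems bump True by simp
      ultimately show ?thesis using bump True by auto
    next
      case False
      have "filter (\<lambda>y. y \<le> i) B = []" using bump by (auto intro!: filter_le_none)
      then have "col_upto (R # Rs) i c = 0"
        by (intro col_upto_eq_0) (use Cons.prems bump False in \<open>auto intro: order.trans[OF filter_less_eq]\<close>)
      then show ?thesis using eq by simp
    qed
  qed
qed

text \<open>
  The columns strictly between the two new boxes. Down to the row in which the path leaves the entries
  \<open>\<le> i\<close>, the bumping takes place to the right of column \<open>c\<close>, so after the insertion each row has more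
  than \<open>Suc c\<close> entries \<open>\<le> Suc i\<close>. There the path must bump a letter \<open>Suc i\<close>, since otherwise the two
  new boxes would coincide, and \<open>col_upto_row_insert_start\<close> applies to the remaining rows.
\<close>

lemma col_upto_row_insert_between:
  "tableau P \<Longrightarrow> z \<le> i \<Longrightarrow> new_col z P (Suc i) \<le> c \<Longrightarrow> c < new_col z P i
    \<Longrightarrow> col_upto (row_insert z P) i c \<le> col_upto (row_insert z P) (Suc i) (Suc c)"
proof (induction P arbitrary: z)
  case Nil
  then show ?case by simp
next
  case (Cons R Rs)
  then have s: "sorted_wrt (<) R" and t: "tableau Rs" by auto
  from s show ?case
  proof (cases rule: row_split[of R z])
    case last
    then show ?thesis using Cons.prems by simp
  next
    case (bump A y B)
    have y: "y \<le> Suc i" using Cons.prems bump by (auto split: if_splits)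
    have le: "new_col y Rs i \<le> length A" using new_col_bumped_le[of A y B Rs] Cons.prems bump by fastforce
    have c: "c < length A" using Cons.prems bump le by (auto split: if_splits)
    have A: "filter (\<lambda>y. y \<le> Suc i) A = A" using bump Cons.prems by (auto intro!: filter_le_all)
    have "col_upto (row_insert y Rs) i c \<le> col_upto (row_insert y Rs) (Suc i) (Suc c)"
    proof (cases "y = Suc i")
      case True
      then show ?thesis using col_upto_row_insert_start[OF t, of i c] Cons.prems bump by auto
    next
      case False
      then show ?thesis using Cons.IH[OF t, of y] Cons.prems bump y by auto
    qed
    then show ?thesis using bump A c Cons.prems by auto
  qed
qed

lemma below_row_insert:
  assumes t: "tableau ((A @ y # B) # Rs)" and A: "\<forall>a\<in>set A. a < z" and zy: "z \<le> y"
  shows "below (A @ z # B) (hd (row_insert y Rs))"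
proof (cases Rs)
  case Nil
  then show ?thesis using assms by (cases A) (auto simp: below_def)
next
  case (Cons S Ss)
  have bl: "below (A @ y # B) S" and S: "sorted_wrt (<) S" using t Cons by auto
  have le: "length (takeWhile (\<lambda>a. a < y) S) \<le> length A"
    by (rule takeWhile_below[OF bl _ S]) (use A zy in fastforce)
  have zle: "(A @ z # B) ! c \<le> (A @ y # B) ! c" for c
    using zy by (auto simp: nth_append nth_Cons split: nat.split)
  have zq: "(A @ z # B) ! q \<le> y" if "q \<le> length A" for q
    using that A zy nth_mem[of q A] by (cases "q < length A") (fastforce simp: nth_append)+
  from S show ?thesis
  proof (cases rule: row_split[of S y])
    case last
    then have l: "length S \<le> length A" using le by (simp add: takeWhile_eq_all_conv[THEN iffD2])
    have "(A @ z # B) ! c \<le> (S @ [y]) ! c" if "c < Suc (length S)" for c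
      using that bl l zle[of c] zq[of c] order.trans unfolding below_def
      by (cases "c < length S") (fastforce simp: nth_append less_Suc_eq)+
    then show ?thesis using last l Cons by (simp add: below_def)
  next
    case (bump A' y' B')
    then have l: "length A' \<le> length A" using le by simp
    have "(A @ z # B) ! c \<le> (A' @ y # B') ! c" if "c < length S" for c
    proof (cases "c = length A'")
      case True
      then show ?thesis using zq[of c] l by simp
    next
      case False
      then have "(A' @ y # B') ! c = S ! c" using bump by (auto simp: nth_append nth_Cons split: nat.split)
      then show ?thesis using bl zle[of c] that order.trans unfolding below_def by fastforce
    qed
    then show ?thesis using bump bl Cons by (simp add: below_def)
  qed
qed

lemma row_insert_ne [simp]: "row_insert z P \<noteq> []"
  by (cases P) (auto split: list.split)

lemma tableau_row_insert: "tableau P \<Longrightarrow> tableau (row_insert z P)"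
proof (induction P arbitrary: z)
  case (Cons R Rs)
  then have s: "sorted_wrt (<) R" and t: "tableau Rs" by auto
  from s show ?case
  proof (cases rule: row_split[of R z])
    case last
    then show ?thesis using Cons.prems by (auto simp: sorted_wrt_append below_def nth_append)
  next
    case (bump A y B)
    have "below (A @ z # B) (hd (row_insert y Rs))"
      using Cons.prems bump by (intro below_row_insert) auto
    then show ?thesis using bump Cons by (auto simp: sorted_wrt_append)
  qed
qed auto

lemma mset_row_insert: "tableau P \<Longrightarrow> mset (concat (row_insert z P)) = add_mset z (mset (concat P))"
proof (induction P arbitrary: z)
  case (Cons R Rs)
  then have s: "sorted_wrt (<) R" and t: "tableau Rs" by auto
  from s show ?case
    by (cases rule: row_split[of R z]) (use Cons t in auto)
qed auto

text \<open>
  If \<open>z' \<le> z\<close>, the bumping path of \<open>z'\<close> stays weakly to the left of that of \<open>z\<close>: in each row it bumps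
  an entry that is at most the one left there by \<open>z\<close>.
\<close>

lemma new_col_row_insert_le:
  "tableau P \<Longrightarrow> z' \<le> z \<Longrightarrow> z \<le> i \<Longrightarrow> new_col z' (row_insert z P) i \<le> new_col z P i"
proof (induction P arbitrary: z z')
  case (Cons R Rs)
  have t': "tableau (row_insert z (R # Rs))" using Cons by (intro tableau_row_insert)
  from Cons have s: "sorted_wrt (<) R" and t: "tableau Rs" by auto
  have pos: "length (takeWhile (\<lambda>a. a < z') (A @ z # B)) \<le> length A" for A B
    using Cons.prems by (induction A) auto
  from s show ?case
  proof (cases rule: row_split[of R z])
    case last
    then have "new_col z (R # Rs) i = length R" "row_insert z (R # Rs) = (R @ [z]) # Rs" by simp_all
    then show ?thesis using new_col_le_pos[of "R @ [z]" Rs z' i] t' pos[of R "[]"] order.trans by metis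
  next
    case (bump A y B)
    show ?thesis
    proof (cases "y \<le> i")
      case False
      then show ?thesis using bump new_col_le_pos[of "A @ z # B" "row_insert y Rs" z' i] t' pos[of A B]
        by (auto split: if_splits simp del: new_col.simps(2)) (simp_all)
    next
      case True
      obtain y' ys where y': "dropWhile (\<lambda>a. a < z') (A @ z # B) = y' # ys" "y' \<le> z"
      proof -
        have "\<exists>y' ys. dropWhile (\<lambda>a. a < z') (A @ z # B) = y' # ys \<and> y' \<le> z"
          using bump(4) Cons.prems by (induction A) auto
        then show ?thesis using that by blast
      qed
      have "new_col y' (row_insert y Rs) i \<le> new_col y Rs i"
        using Cons.IH[OF t, of y' y] True y' bump by auto
      then show ?thesis using bump True y' Cons.prems by auto
    qed
  qed
qed auto

text \<open>
  If \<open>z < z'\<close>, the path of \<open>z'\<close> passes strictly to the right of that of \<open>z\<close>, hence it ends no lower.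
\<close>

lemma insertion_row_row_insert_le:
  "tableau P \<Longrightarrow> z < z' \<Longrightarrow> insertion_row z' (row_insert z P) \<le> insertion_row z P"
proof (induction P arbitrary: z z')
  case (Cons R Rs)
  from Cons have s: "sorted_wrt (<) R" and t: "tableau Rs" by auto
  from s show ?case
  proof (cases rule: row_split[of R z])
    case last
    then have "dropWhile (\<lambda>a. a < z') (R @ [z]) = []" using Cons.prems by fastforce
    then show ?thesis using last by simp
  next
    case (bump A y B)
    have A: "dropWhile (\<lambda>a. a < z') (A @ z # B) = dropWhile (\<lambda>a. a < z') B"
      using bump(4) Cons.prems by (induction A) auto
    show ?thesis
    proof (cases "dropWhile (\<lambda>a. a < z') B")
      case Nil
      then show ?thesis using bump A by simp
    next
      case (Cons y' ys)
      then have "y' \<in> set B" by (metis list.set_intros(1) set_dropWhileD)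
      then have "y < y'" using bump by auto
      then show ?thesis using bump A Cons Cons.IH[OF t] Cons.prems by (simp add: \<open>tableau Rs \<Longrightarrow> y < y' \<Longrightarrow> _\<close>)
    qed
  qed
qed auto

lemma map_length_row_insert:
  "tableau P \<Longrightarrow> map length P = map length Q \<Longrightarrow>
    map length (row_insert z P) = map length (add_entry (insertion_row z P) u Q)"
proof (induction P arbitrary: z Q)
  case Nil
  then show ?case by (simp add: add_entry_def)
next
  case (Cons R Rs)
  from Cons have s: "sorted_wrt (<) R" and t: "tableau Rs" by auto
  obtain S Ss where Q: "Q = S # Ss" "length R = length S" "map length Rs = map length Ss"
    using Cons.prems by (cases Q) auto
  from s show ?case
  proof (cases rule: row_split[of R z])
    case last
    then show ?thesis using Q by (simp add: add_entry_def)
  next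
    case (bump A y B)
    then show ?thesis using Q Cons.IH[OF t Q(3), of y] by (auto simp: add_entry_def split: if_splits)
  qed
qed

lemma insertion_row_le: "insertion_row z P \<le> length P"
  by (induction P arbitrary: z) (auto split: list.split)

text \<open>
  The columns weakly to the right of the box that the insertion of \<open>z\<close> adds to the entries \<open>\<le> i\<close>.
  They are the combinatorial counterpart of the sets \<open>J\<close> attached to a hyperplane below.
\<close>

definition Jins :: "nat \<Rightarrow> nat list list \<Rightarrow> nat \<Rightarrow> nat set" where
  "Jins z P i = {c. z \<le> i \<and> new_col z P i \<le> c}"

lemma Jins_up: "c \<in> Jins z P i \<Longrightarrow> c \<le> c' \<Longrightarrow> c' \<in> Jins z P i"
  by (auto simp: Jins_def)

lemma Jins_mono: "tableau P \<Longrightarrow> Jins z P i \<subseteq> Jins z P (Suc i)"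
  using new_col_antimono[of P z i] by (auto simp: Jins_def)

lemma Jins_first: "c \<in> Jins z P i \<and> (c = 0 \<or> c - 1 \<notin> Jins z P i) \<longleftrightarrow> z \<le> i \<and> c = new_col z P i"
  by (auto simp: Jins_def)

lemma col_upto_Jins:
  "tableau P \<Longrightarrow> col_upto (row_insert z P) i c
     = col_upto P i c + (if c \<in> Jins z P i \<and> (c = 0 \<or> c - 1 \<notin> Jins z P i) then 1 else 0)"
  unfolding Jins_first using col_upto_row_insert_less[of P i z c] col_upto_row_insert_ge[of P z i c]
  by (cases "z \<le> i") auto

text \<open>
  This inequality prevents the type of a flag from losing, in passing to a hyperplane, a box further
  to the left than the insertion has put it; see \<open>flag_J_bound\<close>.
\<close>

lemma Jins_gap:
  assumes "tableau P" "c \<in> Jins z P (Suc i)" "c \<notin> Jins z P i"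
  shows "col_upto (row_insert z P) i c \<le> col_upto (row_insert z P) (Suc i) (Suc c)"
proof (cases "z \<le> i")
  case True
  then show ?thesis using assms col_upto_row_insert_between[of P z i c] by (auto simp: Jins_def)
next
  case False
  then have "z = Suc i" using assms by (auto simp: Jins_def)
  then show ?thesis using assms col_upto_row_insert_start[of P i c] by (auto simp: Jins_def)
qed

text \<open>
  The strict inequality provides the free generator by which a flag can be moved; see
  \<open>flag_general_position\<close>.
\<close>

lemma Jins_removable:
  assumes "tableau P" "0 < z" "c \<in> Jins z P i" "c = 0 \<or> c - 1 \<notin> Jins z P i"
  shows "col_upto (row_insert z P) (Suc i) (Suc c) < col_upto (row_insert z P) i c"
  using col_upto_row_insert_Suc[OF assms(1,2), of i c] col_upto_Jins[OF assms(1), of z i c] assms(3,4) by simp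

section \<open>Reverse insertion and the array of a pair of tableaux\<close>

text \<open>
  The bumping is undone from row \<open>r\<close> upwards: its last entry is ejected, and an entry \<open>y\<close> ejected
  from a row replaces the last entry \<open>\<le> y\<close> of the row above. The condition on \<open>r\<close> says that the last
  box of row \<open>r\<close> is a corner of the shape.
\<close>

lemma reverse_row_insert:
  assumes "tableau Q" "r < length Q" "Suc r < length Q \<Longrightarrow> length (Q ! Suc r) < length (Q ! r)"
  shows "\<exists>P z. tableau P \<and> row_insert z P = Q \<and> insertion_row z P = r"
  using assms
proof (induction Q arbitrary: r)
  case Nil
  then show ?case by simp
next
  case (Cons R Rs)
  then have s: "sorted_wrt (<) R" and t: "tableau Rs" and ne: "R \<noteq> []" by auto
  have R: "R = butlast R @ [last R]" using ne by simp
  have lt: "\<forall>a\<in>set (butlast R). a < last R" and sb: "sorted_wrt (<) (butlast R)"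
    using s by (subst (asm) R, simp add: sorted_wrt_append)+
  show ?case
  proof (cases r)
    case 0
    show ?thesis
    proof (cases "butlast R = []")
      case True
      then obtain a where R1: "R = [a]" using ne by (cases R) (auto split: if_splits)
      then have "Rs = []" using Cons.prems(3) t 0 by (cases Rs) auto
      then have "row_insert a [] = R # Rs" "insertion_row a [] = r" "tableau []" using 0 R1 by simp_all
      then show ?thesis by blast
    next
      case False
      have "below (butlast R) (hd Rs)" if Rsne: "Rs \<noteq> []"
      proof -
        have b: "below R (hd Rs)" using Cons.prems(1) Rsne by simp
        have "length (hd Rs) < length R" using Cons.prems(3) Rsne 0 by (simp add: hd_conv_nth)
        then show ?thesis using b by (simp add: below_def nth_butlast)
      qed
      then have "tableau (butlast R # Rs)" using False sb t by simp
      moreover have "row_insert (last R) (butlast R # Rs) = R # Rs" "insertion_row (last R) (butlast R # Rs) = r"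
        using lt 0 ne by simp_all
      ultimately show ?thesis by blast
    qed
  next
    case (Suc r')
    have "\<exists>P z. tableau P \<and> row_insert z P = Rs \<and> insertion_row z P = r'"
      by (rule Cons.IH[OF t]) (use Cons.prems Suc in auto)
    then obtain Rs' y where Rs': "tableau Rs'" "row_insert y Rs' = Rs" "insertion_row y Rs' = r'" by blast
    then have Rsne: "Rs \<noteq> []" by auto
    let ?H = "if Rs' = [] then [] else hd Rs'"
    have sH: "sorted_wrt (<) ?H" using Rs' by (cases Rs') auto
    \<comment> \<open>the first row of \<open>Rs\<close> is that of \<open>Rs'\<close> with \<open>y\<close> at its insertion position\<close>
    obtain q where q: "q < length (hd Rs)" "hd Rs ! q = y" "length ?H \<le> length (hd Rs)"
      "\<forall>c<length ?H. hd Rs ! c \<le> ?H ! c" "\<forall>c<length ?H. q \<le> c \<longrightarrow> y \<le> ?H ! c"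
    proof (cases Rs')
      case Nil
      then show ?thesis using that[of 0] Rs' by auto
    next
      case (Cons S Ss)
      then have "sorted_wrt (<) S" using Rs' by auto
      then show ?thesis
      proof (cases rule: row_split[of S y])
        case last
        then show ?thesis using that[of "length S"] Rs' Cons by (auto simp: nth_append)
      next
        case (bump A y' B)
        have "y \<le> S ! c" if "c < length S" "length A \<le> c" for c
        proof -
          have "S ! c = (y' # B) ! (c - length A)" "c - length A < length (y' # B)"
            using that bump by (simp_all add: nth_append)
          then have "S ! c \<in> set (y' # B)" using nth_mem by metis
          then show ?thesis using bump by auto
        qed
        moreover have "hd Rs = A @ y # B" using Rs' Cons bump by auto
        ultimately show ?thesis using that[of "length A"] Cons bump
          by (auto simp: nth_append nth_Cons split: nat.split)
      qed
    qed
    have bl: "below R (hd Rs)" using Cons.prems Rsne by simp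
    \<comment> \<open>row \<open>R\<close> is cut after its last entry \<open>\<le> y\<close>, which is the letter \<open>z\<close> to be ejected\<close>
    define A' where "A' = takeWhile (\<lambda>a. a \<le> y) R"
    define B where "B = dropWhile (\<lambda>a. a \<le> y) R"
    have RAB: "R = A' @ B" by (simp add: A'_def B_def)
    have qA: "q < length A'"
    proof (rule ccontr)
      assume "\<not> ?thesis"
      then have l: "length A' \<le> q" by simp
      have "R ! q \<le> y" "q < length R" using bl q unfolding below_def by auto
      moreover have "\<not> R ! length A' \<le> y"
        using nth_length_takeWhile[of "\<lambda>a. a \<le> y" R] l calculation by (simp add: A'_def)
      moreover have "R ! length A' \<le> R ! q" using l s calculation
        by (metis sorted_wrt_nth_less le_neq_implies_less less_imp_le order_refl)
      ultimately show False by simp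
    qed
    define A where "A = butlast A'"
    define z where "z = last A'"
    have "A' \<noteq> []" using qA by auto
    then have A': "A' = A @ [z]" by (simp add: A_def z_def)
    have zy: "z \<le> y" using A' set_takeWhileD[of z "\<lambda>a. a \<le> y" R] by (auto simp: A'_def)
    have Rz: "R = A @ z # B" using RAB A' by simp
    have Az: "\<forall>a\<in>set A. a < z" and sB: "\<forall>b\<in>set B. z < b" "sorted_wrt (<) A" "sorted_wrt (<) B"
      "\<forall>a\<in>set A. \<forall>b\<in>set B. a < b"
      using s by (auto simp: Rz sorted_wrt_append)
    have yB: "\<forall>b\<in>set B. y < b"
    proof (cases B)
      case (Cons b B')
      then have "y < b" using hd_dropWhile[of "\<lambda>a. a \<le> y" R] by (simp add: B_def)
      then show ?thesis using sB Cons by auto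
    qed simp
    have "below (A @ y # B) (hd Rs')" if "Rs' \<noteq> []"
      unfolding below_def
    proof (intro conjI allI impI)
      show "length (hd Rs') \<le> length (A @ y # B)" using q(3) bl that Rz unfolding below_def by auto
      fix c assume c: "c < length (hd Rs')"
      show "(A @ y # B) ! c \<le> hd Rs' ! c"
      proof (cases "c = length A")
        case True
        then show ?thesis using q(5) c qA A' that by simp
      next
        case False
        then have "(A @ y # B) ! c = R ! c" by (auto simp: Rz nth_append nth_Cons split: nat.split)
        moreover have "R ! c \<le> hd Rs ! c" "hd Rs ! c \<le> hd Rs' ! c"
          using c q(3,4) bl that unfolding below_def by auto
        ultimately show ?thesis by simp
      qed
    qed
    then have "tableau ((A @ y # B) # Rs')"
      using Rs' sB yB Az zy by (auto simp: sorted_wrt_append)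
    moreover have "dropWhile (\<lambda>a. a < z) (A @ y # B) = y # B" "takeWhile (\<lambda>a. a < z) (A @ y # B) = A"
      using Az zy by (simp_all add: dropWhile_append takeWhile_append)
    then have "row_insert z ((A @ y # B) # Rs') = R # Rs" "insertion_row z ((A @ y # B) # Rs') = r"
      using Rs' Rz Suc by simp_all
    ultimately show ?thesis by blast
  qed
qed

lemma all_nat_split: "(\<forall>n. X n) \<longleftrightarrow> X 0 \<and> (\<forall>n. X (Suc n))"
  by (metis nat.exhaust)

lemma tableau_nth:
  "tableau P \<longleftrightarrow> (\<forall>r<length P. P ! r \<noteq> [] \<and> sorted_wrt (<) (P ! r)) \<and>
     (\<forall>r. Suc r < length P \<longrightarrow> below (P ! r) (P ! Suc r))"
proof (induction P)
  case (Cons R Rs)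
  have 1: "(\<forall>r<length (R # Rs). X ((R # Rs) ! r)) \<longleftrightarrow> X R \<and> (\<forall>r<length Rs. X (Rs ! r))" for X
    by (auto simp: less_Suc_eq_0_disj)
  have 2: "(\<forall>r. Suc r < length (R # Rs) \<longrightarrow> below ((R # Rs) ! r) ((R # Rs) ! Suc r)) \<longleftrightarrow>
    (Rs \<noteq> [] \<longrightarrow> below R (hd Rs)) \<and> (\<forall>r. Suc r < length Rs \<longrightarrow> below (Rs ! r) (Rs ! Suc r))"
    by (subst all_nat_split) (auto simp: hd_conv_nth)
  show ?case unfolding 2 using 1[of "\<lambda>R. R \<noteq> [] \<and> sorted_wrt (<) R"] Cons by auto
qed simp

lemma rsk_Nil [simp]: "rsk [] = ([], [])"
  by (simp add: rsk_def)

lemma rsk_snoc: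
  "rsk (a @ [(u, w)]) = (row_insert w (fst (rsk a)), add_entry (insertion_row w (fst (rsk a))) u (snd (rsk a)))"
  by (simp add: rsk_def split_beta)

lemma tableau_rsk: "tableau (fst (rsk a))"
  by (induction a rule: rev_induct) (auto simp: rsk_snoc tableau_row_insert)

lemma shape_rsk: "map length (fst (rsk a)) = map length (snd (rsk a))"
proof (induction a rule: rev_induct)
  case (snoc p a)
  then show ?case by (cases p) (simp add: rsk_snoc map_length_row_insert[OF tableau_rsk])
qed simp

lemma mset_add_entry: "r \<le> length Q \<Longrightarrow> mset (concat (add_entry r u Q)) = add_mset u (mset (concat Q))"
proof (cases "r < length Q")
  case True
  then obtain X R Y where Q: "Q = X @ R # Y" "length X = r" by (metis id_take_nth_drop length_take min.absorb2 less_imp_le)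
  then have "add_entry r u Q = X @ (R @ [u]) # Y" by (auto simp: add_entry_def)
  then show ?thesis using Q by simp
qed (simp add: add_entry_def)

lemma add_entry_shape_cancel:
  assumes eq: "map length (add_entry r u P) = map length (add_entry r u Q)"
    and r: "r \<le> length P" "r \<le> length Q" and t: "tableau Q" "tableau P"
  shows "map length P = map length Q"
proof -
  have ne: "\<And>s. s < length P \<Longrightarrow> P ! s \<noteq> []" "\<And>s. s < length Q \<Longrightarrow> Q ! s \<noteq> []"
    using t by (auto simp: tableau_nth)
  have nth: "length (add_entry r u R ! s) = (if s = length R then 1 else if s = r then Suc (length (R ! s)) else length (R ! s))"
    if "s < length (add_entry r u R)" "r \<le> length R" for s and R :: "nat list list"
    using that by (auto simp: add_entry_def nth_append split: if_splits)
  have len: "length (add_entry r u R) = (if r < length R then length R else Suc (length R))" for R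
    by (simp add: add_entry_def)
  have eqn: "length (add_entry r u P ! s) = length (add_entry r u Q ! s)" if "s < length (add_entry r u P)" for s
    using eq that by (metis length_map nth_map)
  have leq: "length (add_entry r u P) = length (add_entry r u Q)" using eq by (metis length_map)
  have lPQ: "length P = length Q"
  proof (rule ccontr)
    assume n: "length P \<noteq> length Q"
    then have "r < length P \<and> r = length Q \<or> r = length P \<and> r < length Q"
      using leq r by (auto simp: len split: if_splits)
    then show False
      using eqn[of r] nth[of r P] nth[of r Q] ne[of r] r by (auto simp: len split: if_splits)
  qed
  show ?thesis
  proof (rule nth_equalityI)
    fix s assume "s < length (map length P)"
    then have s: "s < length P" "s < length Q" using lPQ by auto
    then have "s < length (add_entry r u P)" "s < length (add_entry r u Q)" by (auto simp: len)
    then show "map length P ! s = map length Q ! s"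
      using eqn[of s] nth[of s P] nth[of s Q] s r by (auto split: if_splits)
  qed (use lPQ in simp)
qed

text \<open>
  The order in which the columns \<open>(u, w)\<close> of an array are read; it is reflexive.
\<close>

definition array_order :: "nat \<times> nat \<Rightarrow> nat \<times> nat \<Rightarrow> bool" where
  "array_order p q \<longleftrightarrow> fst p < fst q \<or> fst p = fst q \<and> snd q \<le> snd p"

lemma array_order_trans: "array_order p q \<Longrightarrow> array_order q r \<Longrightarrow> array_order p r"
  by (auto simp: array_order_def)

text \<open>
  The last letter is recovered by reverse insertion at the lowest box of the recording tableau that
  carries the greatest entry \<open>u\<close>. The choice of the lowest box is what makes the array ordered: if the
  letter before it were smaller and had the same \<open>u\<close>, its box would lie in a row that is at
  least as low, and in a different one, because a row contains \<open>u\<close> only once.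
\<close>

lemma rsk_surj:
  "tableau P \<Longrightarrow> tableau Q \<Longrightarrow> map length P = map length Q \<Longrightarrow>
    \<exists>a. rsk a = (P, Q) \<and> sorted_wrt array_order a \<and> fst ` set a \<subseteq> set (concat Q) \<and> snd ` set a \<subseteq> set (concat P)"
proof (induction "length (concat Q)" arbitrary: P Q)
  case 0
  then have "Q = []" by (cases Q) auto
  then show ?case using 0 by (intro exI[of _ "[]"]) auto
next
  case (Suc k)
  let ?E = "set (concat Q)"
  define u where "u = Max ?E"
  have ne: "?E \<noteq> {}" using Suc(2) by (metis list.size(3) nat.distinct(1) set_empty2 set_empty)
  then have uE: "u \<in> ?E" and umax: "\<And>v. v \<in> ?E \<Longrightarrow> v \<le> u" by (auto simp: u_def simp del: set_concat)
  define X where "X = {r. r < length Q \<and> u \<in> set (Q ! r)}"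
  have "finite X" by (simp add: X_def)
  have "X \<noteq> {}" using uE by (auto simp: X_def) (metis in_set_conv_nth)
  \<comment> \<open>the lowest row that contains the greatest entry\<close>
  define r where "r = Max X"
  have "r \<in> X" using \<open>finite X\<close> \<open>X \<noteq> {}\<close> by (simp add: r_def)
  then have r: "r < length Q" and ur: "u \<in> set (Q ! r)" by (auto simp: X_def)
  have rmax: "\<And>s. s < length Q \<Longrightarrow> u \<in> set (Q ! s) \<Longrightarrow> s \<le> r" using \<open>finite X\<close> by (simp add: r_def X_def)
  have Qne: "\<And>s. s < length Q \<Longrightarrow> Q ! s \<noteq> []" and Qs: "\<And>s. s < length Q \<Longrightarrow> sorted_wrt (<) (Q ! s)"
    and Qb: "\<And>s. Suc s < length Q \<Longrightarrow> below (Q ! s) (Q ! Suc s)" using Suc.prems(2) by (auto simp: tableau_nth)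
  have inE: "\<And>s v. s < length Q \<Longrightarrow> v \<in> set (Q ! s) \<Longrightarrow> v \<in> ?E" by auto
  have Qr: "Q ! r = butlast (Q ! r) @ [last (Q ! r)]" using Qne[OF r] by simp
  have lb: "\<forall>a\<in>set (butlast (Q ! r)). a < last (Q ! r)" and sb: "sorted_wrt (<) (butlast (Q ! r))"
    using Qs[OF r] by (subst (asm) Qr, simp add: sorted_wrt_append)+
  have lu: "last (Q ! r) = u"
  proof (rule ccontr)
    assume "last (Q ! r) \<noteq> u"
    then have "u \<in> set (butlast (Q ! r))" using ur by (subst (asm) Qr) auto
    then have "u < last (Q ! r)" using lb by simp
    moreover have "last (Q ! r) \<in> ?E" using inE[OF r] Qne[OF r] by simp
    ultimately show False using umax by fastforce
  qed
  have corner: "length (Q ! Suc r) < length (Q ! r)" if "Suc r < length Q"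
  proof (rule ccontr)
    assume "\<not> ?thesis"
    then have l: "length (Q ! Suc r) = length (Q ! r)" using Qb[OF that] by (auto simp: below_def)
    let ?c = "length (Q ! r) - 1"
    have "?c < length (Q ! r)" using Qne[OF r] by simp
    then have "Q ! r ! ?c \<le> Q ! Suc r ! ?c" "Q ! Suc r ! ?c \<in> set (Q ! Suc r)"
      using Qb[OF that] l by (auto simp: below_def)
    moreover have "Q ! r ! ?c = u" using lu Qne[OF r] by (simp add: last_conv_nth)
    ultimately have "u \<in> set (Q ! Suc r)" using umax[OF inE[OF that]] by (metis le_antisym)
    then show False using rmax[OF that] by simp
  qed
  \<comment> \<open>the box of \<open>u\<close> in row \<open>r\<close> is removed, with the row if it was alone\<close>
  define Q' where "Q' = (if length (Q ! r) = 1 then butlast Q else Q[r := butlast (Q ! r)])"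
  have last_row: "Suc r = length Q" if "length (Q ! r) = 1"
    using corner Qne[of "Suc r"] that r by (cases "Suc r < length Q") auto
  have Q'Q: "add_entry r u Q' = Q"
  proof (cases "length (Q ! r) = 1")
    case True
    then have "Q ! r = [u]" using lu by (cases "Q ! r") auto
    then have Qb: "Q = butlast Q @ [[u]]" using last_row[OF True] r
      by (metis append_butlast_last_id diff_Suc_1 last_conv_nth length_greater_0_conv gr_implies_not0 list.size(3))
    have "\<not> r < length (butlast Q)" using last_row[OF True] by simp
    then show ?thesis using True Qb unfolding add_entry_def Q'_def by simp
  next
    case False
    have "butlast (Q ! r) @ [u] = Q ! r" using Qr[symmetric] unfolding lu .
    then show ?thesis using False r by (simp add: add_entry_def Q'_def)
  qed
  have len': "length (concat Q') = k"
  proof -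
    note mset_add_entry[of r Q' u]
    moreover have "r \<le> length Q'" using r last_row by (auto simp: Q'_def)
    ultimately have "size (mset (concat Q)) = Suc (size (mset (concat Q')))" using Q'Q by simp
    then show ?thesis using Suc(2) by (simp only: size_mset)
  qed
  have nthQ': "Q' ! s = (if s = r then butlast (Q ! r) else Q ! s)" if "s < length Q'" for s
    using that last_row r by (auto simp: Q'_def nth_butlast nth_list_update)
  have lQ': "length Q' \<le> length Q" by (simp add: Q'_def)
  have tabQ': "tableau Q'"
    unfolding tableau_nth
  proof (intro conjI allI impI)
    fix s assume s: "s < length Q'"
    show "Q' ! s \<noteq> []"
    proof (cases "s = r")
      case True
      then have "length (Q ! r) \<noteq> 1" using s last_row by (auto simp: Q'_def)
      then have "length (butlast (Q ! r)) \<noteq> 0" using Qne[OF r] by (cases "Q ! r") auto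
      then show ?thesis using nthQ'[OF s] True by (metis list.size(3))
    qed (use nthQ'[OF s] Qne s lQ' in auto)
    show "sorted_wrt (<) (Q' ! s)" using nthQ'[OF s] Qs[of s] sb s lQ' by auto
  next
    fix s assume s: "Suc s < length Q'"
    then have "below (Q ! s) (Q ! Suc s)" using Qb lQ' by auto
    then show "below (Q' ! s) (Q' ! Suc s)"
      using nthQ'[of s] nthQ'[of "Suc s"] s corner lQ'
      by (auto simp: below_def nth_butlast)
  qed
  obtain P' z where P': "tableau P'" "row_insert z P' = P" "insertion_row z P' = r"
  proof -
    have "length P = length Q" and "\<And>s. s < length Q \<Longrightarrow> length (P ! s) = length (Q ! s)"
      using Suc.prems(3) by (metis length_map, metis length_map nth_map)
    then show ?thesis using reverse_row_insert[OF Suc.prems(1), of r] r corner that by auto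
  qed
  have zP: "set (concat P) = insert z (set (concat P'))"
    using mset_row_insert[OF P'(1), of z] P'(2) by (metis set_mset_add_mset_insert set_mset_mset)
  have shape': "map length P' = map length Q'"
  proof -
    have l: "map length P = map length (add_entry r u P')" using map_length_row_insert[OF P'(1) refl, of z u] P' by simp
    have "map length (add_entry r u P') = map length (add_entry r u Q')" using l Suc.prems(3) Q'Q by simp
    moreover have "r \<le> length P'" using insertion_row_le[of z P'] P' by simp
    moreover have "r \<le> length Q'" using r last_row by (auto simp: Q'_def)
    ultimately show ?thesis using tabQ' P'(1) by (rule_tac add_entry_shape_cancel)
  qed
  obtain a where a: "rsk a = (P', Q')" "sorted_wrt array_order a"
    "fst ` set a \<subseteq> set (concat Q')" "snd ` set a \<subseteq> set (concat P')"
    using Suc.hyps(1)[OF len'[symmetric] P'(1) tabQ' shape'] by blast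
  have subQ: "set (concat Q') \<subseteq> ?E"
  proof -
    have "v \<in> ?E" if "s < length Q'" "v \<in> set (Q' ! s)" for s v
      using inE[of s v] that nthQ'[of s] lQ' r by (auto split: if_splits dest: in_set_butlastD)
    then show ?thesis by (metis (no_types, lifting) UN_E in_set_conv_nth set_concat subsetI)
  qed
  \<comment> \<open>by transitivity, only the last column of \<open>a\<close> has to be compared\<close>
  have ord: "array_order p (u, z)" if "p \<in> set a" for p
  proof (cases a rule: rev_cases)
    case (snoc b q)
    obtain u' z' where q: "q = (u', z')" by (cases q)
    have "array_order q (u, z)"
    proof (cases "u' = u \<and> z' < z")
      case True
      define r' where "r' = insertion_row z' (fst (rsk b))"
      have rb: "P' = row_insert z' (fst (rsk b))" "Q' = add_entry r' u (snd (rsk b))"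
        using a(1) True by (simp_all add: snoc q rsk_snoc r'_def)
      have "r \<le> r'" using insertion_row_row_insert_le[OF tableau_rsk, of z' z b] True P' rb by (simp add: r'_def)
      have "r' \<le> length (snd (rsk b))" using insertion_row_le shape_rsk[of b] unfolding r'_def by (metis length_map)
      then have u': "r' < length Q'" "u \<in> set (Q' ! r')" using rb by (auto simp: add_entry_def nth_append)
      have "r' \<noteq> r" using u' nthQ'[of r'] lb lu by auto
      moreover have "r' \<le> r" using rmax[of r'] u' nthQ'[of r'] lQ' calculation by auto
      ultimately show ?thesis using \<open>r \<le> r'\<close> by simp
    next
      case False
      have "u' \<in> set (concat Q')" using a(3) by (auto simp: snoc q)
      then have "u' \<le> u" using subQ umax by blast
      then show ?thesis using False by (auto simp: array_order_def q)
    qed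
    moreover have "p = q \<or> array_order p q" using a(2) that by (auto simp: snoc sorted_wrt_append)
    ultimately show ?thesis using array_order_trans by blast
  qed (use that in simp)
  have "rsk (a @ [(u, z)]) = (P, Q)" using a(1) P' Q'Q by (simp add: rsk_snoc)
  moreover have "sorted_wrt array_order (a @ [(u, z)])" using a(2) ord by (simp add: sorted_wrt_append)
  moreover have "fst ` set (a @ [(u, z)]) \<subseteq> ?E" using a(3) subQ uE by auto
  moreover have "snd ` set (a @ [(u, z)]) \<subseteq> set (concat P)" using a(4) zP by auto
  ultimately show ?case by blast
qed

section \<open>Column lengths of tableaux and partitions\<close>

text \<open>
  The length of column \<open>c\<close> of the shape of a tableau.
\<close>

definition shape_col :: "nat list list \<Rightarrow> nat \<Rightarrow> nat" where
  "shape_col P c = length (filter (\<lambda>l. c < l) (map length P))"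

lemma col_upto_all: "\<forall>y\<in>set (concat P). y \<le> i \<Longrightarrow> col_upto P i c = shape_col P c"
  by (induction P) (auto simp: shape_col_def)

lemma tableau_rows: "tableau P \<Longrightarrow> \<forall>R\<in>set P. sorted_wrt (<) R"
  by (induction P) auto

text \<open>
  Rows are strict with entries in \<open>{1..n}\<close>, so no row has more than \<open>n\<close> boxes.
\<close>

lemma sum_col_upto:
  assumes "\<forall>R\<in>set P. sorted_wrt (<) R" "\<forall>y\<in>set (concat P). 1 \<le> y \<and> y \<le> n"
  shows "(\<Sum>c<n. col_upto P i c) = length (filter (\<lambda>y. y \<le> i) (concat P))"
  using assms
proof (induction P)
  case (Cons R P)
  let ?F = "filter (\<lambda>y. y \<le> i) R"
  have "distinct R" using Cons.prems(1) by (simp add: strict_sorted_iff)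
  have "length ?F \<le> length R" by simp
  also have "\<dots> = card (set R)" using \<open>distinct R\<close> by (simp add: distinct_card)
  also have "\<dots> \<le> card {1..n}" using Cons.prems(2) by (intro card_mono) auto
  finally have l: "length ?F \<le> n" by simp
  have "(\<Sum>c<n. if c < length ?F then 1 else 0 :: nat) = card ({..<n} \<inter> {c. c < length ?F})"
    by (simp add: sum.If_cases)
  also have "{..<n} \<inter> {c. c < length ?F} = {..<length ?F}" using l by auto
  finally have "(\<Sum>c<n. if c < length ?F then 1 else 0 :: nat) = length ?F" by simp
  moreover have "(\<Sum>c<n. col_upto P i c) = length (filter (\<lambda>y. y \<le> i) (concat P))"
    by (rule Cons.IH) (use Cons.prems in auto)
  ultimately show ?case by (simp add: sum.distrib)
qed simp

lemma col_upto_card: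
  assumes "\<forall>R\<in>set P. sorted_wrt (<) R"
  shows "col_upto P i c = card {r. r < length P \<and> c < length (P ! r) \<and> P ! r ! c \<le> i}"
proof -
  have "{r. r < length P \<and> c < length (filter (\<lambda>y. y \<le> i) (P ! r))} = {r. r < length P \<and> c < length (P ! r) \<and> P ! r ! c \<le> i}"
    using assms by (auto simp: less_length_filter_le)
  then show ?thesis by (simp add: col_upto_def length_filter_conv_card)
qed

lemma shape_col_card: "shape_col P c = card {r. r < length P \<and> c < length (P ! r)}"
proof -
  have "{r. r < length (map length P) \<and> c < map length P ! r} = {r. r < length P \<and> c < length (P ! r)}" by auto
  then show ?thesis by (simp add: shape_col_def length_filter_conv_card)
qed

lemma less_card_downclosed:
  assumes "finite S" "\<And>r r'. r \<in> S \<Longrightarrow> r' \<le> r \<Longrightarrow> r' \<in> S"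
  shows "r < card S \<longleftrightarrow> r \<in> (S :: nat set)"
proof -
  have "S = {..<card S}"
  proof (cases "S = {}")
    case False
    have "S = {..Max S}" using assms False by (auto intro: assms(2)[OF Max_in])
    then show ?thesis by (metis card_atMost lessThan_Suc_atMost)
  qed simp
  then show ?thesis by blast
qed

lemma tableau_column_mono:
  assumes "tableau T" "r' \<le> r" "r < length T" "c < length (T ! r)"
  shows "c < length (T ! r') \<and> T ! r' ! c \<le> T ! r ! c"
  using assms(2-)
proof (induction r rule: dec_induct)
  case (step r)
  have "below (T ! r) (T ! Suc r)" using assms(1) step.prems by (simp add: tableau_nth)
  then have "c < length (T ! r)" "T ! r ! c \<le> T ! Suc r ! c" using step.prems by (auto simp: below_def)
  then show ?case using step by force
qed simp

text \<open>
  Columns increase weakly, so the entries \<open>\<le> i\<close> fill the top of each column.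
\<close>

lemma less_col_upto_iff:
  assumes "tableau T"
  shows "r < col_upto T i c \<longleftrightarrow> r < length T \<and> c < length (T ! r) \<and> T ! r ! c \<le> i"
proof -
  let ?S = "{r. r < length T \<and> c < length (T ! r) \<and> T ! r ! c \<le> i}"
  have "r < card ?S \<longleftrightarrow> r \<in> ?S"
  proof (rule less_card_downclosed)
    fix r r' assume r: "r \<in> ?S" "r' \<le> r"
    then show "r' \<in> ?S" using tableau_column_mono[OF assms, of r' r c] by auto
  qed simp
  then show ?thesis using col_upto_card[OF tableau_rows[OF assms]] by simp
qed

text \<open>
  The length of column \<open>c\<close> of the partition, whose parts are the rows.
\<close>

definition col_len :: "nat list \<Rightarrow> nat \<Rightarrow> nat" where
  "col_len lam c = length (filter (\<lambda>l. c < l) lam)"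

lemma shape_col_col_len: "shape_col P c = col_len (map length P) c"
  by (simp add: shape_col_def col_len_def)

lemma boxes_col_len: "partition_shape lam \<Longrightarrow> (r, c) \<in> boxes lam \<longleftrightarrow> r < col_len lam c"
proof (induction lam arbitrary: r)
  case Nil
  then show ?case by (simp add: boxes_def col_len_def)
next
  case (Cons a lam)
  have p: "partition_shape lam" and a: "\<forall>l\<in>set lam. l \<le> a" using Cons.prems by (auto simp: partition_shape_def)
  have z: "col_len lam c = 0" if "a \<le> c"
    using a that by (auto simp: col_len_def filter_empty_conv)
  show ?case
  proof (cases r)
    case 0
    then show ?thesis using z by (auto simp: boxes_def col_len_def)
  next
    case (Suc r')
    have "(r, c) \<in> boxes (a # lam) \<longleftrightarrow> (r', c) \<in> boxes lam" by (simp add: boxes_def Suc)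
    also have "\<dots> \<longleftrightarrow> r' < col_len lam c" by (rule Cons.IH[OF p])
    also have "\<dots> \<longleftrightarrow> r < col_len (a # lam) c" using z by (cases "c < a") (auto simp: col_len_def Suc)
    finally show ?thesis .
  qed
qed

lemma partition_eqI:
  assumes "partition_shape lam" "partition_shape lam'" "\<And>c. col_len lam c = col_len lam' c"
  shows "lam = lam'"
proof -
  have pos: "0 < l" if "l \<in> set lam \<or> l \<in> set lam'" for l using assms(1,2) that by (auto simp: partition_shape_def)
  have len: "length lam = col_len lam 0" "length lam' = col_len lam' 0" using pos by (simp_all add: col_len_def)
  have b: "boxes lam = boxes lam'" using boxes_col_len[OF assms(1)] boxes_col_len[OF assms(2)] assms(3) by auto
  show ?thesis
  proof (rule nth_equalityI)
    show l: "length lam = length lam'" using len assms(3) by simp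
    fix r assume r: "r < length lam"
    have "c < lam ! r \<longleftrightarrow> c < lam' ! r" for c
    proof -
      have "(r, c) \<in> boxes lam \<longleftrightarrow> (r, c) \<in> boxes lam'" using b by simp
      then show ?thesis using r l by (simp add: boxes_def)
    qed
    then show "lam ! r = lam' ! r" by (metis linorder_neqE_nat less_irrefl)
  qed
qed

lemma card_boxes: "card (boxes lam) = sum_list lam"
proof -
  have "boxes lam = Sigma {..<length lam} (\<lambda>r. {..<lam ! r})" by (auto simp: boxes_def)
  then have "card (boxes lam) = (\<Sum>r<length lam. lam ! r)" by simp
  then show ?thesis by (simp add: sum_list_sum_nth atLeast0LessThan)
qed

lemma tableau_ssyt:
  assumes "T \<in> ssyt lam \<mu>"
  shows "tableau T" "\<forall>y\<in>set (concat T). 1 \<le> y \<and> y \<le> length \<mu>" "partition_shape lam" "map length T = lam"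
    "\<And>i. i \<in> {1..length \<mu>} \<Longrightarrow> count_list (concat T) i = \<mu> ! (i - 1)"
proof -
  show part: "partition_shape lam" and len: "map length T = lam" using assms by (simp_all add: ssyt_def)
  have ent: "\<And>r c. (r, c) \<in> boxes lam \<Longrightarrow> T ! r ! c \<in> {1..length \<mu>}"
    and row: "\<And>r c. (r, c) \<in> boxes lam \<Longrightarrow> (r, Suc c) \<in> boxes lam \<Longrightarrow> T ! r ! c < T ! r ! Suc c"
    and col: "\<And>r c. (r, c) \<in> boxes lam \<Longrightarrow> (Suc r, c) \<in> boxes lam \<Longrightarrow> T ! r ! c \<le> T ! Suc r ! c"
    using assms by (auto simp: ssyt_def)
  show "\<And>i. i \<in> {1..length \<mu>} \<Longrightarrow> count_list (concat T) i = \<mu> ! (i - 1)" using assms by (auto simp: ssyt_def)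
  have box: "(r, c) \<in> boxes lam \<longleftrightarrow> r < length T \<and> c < length (T ! r)" for r c
    using len by (auto simp: boxes_def)
  have lens: "length (T ! r) = lam ! r" "length T = length lam" if "r < length T" for r using len that by auto
  show "tableau T"
    unfolding tableau_nth
  proof (intro conjI allI impI)
    fix r assume r: "r < length T"
    have "lam ! r \<in> set lam" using r lens[OF r] by simp
    then have "0 < lam ! r" using part by (simp add: partition_shape_def)
    then show "T ! r \<noteq> []" using lens[OF r] by auto
    show "sorted_wrt (<) (T ! r)"
      by (rule sorted_wrt_iff_nth_Suc_transp[THEN iffD2]) (auto simp: row box r)
  next
    fix r assume r: "Suc r < length T"
    have "lam ! Suc r \<le> lam ! r"
      using part r lens by (auto simp: partition_shape_def intro: sorted_wrt_nth_less[of "(\<ge>)"])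
    then have "length (T ! Suc r) \<le> length (T ! r)" using lens r by simp
    then show "below (T ! r) (T ! Suc r)" using col box r by (auto simp: below_def)
  qed
  show "\<forall>y\<in>set (concat T). 1 \<le> y \<and> y \<le> length \<mu>"
  proof
    fix y assume "y \<in> set (concat T)"
    then obtain R where "R \<in> set T" "y \<in> set R" by auto
    then obtain r c where "r < length T" "c < length (T ! r)" "y = T ! r ! c" by (metis in_set_conv_nth)
    then show "1 \<le> y \<and> y \<le> length \<mu>" using ent[of r c] box by auto
  qed
qed

section \<open>Insertion of words\<close>

definition ins :: "nat list \<Rightarrow> nat list list" where
  "ins w = foldl (\<lambda>P z. row_insert z P) [] w"

lemma ins_Nil [simp]: "ins [] = []" and ins_snoc [simp]: "ins (w @ [z]) = row_insert z (ins w)"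
  by (simp_all add: ins_def)

lemma tableau_ins: "tableau (ins w)"
  by (induction w rule: rev_induct) (auto intro: tableau_row_insert)

lemma mset_ins: "mset (concat (ins w)) = mset w"
  by (induction w rule: rev_induct) (auto simp: mset_row_insert[OF tableau_ins])

lemma set_ins: "set (concat (ins w)) = set w"
  by (rule mset_eq_setD[OF mset_ins])

text \<open>
  The minimal dimension of \<open>F\<^sub>i \<inter> F'\<^sub>k\<close> for flags attached to the word \<open>w\<close>.
\<close>

definition cnt :: "nat list \<Rightarrow> nat \<Rightarrow> nat \<Rightarrow> nat" where
  "cnt w k i = length (filter (\<lambda>a. a \<le> i) (take k w))"

lemma cnt_snoc: "k \<le> length w \<Longrightarrow> cnt (w @ [z]) k i = cnt w k i"
  by (simp add: cnt_def)

definition letters :: "nat \<Rightarrow> nat list \<Rightarrow> bool" where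
  "letters n w \<longleftrightarrow> (\<forall>a\<in>set w. 1 \<le> a \<and> a \<le> n)"

lemma letters_snoc: "letters n (w @ [z]) \<longleftrightarrow> letters n w \<and> 1 \<le> z \<and> z \<le> n"
  by (auto simp: letters_def)

lemma col_upto_shape: "letters n w \<Longrightarrow> n \<le> i \<Longrightarrow> col_upto (ins w) i c = shape_col (ins w) c"
  by (rule col_upto_all) (force simp: set_ins letters_def simp del: set_concat)

lemma sum_col_upto_ins:
  assumes "letters n w"
  shows "(\<Sum>c<n. col_upto (ins w) i c) = length (filter (\<lambda>y. y \<le> i) w)"
proof -
  have "(\<Sum>c<n. col_upto (ins w) i c) = length (filter (\<lambda>y. y \<le> i) (concat (ins w)))"
    by (rule sum_col_upto[OF tableau_rows[OF tableau_ins]]) (use assms in \<open>auto simp: set_ins letters_def simp del: set_concat\<close>)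
  also have "\<dots> = size (filter_mset (\<lambda>y. y \<le> i) (mset (concat (ins w))))"
    by (metis mset_filter size_mset)
  also have "\<dots> = length (filter (\<lambda>y. y \<le> i) w)" unfolding mset_ins by (metis mset_filter size_mset)
  finally show ?thesis .
qed

definition descending :: "nat list \<Rightarrow> nat \<Rightarrow> nat \<Rightarrow> bool" where
  "descending w l k \<longleftrightarrow> sorted_wrt (\<ge>) (drop l (take k w))"

text \<open>
  If the letters after position \<open>l\<close> decrease weakly down to \<open>z\<close>, all letters smaller than \<open>z\<close> are among
  the first \<open>l\<close>.
\<close>

lemma cnt_descending:
  assumes "descending (w @ [z]) l (Suc (length w))" "l \<le> length w" "1 \<le> z"
  shows "cnt w l (z - 1) = cnt w (length w) (z - 1)"
proof -
  have "drop l (take (Suc (length w)) (w @ [z])) = drop l w @ [z]" using assms(2) by simp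
  then have "\<forall>a\<in>set (drop l w). z \<le> a" using assms(1) by (simp add: descending_def sorted_wrt_append)
  then have "filter (\<lambda>a. a \<le> z - 1) (drop l w) = []" using assms(3) by (auto simp: filter_empty_conv)
  moreover have "filter (\<lambda>a. a \<le> z - 1) w = filter (\<lambda>a. a \<le> z - 1) (take l w) @ filter (\<lambda>a. a \<le> z - 1) (drop l w)"
    by (metis append_take_drop_id filter_append)
  ultimately show ?thesis by (simp add: cnt_def)
qed

text \<open>
  Inserting a weakly decreasing block moves the new boxes weakly to the left, so the columns to the
  left of the last new box are those from before the block.
\<close>

lemma columns_before_block:
  "sorted_wrt (\<ge>) (b @ [z]) \<Longrightarrow> letters n (v @ b @ [z]) \<Longrightarrow> c < new_col z (ins (v @ b)) n
    \<Longrightarrow> col_upto (ins (v @ b @ [z])) n c = col_upto (ins v) n c"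
proof (induction b arbitrary: z rule: rev_induct)
  case Nil
  then have "z \<le> n" by (simp add: letters_def)
  then show ?case using Nil col_upto_row_insert_ge[OF tableau_ins[of v], of z n c] by simp
next
  case (snoc y b)
  have zy: "z \<le> y" "y \<le> n" using snoc.prems by (auto simp: sorted_wrt_append letters_def)
  have ass: "ins (v @ (b @ [y]) @ [z]) = row_insert z (ins (v @ b @ [y]))" "ins (v @ b @ [y]) = row_insert y (ins (v @ b))"
    using ins_snoc[of "v @ b @ [y]" z] ins_snoc[of "v @ b" y] by simp_all
  have lt: "c < new_col z (ins (v @ b @ [y])) n" using snoc.prems(3) by simp
  then have "c < new_col y (ins (v @ b)) n"
    using new_col_row_insert_le[OF tableau_ins[of "v @ b"] zy] unfolding ass(2) by linarith
  then have "col_upto (ins (v @ b @ [y])) n c = col_upto (ins v) n c"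
    using snoc.prems(1,2) by (intro snoc.IH) (auto simp: sorted_wrt_append letters_def)
  moreover have "z \<le> n" using zy by simp
  ultimately show ?case
    unfolding ass(1) using col_upto_row_insert_ge[OF tableau_ins[of "v @ b @ [y]"], of z n c] lt by simp
qed

lemma col_upto_ins_mono: "letters n (v @ b) \<Longrightarrow> col_upto (ins v) n c \<le> col_upto (ins (v @ b)) n c"
proof (induction b rule: rev_induct)
  case (snoc y b)
  have "y \<le> n" "letters n (v @ b)" using snoc.prems by (auto simp: letters_def)
  then show ?case
    using snoc.IH ins_snoc[of "v @ b" y] col_upto_row_insert_ge[OF tableau_ins[of "v @ b"], of y n c] by simp
qed simp

section \<open>Arrays and their recording tableaux\<close>

lemma fst_rsk: "fst (rsk a) = ins (map snd a)"
proof (induction a rule: rev_induct)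
  case (snoc p a)
  then show ?case by (cases p) (simp add: rsk_snoc)
qed simp

lemma col_upto_add_entry_less: "j < u \<Longrightarrow> col_upto (add_entry r u Q) j c = col_upto Q j c"
proof (cases "r < length Q")
  case True
  assume "j < u"
  have "Q = take r Q @ Q ! r # drop (Suc r) Q" using True by (simp add: id_take_nth_drop)
  then have "col_upto Q j c = col_upto (take r Q @ Q ! r # drop (Suc r) Q) j c" by simp
  then show ?thesis using True \<open>j < u\<close> by (simp add: add_entry_def upd_conv_take_nth_drop col_upto_def)
qed (simp add: add_entry_def col_upto_def)

lemma set_add_entry: "r \<le> length Q \<Longrightarrow> set (concat (add_entry r u Q)) = insert u (set (concat Q))"
  using mset_add_entry[of r Q u] by (metis set_mset_add_mset_insert set_mset_mset)

lemma set_rsk: "set (concat (fst (rsk a))) = snd ` set a" "set (concat (snd (rsk a))) = fst ` set a"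
proof (induction a rule: rev_induct)
  case (snoc p a)
  obtain u z where p: "p = (u, z)" by (cases p)
  { case 1
    have "set_mset (mset (concat (row_insert z (fst (rsk a))))) = insert z (set (concat (fst (rsk a))))"
      by (simp only: mset_row_insert[OF tableau_rsk] set_mset_add_mset_insert set_mset_mset)
    then show ?case using snoc(1) by (simp add: p rsk_snoc)
  next
    case 2
    have "insertion_row z (fst (rsk a)) \<le> length (snd (rsk a))"
      using insertion_row_le shape_rsk[of a] by (metis length_map)
    then show ?case using snoc(2) by (simp add: p rsk_snoc set_add_entry del: set_concat)
  }
qed simp_all

text \<open>
  The entries \<open>\<le> j\<close> of the recording tableau occupy the boxes that are present after the letters
  with upper entry \<open>\<le> j\<close> have been inserted.
\<close>

lemma col_upto_recording:
  "sorted_wrt array_order a \<Longrightarrow>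
    col_upto (snd (rsk a)) j c = shape_col (fst (rsk (filter (\<lambda>p. fst p \<le> j) a))) c"
proof (induction a rule: rev_induct)
  case (snoc p a)
  obtain u z where p: "p = (u, z)" by (cases p)
  have le: "\<forall>q\<in>set a. fst q \<le> u" using snoc.prems by (auto simp: sorted_wrt_append array_order_def p)
  show ?case
  proof (cases "u \<le> j")
    case True
    then have "filter (\<lambda>p. fst p \<le> j) (a @ [p]) = a @ [p]" using le by (intro filter_True) (auto simp: p)
    moreover have "\<forall>y\<in>set (concat (snd (rsk (a @ [p])))). y \<le> j"
      unfolding set_rsk using le True by (auto simp: p)
    ultimately show ?thesis using col_upto_all shape_rsk[of "a @ [p]"] by (simp add: shape_col_def)
  next
    case False
    then show ?thesis using snoc by (simp add: p rsk_snoc col_upto_add_entry_less sorted_wrt_append)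
  qed
qed (simp add: shape_col_def)

lemma rsk_letters:
  assumes "T \<in> ssyt lam \<mu>" "T' \<in> ssyt lam \<nu>" "rsk a = (T, T')"
  shows "letters (length \<mu>) (map snd a)" "\<And>p. p \<in> set a \<Longrightarrow> fst p \<in> {1..length \<nu>} \<and> snd p \<in> {1..length \<mu>}"
    "ins (map snd a) = T"
proof -
  have "snd ` set a = set (concat T)" "fst ` set a = set (concat T')" using set_rsk[of a] assms(3) by simp_all
  then show *: "fst p \<in> {1..length \<nu>} \<and> snd p \<in> {1..length \<mu>}" if "p \<in> set a" for p
    using tableau_ssyt(2)[OF assms(1)] tableau_ssyt(2)[OF assms(2)] that by (metis atLeastAtMost_iff image_eqI)
  then show "letters (length \<mu>) (map snd a)" by (auto simp: letters_def)
  show "ins (map snd a) = T" using fst_rsk[of a] assms(3) by simp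
qed

text \<open>
  The letters that stand below the upper entries \<open>\<le> j\<close>; in a sorted array they form a prefix.
\<close>

definition word_upto :: "(nat \<times> nat) list \<Rightarrow> nat \<Rightarrow> nat list" where
  "word_upto a j = map snd (filter (\<lambda>p. fst p \<le> j) a)"

lemma recording_profile:
  assumes "sorted_wrt array_order a" "rsk a = (T, T')"
  shows "col_upto T' j c = shape_col (ins (word_upto a j)) c"
  using col_upto_recording[OF assms(1), of j c] assms(2) by (simp add: fst_rsk word_upto_def)

lemma word_upto_0: "(\<And>p. p \<in> set a \<Longrightarrow> 1 \<le> fst p) \<Longrightarrow> word_upto a 0 = []"
  unfolding word_upto_def by (force simp: filter_empty_conv)

lemma word_upto_full: "(\<And>p. p \<in> set a \<Longrightarrow> fst p \<le> m) \<Longrightarrow> word_upto a m = map snd a"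
  unfolding word_upto_def by (subst filter_True) auto

lemma sorted_array_split:
  "sorted_wrt array_order a \<Longrightarrow> a = filter (\<lambda>p. fst p \<le> j) a @ filter (\<lambda>p. \<not> fst p \<le> j) a"
proof (induction a)
  case (Cons p a)
  show ?case
  proof (cases "fst p \<le> j")
    case False
    then have "\<forall>q\<in>set a. \<not> fst q \<le> j" using Cons.prems by (auto simp: array_order_def)
    then have "filter (\<lambda>p. fst p \<le> j) a = []" "filter (\<lambda>p. \<not> fst p \<le> j) a = a"
      by (simp_all add: filter_empty_conv filter_id_conv)
    then show ?thesis using False by simp
  qed (use Cons in simp)
qed simp

lemma word_upto_prefix:
  assumes "sorted_wrt array_order a"
  shows "take (length (word_upto a j)) (map snd a) = word_upto a j"
proof -
  have "map snd a = word_upto a j @ map snd (filter (\<lambda>p. \<not> fst p \<le> j) a)"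
    unfolding word_upto_def map_append[symmetric] by (subst sorted_array_split[OF assms, of j]) (rule refl)
  then show ?thesis by simp
qed

lemma word_upto_Suc:
  assumes "sorted_wrt array_order a"
  shows "word_upto a (Suc j) = word_upto a j @ map snd (filter (\<lambda>p. fst p = Suc j) a)"
proof -
  let ?a = "filter (\<lambda>p. fst p \<le> Suc j) a"
  have "sorted_wrt array_order ?a" using assms by (rule sorted_wrt_filter)
  from sorted_array_split[OF this, of j]
  have "?a = filter (\<lambda>p. fst p \<le> j) ?a @ filter (\<lambda>p. \<not> fst p \<le> j) ?a" .
  moreover have "filter (\<lambda>p. fst p \<le> j) ?a = filter (\<lambda>p. fst p \<le> j) a" "filter (\<lambda>p. \<not> fst p \<le> j) ?a = filter (\<lambda>p. fst p = Suc j) a"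
    by (auto intro!: filter_cong)
  ultimately show ?thesis unfolding word_upto_def by (metis map_append)
qed

lemma block_descending:
  assumes "sorted_wrt array_order a"
  shows "sorted_wrt (\<ge>) (map snd (filter (\<lambda>p. fst p = Suc j) a))"
proof -
  have "sorted_wrt array_order (filter (\<lambda>p. fst p = Suc j) a)" using assms by (rule sorted_wrt_filter)
  then show ?thesis
    unfolding sorted_wrt_map by (rule sorted_wrt_mono_rel[rotated]) (auto simp: array_order_def)
qed

lemma length_word_upto_mono: "sorted_wrt array_order a \<Longrightarrow> j \<le> j' \<Longrightarrow> length (word_upto a j) \<le> length (word_upto a j')"
  by (rule lift_Suc_mono_le[of "\<lambda>j. length (word_upto a j)"]) (simp_all add: word_upto_Suc)

text \<open>
  The sum of the matrix entries in the rows \<open>\<le> i\<close> and the columns \<open>\<le> j\<close>.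
\<close>

definition corner :: "(nat \<times> nat) list \<Rightarrow> nat \<Rightarrow> nat \<Rightarrow> nat" where
  "corner a i j = length (filter (\<lambda>p. snd p \<le> i \<and> fst p \<le> j) a)"

lemma cnt_word_upto: "sorted_wrt array_order a \<Longrightarrow> cnt (map snd a) (length (word_upto a j)) i = corner a i j"
  unfolding cnt_def word_upto_prefix unfolding word_upto_def corner_def
  by (simp add: filter_map o_def conj_commute)

text \<open>
  The matrix is recovered from its corner sums by inclusion and exclusion.
\<close>

lemma corner_count:
  "corner a (Suc i) (Suc j) + corner a i j = corner a (Suc i) j + corner a i (Suc j) + count_list a (Suc j, Suc i)"
  by (induction a) (auto simp: corner_def)

lemma sorted_wrt_unique:
  assumes "\<And>p q. R p q \<Longrightarrow> R q p \<Longrightarrow> p = q"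
  shows "sorted_wrt R xs \<Longrightarrow> sorted_wrt R ys \<Longrightarrow> mset xs = mset ys \<Longrightarrow> xs = ys"
proof (induction xs arbitrary: ys)
  case (Cons x xs)
  obtain y ys' where ys: "ys = y # ys'" using Cons.prems(3) by (cases ys) auto
  have "set (x # xs) = set (y # ys')" using Cons.prems(3) unfolding ys by (rule mset_eq_setD)
  then have "x = y \<or> x \<in> set ys' \<and> y \<in> set xs" by auto
  then have "x = y" using Cons.prems(1,2) assms[of x y] unfolding ys by auto
  then show ?case using Cons ys by simp
qed simp

lemma count_list_concat_map: "count_list (concat (map f xs)) y = sum_list (map (\<lambda>x. count_list (f x) y) xs)"
  by (induction xs) auto

lemma count_list_replicate: "count_list (replicate k z) y = (if z = y then k else 0)"
  by (induction k) auto

lemma count_matrix_array: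
  assumes "\<And>i j. \<not> (i \<in> {1..n} \<and> j \<in> {1..m}) \<Longrightarrow> M i j = 0"
  shows "count_list (matrix_array n m M) (u, w) = M w u"
proof -
  have "count_list (matrix_array n m M) (u, w)
      = (\<Sum>u'\<in>{1..<Suc m}. \<Sum>w'\<in>{1..<Suc n}. if u' = u \<and> w' = w then M w' u' else 0)"
    unfolding matrix_array_def count_list_concat_map count_list_replicate
    by (simp add: sum_list_distinct_conv_sum_set del: upt_Suc)
  also have "\<dots> = (\<Sum>u'\<in>{1..<Suc m}. if u' = u then (\<Sum>w'\<in>{1..<Suc n}. if w' = w then M w' u' else 0) else 0)"
    by (intro sum.cong) auto
  also have "\<dots> = M w u" using assms[of w u] by (auto simp: sum.delta)
  finally show ?thesis .
qed

lemma sorted_matrix_array: "sorted_wrt array_order (matrix_array n m M)"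
proof -
  have [simp]: "array_order (u, w) (u', w') \<longleftrightarrow> u < u' \<or> u = u' \<and> w' \<le> w" for u w u' w'
    by (simp add: array_order_def)
  have inner: "sorted_wrt array_order (concat (map (\<lambda>w. replicate (M w u) (u, w)) ws))"
    if "sorted_wrt (>) ws" for ws and u :: nat
    using that
  proof (induction ws)
    case (Cons w ws)
    have "sorted_wrt array_order (replicate k (u, w))" for k
      by (induction k) auto
    then show ?case using Cons by (auto simp: sorted_wrt_append)
  qed simp
  have "sorted_wrt array_order (concat (map (\<lambda>u. concat (map (\<lambda>w. replicate (M w u) (u, w)) ws)) us))"
    if "sorted_wrt (<) us" "sorted_wrt (>) ws" for us ws
    using that
  proof (induction us)
    case (Cons u us)
    then show ?case using inner[of ws u] by (auto simp: sorted_wrt_append)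
  qed simp
  then show ?thesis unfolding matrix_array_def
    by (simp add: sorted_wrt_rev sorted_wrt_upt del: upt_Suc)
qed

lemma matrix_array_eq:
  assumes "sorted_wrt array_order a" "\<And>p. p \<in> set a \<Longrightarrow> fst p \<in> {1..m} \<and> snd p \<in> {1..n}"
  shows "matrix_array n m (\<lambda>i j. count_list a (j, i)) = a"
proof (rule sorted_wrt_unique)
  show "p = q" if "array_order p q" "array_order q p" for p q
    using that by (auto simp: array_order_def prod_eq_iff)
  have "count_list (matrix_array n m (\<lambda>i j. count_list a (j, i))) p = count_list a p" for p
  proof (cases p)
    case (Pair u w)
    then show ?thesis unfolding Pair
      by (intro count_matrix_array) (use assms(2)[of "(_, _)"] in \<open>auto simp: count_list_0_iff\<close>)
  qed
  then show "mset (matrix_array n m (\<lambda>i j. count_list a (j, i))) = mset a"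
    by (intro multiset_eqI) (simp add: count_mset)
qed (rule sorted_matrix_array, rule assms(1))

section \<open>Algebras of functions\<close>

text \<open>
  Algebras of functions that contain the constants. The polynomials in one variable
  serve for curves, the polynomial functions on frames for the topology of the flag variety; openness
  of rank conditions is proved once for both.
\<close>

definition palg :: "('p \<Rightarrow> 'k::field) set \<Rightarrow> bool" where
  "palg P \<longleftrightarrow> (\<forall>a. (\<lambda>_. a) \<in> P) \<and> (\<forall>p\<in>P. \<forall>q\<in>P. (\<lambda>x. p x + q x) \<in> P \<and> (\<lambda>x. p x * q x) \<in> P)"

lemma palg_const: "palg P \<Longrightarrow> (\<lambda>_. a) \<in> P"
  and palg_add: "palg P \<Longrightarrow> p \<in> P \<Longrightarrow> q \<in> P \<Longrightarrow> (\<lambda>x. p x + q x) \<in> P"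
  and palg_mult: "palg P \<Longrightarrow> p \<in> P \<Longrightarrow> q \<in> P \<Longrightarrow> (\<lambda>x. p x * q x) \<in> P"
  by (auto simp: palg_def)

lemma palg_diff: "palg P \<Longrightarrow> p \<in> P \<Longrightarrow> q \<in> P \<Longrightarrow> (\<lambda>x. p x - q x) \<in> P"
  using palg_add[of P p "\<lambda>x. (-1) * q x"] palg_mult[of P "\<lambda>_. -1" q] palg_const[of P "-1"] by simp

lemma palg_poly: "palg (range (poly :: 'k::field poly \<Rightarrow> _))"
  unfolding palg_def
proof (intro conjI allI ballI)
  show "(\<lambda>_. a) \<in> range poly" for a :: 'k by (rule range_eqI[of _ _ "[:a:]"]) auto
  fix p q :: "'k \<Rightarrow> 'k" assume "p \<in> range poly" "q \<in> range poly"
  then obtain P Q where "p = poly P" "q = poly Q" by auto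
  then have "(\<lambda>x. p x + q x) = poly (P + Q)" "(\<lambda>x. p x * q x) = poly (P * Q)" by auto
  then show "(\<lambda>x. p x + q x) \<in> range poly" "(\<lambda>x. p x * q x) \<in> range poly" by simp_all
qed

lemma poly_id: "(\<lambda>s. s) \<in> range (poly :: 'k::field poly \<Rightarrow> _)"
  by (rule range_eqI[of _ _ "[:0, 1:]"]) auto

lemma cofinite_poly: "q \<in> range poly \<Longrightarrow> q s0 \<noteq> 0 \<Longrightarrow> \<forall>\<^sub>F s in cofinite. q (s::'k::field) \<noteq> 0"
proof -
  assume "q \<in> range poly" and nz: "q s0 \<noteq> 0"
  then obtain Q where Q1: "q = poly Q" by blast
  have Q2: "Q \<noteq> 0" using nz by (auto simp: Q1)
  show ?thesis unfolding Q1 eventually_cofinite using poly_roots_finite[OF Q2] by simp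
qed

text \<open>
  Infinite fields enter through this step alone: curves are useful because a condition that holds
  almost everywhere holds somewhere.
\<close>

lemma cofinite_ex: "infinite (UNIV :: 'k set) \<Longrightarrow> \<forall>\<^sub>F s in cofinite. P (s::'k) \<Longrightarrow> \<exists>s. P s"
proof (rule ccontr)
  assume "infinite (UNIV :: 'k set)" "\<forall>\<^sub>F s in cofinite. P s" "\<not> (\<exists>s. P s)"
  then show False by (simp add: eventually_cofinite)
qed

section \<open>Jordan types of subspaces\<close>

locale fdvs = finite_dimensional_vector_space scale Basis
  for scale :: "'a::field \<Rightarrow> 'b::ab_group_add \<Rightarrow> 'b"  (infixr \<open>\<cdot>\<close> 75)
    and Basis :: "'b set"
begin

interpretation self: finite_dimensional_vector_space_pair scale Basis scale Basis
  by unfold_locales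

lemma vector_space_field: "vector_space ((*) :: 'a \<Rightarrow> 'a \<Rightarrow> 'a)"
  by unfold_locales (simp_all add: algebra_simps)

interpretation dual: vector_space_pair scale "(*) :: 'a \<Rightarrow> 'a \<Rightarrow> 'a"
  by (intro vector_space_pair.intro vector_space_field) unfold_locales

abbreviation endo :: "('b \<Rightarrow> 'b) \<Rightarrow> bool" where
  "endo x \<equiv> Vector_Spaces.linear scale scale x"

abbreviation functional :: "('b \<Rightarrow> 'a) \<Rightarrow> bool" where
  "functional \<phi> \<equiv> Vector_Spaces.linear scale (*) \<phi>"

lemma endo_id: "endo (\<lambda>v. v)"
  by (simp add: Vector_Spaces.linear_iff vector_space_axioms)

lemma endo_funpow: "endo x \<Longrightarrow> endo (x ^^ c)"
proof (induction c)
  case 0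
  then show ?case using endo_id by (simp add: id_def)
next
  case (Suc c)
  then show ?case using Vector_Spaces.linear_compose[of scale scale "x ^^ c" scale x] by (simp add: o_def)
qed

lemma endo_add: "endo x \<Longrightarrow> x (u + v) = x u + x v" by (rule self.linear_add)

lemma endo_scale: "endo x \<Longrightarrow> x (a \<cdot> v) = a \<cdot> x v" by (rule self.linear_scale)

lemma endo_0: "endo x \<Longrightarrow> x 0 = 0" by (rule self.linear_0)

lemma endo_diff: "endo x \<Longrightarrow> x (u - v) = x u - x v" by (rule self.linear_diff)

lemma endo_sum: "endo x \<Longrightarrow> x (sum f A) = (\<Sum>a\<in>A. x (f a))" by (rule self.linear_sum)

lemma functional_add: "functional \<phi> \<Longrightarrow> \<phi> (u + v) = \<phi> u + \<phi> v" by (rule dual.linear_add)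

lemma functional_scale: "functional \<phi> \<Longrightarrow> \<phi> (a \<cdot> v) = a * \<phi> v" by (rule dual.linear_scale)

lemma functional_diff: "functional \<phi> \<Longrightarrow> \<phi> (u - v) = \<phi> u - \<phi> v" by (rule dual.linear_diff)

lemma functional_compose: "functional \<phi> \<Longrightarrow> endo x \<Longrightarrow> functional (\<lambda>v. \<phi> (x v))"
  using Vector_Spaces.linear_compose[of scale scale x "(*)" \<phi>] by (simp add: o_def)

lemma subspace_image: "endo x \<Longrightarrow> subspace S \<Longrightarrow> subspace (x ` S)" by (rule self.linear_subspace_image)

lemma functional_0_on_span: "functional \<phi> \<Longrightarrow> (\<And>b. b \<in> B \<Longrightarrow> \<phi> b = 0) \<Longrightarrow> v \<in> span B \<Longrightarrow> \<phi> v = 0"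
  by (rule dual.linear_eq_0_on_span)

definition K :: "('b \<Rightarrow> 'b) \<Rightarrow> nat \<Rightarrow> 'b set" where
  "K x c = {v. (x ^^ c) v = 0}"

text \<open>
  If \<open>U\<close> is stable under \<open>x\<close> and \<open>x\<close> is nilpotent on it, this is the number of Jordan blocks of size
  greater than \<open>c\<close> of \<open>x\<close> on \<open>U\<close>, that is, the length of column \<open>c\<close> of the Jordan type.
\<close>

definition jcol :: "('b \<Rightarrow> 'b) \<Rightarrow> 'b set \<Rightarrow> nat \<Rightarrow> nat" where
  "jcol x U c = dim ((x ^^ c) ` (U \<inter> K x (Suc c)))"

lemma subspace_K: "endo x \<Longrightarrow> subspace (K x c)"
  unfolding K_def by (rule self.linear_subspace_kernel[OF endo_funpow])

lemma K_mono_Suc: "endo x \<Longrightarrow> K x c \<subseteq> K x (Suc c)"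
  by (auto simp: K_def endo_0)

lemma K_mono: "endo x \<Longrightarrow> c \<le> c' \<Longrightarrow> K x c \<subseteq> K x c'"
  by (rule lift_Suc_mono_le[of "K x"]) (auto dest: K_mono_Suc)

lemma rank_nullity:
  assumes f: "endo f" and S: "subspace S"
  shows "dim S = dim (f ` S) + dim (S \<inter> {v. f v = 0})"
proof -
  let ?N = "S \<inter> {v. f v = 0}"
  obtain g where g: "range g \<subseteq> S" "endo g" "\<And>v. v \<in> f ` S \<Longrightarrow> f (g v) = v"
    using self.linear_exists_right_inverse_on[OF f S] by blast
  have sN: "subspace ?N" using S self.linear_subspace_kernel[OF f] by (rule subspace_inter)
  have sf: "subspace (f ` S)" using f S by (rule subspace_image)
  have sg: "subspace (g ` f ` S)" using g(2) sf by (rule subspace_image)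
  have sum: "{u + v |u v. u \<in> ?N \<and> v \<in> g ` f ` S} = S"
  proof
    show "{u + v |u v. u \<in> ?N \<and> v \<in> g ` f ` S} \<subseteq> S" using g(1) S by (auto intro!: subspace_add)
    show "S \<subseteq> {u + v |u v. u \<in> ?N \<and> v \<in> g ` f ` S}"
    proof
      fix v assume v: "v \<in> S"
      have "v - g (f v) \<in> ?N" using v g S by (auto simp: endo_diff[OF f] intro!: subspace_diff)
      then show "v \<in> {u + v |u v. u \<in> ?N \<and> v \<in> g ` f ` S}"
        using v by (intro CollectI exI[of _ "v - g (f v)"] exI[of _ "g (f v)"]) auto
    qed
  qed
  have "?N \<inter> g ` f ` S = {0}"
    using g sN sg by (auto simp: endo_0 dest: subspace_0)
  then have "dim S + 0 = dim ?N + dim (g ` f ` S)"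
    using dim_sums_Int[OF sN sg] sum by (simp add: dim_empty)
  moreover have "dim (g ` f ` S) = dim (f ` S)"
    by (rule self.dim_image_eq[OF g(2)]) (use g sf in \<open>metis inj_on_inverseI span_eq_iff\<close>)
  ultimately show ?thesis by simp
qed

lemma dim_K_Suc:
  assumes "endo x" "subspace U"
  shows "dim (U \<inter> K x (Suc c)) = dim (U \<inter> K x c) + jcol x U c"
proof -
  have "U \<inter> K x (Suc c) \<inter> {v. (x ^^ c) v = 0} = U \<inter> K x c"
    using K_mono_Suc[OF assms(1)] by (auto simp: K_def)
  then show ?thesis
    using rank_nullity[OF endo_funpow[OF assms(1)], of "U \<inter> K x (Suc c)" c] assms subspace_K
    by (simp add: jcol_def subspace_inter)
qed

lemma K_0 [simp]: "K x 0 = {0}" by (auto simp: K_def)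

lemma dim_Int_K: "endo x \<Longrightarrow> subspace U \<Longrightarrow> dim (U \<inter> K x c) = (\<Sum>j<c. jcol x U j)"
proof (induction c)
  case 0
  then have "U \<inter> K x 0 = {0}" by (auto simp: subspace_0)
  then show ?case by simp
qed (simp add: dim_K_Suc)

lemma jcol_mono: "U \<subseteq> U' \<Longrightarrow> jcol x U c \<le> jcol x U' c"
  unfolding jcol_def by (intro dim_subset) auto

lemma funpow_Suc_right_app: "(x ^^ Suc c) v = (x ^^ c) (x v)"
  by (simp add: funpow_swap1)

text \<open>
  The type of \<open>x\<close> on \<open>D\<close> contains the type on \<open>W\<close> with its first column removed, since that is the
  type on \<open>x W\<close>.
\<close>

lemma jcol_Suc_le:
  assumes "x ` W \<subseteq> D"
  shows "jcol x W (Suc c) \<le> jcol x D c"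
proof -
  have "(x ^^ Suc c) ` (W \<inter> K x (Suc (Suc c))) \<subseteq> (x ^^ c) ` (D \<inter> K x (Suc c))"
  proof
    fix u assume "u \<in> (x ^^ Suc c) ` (W \<inter> K x (Suc (Suc c)))"
    then obtain w where w: "w \<in> W" "(x ^^ Suc (Suc c)) w = 0" "u = (x ^^ Suc c) w" by (auto simp: K_def)
    then have "x w \<in> D \<inter> K x (Suc c)" "u = (x ^^ c) (x w)"
      using assms funpow_Suc_right_app[of "Suc c" x w] funpow_Suc_right_app[of c x w] by (auto simp: K_def)
    then show "u \<in> (x ^^ c) ` (D \<inter> K x (Suc c))" by blast
  qed
  then show ?thesis unfolding jcol_def by (rule dim_subset)
qed

text \<open>
  The inequality says that \<open>B\<close> has Jordan chains of length \<open>Suc c\<close> that do not prolong to chains of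
  \<open>W\<close>. The vector \<open>t\<close> is free in the sense that endomorphisms commuting with \<open>x\<close> can move it; see
  \<open>exists_commuting_move\<close>.
\<close>

lemma exists_free_generator:
  assumes "endo x" "jcol x W (Suc c) < jcol x B c"
  shows "\<exists>t\<in>B \<inter> K x (Suc c). (x ^^ c) t \<notin> (x ^^ Suc c) ` W"
proof (rule ccontr)
  assume n: "\<not> ?thesis"
  have "(x ^^ c) ` (B \<inter> K x (Suc c)) \<subseteq> (x ^^ Suc c) ` (W \<inter> K x (Suc (Suc c)))"
  proof
    fix u assume "u \<in> (x ^^ c) ` (B \<inter> K x (Suc c))"
    then obtain t where t: "t \<in> B \<inter> K x (Suc c)" "u = (x ^^ c) t" by blast
    then obtain w where w: "w \<in> W" "(x ^^ c) t = (x ^^ Suc c) w" using n by blast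
    have "(x ^^ Suc (Suc c)) w = 0" using t w(2) by (simp add: K_def)
    then show "u \<in> (x ^^ Suc c) ` (W \<inter> K x (Suc (Suc c)))" using w t by (auto simp: K_def)
  qed
  then have "jcol x B c \<le> jcol x W (Suc c)" unfolding jcol_def by (rule dim_subset)
  then show False using assms by simp
qed

lemma funpow_commute_on:
  assumes "\<And>w. w \<in> W \<Longrightarrow> h (x w) = x' (h w)" "x ` W \<subseteq> W" "w \<in> W"
  shows "h ((x ^^ c) w) = (x' ^^ c) (h w)" "(x ^^ c) w \<in> W"
  by (induction c) (use assms in auto)

lemma jcol_image:
  assumes h: "endo h" "inj_on h W" and com: "\<And>w. w \<in> W \<Longrightarrow> h (x w) = x' (h w)"
    and W: "x ` W \<subseteq> W" "subspace W" and U: "U \<subseteq> W" and x: "endo x"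
  shows "jcol x' (h ` U) c = jcol x U c"
proof -
  have z: "h u = 0 \<longleftrightarrow> u = 0" if "u \<in> W" for u
    using inj_on_eq_iff[OF h(2) that subspace_0[OF W(2)]] endo_0[OF h(1)] by simp
  note c = funpow_commute_on[of W h x x', OF com W(1)]
  have "(x' ^^ c) ` (h ` U \<inter> K x' (Suc c)) = h ` (x ^^ c) ` (U \<inter> K x (Suc c))" (is "?L = ?R")
  proof
    show "?L \<subseteq> ?R"
    proof
      fix v assume "v \<in> ?L"
      then obtain u where u: "u \<in> U" "(x' ^^ Suc c) (h u) = 0" "v = (x' ^^ c) (h u)" by (auto simp: K_def)
      then have "h ((x ^^ Suc c) u) = 0" "v = h ((x ^^ c) u)" using c[of u] U by (metis subsetD)+
      moreover have "(x ^^ Suc c) u \<in> W" using c(2)[of u "Suc c"] u U by blast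
      ultimately show "v \<in> ?R" using u z by (auto simp: K_def)
    qed
    show "?R \<subseteq> ?L"
    proof
      fix v assume "v \<in> ?R"
      then obtain u where u: "u \<in> U" "(x ^^ Suc c) u = 0" "v = h ((x ^^ c) u)" by (auto simp: K_def)
      then have "(x' ^^ Suc c) (h u) = 0" "v = (x' ^^ c) (h u)"
        using c(1)[of u "Suc c"] c(1)[of u c] U endo_0[OF h(1)] by auto
      then show "v \<in> ?L" using u by (auto simp: K_def)
    qed
  qed
  moreover have "dim (h ` ((x ^^ c) ` (U \<inter> K x (Suc c)))) = dim ((x ^^ c) ` (U \<inter> K x (Suc c)))"
  proof (rule self.dim_image_eq[OF h(1)], rule inj_on_subset[OF h(2)])
    show "span ((x ^^ c) ` (U \<inter> K x (Suc c))) \<subseteq> W"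
      by (rule span_minimal[OF _ W(2)]) (use c(2) U in auto)
  qed
  ultimately show ?thesis unfolding jcol_def by simp
qed

lemma dim_funpow_image:
  assumes "endo x" "subspace U"
  shows "dim ((x ^^ g) ` U) + (\<Sum>c<g. jcol x U c) = dim U"
proof -
  have "dim U = dim ((x ^^ g) ` U) + dim (U \<inter> {v. (x ^^ g) v = 0})"
    by (rule rank_nullity[OF endo_funpow[OF assms(1)] assms(2)])
  then show ?thesis using dim_Int_K[OF assms, of g] by (simp add: K_def)
qed

section \<open>Hyperplanes\<close>

lemma exists_functional:
  assumes "subspace U" "s \<notin> U"
  shows "\<exists>\<phi>. functional \<phi> \<and> (\<forall>u\<in>U. \<phi> u = 0) \<and> \<phi> s = 1"
proof -
  obtain B where B: "B \<subseteq> U" "independent B" "U \<subseteq> span B" using basis_exists by metis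
  then have "span B = U" using assms(1) by (metis span_minimal subset_antisym)
  then have ind: "independent (insert s B)" using B assms by (simp add: independent_insert)
  obtain \<phi> where \<phi>: "functional \<phi>" "\<forall>b\<in>insert s B. \<phi> b = (if b = s then 1 else 0)"
    using dual.linear_independent_extend[OF ind, of "\<lambda>b. if b = s then 1 else 0"] by blast
  have sB: "s \<notin> B" using assms B by blast
  have "\<phi> u = 0" if "u \<in> U" for u
  proof (rule functional_0_on_span[OF \<phi>(1), of B u])
    show "\<phi> b = 0" if "b \<in> B" for b using \<phi>(2) that sB by auto
  qed (use that B in blast)
  then show ?thesis using \<phi> by auto
qed

lemma exists_hyperplane:
  assumes "subspace U" "subspace W" "U \<subseteq> W" "s \<in> W" "s \<notin> U"
  obtains A where "subspace A" "U \<subseteq> A" "A \<subseteq> W" "s \<notin> A" "dim W = Suc (dim A)"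
proof -
  obtain \<phi> where \<phi>: "functional \<phi>" "\<forall>u\<in>U. \<phi> u = 0" "\<phi> s = 1" using exists_functional assms by blast
  let ?A = "W \<inter> {w. \<phi> w = 0}"
  have A: "subspace ?A" using assms(2) dual.linear_subspace_kernel[OF \<phi>(1)] by (rule subspace_inter)
  have sA: "s \<notin> ?A" using \<phi> by simp
  have "W \<subseteq> span (insert s ?A)"
  proof
    fix w assume w: "w \<in> W"
    have "w - \<phi> w \<cdot> s \<in> ?A"
      using w assms \<phi> by (auto intro!: subspace_diff subspace_scale simp: functional_diff functional_scale)
    then show "w \<in> span (insert s ?A)" by (metis span_breakdown_eq span_base)
  qed
  then have "span (insert s ?A) = W" using assms by (intro equalityI span_minimal) auto
  then have "dim W = dim (insert s ?A)" by (metis dim_span)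
  also have "\<dots> = Suc (dim ?A)" using sA A by (simp add: dim_insert span_eq_iff[THEN iffD2])
  finally show ?thesis using that[of ?A] A sA \<phi> assms by blast
qed

lemma dim_insert_subspace: "subspace H \<Longrightarrow> e \<notin> H \<Longrightarrow> dim (insert e H) = Suc (dim H)"
  by (simp add: dim_insert span_eq_iff[THEN iffD2])

lemma dim_Int_hyperplane:
  assumes "subspace A" "subspace W" "A \<subseteq> W" "dim W \<le> Suc (dim A)" "subspace S" "S \<subseteq> W"
  shows "dim S = dim (S \<inter> A) + (if S \<subseteq> A then 0 else 1)"
proof (cases "S \<subseteq> A")
  case True
  then show ?thesis by (simp add: Int_absorb2)
next
  case False
  have "{u + v |u v. u \<in> S \<and> v \<in> A} \<subseteq> W" using assms by (auto intro!: subspace_add)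
  then have "dim {u + v |u v. u \<in> S \<and> v \<in> A} \<le> dim W" by (rule dim_subset)
  then have "dim S \<le> Suc (dim (S \<inter> A))" using dim_sums_Int[OF assms(5,1)] assms(4) by linarith
  moreover have "dim (S \<inter> A) < dim S"
    using False subspace_dim_equal[of "S \<inter> A" S] assms by (metis Int_lower1 inf.orderI not_le subspace_inter)
  ultimately show ?thesis using False by simp
qed

lemma span_insert_elim:
  assumes "w \<in> span (insert e G)" "subspace G"
  obtains k b where "b \<in> G" "w = k \<cdot> e + b"
proof -
  obtain k where "w - k \<cdot> e \<in> span G" using assms(1) by (auto simp: span_insert)
  then have "w - k \<cdot> e \<in> G" using assms(2) by (simp add: span_eq_iff[THEN iffD2])
  then show ?thesis using that[of "w - k \<cdot> e" k] by simp
qed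

lemma span_insert_Int:
  assumes "subspace G" "G \<subseteq> A" "subspace A" "e \<notin> A"
  shows "span (insert e G) \<inter> A = G"
proof
  show "span (insert e G) \<inter> A \<subseteq> G"
  proof
    fix w assume w: "w \<in> span (insert e G) \<inter> A"
    then obtain k where "w - k \<cdot> e \<in> span G" by (auto simp: span_insert)
    then have k: "w - k \<cdot> e \<in> G" using assms(1) by (simp add: span_eq_iff[THEN iffD2])
    have wA: "w \<in> A" "w - k \<cdot> e \<in> A" using w k assms(2) by blast+
    have ke: "k \<cdot> e \<in> A" using subspace_diff[OF assms(3) wA] by simp
    have "k = 0"
    proof (rule ccontr)
      assume "k \<noteq> 0"
      then have "(1/k) \<cdot> (k \<cdot> e) = e" by simp
      then show False using subspace_scale[OF assms(3) ke, of "1/k"] assms(4) by simp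
    qed
    then show "w \<in> G" using k by simp
  qed
  show "G \<subseteq> span (insert e G) \<inter> A" using assms(2) by (auto intro: span_base)
qed

text \<open>
  The least element of this up-set is the column in which the types of \<open>W\<close> and \<open>W \<inter> A\<close> differ, for a
  hyperplane \<open>A\<close> of a space containing \<open>W\<close> (\<open>jcol_hyperplane\<close>).
\<close>

definition J :: "('b \<Rightarrow> 'b) \<Rightarrow> 'b set \<Rightarrow> 'b set \<Rightarrow> nat set" where
  "J x W A = {c. \<not> W \<inter> K x (Suc c) \<subseteq> A}"

lemma J_mono: "W \<subseteq> W' \<Longrightarrow> J x W A \<subseteq> J x W' A"
  by (auto simp: J_def)

lemma J_up: "endo x \<Longrightarrow> c \<in> J x W A \<Longrightarrow> c \<le> c' \<Longrightarrow> c' \<in> J x W A"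
  using K_mono[of x "Suc c" "Suc c'"] by (auto simp: J_def)

lemma dim_Int_K_hyperplane:
  assumes "endo x" "subspace A" "subspace W" "A \<subseteq> W" "dim W \<le> Suc (dim A)" "subspace S" "S \<subseteq> W"
  shows "dim (S \<inter> K x (Suc c)) = dim (S \<inter> A \<inter> K x (Suc c)) + (if c \<in> J x S A then 1 else 0)"
proof -
  have "S \<inter> K x (Suc c) \<inter> A = S \<inter> A \<inter> K x (Suc c)" by blast
  moreover have "subspace (S \<inter> K x (Suc c))" "S \<inter> K x (Suc c) \<subseteq> W"
    using assms subspace_K[OF assms(1)] by (auto intro: subspace_inter)
  ultimately show ?thesis
    using dim_Int_hyperplane[OF assms(2-5), of "S \<inter> K x (Suc c)"] by (simp add: J_def)
qed

lemma jcol_hyperplane: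
  assumes "endo x" "subspace A" "subspace W" "A \<subseteq> W" "dim W \<le> Suc (dim A)" "subspace S" "S \<subseteq> W"
  shows "jcol x S c = jcol x (S \<inter> A) c + (if c \<in> J x S A \<and> (c = 0 \<or> c - 1 \<notin> J x S A) then 1 else 0)"
proof (cases c)
  case 0
  then show ?thesis
    using dim_Int_K_hyperplane[OF assms, of 0] dim_K_Suc[OF assms(1,6), of 0]
      dim_K_Suc[OF assms(1) subspace_inter[OF assms(6,2)], of 0]
    by (auto simp: subspace_0 assms Int_insert_right_if1 subspace_inter)
next
  case (Suc k)
  then show ?thesis
    using dim_Int_K_hyperplane[OF assms, of k] dim_Int_K_hyperplane[OF assms, of c]
      dim_K_Suc[OF assms(1,6), of c] dim_K_Suc[OF assms(1) subspace_inter[OF assms(6,2)], of c]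
      J_up[OF assms(1), of k S A c]
    by (auto split: if_splits)
qed

text \<open>
  Conversely to \<open>jcol_hyperplane\<close>, the column of the removed box determines \<open>J\<close>.
\<close>

lemma J_from_jcol:
  assumes x: "endo x" and A: "subspace A" "subspace W" "A \<subseteq> W" "dim W \<le> Suc (dim A)"
    and jcol: "\<And>c. jcol x W c = jcol x A c + (if c = g then 1 else 0)"
  shows "J x W A = {c. g \<le> c}"
proof -
  have WA: "W \<inter> A = A" using A(3) by (rule Int_absorb1)
  have eq: "c = g \<longleftrightarrow> c \<in> J x W A \<and> (c = 0 \<or> c - 1 \<notin> J x W A)" for c
  proof -
    have gen: "p = q" if "(a::nat) + (if p then 1 else 0) = a + (if q then 1 else 0)" for a p q
      using that by (cases p; cases q) simp_all
    have "jcol x W c = jcol x A c + (if c \<in> J x W A \<and> (c = 0 \<or> c - 1 \<notin> J x W A) then 1 else 0)"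
      using jcol_hyperplane[OF x A(1,2,3,4) A(2) order_refl, of c] by (simp only: WA)
    then have "jcol x A c + (if c = g then 1 else 0) = jcol x A c + (if c \<in> J x W A \<and> (c = 0 \<or> c - 1 \<notin> J x W A) then 1 else 0)"
      using jcol[of c] by (rule trans[OF sym, rotated])
    then show ?thesis by (rule gen)
  qed
  have "g \<in> J x W A" using eq[of g] by blast
  moreover have "g \<le> c" if c: "c \<in> J x W A" for c
  proof -
    define c0 where "c0 = (LEAST c. c \<in> J x W A)"
    have c0J: "c0 \<in> J x W A" unfolding c0_def using c by (rule LeastI)
    have le: "c0 \<le> c'" if "c' \<in> J x W A" for c' unfolding c0_def using that by (rule Least_le)
    have "c0 = 0 \<or> c0 - 1 \<notin> J x W A" using le[of "c0 - 1"] by (cases c0) auto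
    then show ?thesis using eq[of c0] le[OF c] c0J by simp
  qed
  ultimately show ?thesis using J_up[OF x] by blast
qed

text \<open>
  Column \<open>g\<close> is longer than the next one, so there is a Jordan block of size \<open>Suc g\<close>. Its generator
  \<open>s\<close> is not in \<open>x W + ker x\<^sup>g\<close>, and a hyperplane that contains this subspace but not \<open>s\<close> will do.
\<close>

lemma exists_hyperplane_of_type:
  assumes x: "endo x" and W: "subspace W" and g: "jcol x W (Suc g) < jcol x W g"
  shows "\<exists>A. subspace A \<and> A \<subseteq> W \<and> x ` W \<inter> W \<subseteq> A \<and> dim W = Suc (dim A) \<and> J x W A = {c. g \<le> c}"
proof -
  obtain s where s: "s \<in> W" "s \<in> K x (Suc g)" "(x ^^ g) s \<notin> (x ^^ Suc g) ` W"
    using exists_free_generator[OF x g] by blast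
  let ?X = "x ` W \<inter> W \<union> W \<inter> K x g"
  let ?U = "span ?X"
  have sub: "?X \<subseteq> W" by blast
  have sU: "s \<notin> ?U"
  proof
    assume "s \<in> ?U"
    moreover have "?U \<subseteq> {a + b |a b. a \<in> x ` W \<and> b \<in> K x g}"
    proof (rule span_minimal)
      show "?X \<subseteq> {a + b |a b. a \<in> x ` W \<and> b \<in> K x g}"
      proof
        fix v assume "v \<in> ?X"
        then consider "v \<in> x ` W" | "v \<in> K x g" by blast
        then show "v \<in> {a + b |a b. a \<in> x ` W \<and> b \<in> K x g}"
        proof cases
          case 1
          then show ?thesis using subspace_0[OF subspace_K[OF x, of g]] by (intro CollectI exI[of _ v] exI[of _ 0]) simp
        next
          case 2
          then show ?thesis using subspace_0[OF subspace_image[OF x W]] by (intro CollectI exI[of _ 0] exI[of _ v]) simp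
        qed
      qed
      show "subspace {a + b |a b. a \<in> x ` W \<and> b \<in> K x g}" by (rule subspace_sums[OF subspace_image[OF x W] subspace_K[OF x]])
    qed
    ultimately obtain a b where ab: "s = a + b" "a \<in> x ` W" "b \<in> K x g" by blast
    then obtain w where w: "w \<in> W" "a = x w" by blast
    have "(x ^^ g) s = (x ^^ g) (x w) + (x ^^ g) b" using ab w endo_add[OF endo_funpow[OF x]] by simp
    also have "\<dots> = (x ^^ Suc g) w" using ab(3) by (simp add: K_def funpow_swap1)
    finally show False using s(3) w(1) by blast
  qed
  have UW: "?U \<subseteq> W" using sub W by (rule span_minimal)
  obtain A where A: "subspace A" "?U \<subseteq> A" "A \<subseteq> W" "s \<notin> A" "dim W = Suc (dim A)"
    by (rule exists_hyperplane[OF subspace_span W UW s(1) sU])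
  have XA: "?X \<subseteq> A" using order.trans[OF span_superset A(2)] .
  have "c \<in> J x W A \<longleftrightarrow> g \<le> c" for c
  proof
    assume c: "c \<in> J x W A"
    show "g \<le> c"
    proof (rule ccontr)
      assume "\<not> g \<le> c"
      then have "K x (Suc c) \<subseteq> K x g" by (intro K_mono[OF x]) simp
      moreover obtain v where "v \<in> W" "v \<in> K x (Suc c)" "v \<notin> A" using c unfolding J_def by blast
      ultimately show False using XA by blast
    qed
  next
    assume "g \<le> c"
    moreover have "g \<in> J x W A" using s A(4) by (auto simp: J_def)
    ultimately show "c \<in> J x W A" using J_up[OF x] by blast
  qed
  then have "J x W A = {c. g \<le> c}" by blast
  then show ?thesis using A XA by blast
qed

text \<open>
  Let \<open>f\<close> vanish on \<open>x\<^sup>c\<^sup>+\<^sup>1 W\<close> with \<open>f (x\<^sup>c t) = 1\<close>. The map that sends \<open>w\<close> to the sum of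
  \<open>f (x\<^sup>k w) x\<^sup>c\<^sup>-\<^sup>k s\<close> over \<open>k \<le> c\<close> commutes with \<open>x\<close>, because the terms that fall out at the two
  ends of the sum vanish, and it sends \<open>t\<close> to \<open>s\<close> modulo \<open>x W\<close>.
\<close>

lemma exists_commuting_move:
  assumes x: "endo x" and W: "subspace W" "x ` W \<subseteq> W" and s: "s \<in> W" "s \<in> K x (Suc c)" "s \<notin> A"
    and t: "t \<in> W" "(x ^^ c) t \<notin> (x ^^ Suc c) ` W" and A: "subspace A" "x ` W \<subseteq> A"
  shows "\<exists>y. endo y \<and> y ` W \<subseteq> W \<and> (\<forall>w\<in>W. y (x w) = x (y w)) \<and> y t \<notin> A"
proof -
  obtain f where f: "functional f" "\<forall>u\<in>(x ^^ Suc c) ` W. f u = 0" "f ((x ^^ c) t) = 1"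
    using exists_functional[OF subspace_image[OF endo_funpow[OF x] W(1)] t(2)] by blast
  have inW: "(x ^^ k) w \<in> W" if "w \<in> W" for k w
    using that W(2) by (induction k) auto
  define y where "y w = (\<Sum>k\<le>c. f ((x ^^ k) w) \<cdot> (x ^^ (c - k)) s)" for w
  have "endo y"
    unfolding Vector_Spaces.linear_iff y_def
    by (simp add: vector_space_axioms endo_add[OF endo_funpow[OF x]] endo_scale[OF endo_funpow[OF x]]
        functional_add[OF f(1)] functional_scale[OF f(1)] scale_left_distrib sum.distrib scale_sum_right)
  moreover have "y w \<in> W" for w
    unfolding y_def using s inW W by (intro subspace_sum subspace_scale) auto
  moreover have "y (x w) = x (y w)" if w: "w \<in> W" for w
  proof -
    let ?g = "\<lambda>k. f ((x ^^ k) w) \<cdot> (x ^^ (Suc c - k)) s"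
    \<comment> \<open>the two sums differ in the terms \<open>?g 0\<close> and \<open>?g (Suc c)\<close>, which vanish\<close>
    have "y (x w) = (\<Sum>k\<le>c. ?g (Suc k))"
      unfolding y_def by (intro sum.cong) (simp_all add: funpow_swap1)
    also have "\<dots> = (\<Sum>k\<le>Suc c. ?g k) - ?g 0" by (simp only: sum.atMost_Suc_shift) simp
    also have "?g 0 = 0" using s(2) by (simp add: K_def)
    also have "(\<Sum>k\<le>Suc c. ?g k) = (\<Sum>k\<le>c. ?g k) + ?g (Suc c)" by simp
    also have "f ((x ^^ Suc c) w) = 0" using f(2) w by blast
    also have "(\<Sum>k\<le>c. ?g k) = x (y w)"
      unfolding y_def by (simp add: endo_sum[OF x] endo_scale[OF x] Suc_diff_le)
    finally show ?thesis by simp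
  qed
  moreover have "y t \<notin> A"
  proof
    assume yt: "y t \<in> A"
    have "y t = (\<Sum>k<c. f ((x ^^ k) t) \<cdot> (x ^^ (c - k)) s) + s"
      unfolding y_def by (simp add: lessThan_Suc_atMost[symmetric] f(3))
    moreover have "(\<Sum>k<c. f ((x ^^ k) t) \<cdot> (x ^^ (c - k)) s) \<in> A"
    proof (intro subspace_sum subspace_scale A(1))
      fix k assume "k \<in> {..<c}"
      then obtain j where "c - k = Suc j" by (metis lessThan_iff Suc_diff_Suc)
      moreover have "x ((x ^^ j) s) \<in> A" using A(2) inW[OF s(1), of j] by blast
      ultimately show "(x ^^ (c - k)) s \<in> A" by simp
    qed
    ultimately have yd: "y t - s \<in> A" by simp
    have "y t - (y t - s) \<in> A" by (rule subspace_diff[OF A(1) yt yd])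
    then have "s \<in> A" by simp
    then show False using s(3) by simp
  qed
  ultimately show ?thesis by blast
qed

section \<open>Independence and rank as open conditions\<close>

text \<open>
  Independence of a list as a family: repetitions are excluded.
\<close>

definition ind :: "'b list \<Rightarrow> bool" where
  "ind vs \<longleftrightarrow> distinct vs \<and> independent (set vs)"

lemma ind_Cons: "ind (v # vs) \<longleftrightarrow> ind vs \<and> v \<notin> span (set vs)"
  by (auto simp: ind_def independent_insert span_base)

lemma ind_rotate: "ind (vs @ [v]) \<longleftrightarrow> ind (v # vs)"
  by (auto simp: ind_def)

lemma span_insert_combine:
  assumes "a \<noteq> 0"
  shows "span (insert v (insert (a \<cdot> u - b \<cdot> v) S)) = span (insert v (insert u S))"
proof -
  let ?L = "insert v (insert (a \<cdot> u - b \<cdot> v) S)" and ?R = "insert v (insert u S)"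
  have "a \<cdot> u - b \<cdot> v \<in> span ?R"
    by (intro span_diff span_scale span_base) auto
  then have "?L \<subseteq> span ?R" by (auto intro: span_base)
  moreover have "u \<in> span ?L"
  proof -
    have "(1/a) \<cdot> ((a \<cdot> u - b \<cdot> v) + b \<cdot> v) \<in> span ?L"
      by (intro span_scale span_add span_base) auto
    then show ?thesis using assms by simp
  qed
  then have "?R \<subseteq> span ?L" by (auto intro: span_base)
  ultimately show ?thesis by (simp add: span_eq)
qed

lemma span_eliminate:
  assumes "a \<noteq> 0"
  shows "span (insert v (set (map (\<lambda>u. a \<cdot> u - b u \<cdot> v) us))) = span (insert v (set us))"
proof (induction us)
  case (Cons u us)
  let ?M = "set (map (\<lambda>u. a \<cdot> u - b u \<cdot> v) us)"
  have "span (insert v (insert (a \<cdot> u - b u \<cdot> v) ?M)) = span (insert v (insert u ?M))"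
    by (rule span_insert_combine[OF assms])
  also have "\<dots> = span (insert u (insert v ?M))" by (simp only: insert_commute)
  also have "\<dots> = span (insert u (insert v (set us)))"
    by (simp only: span_insert[of u] Cons.IH)
  finally show ?case by (simp add: insert_commute[of v u])
qed simp

lemma ind_eliminate:
  assumes "a \<noteq> 0"
  shows "ind (map (\<lambda>u. a \<cdot> u - b u \<cdot> v) us @ [v]) \<longleftrightarrow> ind (us @ [v])"
proof (induction us)
  case (Cons u us)
  let ?Y = "span (insert v (set us))"
  have "a \<cdot> u - b u \<cdot> v \<in> ?Y \<longleftrightarrow> u \<in> ?Y"
  proof
    assume "a \<cdot> u - b u \<cdot> v \<in> ?Y"
    then have "(1/a) \<cdot> ((a \<cdot> u - b u \<cdot> v) + b u \<cdot> v) \<in> ?Y"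
      by (intro span_scale span_add) (auto intro: span_base span_scale)
    then show "u \<in> ?Y" using assms by simp
  next
    assume "u \<in> ?Y"
    then show "a \<cdot> u - b u \<cdot> v \<in> ?Y" by (intro span_diff span_scale) (auto intro: span_base)
  qed
  then show ?case using Cons span_eliminate[OF assms, of v b us] by (simp add: ind_Cons)
qed simp

text \<open>
  The vector-valued functions whose coordinates lie in the given algebra; testing with all linear
  forms avoids the choice of coordinates.
\<close>

definition pvec :: "('p \<Rightarrow> 'a) set \<Rightarrow> ('p \<Rightarrow> 'b) \<Rightarrow> bool" where
  "pvec P f \<longleftrightarrow> (\<forall>\<phi>. functional \<phi> \<longrightarrow> (\<lambda>p. \<phi> (f p)) \<in> P)"

lemma pvec_const: "palg P \<Longrightarrow> pvec P (\<lambda>_. v)"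
  by (auto simp: pvec_def palg_const)

lemma pvec_add: "palg P \<Longrightarrow> pvec P f \<Longrightarrow> pvec P g \<Longrightarrow> pvec P (\<lambda>p. f p + g p)"
  by (auto simp: pvec_def functional_add intro: palg_add)

lemma pvec_diff: "palg P \<Longrightarrow> pvec P f \<Longrightarrow> pvec P g \<Longrightarrow> pvec P (\<lambda>p. f p - g p)"
  by (auto simp: pvec_def functional_diff intro: palg_diff)

lemma pvec_scale: "palg P \<Longrightarrow> q \<in> P \<Longrightarrow> pvec P f \<Longrightarrow> pvec P (\<lambda>p. q p \<cdot> f p)"
  by (auto simp: pvec_def functional_scale intro: palg_mult)

lemma pvec_endo: "endo x \<Longrightarrow> pvec P f \<Longrightarrow> pvec P (\<lambda>p. x (f p))"
  using functional_compose by (fastforce simp: pvec_def)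

lemma pvec_sum: "palg P \<Longrightarrow> (\<And>a. a \<in> A \<Longrightarrow> pvec P (f a)) \<Longrightarrow> pvec P (\<lambda>p. \<Sum>a\<in>A. f a p)"
  by (induction A rule: infinite_finite_induct) (auto intro: pvec_const pvec_add)

text \<open>
  Gaussian elimination with one pivot at a time: if \<open>\<phi> (f p\<^sub>0) \<noteq> 0\<close>, then wherever \<open>\<phi> (f p) \<noteq> 0\<close> the
  family is independent as soon as the vectors \<open>\<phi> (f p) g p - \<phi> (g p) f p\<close> are, and these again
  have coordinates in the algebra. The product of the pivots is the required function; it plays the
  part of a minor.
\<close>

lemma ind_open:
  assumes P: "palg P" and "\<And>f. f \<in> set fs \<Longrightarrow> pvec P f" and "ind (map (\<lambda>f. f p0) fs)"
  shows "\<exists>q\<in>P. q p0 \<noteq> 0 \<and> (\<forall>p. q p \<noteq> 0 \<longrightarrow> ind (map (\<lambda>f. f p) fs))"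
  using assms(2-)
proof (induction "length fs" arbitrary: fs)
  case 0
  then show ?case using palg_const[OF P, of 1] by (intro bexI[of _ "\<lambda>_. 1"]) (auto simp: ind_def)
next
  case (Suc n)
  then obtain f gs where fs: "fs = f # gs" by (cases fs) auto
  have "f p0 \<notin> span {}"
    using Suc.prems(2) span_mono[of "{}" "set (map (\<lambda>f. f p0) gs)"] unfolding fs by (auto simp: ind_Cons)
  then obtain \<phi> where \<phi>: "functional \<phi>" "\<phi> (f p0) = 1"
    using exists_functional[of "span {}" "f p0"] by auto
  let ?T = "\<lambda>p u. \<phi> (f p) \<cdot> u - \<phi> u \<cdot> f p"
  let ?hs = "map (\<lambda>g p. ?T p (g p)) gs"
  have \<phi>f: "(\<lambda>p. \<phi> (g p)) \<in> P" if "g \<in> set fs" for g using Suc.prems(1)[OF that] \<phi> by (auto simp: pvec_def)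
  have pv: "pvec P h" if h: "h \<in> set ?hs" for h
  proof -
    obtain g where g: "g \<in> set gs" "h = (\<lambda>p. ?T p (g p))" using h by auto
    have "pvec P f" "pvec P g" using Suc.prems(1) g by (auto simp: fs)
    then show ?thesis unfolding g(2) using g(1) \<phi>f fs by (auto intro!: pvec_diff pvec_scale P)
  qed
  have maph: "map (\<lambda>h. h p) ?hs = map (?T p) (map (\<lambda>g. g p) gs)" for p by simp
  have "ind (map (\<lambda>g. g p0) gs @ [f p0])" using Suc.prems(2) by (simp add: fs ind_rotate)
  then have "ind (map (\<lambda>h. h p0) ?hs @ [f p0])"
    unfolding maph by (subst ind_eliminate) (simp_all add: \<phi>(2))
  then have "ind (map (\<lambda>h. h p0) ?hs)" by (simp only: ind_rotate ind_Cons)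
  then obtain q where q: "q \<in> P" "q p0 \<noteq> 0" "\<forall>p. q p \<noteq> 0 \<longrightarrow> ind (map (\<lambda>h. h p) ?hs)"
    using Suc.hyps(1)[of ?hs] Suc.hyps(2) pv fs by auto
  show ?case
  proof (intro bexI[of _ "\<lambda>p. q p * \<phi> (f p)"] conjI allI impI)
    show "(\<lambda>p. q p * \<phi> (f p)) \<in> P" using q(1) \<phi>f[of f] by (intro palg_mult P) (auto simp: fs)
    show "q p0 * \<phi> (f p0) \<noteq> 0" using q \<phi> by simp
    fix p assume nz: "q p * \<phi> (f p) \<noteq> 0"
    then have nz': "q p \<noteq> 0" "\<phi> (f p) \<noteq> 0" by simp_all
    have \<phi>0: "\<phi> u = 0" if u: "u \<in> set (map (\<lambda>h. h p) ?hs)" for u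
    proof -
      obtain g where "u = ?T p (g p)" using u by auto
      then show ?thesis by (simp add: functional_diff[OF \<phi>(1)] functional_scale[OF \<phi>(1)])
    qed
    have "f p \<notin> span (set (map (\<lambda>h. h p) ?hs))"
    proof
      assume m: "f p \<in> span (set (map (\<lambda>h. h p) ?hs))"
      have "\<phi> (f p) = 0" by (rule functional_0_on_span[OF \<phi>(1) \<phi>0 m])
      then show False using nz' by simp
    qed
    moreover have "ind (map (\<lambda>h. h p) ?hs)" using q(3) nz'(1) by blast
    ultimately have "ind (map (\<lambda>h. h p) ?hs @ [f p])" unfolding ind_rotate ind_Cons by blast
    then have "ind (map (\<lambda>g. g p) gs @ [f p])"
      unfolding maph ind_eliminate[OF nz'(2)] .
    then show "ind (map (\<lambda>g. g p) fs)" by (simp add: fs ind_rotate)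
  qed
qed

text \<open>
  Rank is lower semicontinuous: a maximal independent subfamily at \<open>p\<^sub>0\<close> stays independent nearby.
\<close>

lemma dim_union_open:
  assumes P: "palg P" and fs: "\<And>f. f \<in> set fs \<Longrightarrow> pvec P f"
  shows "\<exists>q\<in>P. q p0 \<noteq> 0 \<and> (\<forall>p. q p \<noteq> 0 \<longrightarrow>
     dim (S \<union> set (map (\<lambda>f. f p0) fs)) \<le> dim (S \<union> set (map (\<lambda>f. f p) fs)))"
proof -
  let ?X = "\<lambda>p. S \<union> set (map (\<lambda>f. f p) fs)"
  obtain B where B: "B \<subseteq> ?X p0" "independent B" "card B = dim (?X p0)" using basis_exists by metis
  have "finite B" using B finiteI_independent by blast
  then obtain bs where bs: "set bs = B" "distinct bs" using finite_distinct_list by blast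
  define h where "h b = (if b \<in> S then (\<lambda>_. b) else (SOME f. f \<in> set fs \<and> f p0 = b))" for b
  have h: "pvec P (h b) \<and> h b p0 = b \<and> (\<forall>p. h b p \<in> ?X p)" if "b \<in> B" for b
  proof (cases "b \<in> S")
    case False
    then have "\<exists>f. f \<in> set fs \<and> f p0 = b" using that B by auto
    then have "(SOME f. f \<in> set fs \<and> f p0 = b) \<in> set fs \<and> (SOME f. f \<in> set fs \<and> f p0 = b) p0 = b"
      by (rule someI_ex)
    then have "h b \<in> set fs \<and> h b p0 = b" using False by (simp add: h_def)
    then show ?thesis using fs by auto
  qed (simp add: h_def pvec_const P)
  have "map (\<lambda>f. f p0) (map h bs) = bs" using h bs by (auto intro!: map_idI)
  then have "\<exists>q\<in>P. q p0 \<noteq> 0 \<and> (\<forall>p. q p \<noteq> 0 \<longrightarrow> ind (map (\<lambda>f. f p) (map h bs)))"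
    using h bs B by (intro ind_open[OF P]) (auto simp: ind_def)
  then obtain q where q: "q \<in> P" "q p0 \<noteq> 0" "\<And>p. q p \<noteq> 0 \<Longrightarrow> ind (map (\<lambda>f. f p) (map h bs))" by blast
  have "dim (?X p0) \<le> dim (?X p)" if "q p \<noteq> 0" for p
  proof -
    let ?L = "map (\<lambda>f. f p) (map h bs)"
    have "card (set ?L) = length bs" "independent (set ?L)"
      using q(3)[OF that] distinct_card[of ?L] by (simp_all add: ind_def)
    moreover have "set ?L \<subseteq> ?X p" using h bs by auto
    ultimately show ?thesis using independent_card_le_dim[of "set ?L" "?X p"] B bs distinct_card[of bs] by simp
  qed
  then show ?thesis using q by blast
qed

lemma dim_Union_Int:
  assumes "subspace S"
  shows "dim (S \<union> X) + dim (S \<inter> span X) = dim S + dim X"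
proof -
  have "span (S \<union> X) = {u + v |u v. u \<in> S \<and> v \<in> span X}"
    using assms by (simp add: span_Un span_eq_iff[THEN iffD2])
  then have "dim (S \<union> X) = dim {u + v |u v. u \<in> S \<and> v \<in> span X}" by (metis dim_span)
  then show ?thesis using dim_sums_Int[OF assms subspace_span, of X] by simp
qed

text \<open>
  As the sum of \<open>S\<close> with the span can only grow near \<open>p\<^sub>0\<close>, and the dimension of the span itself is
  maximal at \<open>p\<^sub>0\<close>, the intersection can only shrink.
\<close>

lemma dim_Int_span_open:
  assumes P: "palg P" and fs: "\<And>f. f \<in> set fs \<Longrightarrow> pvec P f" and S: "subspace S"
    and i: "ind (map (\<lambda>f. f p0) fs)"
  shows "\<exists>q\<in>P. q p0 \<noteq> 0 \<and> (\<forall>p. q p \<noteq> 0 \<longrightarrow>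
     dim (S \<inter> span (set (map (\<lambda>f. f p) fs))) \<le> dim (S \<inter> span (set (map (\<lambda>f. f p0) fs))))"
proof -
  let ?X = "\<lambda>p. set (map (\<lambda>f. f p) fs)"
  obtain q where q: "q \<in> P" "q p0 \<noteq> 0" "\<And>p. q p \<noteq> 0 \<Longrightarrow> dim (S \<union> ?X p0) \<le> dim (S \<union> ?X p)"
    using dim_union_open[OF P fs, of fs p0 S] by blast
  have "dim (S \<inter> span (?X p)) \<le> dim (S \<inter> span (?X p0))" if "q p \<noteq> 0" for p
  proof -
    have "dim (?X p0) = length fs"
      using i distinct_card[of "map (\<lambda>f. f p0) fs"] by (simp add: ind_def dim_eq_card_independent)
    moreover have "dim (?X p) \<le> length fs"
      using dim_le_card'[of "?X p"] card_length[of "map (\<lambda>f. f p) fs"] by simp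
    ultimately show ?thesis
      using dim_Union_Int[OF S, of "?X p"] dim_Union_Int[OF S, of "?X p0"] q(3)[OF that] by linarith
  qed
  then show ?thesis using q by blast
qed

text \<open>
  Where the dimension of the span does not grow, the rank of the family enlarged by \<open>f\<close> detects whether
  \<open>f\<close> lies in the span, and rank is lower semicontinuous.
\<close>

lemma not_in_span_open:
  assumes P: "palg P" and f: "pvec P f" and fs: "\<And>g. g \<in> set fs \<Longrightarrow> pvec P g"
    and n: "f p0 \<notin> span (set (map (\<lambda>g. g p0) fs))"
  shows "\<exists>q\<in>P. q p0 \<noteq> 0 \<and> (\<forall>p. q p \<noteq> 0 \<longrightarrow>
     dim (set (map (\<lambda>g. g p) fs)) \<le> dim (set (map (\<lambda>g. g p0) fs)) \<longrightarrow> f p \<notin> span (set (map (\<lambda>g. g p) fs)))"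
proof -
  let ?X = "\<lambda>p. set (map (\<lambda>g. g p) fs)"
  have pv: "\<And>g. g \<in> set (f # fs) \<Longrightarrow> pvec P g" using f fs by auto
  have "\<exists>q\<in>P. q p0 \<noteq> 0 \<and> (\<forall>p. q p \<noteq> 0 \<longrightarrow>
     dim ({} \<union> set (map (\<lambda>f. f p0) (f # fs))) \<le> dim ({} \<union> set (map (\<lambda>f. f p) (f # fs))))"
    by (rule dim_union_open[OF P pv])
  then obtain q where q: "q \<in> P" "q p0 \<noteq> 0" and q3: "\<forall>p. q p \<noteq> 0 \<longrightarrow>
     dim ({} \<union> set (map (\<lambda>f. f p0) (f # fs))) \<le> dim ({} \<union> set (map (\<lambda>f. f p) (f # fs)))"
    by (elim bexE conjE)
  have "f p \<notin> span (?X p)" if "q p \<noteq> 0" "dim (?X p) \<le> dim (?X p0)" for p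
  proof
    assume i: "f p \<in> span (?X p)"
    have "dim (insert (f p0) (?X p0)) \<le> dim (insert (f p) (?X p))" using q3 that(1) by simp
    moreover have "dim (insert (f p) (?X p)) = dim (?X p)" using i by (simp only: dim_insert if_True)
    moreover have "dim (insert (f p0) (?X p0)) = dim (?X p0) + 1" using n by (simp only: dim_insert if_False)
    ultimately show False using that(2) by simp
  qed
  then show ?thesis using q by blast
qed

lemma endo_move: "endo y \<Longrightarrow> endo (\<lambda>v. v + s \<cdot> y v)"
proof -
  assume y: "endo y"
  show ?thesis unfolding Vector_Spaces.linear_iff
    by (simp add: vector_space_axioms endo_add[OF y] endo_scale[OF y] scale_right_distrib mult.commute)
qed

text \<open>
  The maps \<open>1 + s y\<close> form a line through the identity, and invertibility is open.
\<close>

lemma move_bij_cofinite: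
  assumes y: "endo y" "y ` W \<subseteq> W" and W: "subspace W"
  shows "\<forall>\<^sub>F s in cofinite. inj_on (\<lambda>v. v + s \<cdot> y v) W \<and> (\<lambda>v. v + s \<cdot> y v) ` W = W"
proof -
  obtain B where B: "B \<subseteq> W" "independent B" "W \<subseteq> span B" using basis_exists by metis
  have sB: "span B = W" using B W by (metis span_minimal subset_antisym)
  have "finite B" using B finiteI_independent by blast
  then obtain bs where bs: "set bs = B" "distinct bs" using finite_distinct_list by blast
  let ?fs = "map (\<lambda>b s. b + s \<cdot> y b) bs"
  have "\<exists>q\<in>range poly. q 0 \<noteq> 0 \<and> (\<forall>s. q s \<noteq> 0 \<longrightarrow> ind (map (\<lambda>f. f s) ?fs))"
  proof (rule ind_open[OF palg_poly])
    show "pvec (range poly) f" if "f \<in> set ?fs" for f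
      using that by (auto intro!: pvec_add pvec_scale pvec_const palg_poly poly_id)
    show "ind (map (\<lambda>f. f 0) ?fs)" using bs B by (simp add: o_def ind_def)
  qed
  then obtain q where q: "q \<in> range poly" "q 0 \<noteq> 0" "\<And>s. q s \<noteq> 0 \<Longrightarrow> ind (map (\<lambda>f. f s) ?fs)" by blast
  have good: "inj_on (\<lambda>v. v + s \<cdot> y v) W \<and> (\<lambda>v. v + s \<cdot> y v) ` W = W" if "q s \<noteq> 0" for s
  proof -
    let ?h = "\<lambda>v. v + s \<cdot> y v"
    have e: "endo ?h" using y(1) by (rule endo_move)
    have "map (\<lambda>f. f s) ?fs = map ?h bs" by simp
    then have "ind (map ?h bs)" using q(3)[OF that] by (simp add: o_def)
    then have i: "independent (?h ` B)" "inj_on ?h B" using bs by (auto simp: ind_def distinct_map)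
    then have inj: "inj_on ?h W" using self.linear_inj_on_span_iff_independent_image[OF e i(1)] sB by simp
    have sub: "?h ` W \<subseteq> W" using y W by (auto intro!: subspace_add subspace_scale)
    have "dim (?h ` W) = dim W"
      by (rule self.dim_image_eq[OF e]) (use inj W in \<open>simp add: span_eq_iff[THEN iffD2]\<close>)
    then have "?h ` W = W" using sub subspace_image[OF e W] W by (intro subspace_dim_equal) auto
    then show ?thesis using inj by blast
  qed
  show ?thesis using cofinite_poly[OF q(1,2)] by (rule eventually_mono) (rule good)
qed

section \<open>Jordan bases adapted to a subspace\<close>

text \<open>
  The pair \<open>(t, k)\<close> stands for the vector \<open>x\<^sup>k t\<close> of the Jordan chain generated by \<open>t\<close>.
\<close>

definition chains :: "'b set \<Rightarrow> ('b \<Rightarrow> nat) \<Rightarrow> ('b \<times> nat) set" where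
  "chains I l = Sigma I (\<lambda>t. {..<l t})"

definition cvec :: "('b \<Rightarrow> 'b) \<Rightarrow> 'b \<times> nat \<Rightarrow> 'b" where
  "cvec x = (\<lambda>(t, k). (x ^^ k) t)"

text \<open>
  A Jordan basis of \<open>W\<close>, given by its generators \<open>I\<close> and the lengths \<open>l\<close> of their chains. Since the
  lengths add up to the dimension of \<open>W\<close>, the spanning chain vectors are a basis.
\<close>

definition xbasis :: "('b \<Rightarrow> 'b) \<Rightarrow> 'b set \<Rightarrow> 'b set \<Rightarrow> ('b \<Rightarrow> nat) \<Rightarrow> bool" where
  "xbasis x W I l \<longleftrightarrow> finite I \<and> (\<forall>t\<in>I. 0 < l t \<and> (x ^^ l t) t = 0)
     \<and> span (cvec x ` chains I l) = W \<and> (\<Sum>t\<in>I. l t) = dim W"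

lemma finite_chains: "finite I \<Longrightarrow> finite (chains I l)"
  by (simp add: chains_def)

lemma in_chains: "(t, k) \<in> chains I l \<longleftrightarrow> t \<in> I \<and> k < l t"
  by (simp add: chains_def)

lemma xbasis_independent:
  assumes "xbasis x W I l"
  shows "inj_on (cvec x) (chains I l)" "independent (cvec x ` chains I l)"
proof -
  let ?C = "cvec x ` chains I l"
  have fin: "finite (chains I l)" using assms by (auto simp: xbasis_def finite_chains)
  have c: "card (chains I l) = dim W" using assms by (auto simp: xbasis_def chains_def)
  have W: "W = span ?C" using assms by (simp add: xbasis_def)
  have "dim W \<le> card ?C" unfolding W using fin by (simp add: dim_le_card')
  moreover have "card ?C \<le> card (chains I l)" using fin by (rule card_image_le)
  ultimately have e: "card ?C = card (chains I l)" using c by simp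
  then show "inj_on (cvec x) (chains I l)" using fin by (intro eq_card_imp_inj_on)
  show "independent ?C"
    by (rule card_le_dim_spanning[of _ W]) (use fin e c W span_superset in auto)
qed

lemma xbasis_in: "xbasis x W I l \<Longrightarrow> t \<in> I \<Longrightarrow> k < l t \<Longrightarrow> (x ^^ k) t \<in> W"
proof -
  assume b: "xbasis x W I l" and "t \<in> I" "k < l t"
  then have "cvec x (t, k) \<in> cvec x ` chains I l" by (intro imageI) (simp add: in_chains)
  then have "cvec x (t, k) \<in> span (cvec x ` chains I l)" by (rule span_base)
  then show "(x ^^ k) t \<in> W" using b by (simp add: xbasis_def cvec_def)
qed

lemma funpow_vanish:
  assumes "endo x" "(x ^^ a) t = 0" "a \<le> b"
  shows "(x ^^ b) t = 0"
  using assms K_mono[of x a b] by (auto simp: K_def)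

lemma funpow_cvec: "(x ^^ c) (cvec x (t, k)) = cvec x (t, k + c)"
  by (induction c) (simp_all add: cvec_def)

text \<open>
  The operator \<open>x\<^sup>c\<close> shifts the chains by \<open>c\<close>, so the ranks of its restrictions count pairs; the column
  lengths are the differences of consecutive ranks. A chain of length \<open>l t\<close> contributes to column \<open>c\<close>
  through the vector that \<open>x\<^sup>c\<close> sends to its end.
\<close>

lemma jcol_span_chains:
  assumes x: "endo x" and b: "xbasis x W I l" and D: "D \<subseteq> chains I l"
  shows "jcol x (span (cvec x ` D)) c = card {t \<in> I. c < l t \<and> (t, l t - 1 - c) \<in> D}"
proof -
  let ?U = "span (cvec x ` D)"
  have finI: "finite I" using b by (simp add: xbasis_def)
  then have fin: "finite D" using D finite_chains finite_subset by blast
  note inj = xbasis_independent[OF b]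
  have rank: "dim ((x ^^ c) ` ?U) = card {(t, k) \<in> D. k + c < l t}" for c
  proof -
    let ?E = "(\<lambda>(t, k). (t, k + c)) ` {(t, k) \<in> D. k + c < l t}"
    have E: "?E \<subseteq> chains I l" using D by (auto simp: chains_def)
    have im: "(x ^^ c) ` ?U = span ((x ^^ c) ` cvec x ` D)"
      using self.linear_span_image[OF endo_funpow[OF x]] by simp
    have val: "cvec x (t, k + c) = 0" if "(t, k) \<in> D" "\<not> k + c < l t" for t k
      using funpow_vanish[OF x, of "l t" t "k + c"] b D that by (auto simp: cvec_def xbasis_def chains_def)
    have "(x ^^ c) ` cvec x ` D \<subseteq> insert 0 (cvec x ` ?E)"
    proof
      fix v assume "v \<in> (x ^^ c) ` cvec x ` D"
      then obtain t k where t: "(t, k) \<in> D" "v = cvec x (t, k + c)" by (auto simp: funpow_cvec)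
      show "v \<in> insert 0 (cvec x ` ?E)"
      proof (cases "k + c < l t")
        case True
        then have "(t, k + c) \<in> ?E" using t by (intro image_eqI[of _ _ "(t, k)"]) auto
        then show ?thesis using t by blast
      qed (use val t in auto)
    qed
    then have "span ((x ^^ c) ` cvec x ` D) \<subseteq> span (insert 0 (cvec x ` ?E))" by (rule span_mono)
    then have "span ((x ^^ c) ` cvec x ` D) \<subseteq> span (cvec x ` ?E)" by (simp only: span_insert_0)
    moreover have "cvec x ` ?E \<subseteq> (x ^^ c) ` cvec x ` D"
    proof
      fix v assume "v \<in> cvec x ` ?E"
      then obtain t k where t: "(t, k) \<in> D" "v = cvec x (t, k + c)" by auto
      then show "v \<in> (x ^^ c) ` cvec x ` D" unfolding t(2) funpow_cvec[symmetric] by blast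
    qed
    then have "span (cvec x ` ?E) \<subseteq> span ((x ^^ c) ` cvec x ` D)" by (rule span_mono)
    ultimately have "(x ^^ c) ` ?U = span (cvec x ` ?E)" using im by simp
    then have "dim ((x ^^ c) ` ?U) = dim (cvec x ` ?E)" by simp
    also have "\<dots> = card (cvec x ` ?E)"
      using independent_mono[OF inj(2) image_mono[OF E]] by (rule dim_eq_card_independent)
    also have "\<dots> = card ?E" using inj_on_subset[OF inj(1) E] by (rule card_image)
    also have "\<dots> = card {(t, k) \<in> D. k + c < l t}" by (rule card_image) (auto simp: inj_on_def)
    finally show ?thesis .
  qed
  have nul: "dim ?U = dim ((x ^^ c) ` ?U) + dim (?U \<inter> K x c)" for c
    using rank_nullity[OF endo_funpow[OF x] subspace_span] by (simp add: K_def)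
  have 1: "dim ((x ^^ c) ` ?U) = jcol x ?U c + dim ((x ^^ Suc c) ` ?U)"
    using nul[of c] nul[of "Suc c"] dim_K_Suc[OF x subspace_span, of "cvec x ` D" c] by linarith
  have eqs: "{(t, k) \<in> D. k + c < l t} = {(t, k) \<in> D. k + c + 1 = l t} \<union> {(t, k) \<in> D. k + Suc c < l t}"
    by auto
  have 2: "card {(t, k) \<in> D. k + c < l t} =
     card {(t, k) \<in> D. k + c + 1 = l t} + card {(t, k) \<in> D. k + Suc c < l t}"
    unfolding eqs by (rule card_Un_disjoint) (use fin in \<open>auto intro: finite_subset[of _ D]\<close>)
  have 3: "card {(t, k) \<in> D. k + c + 1 = l t} = card {t \<in> I. c < l t \<and> (t, l t - 1 - c) \<in> D}"
  proof -
    have "{(t, k) \<in> D. k + c + 1 = l t} = (\<lambda>t. (t, l t - 1 - c)) ` {t \<in> I. c < l t \<and> (t, l t - 1 - c) \<in> D}" (is "?L = ?R")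
    proof
      show "?L \<subseteq> ?R"
      proof
        fix p assume "p \<in> ?L"
        then obtain t k where k: "p = (t, k)" "(t, k) \<in> D" "k + c + 1 = l t" by auto
        then have k': "k = l t - 1 - c" "c < l t" "t \<in> I" using D by (auto simp: chains_def)
        then show "p \<in> ?R" using k by (intro image_eqI[of _ _ t]) auto
      qed
    qed auto
    then show ?thesis by (simp add: card_image inj_on_def)
  qed
  show ?thesis using 1 2 3 by (simp only: rank)
qed

text \<open>
  Write \<open>x e = x h' + v\<close> with \<open>v\<close> a combination of generators lying in \<open>B\<close>, and replace \<open>e\<close> by
  \<open>e' = e - h'\<close>, so that \<open>x e' = v\<close>. If \<open>v = 0\<close>, then \<open>e'\<close> generates a new chain of length one.
  Otherwise \<open>e'\<close> takes the place of a generator \<open>t\<^sub>0\<close> of greatest length occurring in \<open>v\<close>,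
  and its chain is longer by one; the greatest length is needed for the chain of \<open>e'\<close> to end in time.
\<close>

lemma xbasis_extend:
  assumes x: "endo x" and b: "xbasis x H I l" and H: "subspace H" "x ` H \<subseteq> H" and B: "B \<subseteq> span (x ` H \<union> (I \<inter> B))"
    and e: "e \<notin> H" "x e \<in> B"
    and W: "W = span (insert e H)"
  shows "\<exists>I' l'. xbasis x W I' l' \<and> B \<subseteq> span (x ` W \<union> (I' \<inter> B))"
proof -
  have finI: "finite I" and l: "\<And>t. t \<in> I \<Longrightarrow> 0 < l t \<and> (x ^^ l t) t = 0"
    and sp: "span (cvec x ` chains I l) = H" and sum: "(\<Sum>t\<in>I. l t) = dim H"
    using b by (auto simp: xbasis_def)
  have dW: "dim W = Suc (dim H)" using e H by (simp add: W dim_insert_subspace)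
  have HW: "H \<subseteq> W" and eW: "e \<in> W" using W by (auto intro: span_base)
  have sW: "subspace W" using W by simp
  have IH: "t \<in> H" if "t \<in> I" for t using xbasis_in[OF b that, of 0] l[OF that] by simp
  have "x e \<in> span (x ` H \<union> (I \<inter> B))" using B e by blast
  then obtain h v where hv: "x e = h + v" "h \<in> span (x ` H)" "v \<in> span (I \<inter> B)" by (auto simp: span_Un)
  have "subspace (x ` H)" using x H by (intro subspace_image)
  \<comment> \<open>the part of \<open>x e\<close> in \<open>x H\<close> is absorbed into the new vector\<close>
  then have "h \<in> x ` H" using hv(2) by (metis span_eq_iff)
  then obtain h' where h': "h' \<in> H" "h = x h'" by blast
  have "finite (I \<inter> B)" using finI by simp
  then obtain \<alpha> where \<alpha>: "v = (\<Sum>t\<in>I \<inter> B. \<alpha> t \<cdot> t)" using hv(3) by (auto simp: span_finite)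
  define e' where "e' = e - h'"
  have xe': "x e' = v" using hv h' by (simp add: e'_def endo_diff[OF x])
  have ee': "e = e' + h'" by (simp add: e'_def)
  have e'H: "e' \<notin> H" using e h' subspace_add[OF H(1)] unfolding ee' by blast
  have e'I: "e' \<notin> I" using e'H IH by blast
  have e'W: "e' \<in> W" unfolding e'_def using eW HW h' sW by (blast intro: subspace_diff)
  have inH: "(x ^^ k) u \<in> H" if "u \<in> H" for k u using that H by (induction k) auto
  have vH: "v \<in> H" unfolding \<alpha> using IH H by (intro subspace_sum subspace_scale) auto
  have xkW: "(x ^^ k) e' \<in> W" for k
  proof (cases k)
    case (Suc j)
    then have "(x ^^ k) e' = (x ^^ j) v" using xe' by (simp add: funpow_swap1)
    then show ?thesis using inH[OF vH, of j] HW by auto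
  qed (use e'W in simp)
  \<comment> \<open>a family spans \<open>W\<close> if it yields the old chains and contains \<open>e'\<close>\<close>
  have spanI: "span (cvec x ` chains I' l') = W"
    if I': "I' \<subseteq> insert e' I" and m: "e' \<in> I'" "0 < l' e'" and ltk: "\<And>t k. t \<in> I \<Longrightarrow> k < l t \<Longrightarrow> (x ^^ k) t \<in> span (cvec x ` chains I' l')"
    for I' l'
  proof
    show "span (cvec x ` chains I' l') \<subseteq> W"
    proof (rule span_minimal[OF _ sW], rule subsetI)
      fix u assume "u \<in> cvec x ` chains I' l'"
      then obtain t k where t: "t \<in> I'" "u = (x ^^ k) t" by (auto simp: chains_def cvec_def)
      show "u \<in> W"
      proof (cases "t = e'")
        case False
        then have "t \<in> H" using t I' IH by auto
        then show ?thesis using inH[of t k] HW t by auto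
      qed (use xkW t in auto)
    qed
    let ?S = "span (cvec x ` chains I' l')"
    have "cvec x ` chains I l \<subseteq> ?S" using ltk by (auto simp: chains_def cvec_def)
    then have HS: "H \<subseteq> ?S" unfolding sp[symmetric] by (rule span_minimal) simp
    have "cvec x (e', 0) \<in> ?S" using m by (intro span_base imageI) (simp add: chains_def)
    then have "e' + h' \<in> ?S" using HS h' by (intro span_add) (auto simp: cvec_def)
    then have "insert e H \<subseteq> ?S" using ee' HS by simp
    then show "W \<subseteq> ?S" unfolding W by (rule span_minimal) simp
  qed
  show ?thesis
  proof (cases "\<exists>t\<in>I \<inter> B. \<alpha> t \<noteq> 0")
    case False
    then have v0: "v = 0" by (simp add: \<alpha>)
    let ?I = "insert e' I" and ?l = "l(e' := 1)"
    have "(x ^^ k) t \<in> span (cvec x ` chains ?I ?l)" if "t \<in> I" "k < l t" for t k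
    proof -
      have "cvec x (t, k) \<in> cvec x ` chains ?I ?l" using that e'I by (intro imageI) (auto simp: chains_def)
      then have "cvec x (t, k) \<in> span (cvec x ` chains ?I ?l)" by (rule span_base)
      then show ?thesis by (simp add: cvec_def)
    qed
    then have "span (cvec x ` chains ?I ?l) = W" by (intro spanI) auto
    moreover have "sum ?l ?I = dim W"
    proof -
      have "sum ?l I = sum l I" by (rule sum.cong) (use e'I in auto)
      then show ?thesis using finI e'I sum dW by simp
    qed
    ultimately have "xbasis x W ?I ?l" using finI l xe' v0 by (auto simp: xbasis_def)
    moreover have "span (x ` H \<union> (I \<inter> B)) \<subseteq> span (x ` W \<union> (?I \<inter> B))"
      using HW by (intro span_mono) auto
    ultimately show ?thesis using B by blast
  next
    case True
    let ?T = "{t \<in> I \<inter> B. \<alpha> t \<noteq> 0}"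
    have fT: "finite ?T" "?T \<noteq> {}" using finI True by auto
    define t0 where "t0 = arg_max_on l ?T"
    have t0: "t0 \<in> ?T" "\<And>t. t \<in> ?T \<Longrightarrow> l t \<le> l t0"
    proof -
      obtain s where s: "s \<in> ?T" "l s = Max (l ` ?T)" using Max_in[of "l ` ?T"] fT by (metis (no_types, lifting) finite_imageI image_iff image_is_empty)
      have "\<forall>y. y \<in> ?T \<longrightarrow> l y \<le> l s" using s(2) fT by simp
      then have "is_arg_max l (\<lambda>t. t \<in> ?T) s" using s(1) by (auto simp: is_arg_max_linorder)
      then have "is_arg_max l (\<lambda>t. t \<in> ?T) t0" unfolding t0_def arg_max_on_def arg_max_def by (rule someI)
      then show "t0 \<in> ?T" "\<And>t. t \<in> ?T \<Longrightarrow> l t \<le> l t0" unfolding is_arg_max_linorder by blast+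
    qed
    have t0I: "t0 \<in> I" "t0 \<in> B" "\<alpha> t0 \<noteq> 0" using t0(1) by auto
    \<comment> \<open>the generator \<open>t0\<close> is recovered from \<open>x e' = v\<close> and the other generators\<close>
    let ?I = "insert e' (I - {t0})" and ?l = "l(e' := Suc (l t0))"
    let ?R = "\<lambda>k. \<Sum>t\<in>I \<inter> B - {t0}. \<alpha> t \<cdot> (x ^^ k) t"
    have vsplit: "(x ^^ k) v = \<alpha> t0 \<cdot> (x ^^ k) t0 + ?R k" for k
      unfolding \<alpha> endo_sum[OF endo_funpow[OF x]] endo_scale[OF endo_funpow[OF x]]
      using finI t0I by (subst sum.remove[of _ t0]) auto
    have t0eq: "(x ^^ k) t0 = (1 / \<alpha> t0) \<cdot> ((x ^^ k) v - ?R k)" for k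
      using t0I(3) by (simp add: vsplit)
    have v0: "(x ^^ l t0) v = 0"
      unfolding \<alpha> endo_sum[OF endo_funpow[OF x]] endo_scale[OF endo_funpow[OF x]]
    proof (rule sum.neutral, rule ballI)
      fix t assume t: "t \<in> I \<inter> B"
      show "\<alpha> t \<cdot> (x ^^ l t0) t = 0"
      proof (cases "\<alpha> t = 0")
        case False
        then have "l t \<le> l t0" using t t0(2) by blast
        then have "(x ^^ l t0) t = 0" using funpow_vanish[OF x, of "l t" t "l t0"] l t by blast
        then show ?thesis by simp
      qed simp
    qed
    have xSuc: "(x ^^ Suc k) e' = (x ^^ k) v" for k using xe' by (simp add: funpow_swap1)
    have e'0: "(x ^^ Suc (l t0)) e' = 0" unfolding xSuc by (rule v0)
    let ?S = "span (cvec x ` chains ?I ?l)"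
    have base: "(x ^^ k) t \<in> ?S" if "t \<in> ?I" "k < ?l t" for t k
    proof -
      have "cvec x (t, k) \<in> ?S" using that by (intro span_base imageI) (simp add: in_chains del: fun_upd_apply)
      then show ?thesis by (simp add: cvec_def)
    qed
    have S1: "(x ^^ k) t \<in> ?S" if "t \<in> I" "t \<noteq> t0" for t k
    proof (cases "k < l t")
      case True
      then show ?thesis using that e'I by (intro base) auto
    next
      case False
      then have "(x ^^ k) t = 0" using funpow_vanish[OF x, of "l t" t k] l[of t] that by simp
      then show ?thesis by (simp add: span_zero)
    qed
    have S2: "(x ^^ k) v \<in> ?S" for k
    proof (cases "k < l t0")
      case True
      then have "(x ^^ Suc k) e' \<in> ?S" by (intro base) auto
      then show ?thesis unfolding xSuc .
    next
      case False
      then show ?thesis using funpow_vanish[OF x v0, of k] by (simp add: span_zero)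
    qed
    have S3: "(x ^^ k) t0 \<in> ?S" for k
      unfolding t0eq by (intro span_scale span_diff span_sum S2 S1) auto
    have "?S = W"
    proof (rule spanI)
      show "(x ^^ k) t \<in> ?S" if "t \<in> I" for t k using S1[OF that] S3 by (cases "t = t0") auto
    qed auto
    moreover have "sum ?l ?I = dim W"
    proof -
      have "sum ?l (I - {t0}) = sum l (I - {t0})" by (rule sum.cong) (use e'I in auto)
      moreover have "sum l I = l t0 + sum l (I - {t0})" using finI t0I by (simp add: sum.remove)
      ultimately show ?thesis using finI e'I sum dW by simp
    qed
    moreover have "\<forall>t\<in>?I. 0 < ?l t \<and> (x ^^ ?l t) t = 0" using l e'0 e'I by (auto simp del: funpow.simps)
    ultimately have "xbasis x W ?I ?l" using finI unfolding xbasis_def by blast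
    moreover have "B \<subseteq> span (x ` W \<union> (?I \<inter> B))"
    proof -
      let ?R' = "span (x ` W \<union> (?I \<inter> B))"
      have a: "t \<in> ?R'" if "t \<in> I \<inter> B - {t0}" for t using that by (intro span_base) auto
      have vR: "v \<in> ?R'" using xe' e'W by (intro span_base) auto
      have "t0 = (1 / \<alpha> t0) \<cdot> (v - (\<Sum>t\<in>I \<inter> B - {t0}. \<alpha> t \<cdot> t))" using t0eq[of 0] by simp
      moreover have "(1 / \<alpha> t0) \<cdot> (v - (\<Sum>t\<in>I \<inter> B - {t0}. \<alpha> t \<cdot> t)) \<in> ?R'"
        by (intro span_scale span_diff span_sum vR a)
      ultimately have "t0 \<in> ?R'" by simp
      then have "I \<inter> B \<subseteq> ?R'" using a by blast
      moreover have "x ` H \<subseteq> ?R'" using HW by (auto intro!: span_base)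
      ultimately have "x ` H \<union> (I \<inter> B) \<subseteq> ?R'" by simp
      then have "span (x ` H \<union> (I \<inter> B)) \<subseteq> ?R'" by (rule span_minimal) simp
      then show ?thesis using B by blast
    qed
    ultimately show ?thesis by blast
  qed
qed

lemma nilpotent_image_neq:
  assumes x: "endo x" and W: "subspace W" "W \<subseteq> K x N" "W \<noteq> {0}"
  shows "x ` W \<noteq> W"
proof
  assume e: "x ` W = W"
  have "(x ^^ k) ` W = W" for k
  proof (induction k)
    case (Suc k)
    have "(x ^^ Suc k) ` W = x ` (x ^^ k) ` W" by (simp add: image_image)
    then show ?case using Suc e by simp
  qed simp
  then have "W = (x ^^ N) ` W" by simp
  also have "\<dots> \<subseteq> {0}" using W(2) by (auto simp: K_def)
  finally show False using W subspace_0 by blast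
qed

text \<open>
  A Jordan basis of \<open>W\<close> is adapted to a subspace \<open>B\<close> containing \<open>x W\<close> if the generators that lie in \<open>B\<close>
  generate \<open>B\<close> modulo \<open>x W\<close>. It is built from a hyperplane \<open>H\<close> of \<open>W\<close> that contains \<open>B\<close>; if \<open>B = W\<close>, any
  hyperplane containing \<open>x W\<close> serves, and every Jordan basis is adapted to \<open>W\<close>.
\<close>

lemma exists_adapted_xbasis:
  assumes x: "endo x"
  shows "subspace W \<Longrightarrow> subspace B \<Longrightarrow> x ` W \<subseteq> B \<Longrightarrow> B \<subseteq> W \<Longrightarrow> W \<subseteq> K x N \<Longrightarrow>
    \<exists>I l. xbasis x W I l \<and> B \<subseteq> span (x ` W \<union> (I \<inter> B))"
proof (induction "dim W" arbitrary: W B)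
  case 0
  then have "W \<subseteq> {0}" by (simp add: dim_eq_0)
  then have "W = {0}" "B \<subseteq> {0}" using 0 subspace_0[of W] by blast+
  then show ?case by (intro exI[of _ "{}"]) (auto simp: xbasis_def chains_def span_zero)
next
  case (Suc n)
  have xW: "x ` W \<subseteq> W" using Suc.prems by blast
  have "W \<noteq> {0}" using Suc(2) by auto
  then have ne: "x ` W \<noteq> W" using nilpotent_image_neq[OF x] Suc.prems by blast
  \<comment> \<open>the subspace that the hyperplane has to contain\<close>
  define U where "U = (if B = W then x ` W else B)"
  have U: "subspace U" "U \<subseteq> W" "x ` W \<subseteq> U" "U \<noteq> W"
    using Suc.prems xW ne subspace_image[OF x] by (auto simp: U_def)
  then obtain s where s: "s \<in> W" "s \<notin> U" by blast
  obtain H where H: "subspace H" "U \<subseteq> H" "H \<subseteq> W" "s \<notin> H" "dim W = Suc (dim H)"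
    using exists_hyperplane[OF U(1) Suc.prems(1) U(2) s] by blast
  define B' where "B' = (if B = W then H else B)"
  have B': "subspace B'" "x ` W \<subseteq> B'" "B' \<subseteq> H" using H Suc.prems U by (cases "B = W"; simp add: B'_def U_def)+
  have xH: "x ` H \<subseteq> B'" "x ` H \<subseteq> H" using B' H by blast+
  moreover have "H \<subseteq> K x N" using H Suc.prems by blast
  moreover have "n = dim H" using H Suc(2) by simp
  ultimately obtain I l where I: "xbasis x H I l" "B' \<subseteq> span (x ` H \<union> (I \<inter> B'))"
    using Suc.hyps(1)[of H B'] H(1) B' by blast
  have W: "W = span (insert s H)"
  proof (rule subspace_dim_equal[symmetric])
    show "span (insert s H) \<subseteq> W" using s H Suc.prems by (intro span_minimal) auto
    show "dim W \<le> dim (span (insert s H))" using H by (simp add: dim_insert_subspace)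
  qed (use Suc.prems in auto)
  have xs: "x s \<in> B'" using B' s by blast
  obtain I' l' where I': "xbasis x W I' l'" "B' \<subseteq> span (x ` W \<union> (I' \<inter> B'))"
    using xbasis_extend[OF x I(1) H(1) xH(2) I(2) H(4) xs W] by blast
  show ?case
  proof (cases "B = W")
    case False
    then show ?thesis using I' by (auto simp: B'_def)
  next
    case True
    have lp: "0 < l' t" if "t \<in> I'" for t using I'(1) that by (auto simp: xbasis_def)
    have IW: "t \<in> W" if "t \<in> I'" for t using xbasis_in[OF I'(1) that, of 0] lp[OF that] by simp
    have xk: "(x ^^ k) t \<in> W" if "t \<in> I'" for k t using IW[OF that] xW by (induction k) auto
    have "cvec x ` chains I' l' \<subseteq> span (x ` W \<union> (I' \<inter> W))"
    proof
      fix v assume "v \<in> cvec x ` chains I' l'"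
      then obtain t k where t: "t \<in> I'" "v = (x ^^ k) t" by (auto simp: chains_def cvec_def)
      show "v \<in> span (x ` W \<union> (I' \<inter> W))"
      proof (cases k)
        case 0
        then show ?thesis using t IW by (intro span_base) auto
      next
        case (Suc j)
        then show ?thesis using t xk[of t j] by (intro span_base) auto
      qed
    qed
    then have "span (cvec x ` chains I' l') \<subseteq> span (x ` W \<union> (I' \<inter> W))" by (rule span_minimal) simp
    then have "W \<subseteq> span (x ` W \<union> (I' \<inter> W))" using I'(1) by (simp add: xbasis_def)
    then show ?thesis using True I' by blast
  qed
qed

lemma adapted_span:
  assumes x: "endo x" and b: "xbasis x W I l" and B: "B \<subseteq> span (x ` W \<union> (I \<inter> B))" "subspace B" "x ` W \<subseteq> B"
  shows "B = span (cvec x ` {(t, k) \<in> chains I l. 0 < k \<or> t \<in> B})" (is "_ = span (cvec x ` ?D)")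
proof
  have W: "W = span (cvec x ` chains I l)" using b by (simp add: xbasis_def)
  have base: "(x ^^ k) t \<in> span (cvec x ` ?D)" if "(t, k) \<in> ?D" for t k
  proof -
    have "cvec x (t, k) \<in> span (cvec x ` ?D)" using that by (intro span_base imageI)
    then show ?thesis by (simp add: cvec_def)
  qed
  have 1: "x (cvec x (t, k)) \<in> span (cvec x ` ?D)" if "(t, k) \<in> chains I l" for t k
  proof (cases "Suc k < l t")
    case True
    then have "(x ^^ Suc k) t \<in> span (cvec x ` ?D)" using that by (intro base) (auto simp: chains_def)
    then show ?thesis by (simp add: cvec_def)
  next
    case False
    then have "(x ^^ Suc k) t = 0" using that b funpow_vanish[OF x, of "l t" t "Suc k"] by (auto simp: chains_def xbasis_def)
    then show ?thesis by (simp add: cvec_def span_zero)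
  qed
  have "x ` W = span (x ` cvec x ` chains I l)" unfolding W using self.linear_span_image[OF x] by simp
  also have "\<dots> \<subseteq> span (cvec x ` ?D)" by (rule span_minimal) (use 1 in auto)
  finally have xW: "x ` W \<subseteq> span (cvec x ` ?D)" .
  have IB: "I \<inter> B \<subseteq> span (cvec x ` ?D)"
  proof
    fix t assume t: "t \<in> I \<inter> B"
    then have "(x ^^ 0) t \<in> span (cvec x ` ?D)" using b by (intro base) (auto simp: chains_def xbasis_def)
    then show "t \<in> span (cvec x ` ?D)" by simp
  qed
  have "span (x ` W \<union> (I \<inter> B)) \<subseteq> span (cvec x ` ?D)" by (rule span_minimal) (use xW IB in auto)
  then show "B \<subseteq> span (cvec x ` ?D)" using B by blast
  have "cvec x (t, k) \<in> B" if "(t, k) \<in> ?D" for t k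
  proof (cases k)
    case 0
    then show ?thesis using that by (simp add: cvec_def)
  next
    case (Suc j)
    then have "(x ^^ j) t \<in> W" using that xbasis_in[OF b, of t j] by (auto simp: chains_def)
    then have "x ((x ^^ j) t) \<in> B" using B(3) by blast
    then show ?thesis using Suc by (simp add: cvec_def)
  qed
  then show "span (cvec x ` ?D) \<subseteq> B" by (intro span_minimal[OF _ B(2)]) auto
qed

text \<open>
  Used to match the Jordan chains of two operators according to their lengths.
\<close>

lemma bij_same_fibers:
  assumes "finite A" "finite B" "\<And>k. card {a \<in> A. f a = k} = card {b \<in> B. g b = k}"
  shows "\<exists>\<pi>. bij_betw \<pi> A B \<and> (\<forall>a\<in>A. g (\<pi> a) = f a)"
proof -
  have "\<exists>\<pi>. bij_betw \<pi> {a \<in> A. f a = k} {b \<in> B. g b = k}" for k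
    using assms by (intro finite_same_card_bij) auto
  then obtain \<pi> where \<pi>: "\<And>k. bij_betw (\<pi> k) {a \<in> A. f a = k} {b \<in> B. g b = k}" by metis
  have v: "\<pi> (f a) a \<in> B \<and> g (\<pi> (f a) a) = f a" if "a \<in> A" for a
    using bij_betw_apply[OF \<pi>[of "f a"], of a] that by auto
  have "bij_betw (\<lambda>a. \<pi> (f a) a) A B"
    unfolding bij_betw_def
  proof
    show "inj_on (\<lambda>a. \<pi> (f a) a) A"
    proof (rule inj_onI)
      fix a a' assume a: "a \<in> A" "a' \<in> A" "\<pi> (f a) a = \<pi> (f a') a'"
      then have "f a = f a'" using v by metis
      then show "a = a'" using \<pi>[of "f a"] a unfolding bij_betw_def inj_on_def by auto
    qed
    show "(\<lambda>a. \<pi> (f a) a) ` A = B"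
    proof
      show "B \<subseteq> (\<lambda>a. \<pi> (f a) a) ` A"
      proof
        fix b assume "b \<in> B"
        then have "b \<in> \<pi> (g b) ` {a \<in> A. f a = g b}" using \<pi>[of "g b"] unfolding bij_betw_def by auto
        then obtain a where "a \<in> A" "f a = g b" "b = \<pi> (g b) a" by blast
        then show "b \<in> (\<lambda>a. \<pi> (f a) a) ` A" by (intro image_eqI[of _ _ a]) simp_all
      qed
    qed (use v in auto)
  qed
  then show ?thesis using v by (intro exI[of _ "\<lambda>a. \<pi> (f a) a"]) auto
qed

text \<open>
  Relative to \<open>B\<close>, exactly the chains whose generator lies outside \<open>B\<close> lose their first vector, and
  a chain of length \<open>Suc c\<close> then loses its box in column \<open>c\<close>.
\<close>

lemma xbasis_counts:
  assumes x: "endo x" and b: "xbasis x W I l" and B: "B \<subseteq> span (x ` W \<union> (I \<inter> B))" "subspace B" "x ` W \<subseteq> B"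
  shows "jcol x W c = card {t \<in> I. c < l t}"
    and "jcol x W c = jcol x B c + card {t \<in> I. l t = Suc c \<and> t \<notin> B}"
proof -
  have finI: "finite I" using b by (simp add: xbasis_def)
  have W: "span (cvec x ` chains I l) = W" using b by (simp add: xbasis_def)
  have "{t \<in> I. c < l t \<and> (t, l t - 1 - c) \<in> chains I l} = {t \<in> I. c < l t}" by (auto simp: chains_def)
  then show 1: "jcol x W c = card {t \<in> I. c < l t}"
    using jcol_span_chains[OF x b order_refl, of c] unfolding W by simp
  let ?D = "{(t, k) \<in> chains I l. 0 < k \<or> t \<in> B}"
  have D: "{t \<in> I. c < l t \<and> (t, l t - 1 - c) \<in> ?D} = {t \<in> I. c < l t \<and> (l t \<noteq> Suc c \<or> t \<in> B)}"
    by (auto simp: chains_def)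
  have Ds: "?D \<subseteq> chains I l" by auto
  have "jcol x B c = card {t \<in> I. c < l t \<and> (l t \<noteq> Suc c \<or> t \<in> B)}"
    using jcol_span_chains[OF x b Ds, of c] unfolding adapted_span[OF x b B, symmetric] D .
  moreover have "{t \<in> I. c < l t} = {t \<in> I. c < l t \<and> (l t \<noteq> Suc c \<or> t \<in> B)} \<union> {t \<in> I. l t = Suc c \<and> t \<notin> B}" by auto
  then have "card {t \<in> I. c < l t} = card {t \<in> I. c < l t \<and> (l t \<noteq> Suc c \<or> t \<in> B)} + card {t \<in> I. l t = Suc c \<and> t \<notin> B}"
    using finI by (simp only:) (rule card_Un_disjoint, auto)
  ultimately show "jcol x W c = jcol x B c + card {t \<in> I. l t = Suc c \<and> t \<notin> B}" using 1 by simp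
qed

text \<open>
  Pairs \<open>x W \<subseteq> B \<subseteq> W\<close> are classified by the two Jordan types: by \<open>xbasis_counts\<close> the types
  determine how many generators of each length lie inside and outside \<open>B\<close>, so adapted bases can be
  matched.
\<close>

lemma exists_iso:
  assumes x1: "endo x1" and x2: "endo x2"
    and W1: "subspace W1" "subspace B1" "x1 ` W1 \<subseteq> B1" "B1 \<subseteq> W1" "W1 \<subseteq> K x1 N1"
    and W2: "subspace W2" "subspace B2" "x2 ` W2 \<subseteq> B2" "B2 \<subseteq> W2" "W2 \<subseteq> K x2 N2"
    and clW: "\<And>c. jcol x1 W1 c = jcol x2 W2 c" and clB: "\<And>c. jcol x1 B1 c = jcol x2 B2 c"
  shows "\<exists>h. endo h \<and> inj_on h W1 \<and> h ` W1 = W2 \<and> h ` B1 = B2 \<and> (\<forall>w\<in>W1. h (x1 w) = x2 (h w))"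
proof -
  obtain I1 l1 where b1: "xbasis x1 W1 I1 l1" "B1 \<subseteq> span (x1 ` W1 \<union> (I1 \<inter> B1))"
    using exists_adapted_xbasis[OF x1 W1] by blast
  obtain I2 l2 where b2: "xbasis x2 W2 I2 l2" "B2 \<subseteq> span (x2 ` W2 \<union> (I2 \<inter> B2))"
    using exists_adapted_xbasis[OF x2 W2] by blast
  note c1 = xbasis_counts[OF x1 b1 W1(2,3)] and c2 = xbasis_counts[OF x2 b2 W2(2,3)]
  have fin: "finite I1" "finite I2" using b1 b2 by (simp_all add: xbasis_def)
  have pos: "\<And>t. t \<in> I1 \<Longrightarrow> 0 < l1 t" "\<And>t. t \<in> I2 \<Longrightarrow> 0 < l2 t" using b1 b2 by (auto simp: xbasis_def)
  have out: "card {t \<in> I1. l1 t = k \<and> t \<notin> B1} = card {t \<in> I2. l2 t = k \<and> t \<notin> B2}" for k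
  proof (cases k)
    case 0
    then have "{t \<in> I1. l1 t = k \<and> t \<notin> B1} = {}" "{t \<in> I2. l2 t = k \<and> t \<notin> B2} = {}" using pos by fastforce+
    then show ?thesis by (simp only: card.empty)
  next
    case (Suc c)
    then show ?thesis using c1(2)[of c] c2(2)[of c] clW[of c] clB[of c] by simp
  qed
  have split2: "card {t \<in> I. P t} = card {t \<in> I. P t \<and> Q t} + card {t \<in> I. P t \<and> \<not> Q t}"
    if "finite I" for I and P Q :: "'b \<Rightarrow> bool"
  proof -
    have "{t \<in> I. P t} = {t \<in> I. P t \<and> Q t} \<union> {t \<in> I. P t \<and> \<not> Q t}" by blast
    then show ?thesis using that by (simp only:) (rule card_Un_disjoint, auto)
  qed
  have all: "card {t \<in> I1. l1 t = k} = card {t \<in> I2. l2 t = k}" for k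
  proof (cases k)
    case 0
    then have "{t \<in> I1. l1 t = k} = {}" "{t \<in> I2. l2 t = k} = {}" using pos by fastforce+
    then show ?thesis by (simp only: card.empty)
  next
    case (Suc c)
    have s: "card {t \<in> I. c < l t} = card {t \<in> I. l t = k} + card {t \<in> I. Suc c < l t}"
      if "finite I" for I and l :: "'b \<Rightarrow> nat"
    proof -
      have "{t \<in> I. c < l t \<and> l t = k} = {t \<in> I. l t = k}" "{t \<in> I. c < l t \<and> l t \<noteq> k} = {t \<in> I. Suc c < l t}"
        using Suc by auto
      then show ?thesis using split2[OF that, of "\<lambda>t. c < l t" "\<lambda>t. l t = k"] by simp
    qed
    show ?thesis using s[OF fin(1), of l1] s[OF fin(2), of l2] c1(1)[of c] c2(1)[of c] c1(1)[of "Suc c"] c2(1)[of "Suc c"]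
        clW[of c] clW[of "Suc c"] by linarith
  qed
  have inn: "card {t \<in> I1. l1 t = k \<and> t \<in> B1} = card {t \<in> I2. l2 t = k \<and> t \<in> B2}" for k
    using split2[OF fin(1), of "\<lambda>t. l1 t = k" "\<lambda>t. t \<in> B1"] split2[OF fin(2), of "\<lambda>t. l2 t = k" "\<lambda>t. t \<in> B2"]
      all[of k] out[of k] by linarith
  have fib: "card {t \<in> I1. (l1 t, t \<in> B1) = k} = card {t \<in> I2. (l2 t, t \<in> B2) = k}" for k
  proof -
    obtain j b where k: "k = (j, b)" by (cases k)
    show ?thesis using inn[of j] out[of j] by (cases b) (simp_all add: k)
  qed
  obtain \<pi> where \<pi>: "bij_betw \<pi> I1 I2" "\<forall>t\<in>I1. (l2 (\<pi> t), \<pi> t \<in> B2) = (l1 t, t \<in> B1)"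
    using bij_same_fibers[OF fin fib] by blast
  note i1 = xbasis_independent[OF b1(1)]
  \<comment> \<open>chain vectors are sent to the chain vectors with the same exponent\<close>
  define g where "g u = (case inv_into (chains I1 l1) (cvec x1) u of (t, k) \<Rightarrow> cvec x2 (\<pi> t, k))" for u
  obtain h where h: "endo h" "\<forall>u\<in>cvec x1 ` chains I1 l1. h u = g u"
    using self.linear_independent_extend[OF i1(2), of g] by blast
  have hv: "h (cvec x1 (t, k)) = cvec x2 (\<pi> t, k)" if "(t, k) \<in> chains I1 l1" for t k
  proof -
    have "h (cvec x1 (t, k)) = g (cvec x1 (t, k))" using h(2) that by blast
    then show ?thesis using that i1(1) by (simp add: g_def)
  qed
  \<comment> \<open>used for the whole space and for the subspaces adapted to the bases\<close>
  have ch: "(\<lambda>(t, k). (\<pi> t, k)) ` {(t, k) \<in> chains I1 l1. 0 < k \<or> t \<in> X1} = {(t, k) \<in> chains I2 l2. 0 < k \<or> t \<in> X2}"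
    if X: "\<And>t. t \<in> I1 \<Longrightarrow> \<pi> t \<in> X2 \<longleftrightarrow> t \<in> X1" for X1 X2
  proof
    show "(\<lambda>(t, k). (\<pi> t, k)) ` {(t, k) \<in> chains I1 l1. 0 < k \<or> t \<in> X1} \<subseteq> {(t, k) \<in> chains I2 l2. 0 < k \<or> t \<in> X2}"
      using \<pi> X bij_betw_apply[OF \<pi>(1)] by (auto simp: chains_def)
    show "{(t, k) \<in> chains I2 l2. 0 < k \<or> t \<in> X2} \<subseteq> (\<lambda>(t, k). (\<pi> t, k)) ` {(t, k) \<in> chains I1 l1. 0 < k \<or> t \<in> X1}"
    proof
      fix p assume p: "p \<in> {(t, k) \<in> chains I2 l2. 0 < k \<or> t \<in> X2}"
      obtain t k where tk: "p = (t, k)" by (cases p)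
      then obtain t' where "t' \<in> I1" "t = \<pi> t'" using p \<pi>(1) by (auto simp: bij_betw_def chains_def)
      then show "p \<in> (\<lambda>(t, k). (\<pi> t, k)) ` {(t, k) \<in> chains I1 l1. 0 < k \<or> t \<in> X1}"
        using p tk \<pi>(2) X by (intro image_eqI[of _ _ "(t', k)"]) (auto simp: chains_def)
    qed
  qed
  have img: "h ` span (cvec x1 ` {(t, k) \<in> chains I1 l1. 0 < k \<or> t \<in> X1}) = span (cvec x2 ` {(t, k) \<in> chains I2 l2. 0 < k \<or> t \<in> X2})"
    if X: "\<And>t. t \<in> I1 \<Longrightarrow> \<pi> t \<in> X2 \<longleftrightarrow> t \<in> X1" for X1 X2
  proof -
    let ?D = "{(t, k) \<in> chains I1 l1. 0 < k \<or> t \<in> X1}"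
    have "h ` cvec x1 ` ?D = cvec x2 ` (\<lambda>(t, k). (\<pi> t, k)) ` ?D"
      unfolding image_image by (rule image_cong) (auto simp: hv)
    then show ?thesis using ch[OF X] self.linear_span_image[OF h(1), of "cvec x1 ` ?D"] by simp
  qed
  have U: "{(t, k) \<in> chains I l. 0 < k \<or> t \<in> UNIV} = chains I l" for I l by auto
  have "span (cvec x1 ` chains I1 l1) = W1" "span (cvec x2 ` chains I2 l2) = W2"
    using b1(1) b2(1) by (simp_all add: xbasis_def)
  then have hW: "h ` W1 = W2" using img[of UNIV UNIV] unfolding U by simp
  have hB: "h ` B1 = B2"
    using img[of B2 B1] \<pi>(2) unfolding adapted_span[OF x1 b1 W1(2,3), symmetric] adapted_span[OF x2 b2 W2(2,3), symmetric] by blast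
  have "dim W1 = dim W2"
  proof -
    have "dim W1 = sum l1 I1" "dim W2 = sum l2 I2" using b1 b2 by (auto simp: xbasis_def)
    moreover have "sum l2 I2 = sum (\<lambda>t. l2 (\<pi> t)) I1" using \<pi>(1) by (rule sum.reindex_bij_betw[symmetric])
    moreover have "sum (\<lambda>t. l2 (\<pi> t)) I1 = sum l1 I1" using \<pi>(2) by (intro sum.cong) auto
    ultimately show ?thesis by simp
  qed
  then have "dim (W1 \<inter> {v. h v = 0}) = 0" using rank_nullity[OF h(1) W1(1)] hW by simp
  then have "W1 \<inter> {v. h v = 0} \<subseteq> {0}" by (simp add: dim_eq_0)
  then have "inj_on h W1" using self.linear_inj_on_iff_eq_0[OF h(1) W1(1)] by blast
  moreover have "h (x1 w) = x2 (h w)" if w: "w \<in> W1" for w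
  proof (rule self.linear_eq_on[of "\<lambda>v. h (x1 v)" "\<lambda>v. x2 (h v)" w "cvec x1 ` chains I1 l1"])
    show "endo (\<lambda>v. h (x1 v))" "endo (\<lambda>v. x2 (h v))"
      using Vector_Spaces.linear_compose[OF x1 h(1)] Vector_Spaces.linear_compose[OF h(1) x2] by (simp_all add: o_def)
    show "w \<in> span (cvec x1 ` chains I1 l1)" using w b1 by (simp add: xbasis_def)
    fix u assume "u \<in> cvec x1 ` chains I1 l1"
    then obtain t k where t: "(t, k) \<in> chains I1 l1" "u = cvec x1 (t, k)" by auto
    have tI: "t \<in> I1" "k < l1 t" using t by (auto simp: chains_def)
    have "l2 (\<pi> t) = l1 t" "\<pi> t \<in> I2" using \<pi>(2) bij_betw_apply[OF \<pi>(1)] tI by auto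
    have s: "x1 u = cvec x1 (t, Suc k)" "x2 (cvec x2 (\<pi> t, k)) = cvec x2 (\<pi> t, Suc k)"
      by (simp_all add: t cvec_def)
    show "h (x1 u) = x2 (h u)"
    proof (cases "Suc k < l1 t")
      case True
      then have "(t, Suc k) \<in> chains I1 l1" using tI by (simp add: in_chains)
      then show ?thesis using hv t s by simp
    next
      case False
      then have k: "Suc k = l1 t" using tI by simp
      have "(x1 ^^ l1 t) t = 0" using b1(1) tI by (auto simp: xbasis_def)
      moreover have "(x2 ^^ l2 (\<pi> t)) (\<pi> t) = 0" using b2(1) \<open>\<pi> t \<in> I2\<close> by (auto simp: xbasis_def)
      ultimately have "cvec x1 (t, Suc k) = 0" "cvec x2 (\<pi> t, Suc k) = 0"
        unfolding cvec_def prod.case k \<open>l2 (\<pi> t) = l1 t\<close> by simp_all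
      then show ?thesis using endo_0[OF h(1)] s hv t by simp
    qed
  qed
  ultimately show ?thesis using h(1) hW hB by blast
qed

text \<open>
  The chains of a Jordan basis can be indexed by the rows of any tableau of the right shape.
\<close>

lemma xbasis_rows:
  assumes x: "endo x" and W: "subspace W" "x ` W \<subseteq> W" "W \<subseteq> K x N"
    and P: "\<forall>R\<in>set P. R \<noteq> []" and jcol: "\<And>c. jcol x W c = shape_col P c"
  shows "\<exists>I l t. xbasis x W I l \<and> bij_betw t {..<length P} I \<and> (\<forall>r<length P. l (t r) = length (P ! r))"
proof -
  obtain I l where b: "xbasis x W I l" "W \<subseteq> span (x ` W \<union> (I \<inter> W))"
    using exists_adapted_xbasis[OF x W(1) W(1) W(2) order_refl W(3)] by blast
  have finI: "finite I" and pos: "\<forall>t\<in>I. 0 < l t" using b(1) by (auto simp: xbasis_def)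
  have c: "card {t \<in> I. c < l t} = card {r \<in> {..<length P}. c < length (P ! r)}" for c
    using xbasis_counts(1)[OF x b W(1,2), of c] jcol[of c] by (simp add: shape_col_card)
  have pos': "\<forall>r\<in>{..<length P}. 0 < length (P ! r)" using P by auto
  have fib: "card {a \<in> A. f a = k} = card {a \<in> A. k - 1 < f a} - card {a \<in> A. k < f a}"
    if "finite A" "\<forall>a\<in>A. 0 < f a" "0 < k" for A :: "'c set" and f :: "'c \<Rightarrow> nat" and k
  proof -
    have "{a \<in> A. k - 1 < f a} = {a \<in> A. f a = k} \<union> {a \<in> A. k < f a}" using that(3) by auto
    then have "card {a \<in> A. k - 1 < f a} = card {a \<in> A. f a = k} + card {a \<in> A. k < f a}"
      using that(1) by (simp only:) (rule card_Un_disjoint, auto)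
    then show ?thesis by simp
  qed
  have "card {r \<in> {..<length P}. length (P ! r) = k} = card {t \<in> I. l t = k}" for k
  proof (cases "k = 0")
    case True
    then have "{r \<in> {..<length P}. length (P ! r) = k} = {}" "{t \<in> I. l t = k} = {}" using pos pos' by fastforce+
    then show ?thesis by (simp only: card.empty)
  next
    case False
    then show ?thesis
      using fib[OF _ pos', of k] fib[OF finI pos, of k] c[of k] c[of "k - 1"] by simp
  qed
  then obtain t where "bij_betw t {..<length P} I" "\<forall>r\<in>{..<length P}. l (t r) = length (P ! r)"
    using bij_same_fibers[OF finite_lessThan finI, of "length P" "\<lambda>r. length (P ! r)" l] by blast
  then show ?thesis using b(1) by blast
qed

section \<open>Compatible flags\<close>

text \<open>
  Flags of subspaces of \<open>W\<close> with \<open>x F\<^sub>i\<^sub>+\<^sub>1 \<subseteq> F\<^sub>i\<close>, where equal consecutive members are allowed.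
  Unlike a list, a function can be restricted and extended by one member without reindexing.
\<close>

definition cflag :: "('b \<Rightarrow> 'b) \<Rightarrow> nat \<Rightarrow> (nat \<Rightarrow> 'b set) \<Rightarrow> 'b set \<Rightarrow> bool" where
  "cflag x n F W \<longleftrightarrow> F 0 = {0} \<and> F n = W \<and> (\<forall>i\<le>n. subspace (F i))
     \<and> (\<forall>i<n. F i \<subseteq> F (Suc i) \<and> x ` F (Suc i) \<subseteq> F i)"

lemma cflag_step:
  assumes "cflag x n F W" "i < n"
  shows "F i \<subseteq> F (Suc i)" "x ` F (Suc i) \<subseteq> F i" "v \<in> F (Suc i) \<Longrightarrow> x v \<in> F i"
  using assms unfolding cflag_def by blast+

lemma cflag_mono: "cflag x n F W \<Longrightarrow> i \<le> j \<Longrightarrow> j \<le> n \<Longrightarrow> F i \<subseteq> F j"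
proof (induction j)
  case (Suc j)
  show ?case
  proof (cases "i = Suc j")
    case False
    then have "F i \<subseteq> F j" using Suc by simp
    also have "\<dots> \<subseteq> F (Suc j)" using cflag_step(1)[OF Suc.prems(1), of j] Suc.prems(3) by simp
    finally show ?thesis .
  qed simp
qed simp

lemma cflag_subspace: "cflag x n F W \<Longrightarrow> i \<le> n \<Longrightarrow> subspace (F i)"
  by (simp add: cflag_def)

lemma cflag_K: "cflag x n F W \<Longrightarrow> i \<le> n \<Longrightarrow> F i \<subseteq> K x i"
proof (induction i)
  case (Suc i)
  show ?case
  proof
    fix v assume "v \<in> F (Suc i)"
    then have "x v \<in> F i" using cflag_step(3)[OF Suc.prems(1), of i v] Suc.prems(2) by simp
    then have "x v \<in> K x i" using Suc by auto
    then show "v \<in> K x (Suc i)" by (simp add: K_def funpow_swap1)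
  qed
qed (simp add: cflag_def)

lemma cflag_top:
  assumes "cflag x n F W" "endo x"
  shows "subspace W" "x ` W \<subseteq> W" "W \<subseteq> K x n" "i \<le> n \<Longrightarrow> F i \<subseteq> W"
proof -
  have W: "F n = W" using assms by (simp add: cflag_def)
  show "subspace W" "W \<subseteq> K x n" using assms cflag_K[OF assms(1), of n] W by (auto simp: cflag_def)
  show "i \<le> n \<Longrightarrow> F i \<subseteq> W" using cflag_mono[OF assms(1)] W by blast
  show "x ` W \<subseteq> W"
  proof (cases n)
    case 0
    then show ?thesis using assms W endo_0[OF assms(2)] by (auto simp: cflag_def)
  next
    case (Suc k)
    then have "x ` F n \<subseteq> F k" "F k \<subseteq> F n" using cflag_step(1,2)[OF assms(1), of k] by auto
    then show ?thesis using W by blast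
  qed
qed

lemma cflag_dim: "cflag x n F W \<Longrightarrow> endo x \<Longrightarrow> i \<le> n \<Longrightarrow> dim (F i) = (\<Sum>j<n. jcol x (F i) j)"
proof -
  assume a: "cflag x n F W" "endo x" "i \<le> n"
  then have "F i \<inter> K x n = F i" using cflag_top(3,4)[OF a(1,2)] by blast
  then show ?thesis using dim_Int_K[OF a(2) cflag_subspace[OF a(1,3)], of n] by simp
qed

lemma cflag_image:
  assumes F: "cflag x n F W" and h: "endo h" and sub: "W \<subseteq> V" and com: "\<And>w. w \<in> V \<Longrightarrow> h (x w) = x' (h w)" and x: "endo x"
  shows "cflag x' n (\<lambda>i. h ` F i) (h ` W)"
  unfolding cflag_def
proof (intro conjI allI impI)
  show "h ` F 0 = {0}" using F endo_0[OF h] by (simp add: cflag_def)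
  show "h ` F n = h ` W" using F by (simp add: cflag_def)
  show "subspace (h ` F i)" if "i \<le> n" for i using F that by (intro subspace_image[OF h] cflag_subspace)
  fix i assume i: "i < n"
  show "h ` F i \<subseteq> h ` F (Suc i)" using F i by (intro image_mono) (simp add: cflag_def)
  show "x' ` h ` F (Suc i) \<subseteq> h ` F i"
  proof
    fix v assume "v \<in> x' ` h ` F (Suc i)"
    then obtain w where w: "w \<in> F (Suc i)" "v = x' (h w)" by blast
    then have "w \<in> V" using cflag_top(4)[OF F x, of "Suc i"] i sub by auto
    then have "v = h (x w)" using com w by simp
    then show "v \<in> h ` F i" using cflag_step(3)[OF F i w(1)] by blast
  qed
qed

lemma cflag_Int:
  assumes F: "cflag x n F W" and A: "subspace A" "A \<subseteq> W" "x ` W \<subseteq> A" and x: "endo x"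
  shows "cflag x n (\<lambda>i. F i \<inter> A) A"
  unfolding cflag_def
proof (intro conjI allI impI)
  show "F 0 \<inter> A = {0}" using F subspace_0[OF A(1)] by (auto simp: cflag_def)
  show "F n \<inter> A = A" using F A by (auto simp: cflag_def)
  show "subspace (F i \<inter> A)" if "i \<le> n" for i using cflag_subspace[OF F that] A(1) by (rule subspace_inter)
  fix i assume i: "i < n"
  show "F i \<inter> A \<subseteq> F (Suc i) \<inter> A" using F i by (auto simp: cflag_def)
  have "F (Suc i) \<subseteq> W" using cflag_top(4)[OF F x, of "Suc i"] i by simp
  then show "x ` (F (Suc i) \<inter> A) \<subseteq> F i \<inter> A" using F i A(3) unfolding cflag_def by blast
qed

text \<open>
  The type of \<open>x\<close> on \<open>F\<^sub>i\<close> is the shape of the entries \<open>\<le> i\<close> of \<open>P\<close>: the flag lies in the stratum of \<open>P\<close>.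
\<close>

definition has_profile :: "('b \<Rightarrow> 'b) \<Rightarrow> nat \<Rightarrow> (nat \<Rightarrow> 'b set) \<Rightarrow> nat list list \<Rightarrow> bool" where
  "has_profile x n F P \<longleftrightarrow> (\<forall>i\<le>n. \<forall>c. jcol x (F i) c = col_upto P i c)"

text \<open>
  Complete flags whose types follow the insertion of \<open>w\<close> letter by letter, that is, the stratum of the
  standard recording tableau of \<open>w\<close>.
\<close>

definition word_flag :: "('b \<Rightarrow> 'b) \<Rightarrow> nat list \<Rightarrow> (nat \<Rightarrow> 'b set) \<Rightarrow> 'b set \<Rightarrow> bool" where
  "word_flag x w F W \<longleftrightarrow> cflag x (length w) F W \<and> (\<forall>k\<le>length w. \<forall>c. jcol x (F k) c = shape_col (ins (take k w)) c)"

lemma dim_profile: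
  assumes "endo x" "letters n w" "cflag x n F W" "has_profile x n F (ins w)" "i \<le> n"
  shows "dim (F i) = length (filter (\<lambda>y. y \<le> i) w)"
  using cflag_dim[OF assms(3,1,5)] assms(4,5) sum_col_upto_ins[OF assms(2)] by (simp add: has_profile_def)

text \<open>
  Label the vector \<open>x\<^sup>l\<^sup>-\<^sup>1\<^sup>-\<^sup>c t\<close> of the chain of row \<open>r\<close>, of length \<open>l\<close>, with the entry of
  \<open>Q\<close> in the box \<open>(r, c)\<close>, and let \<open>F\<^sub>i\<close> be spanned by the vectors with label \<open>\<le> i\<close>. Rows are strict, so
  \<open>x\<close> lowers the labels.
\<close>

lemma exists_flag:
  assumes x: "endo x" and W: "subspace W" "x ` W \<subseteq> W" "W \<subseteq> K x N"
    and Q: "tableau Q" "\<forall>y\<in>set (concat Q). 1 \<le> y \<and> y \<le> n" and jcol: "\<And>c. jcol x W c = shape_col Q c"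
  shows "\<exists>F. cflag x n F W \<and> has_profile x n F Q"
proof -
  have rows: "Q ! r \<noteq> []" "sorted_wrt (<) (Q ! r)" if "r < length Q" for r using Q(1) that by (auto simp: tableau_nth)
  have "\<forall>R\<in>set Q. R \<noteq> []" using rows by (metis in_set_conv_nth)
  then obtain I l t where b: "xbasis x W I l" and t: "bij_betw t {..<length Q} I" "\<forall>r<length Q. l (t r) = length (Q ! r)"
    using xbasis_rows[OF x W _ jcol] by blast
  define \<rho> where "\<rho> = inv_into {..<length Q} t"
  have \<rho>: "\<rho> s < length Q" "t (\<rho> s) = s" "l s = length (Q ! \<rho> s)" if "s \<in> I" for s
  proof -
    have "s \<in> t ` {..<length Q}" using t(1) that by (simp add: bij_betw_def)
    then show "\<rho> s < length Q" "t (\<rho> s) = s"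
      using inv_into_into[of s t "{..<length Q}"] f_inv_into_f[of s t "{..<length Q}"] by (auto simp: \<rho>_def)
    then show "l s = length (Q ! \<rho> s)" using t(2) by metis
  qed
  have \<rho>t: "\<rho> (t r) = r" "t r \<in> I" if "r < length Q" for r
    using t(1) that by (auto simp: \<rho>_def bij_betw_def)
  define D where "D i = {(s, k) \<in> chains I l. Q ! \<rho> s ! (l s - 1 - k) \<le> i}" for i
  define F where "F i = span (cvec x ` D i)" for i
  have D: "D i \<subseteq> chains I l" for i by (auto simp: D_def)
  have entry: "1 \<le> Q ! \<rho> s ! (l s - 1 - k) \<and> Q ! \<rho> s ! (l s - 1 - k) \<le> n" if "(s, k) \<in> chains I l" for s k
  proof -
    have s: "s \<in> I" "k < l s" using that by (auto simp: chains_def)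
    then have "Q ! \<rho> s ! (l s - 1 - k) \<in> set (Q ! \<rho> s)" using \<rho>(3)[OF s(1)] by (intro nth_mem) auto
    then have "Q ! \<rho> s ! (l s - 1 - k) \<in> set (concat Q)" using \<rho>(1)[OF s(1)] by auto
    then show ?thesis using Q(2) by blast
  qed
  have "D 0 = {}" using entry by (fastforce simp: D_def)
  then have F0: "F 0 = {0}" by (simp add: F_def)
  have "D n = chains I l" using entry by (fastforce simp: D_def)
  then have Fn: "F n = W" using b by (simp add: F_def xbasis_def)
  have "cflag x n F W"
    unfolding cflag_def
  proof (intro conjI allI impI)
    show "F 0 = {0}" "F n = W" by fact+
    show "subspace (F i)" for i by (simp add: F_def)
    show "F i \<subseteq> F (Suc i)" for i unfolding F_def by (intro span_mono image_mono) (auto simp: D_def)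
    show "x ` F (Suc i) \<subseteq> F i" for i
    proof -
      have "x ` cvec x ` D (Suc i) \<subseteq> F i"
      proof
        fix v assume "v \<in> x ` cvec x ` D (Suc i)"
        then obtain s k where sk: "(s, k) \<in> D (Suc i)" "v = (x ^^ Suc k) s" by (auto simp: cvec_def)
        have s: "s \<in> I" "k < l s" "Q ! \<rho> s ! (l s - 1 - k) \<le> Suc i" using sk(1) by (auto simp: D_def chains_def)
        show "v \<in> F i"
        proof (cases "Suc k < l s")
          case True
          have "Q ! \<rho> s ! (l s - 1 - Suc k) < Q ! \<rho> s ! (l s - 1 - k)"
            using rows(2)[OF \<rho>(1)[OF s(1)]] \<rho>(3)[OF s(1)] True by (intro sorted_wrt_nth_less[of "(<)"]) auto
          then have "(s, Suc k) \<in> D i" using s True by (simp add: D_def chains_def)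
          then have "cvec x (s, Suc k) \<in> F i" unfolding F_def by (intro span_base imageI)
          then show ?thesis by (simp add: sk(2) cvec_def)
        next
          case False
          then have "Suc k = l s" using s by simp
          then have "v = 0" using b s(1) unfolding sk(2) by (auto simp: xbasis_def simp del: funpow.simps)
          then show ?thesis by (simp add: F_def span_zero)
        qed
      qed
      then have "span (x ` cvec x ` D (Suc i)) \<subseteq> F i" by (intro span_minimal) (simp_all add: F_def)
      then show ?thesis using self.linear_span_image[OF x, of "cvec x ` D (Suc i)"] by (simp add: F_def)
    qed
  qed
  moreover have "jcol x (F i) c = col_upto Q i c" for i c
  proof -
    have "jcol x (F i) c = card {s \<in> I. c < l s \<and> (s, l s - 1 - c) \<in> D i}"
      unfolding F_def by (rule jcol_span_chains[OF x b D])
    also have "{s \<in> I. c < l s \<and> (s, l s - 1 - c) \<in> D i} = t ` {r. r < length Q \<and> c < length (Q ! r) \<and> Q ! r ! c \<le> i}"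
    proof
      show "{s \<in> I. c < l s \<and> (s, l s - 1 - c) \<in> D i} \<subseteq> t ` {r. r < length Q \<and> c < length (Q ! r) \<and> Q ! r ! c \<le> i}"
      proof
        fix s assume s: "s \<in> {s \<in> I. c < l s \<and> (s, l s - 1 - c) \<in> D i}"
        then have e: "l s - Suc (l s - Suc c) = c" by auto
        have "Q ! \<rho> s ! c \<le> i" using s by (simp add: D_def e)
        then show "s \<in> t ` {r. r < length Q \<and> c < length (Q ! r) \<and> Q ! r ! c \<le> i}"
          using s \<rho>[of s] by (intro image_eqI[of _ _ "\<rho> s"]) auto
      qed
      show "t ` {r. r < length Q \<and> c < length (Q ! r) \<and> Q ! r ! c \<le> i} \<subseteq> {s \<in> I. c < l s \<and> (s, l s - 1 - c) \<in> D i}"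
      proof
        fix s assume "s \<in> t ` {r. r < length Q \<and> c < length (Q ! r) \<and> Q ! r ! c \<le> i}"
        then obtain r where r: "r < length Q" "c < length (Q ! r)" "Q ! r ! c \<le> i" "s = t r" by blast
        have ls: "l s = length (Q ! r)" using r(1,4) t(2) by simp
        then have e: "l s - Suc (l s - Suc c) = c" "l s - Suc c < l s" "c < l s" using r(2) by simp_all
        have "\<rho> s = r" "s \<in> I" using \<rho>t[OF r(1)] r(4) by simp_all
        then show "s \<in> {s \<in> I. c < l s \<and> (s, l s - 1 - c) \<in> D i}" using r(3) e by (simp add: D_def chains_def)
      qed
    qed
    also have "card \<dots> = card {r. r < length Q \<and> c < length (Q ! r) \<and> Q ! r ! c \<le> i}"
    proof (rule card_image, rule inj_on_subset)
      show "inj_on t {..<length Q}" using t(1) by (simp add: bij_betw_def)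
    qed blast
    also have "\<dots> = col_upto Q i c" using col_upto_card[OF tableau_rows[OF Q(1)]] by simp
    finally show ?thesis .
  qed
  ultimately show ?thesis by (auto simp: has_profile_def)
qed

section \<open>Position of a compatible flag with respect to a hyperplane\<close>

text \<open>
  Downward induction on \<open>i\<close>. If the least column \<open>c\<close> of \<open>J x F\<^sub>i A\<close> were not allowed, then the type of
  \<open>F\<^sub>i\<^sub>+\<^sub>1\<close> has, by assumption, a column \<open>Suc c\<close> at least as long as the column \<open>c\<close> of \<open>F\<^sub>i\<close>; but
  \<open>x\<close> maps \<open>F\<^sub>i\<^sub>+\<^sub>1\<close> into \<open>F\<^sub>i \<inter> A\<close>, whose column \<open>c\<close> is shorter than that of \<open>F\<^sub>i\<close>.
\<close>

lemma flag_J_bound: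
  assumes x: "endo x" and F: "cflag x n F W"
    and A: "subspace A" "A \<subseteq> W" "dim W \<le> Suc (dim A)" "x ` W \<subseteq> A"
    and top: "J x W A \<subseteq> Jc n"
    and up: "\<And>i c c'. c \<in> Jc i \<Longrightarrow> c \<le> c' \<Longrightarrow> c' \<in> Jc i"
    and gap: "\<And>i c. i < n \<Longrightarrow> c \<in> Jc (Suc i) \<Longrightarrow> c \<notin> Jc i \<Longrightarrow> jcol x (F i) c \<le> jcol x (F (Suc i)) (Suc c)"
    and i: "i \<le> n"
  shows "J x (F i) A \<subseteq> Jc i"
  using i
proof (induction i rule: inc_induct)
  case base
  then show ?case using top F by (simp add: cflag_def)
next
  case (step i)
  show ?case
  proof
    fix c assume c: "c \<in> J x (F i) A"
    define c0 where "c0 = (LEAST c. c \<in> J x (F i) A)"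
    have c0: "c0 \<in> J x (F i) A" unfolding c0_def by (rule LeastI[of _ c]) (rule c)
    have cc0: "c0 \<le> c" unfolding c0_def by (rule Least_le) (rule c)
    have min: "c0 = 0 \<or> c0 - 1 \<notin> J x (F i) A"
      using not_less_Least[of "c0 - 1" "\<lambda>c. c \<in> J x (F i) A"] unfolding c0_def by (cases "c0") (auto simp: c0_def)
    have sub: "F i \<subseteq> F (Suc i)" "x ` F (Suc i) \<subseteq> F i" using F step by (auto simp: cflag_def)
    have W: "subspace W" "F i \<subseteq> W" "F (Suc i) \<subseteq> W" using cflag_top[OF F x] step by auto
    have "c0 \<in> Jc (Suc i)" using J_mono[OF sub(1)] c0 step.IH by blast
    have "c0 \<in> Jc i"
    proof (rule ccontr)
      assume "c0 \<notin> Jc i"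
      then have "jcol x (F i) c0 \<le> jcol x (F (Suc i)) (Suc c0)" using gap step \<open>c0 \<in> Jc (Suc i)\<close> by blast
      also have "\<dots> \<le> jcol x (F i \<inter> A) c0" by (rule jcol_Suc_le) (use sub W A in blast)
      also have "\<dots> < jcol x (F i) c0"
        using jcol_hyperplane[OF x A(1) W(1) A(2,3), of "F i" c0] cflag_subspace[OF F, of i] step W c0 min by simp
      finally show False by simp
    qed
    then show "c \<in> Jc i" using up cc0 by blast
  qed
qed

text \<open>
  The flag is moved from the top down. If \<open>F\<^sub>n\<close> does not yet meet the requirement, it contains a free
  generator \<open>t\<close> in the right kernel, and for some \<open>a\<close> an automorphism \<open>1 + a y\<close> commuting with \<open>x\<close> moves
  \<open>t\<close> out of \<open>A\<close>. The lower members are then treated inside the image of \<open>F\<^sub>n\<close>, where \<open>A\<close> cuts out a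
  hyperplane or everything.
\<close>

lemma flag_general_position:
  assumes inf: "infinite (UNIV :: 'a set)" and x: "endo x"
    and up: "\<And>i c c'. c \<in> Jc i \<Longrightarrow> c \<le> c' \<Longrightarrow> c' \<in> Jc i"
    and mono: "\<And>i. Jc i \<subseteq> Jc (Suc i)"
  shows "cflag x n F W \<Longrightarrow> subspace A \<Longrightarrow> A \<subseteq> W \<Longrightarrow> dim W \<le> Suc (dim A) \<Longrightarrow> x ` W \<subseteq> A \<Longrightarrow>
     Jc n \<subseteq> J x W A \<Longrightarrow>
     (\<And>i c. i < n \<Longrightarrow> c \<in> Jc i \<Longrightarrow> c = 0 \<or> c - 1 \<notin> Jc i \<Longrightarrow> jcol x (F (Suc i)) (Suc c) < jcol x (F i) c) \<Longrightarrow>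
     \<exists>F'. cflag x n F' W \<and> (\<forall>i\<le>n. \<forall>c. jcol x (F' i) c = jcol x (F i) c) \<and> (\<forall>i\<le>n. Jc i \<subseteq> J x (F' i) A)"
proof (induction n arbitrary: F W A)
  case 0
  then show ?case by (intro exI[of _ F]) (auto simp: cflag_def)
next
  case (Suc n)
  note F = Suc.prems(1) and A = Suc.prems(2-5)
  have W: "subspace W" "x ` W \<subseteq> W" and FW: "\<And>i. i \<le> Suc n \<Longrightarrow> F i \<subseteq> W" using cflag_top[OF F x] by auto
  have FSuc: "F (Suc n) = W" using F by (simp add: cflag_def)
  define B where "B = F n"
  have B: "subspace B" "B \<subseteq> W" "x ` W \<subseteq> B"
    using cflag_subspace[OF F, of n] cflag_step(1,2)[OF F, of n] FSuc by (simp_all add: B_def)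
  have FB: "cflag x n F B" using F by (auto simp: cflag_def B_def)
  \<comment> \<open>an automorphism moving \<open>B\<close> into general position\<close>
  obtain h where h: "endo h" "inj_on h W" "h ` W = W" "\<And>w. w \<in> W \<Longrightarrow> h (x w) = x (h w)" "Jc n \<subseteq> J x (h ` B) A"
  proof (cases "Jc n \<subseteq> J x B A")
    case True
    then show ?thesis using that[of "\<lambda>v. v"] endo_id by auto
  next
    case False
    then obtain c where "c \<in> Jc n" by blast
    \<comment> \<open>the requirement on \<open>F n\<close> concerns only the least column\<close>
    define c0 where "c0 = (LEAST c. c \<in> Jc n)"
    have c0: "c0 \<in> Jc n" unfolding c0_def by (rule LeastI[of _ c]) fact
    have cc0: "\<And>c. c \<in> Jc n \<Longrightarrow> c0 \<le> c" unfolding c0_def by (rule Least_le)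
    have min: "c0 = 0 \<or> c0 - 1 \<notin> Jc n" using cc0[of "c0 - 1"] by (cases c0) auto
    have "jcol x W (Suc c0) < jcol x B c0" using Suc.prems(7)[OF _ c0 min] FSuc B_def by simp
    then obtain t where t: "t \<in> B" "t \<in> K x (Suc c0)" "(x ^^ c0) t \<notin> (x ^^ Suc c0) ` W"
      using exists_free_generator[OF x] by blast
    have inJ: "Jc n \<subseteq> J x S A" if "v \<in> S" "v \<in> K x (Suc c0)" "v \<notin> A" for v S
    proof
      fix c assume "c \<in> Jc n"
      moreover have "c0 \<in> J x S A" using that by (auto simp: J_def)
      ultimately show "c \<in> J x S A" using J_up[OF x] cc0 by blast
    qed
    have tA: "t \<in> A" using inJ[OF t(1,2)] False by blast
    have "c0 \<in> J x W A" using c0 mono[of n] Suc.prems(6) by blast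
    then obtain s where s: "s \<in> W" "s \<in> K x (Suc c0)" "s \<notin> A" by (auto simp: J_def)
    obtain y where y: "endo y" "y ` W \<subseteq> W" "\<And>w. w \<in> W \<Longrightarrow> y (x w) = x (y w)" "y t \<notin> A"
      using exists_commuting_move[OF x W s _ t(3) A(1,4)] t(1) B by blast
    have "\<forall>\<^sub>F s in cofinite. s \<noteq> (0::'a)" by (simp add: eventually_cofinite)
    with move_bij_cofinite[OF y(1,2) W(1)]
    have "\<forall>\<^sub>F s in cofinite. (inj_on (\<lambda>v. v + s \<cdot> y v) W \<and> (\<lambda>v. v + s \<cdot> y v) ` W = W) \<and> s \<noteq> 0" by (rule eventually_conj)
    then obtain a where a: "inj_on (\<lambda>v. v + a \<cdot> y v) W" "(\<lambda>v. v + a \<cdot> y v) ` W = W" "a \<noteq> 0"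
      using cofinite_ex[OF inf] by blast
    let ?h = "\<lambda>v. v + a \<cdot> y v"
    have com: "?h (x w) = x (?h w)" if "w \<in> W" for w
      using y(3)[OF that] by (simp add: endo_add[OF x] endo_scale[OF x])
    have tW: "t \<in> W" using t B by blast
    have "(x ^^ Suc c0) (?h t) = ?h ((x ^^ Suc c0) t)"
      using funpow_commute_on(1)[of W ?h x x t "Suc c0", OF com W(2) tW] by (simp del: funpow.simps)
    also have "\<dots> = 0" using t(2) endo_0[OF y(1)] by (simp add: K_def)
    finally have hK: "?h t \<in> K x (Suc c0)" by (simp add: K_def)
    have "?h t \<notin> A"
    proof
      assume "?h t \<in> A"
      then have "?h t - t \<in> A" using tA A(1) by (intro subspace_diff)
      then have "a \<cdot> y t \<in> A" by simp
      then have "(1/a) \<cdot> (a \<cdot> y t) \<in> A" by (rule subspace_scale[OF A(1)])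
      then show False using a(3) y(4) by simp
    qed
    then have "Jc n \<subseteq> J x (?h ` B) A" using inJ[of "?h t" "?h ` B"] hK t(1) by blast
    then show ?thesis using that[of ?h] endo_move[OF y(1)] a com by blast
  qed
  \<comment> \<open>the induction hypothesis is applied inside \<open>h B\<close>\<close>
  let ?F = "\<lambda>i. h ` F i" and ?B = "h ` B" and ?A = "A \<inter> h ` B"
  have F1: "cflag x n ?F ?B" by (rule cflag_image[OF FB h(1) B(2) h(4) x]) auto
  have hB: "subspace ?B" "?B \<subseteq> W" using subspace_image[OF h(1) B(1)] B(2) h(3) by auto
  have xB: "x ` ?B \<subseteq> ?B" using cflag_top(2)[OF F1 x] .
  have A1: "subspace ?A" "?A \<subseteq> ?B" "dim ?B \<le> Suc (dim ?A)" "x ` ?B \<subseteq> ?A"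
  proof -
    show "subspace ?A" using A(1) hB(1) by (rule subspace_inter)
    have "?B \<inter> A = ?A" by blast
    then show "dim ?B \<le> Suc (dim ?A)" using dim_Int_hyperplane[OF A(1) W(1) A(2,3) hB] by (auto split: if_splits)
    show "x ` ?B \<subseteq> ?A" using xB hB(2) A(4) by blast
  qed auto
  have clh: "jcol x (h ` F i) c = jcol x (F i) c" if "i \<le> Suc n" for i c
    using jcol_image[OF h(1,2,4) W(2,1) FW[OF that] x] .
  have J1: "Jc n \<subseteq> J x ?B ?A" using h(5) by (auto simp: J_def)
  have cond: "jcol x (?F (Suc i)) (Suc c) < jcol x (?F i) c" if "i < n" "c \<in> Jc i" "c = 0 \<or> c - 1 \<notin> Jc i" for i c
    using Suc.prems(7)[of i c] that clh by simp
  have "\<exists>F'. cflag x n F' ?B \<and> (\<forall>i\<le>n. \<forall>c. jcol x (F' i) c = jcol x (?F i) c) \<and> (\<forall>i\<le>n. Jc i \<subseteq> J x (F' i) ?A)"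
    by (rule Suc.IH[OF F1 A1 J1 cond])
  then obtain F' where F'ex: "cflag x n F' ?B \<and> (\<forall>i\<le>n. \<forall>c. jcol x (F' i) c = jcol x (?F i) c) \<and> (\<forall>i\<le>n. Jc i \<subseteq> J x (F' i) ?A)"
    by (rule exE)
  then have F': "cflag x n F' ?B" "\<And>i c. i \<le> n \<Longrightarrow> jcol x (F' i) c = jcol x (?F i) c"
    "\<And>i. i \<le> n \<Longrightarrow> Jc i \<subseteq> J x (F' i) ?A"
    by simp_all
  let ?G = "F'(Suc n := W)"
  have xW: "x ` W \<subseteq> ?B"
  proof
    fix v assume "v \<in> x ` W"
    then obtain w' where w': "w' \<in> W" "v = x w'" by (rule imageE)
    then have "w' \<in> h ` W" using h(3) by simp
    then obtain w where w: "w \<in> W" "v = x (h w)" using w'(2) by blast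
    then have "v = h (x w)" using h(4) by simp
    then show "v \<in> ?B" using B(3) w by blast
  qed
  have "cflag x (Suc n) ?G W"
  proof -
    have n: "F' n = ?B" using F'(1) by (simp add: cflag_def)
    have st: "?G i \<subseteq> ?G (Suc i) \<and> x ` ?G (Suc i) \<subseteq> ?G i" if "i < Suc n" for i
    proof (cases "i = n")
      case True
      then show ?thesis using n hB(2) xW by simp
    next
      case False
      then show ?thesis using cflag_step(1,2)[OF F'(1), of i] that by simp
    qed
    moreover have "subspace (?G i)" if "i \<le> Suc n" for i
      using cflag_subspace[OF F'(1), of i] W(1) that by (cases "i = Suc n") auto
    moreover have "F' 0 = {0}" using F'(1) by (simp add: cflag_def)
    ultimately show ?thesis unfolding cflag_def by simp
  qed
  moreover have "jcol x (?G i) c = jcol x (F i) c" if "i \<le> Suc n" for i c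
    using F'(2)[of i c] clh[of i c] that FSuc by (auto simp: le_Suc_eq)
  moreover have "Jc i \<subseteq> J x (?G i) A" if "i \<le> Suc n" for i
  proof (cases "i = Suc n")
    case True
    then show ?thesis using Suc.prems(6) by simp
  next
    case False
    then have "i \<le> n" using that by simp
    then have "Jc i \<subseteq> J x (F' i) ?A" "F' i \<subseteq> ?B" using F'(3) cflag_top(4)[OF F'(1) x] by auto
    then have "Jc i \<subseteq> J x (F' i) A" by (auto simp: J_def)
    then show ?thesis using False by simp
  qed
  ultimately show ?case by blast
qed

text \<open>
  In the best position, cutting with the hyperplane undoes the insertion for all members of the flag at
  once.
\<close>

lemma profile_hyperplane:
  assumes x: "endo x" and F: "cflag x n F W" and A: "subspace A" "A \<subseteq> W" "dim W \<le> Suc (dim A)"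
    and P: "tableau P" and prof: "has_profile x n F (row_insert z P)" and J: "\<And>i. i \<le> n \<Longrightarrow> J x (F i) A = Jins z P i"
  shows "has_profile x n (\<lambda>i. F i \<inter> A) P"
  unfolding has_profile_def
proof (intro allI impI)
  fix i c assume i: "i \<le> n"
  have "subspace W" "F i \<subseteq> W" using cflag_top[OF F x] i by auto
  then show "jcol x (F i \<inter> A) c = col_upto P i c"
    using jcol_hyperplane[OF x A(1) _ A(2,3) cflag_subspace[OF F i], of c] col_upto_Jins[OF P, of z i c] prof J[OF i] i
    by (simp add: has_profile_def)
qed

lemma profile_J_bound:
  assumes x: "endo x" and F: "cflag x n F W" and A: "subspace A" "A \<subseteq> W" "dim W \<le> Suc (dim A)" "x ` W \<subseteq> A"
    and P: "tableau P" and prof: "has_profile x n F (row_insert z P)" and top: "J x W A \<subseteq> Jins z P n" and i: "i \<le> n"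
  shows "J x (F i) A \<subseteq> Jins z P i"
proof (rule flag_J_bound[where Jc = "Jins z P", OF x F A top Jins_up _ i])
  fix i c assume "i < n" "c \<in> Jins z P (Suc i)" "c \<notin> Jins z P i"
  then show "jcol x (F i) c \<le> jcol x (F (Suc i)) (Suc c)"
    using Jins_gap[OF P] prof by (simp add: has_profile_def)
qed

lemma exists_reverse_insertion_flag:
  assumes inf: "infinite (UNIV :: 'a set)" and x: "endo x" and F: "cflag x n F W"
    and A: "subspace A" "A \<subseteq> W" "dim W \<le> Suc (dim A)" "x ` W \<subseteq> A"
    and P: "tableau P" and z: "0 < z" and prof: "has_profile x n F (row_insert z P)" and top: "J x W A = Jins z P n"
  shows "\<exists>F'. cflag x n F' W \<and> has_profile x n F' (row_insert z P) \<and> (\<forall>i\<le>n. J x (F' i) A = Jins z P i)"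
proof -
  have rem: "jcol x (F (Suc i)) (Suc c) < jcol x (F i) c"
    if "i < n" "c \<in> Jins z P i" "c = 0 \<or> c - 1 \<notin> Jins z P i" for i c
    using Jins_removable[OF P z that(2,3)] prof that(1) by (simp add: has_profile_def)
  have "\<exists>F'. cflag x n F' W \<and> (\<forall>i\<le>n. \<forall>c. jcol x (F' i) c = jcol x (F i) c) \<and> (\<forall>i\<le>n. Jins z P i \<subseteq> J x (F' i) A)"
    by (rule flag_general_position[where Jc = "Jins z P", OF inf x Jins_up Jins_mono[OF P] F A _ rem]) (simp_all add: top)
  then obtain F' where ex: "cflag x n F' W \<and> (\<forall>i\<le>n. \<forall>c. jcol x (F' i) c = jcol x (F i) c) \<and> (\<forall>i\<le>n. Jins z P i \<subseteq> J x (F' i) A)"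
    by (rule exE)
  then have F': "cflag x n F' W" "has_profile x n F' (row_insert z P)" using prof by (simp_all add: has_profile_def)
  have "J x (F' i) A = Jins z P i" if "i \<le> n" for i
    using ex that profile_J_bound[OF x F'(1) A P F'(2) _ that] top by blast
  then show ?thesis using F' by blast
qed

text \<open>
  The converse of \<open>profile_hyperplane\<close>, under a one-sided bound on \<open>J\<close>. By upward induction on \<open>i\<close>, the
  least column of \<open>J\<close> for \<open>F\<^sub>i\<close> is the predicted one: were it further right, the column before it
  would be a gap in the sense of \<open>Jins_gap\<close>, and the type of \<open>F\<^sub>i\<^sub>+\<^sub>1\<close> with its first column removed
  would not fit into that of \<open>F\<^sub>i \<inter> A\<close>.
\<close>

lemma profile_of_insertion:
  assumes x: "endo x" and F: "cflag x n F W" and A: "subspace A" "A \<subseteq> W" "dim W \<le> Suc (dim A)" "x ` W \<subseteq> A"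
    and P: "tableau P" and z: "1 \<le> z" and prof: "has_profile x n (\<lambda>i. F i \<inter> A) P"
    and bound: "\<And>i. i \<le> n \<Longrightarrow> J x (F i) A \<subseteq> Jins z P i"
    and out: "\<And>i. i \<le> n \<Longrightarrow> z \<le> i \<Longrightarrow> \<not> F i \<subseteq> A"
  shows "has_profile x n F (row_insert z P)"
proof -
  have W: "subspace W" "\<And>i. i \<le> n \<Longrightarrow> F i \<subseteq> W" using cflag_top[OF F x] by auto
  have hyp: "jcol x (F i) c = col_upto P i c + (if c \<in> J x (F i) A \<and> (c = 0 \<or> c - 1 \<notin> J x (F i) A) then 1 else 0)" if "i \<le> n" for i c
  proof -
    have "jcol x (F i \<inter> A) c = col_upto P i c" using prof that by (simp add: has_profile_def)
    then show ?thesis using jcol_hyperplane[OF x A(1) W(1) A(2,3) cflag_subspace[OF F that] W(2)[OF that], of c] by (simp only:)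
  qed
  have J: "Jins z P i \<subseteq> J x (F i) A" if "i \<le> n" for i
    using that
  proof (induction i)
    case 0
    then show ?case using z by (auto simp: Jins_def)
  next
    case (Suc i)
    have i: "i \<le> n" "i < n" using Suc.prems by auto
    show ?case
    proof (cases "z \<le> Suc i")
      case False
      then show ?thesis by (auto simp: Jins_def)
    next
      case True
      obtain v where v: "v \<in> F (Suc i)" "v \<notin> A" using out[OF Suc.prems True] by blast
      have "v \<in> K x (Suc i)" using cflag_K[OF F Suc.prems] v(1) by blast
      then have "i \<in> J x (F (Suc i)) A" using v by (auto simp: J_def)
      define c where "c = (LEAST c. c \<in> J x (F (Suc i)) A)"
      have c: "c \<in> J x (F (Suc i)) A" unfolding c_def by (rule LeastI) fact
      have le: "c \<le> c'" if "c' \<in> J x (F (Suc i)) A" for c' unfolding c_def using that by (rule Least_le)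
      have min: "c = 0 \<or> c - 1 \<notin> J x (F (Suc i)) A" using le[of "c - 1"] by (cases c) auto
      let ?g = "new_col z P (Suc i)"
      have gc: "?g \<le> c" using bound[OF Suc.prems] c by (auto simp: Jins_def)
      have "c = ?g"
      proof (rule ccontr)
        assume "c \<noteq> ?g"
        then have gc': "?g < c" "0 < c" using gc by auto
        then have c1: "c - 1 \<in> Jins z P (Suc i)" using True by (auto simp: Jins_def)
        have c2: "c - 1 \<notin> Jins z P i"
        proof
          assume "c - 1 \<in> Jins z P i"
          then have "c - 1 \<in> J x (F i) A" using Suc.IH[OF i(1)] by blast
          then have "c - 1 \<in> J x (F (Suc i)) A" using J_mono[OF cflag_step(1)[OF F i(2)]] by blast
          then show False using min gc' by simp
        qed
        have Sc: "Suc (c - 1) = c" using gc' by simp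
        have sub: "x ` F (Suc i) \<subseteq> F i \<inter> A"
        proof -
          have "x ` F (Suc i) \<subseteq> x ` W" using W(2)[OF Suc.prems] by (rule image_mono)
          then show ?thesis using cflag_step(2)[OF F i(2)] A(4) by blast
        qed
        have "col_upto P (Suc i) c + 1 = jcol x (F (Suc i)) c" using hyp[OF Suc.prems, of c] c min by simp
        also have "\<dots> \<le> jcol x (F i \<inter> A) (c - 1)" using jcol_Suc_le[OF sub, of "c - 1"] Sc by simp
        also have "\<dots> = col_upto P i (c - 1)" using prof i by (simp add: has_profile_def)
        also have "\<dots> \<le> col_upto (row_insert z P) i (c - 1)" using col_upto_Jins[OF P, of z i "c - 1"] by simp
        also have "\<dots> \<le> col_upto (row_insert z P) (Suc i) c" using Jins_gap[OF P c1 c2] Sc by simp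
        also have "\<dots> = col_upto P (Suc i) c" using col_upto_row_insert_ge[OF P True, of c] gc' by simp
        finally show False by simp
      qed
      then show ?thesis using c J_up[OF x c] by (auto simp: Jins_def)
    qed
  qed
  have "J x (F i) A = Jins z P i" if "i \<le> n" for i using J[OF that] bound[OF that] by blast
  then have "jcol x (F i) c = col_upto (row_insert z P) i c" if "i \<le> n" for i c
    using hyp[OF that, of c] col_upto_Jins[OF P, of z i c] that by simp
  then show ?thesis by (simp add: has_profile_def)
qed

section \<open>Rational curves of compatible flags\<close>

lemma exists_complement_list:
  assumes "subspace B" "subspace W" "B \<subseteq> W"
  shows "\<exists>es. length es = dim W - dim B \<and> span (B \<union> set es) = W"
proof -
  obtain C where C: "C \<subseteq> B" "independent C" "B \<subseteq> span C" "card C = dim B" using basis_exists by metis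
  have "C \<subseteq> W" using C assms by blast
  then obtain D where D: "C \<subseteq> D" "D \<subseteq> W" "independent D" "W \<subseteq> span D"
    using maximal_independent_subset_extend C(2) by metis
  have fD: "finite D" using D finiteI_independent by blast
  have cD: "card D = dim W" using D basis_card_eq_dim by blast
  obtain es where es: "set es = D - C" "distinct es" using fD finite_distinct_list[of "D - C"] by auto
  have "length es = card (D - C)" using es distinct_card[of es] by simp
  also have "\<dots> = dim W - dim B" using C D fD cD by (simp add: card_Diff_subset finite_subset)
  finally have l: "length es = dim W - dim B" .
  have "D \<subseteq> B \<union> set es" using es C by blast
  then have "span D \<subseteq> span (B \<union> set es)" by (rule span_mono)
  moreover have "B \<union> set es \<subseteq> W" using es D assms by blast
  then have "span (B \<union> set es) \<subseteq> W" using assms by (intro span_minimal)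
  ultimately have "span (B \<union> set es) = W" using D by blast
  then show ?thesis using l by blast
qed

text \<open>
  Used with a moving frame \<open>u\<close>: the members of a flag are the spans of initial segments.
\<close>

definition fspan :: "(nat \<Rightarrow> 'b) \<Rightarrow> nat \<Rightarrow> 'b set" where
  "fspan u m = span (u ` {..<m})"

lemma fspan_image: "endo h \<Longrightarrow> fspan (\<lambda>j. h (u j)) m = h ` fspan u m"
  unfolding fspan_def using self.linear_span_image[of h "u ` {..<m}"] by (simp add: image_image)

lemma fspan_cong: "(\<And>j. j < m \<Longrightarrow> u j = v j) \<Longrightarrow> fspan u m = fspan v m"
  unfolding fspan_def by (intro arg_cong[of _ _ span] image_cong) auto

lemma fspan_funpow: "endo x \<Longrightarrow> span ((\<lambda>j. (x ^^ g) (u j)) ` {..<m}) = (x ^^ g) ` fspan u m"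
  using fspan_image[OF endo_funpow, of x g u m] by (simp add: fspan_def)

lemma fspan_coeffs:
  assumes "v \<in> fspan u m"
  shows "\<exists>a. v = (\<Sum>j<m. a j \<cdot> u j)"
proof -
  let ?R = "range (\<lambda>a. \<Sum>j<m. a j \<cdot> u j)"
  have "u ` {..<m} \<subseteq> ?R"
  proof
    fix y assume "y \<in> u ` {..<m}"
    then obtain i where i: "i < m" "y = u i" by blast
    have "(\<Sum>j<m. (if j = i then 1 else 0) \<cdot> u j) = (\<Sum>j<m. if j = i then u j else 0)" by (rule sum.cong) auto
    also have "\<dots> = y" using i by simp
    finally show "y \<in> ?R" by (intro range_eqI[of _ _ "\<lambda>j. if j = i then 1 else 0"]) (rule sym)
  qed
  moreover have "subspace ?R"
  proof (rule subspaceI)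
    show "0 \<in> ?R" by (rule range_eqI[of _ _ "\<lambda>_. 0"]) simp
    show "y + y' \<in> ?R" if yR: "y \<in> ?R" "y' \<in> ?R" for y y'
    proof -
      obtain a b where "y = (\<Sum>j<m. a j \<cdot> u j)" "y' = (\<Sum>j<m. b j \<cdot> u j)" using yR by (elim imageE)
      then have "y + y' = (\<Sum>j<m. (a j + b j) \<cdot> u j)" by (simp add: sum.distrib scale_left_distrib)
      then show ?thesis by (intro range_eqI[of _ _ "\<lambda>j. a j + b j"])
    qed
    show "c \<cdot> y \<in> ?R" if yR: "y \<in> ?R" for c y
    proof -
      obtain a where "y = (\<Sum>j<m. a j \<cdot> u j)" using yR by (elim imageE)
      then have "c \<cdot> y = (\<Sum>j<m. (c * a j) \<cdot> u j)" by (simp add: scale_sum_right)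
      then show ?thesis by (intro range_eqI[of _ _ "\<lambda>j. c * a j"])
    qed
  qed
  ultimately have "fspan u m \<subseteq> ?R" unfolding fspan_def by (rule span_minimal)
  then show ?thesis using assms by blast
qed

definition same_profile :: "('b \<Rightarrow> 'b) \<Rightarrow> nat \<Rightarrow> (nat \<Rightarrow> 'b set) \<Rightarrow> (nat \<Rightarrow> 'b set) \<Rightarrow> bool" where
  "same_profile x n F F' \<longleftrightarrow> (\<forall>i\<le>n. \<forall>c. jcol x (F i) c = jcol x (F' i) c)"

text \<open>
  Induction on \<open>n\<close>. The pairs \<open>(W, F\<^sub>n)\<close> of the two flags are isomorphic by an automorphism \<open>h\<close> of \<open>W\<close>
  commuting with \<open>x\<close>. The flag \<open>F0\<close> below \<open>F\<^sub>n\<close> and the preimage under \<open>h\<close> of \<open>F1\<close> are joined by a curve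
  \<open>u\<close>; applying \<open>(1 - s) + s h\<close> to it, and to fixed vectors that complete the frame to \<open>W\<close>, yields a
  curve from \<open>F0\<close> to \<open>F1\<close>. The frame is a frame of flags for all but finitely many \<open>s\<close>.
\<close>

lemma connect:
  assumes x: "endo x"
  shows "cflag x n F0 W \<Longrightarrow> cflag x n F1 W \<Longrightarrow> same_profile x n F0 F1 \<Longrightarrow>
    \<exists>u. (\<forall>j. pvec (range poly) (\<lambda>s. u s j))
      \<and> (\<forall>\<^sub>F s in cofinite. cflag x n (\<lambda>i. fspan (u s) (dim (F0 i))) W
           \<and> same_profile x n (\<lambda>i. fspan (u s) (dim (F0 i))) F0)
      \<and> (\<forall>i\<le>n. fspan (u 0) (dim (F0 i)) = F0 i) \<and> (\<forall>i\<le>n. fspan (u 1) (dim (F0 i)) = F1 i)"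
proof (induction n arbitrary: W F0 F1)
  case 0
  have "W = {0}" "F0 0 = {0}" "F1 0 = {0}" using 0 by (auto simp: cflag_def)
  then show ?case
    by (intro exI[of _ "\<lambda>_ _. 0"]) (auto simp: pvec_const palg_poly fspan_def cflag_def same_profile_def)
next
  case (Suc n)
  note F0 = Suc.prems(1) and F1 = Suc.prems(2)
  have pr: "\<And>i c. i \<le> Suc n \<Longrightarrow> jcol x (F0 i) c = jcol x (F1 i) c" using Suc.prems(3) by (simp add: same_profile_def)
  have W: "subspace W" "x ` W \<subseteq> W" "W \<subseteq> K x (Suc n)" using cflag_top[OF F0 x] by auto
  have FW: "F0 i \<subseteq> W" "F1 i \<subseteq> W" if "i \<le> Suc n" for i using cflag_top(4)[OF F0 x that] cflag_top(4)[OF F1 x that] by auto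
  have FS: "F0 (Suc n) = W" "F1 (Suc n) = W" using F0 F1 by (auto simp: cflag_def)
  let ?B = "F0 n"
  have B: "subspace ?B" "x ` W \<subseteq> ?B" "?B \<subseteq> W" "subspace (F1 n)" "x ` W \<subseteq> F1 n" "F1 n \<subseteq> W"
    using cflag_subspace[OF F0, of n] cflag_step(1,2)[OF F0, of n] cflag_subspace[OF F1, of n] cflag_step(1,2)[OF F1, of n] FS
    by simp_all
  have prn: "jcol x ?B c = jcol x (F1 n) c" for c using pr by simp
  obtain h where h: "endo h" "inj_on h W" "h ` W = W" "h ` ?B = F1 n" "\<And>w. w \<in> W \<Longrightarrow> h (x w) = x (h w)"
    using exists_iso[OF x x W(1) B(1-3) W(3) W(1) B(4-6) W(3) refl prn] by blast
  \<comment> \<open>the second flag, moved back so that its member of index \<open>n\<close> is that of the first\<close>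
  define G where "G i = {w \<in> W. h w \<in> F1 i}" for i
  have hG: "h ` G i = F1 i" if i: "i \<le> Suc n" for i
  proof
    show "F1 i \<subseteq> h ` G i"
    proof
      fix v assume v: "v \<in> F1 i"
      then have "v \<in> h ` W" using FW(2)[OF i] h(3) by auto
      then obtain w where "w \<in> W" "v = h w" by blast
      then show "v \<in> h ` G i" using v by (auto simp: G_def)
    qed
  qed (auto simp: G_def)
  have GW: "G i \<subseteq> W" for i by (auto simp: G_def)
  have Gn: "G n = ?B"
  proof
    show "G n \<subseteq> ?B"
    proof
      fix w assume "w \<in> G n"
      then have w: "w \<in> W" "h w \<in> h ` ?B" using h(4) by (auto simp: G_def)
      then obtain b where "b \<in> ?B" "h w = h b" by blast
      then show "w \<in> ?B" using inj_onD[OF h(2), of w b] w B(3) by auto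
    qed
    show "?B \<subseteq> G n" using h(4) B(3) by (auto simp: G_def)
  qed
  have G: "cflag x n G ?B"
    unfolding cflag_def
  proof (intro conjI allI impI)
    show "G 0 = {0}"
    proof
      show "G 0 \<subseteq> {0}"
      proof
        fix w assume "w \<in> G 0"
        then have w: "w \<in> W" "h w = h 0" using F1 endo_0[OF h(1)] by (auto simp: G_def cflag_def)
        then show "w \<in> {0}" using inj_onD[OF h(2), of w 0] subspace_0[OF W(1)] by simp
      qed
      show "{0} \<subseteq> G 0" using F1 endo_0[OF h(1)] subspace_0[OF W(1)] by (auto simp: G_def cflag_def)
    qed
    show "subspace (G i)" if "i \<le> n" for i
    proof -
      have "subspace {w. h w \<in> F1 i}"
        by (rule self.linear_subspace_linear_preimage[OF h(1)]) (use F1 that in \<open>simp add: cflag_def\<close>)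
      then have "subspace (W \<inter> {w. h w \<in> F1 i})" using W(1) by (intro subspace_inter)
      moreover have "W \<inter> {w. h w \<in> F1 i} = G i" by (auto simp: G_def)
      ultimately show ?thesis by simp
    qed
    fix i assume i: "i < n"
    show "G i \<subseteq> G (Suc i)" using cflag_step(1)[OF F1, of i] i by (auto simp: G_def)
    have "x ` F1 (Suc i) \<subseteq> F1 i" using cflag_step(2)[OF F1, of i] i by simp
    then show "x ` G (Suc i) \<subseteq> G i" using W(2) h(5) by (auto simp: G_def)
  qed (rule Gn)
  have F0n: "cflag x n F0 ?B" using F0 by (auto simp: cflag_def)
  have clG: "jcol x (G i) c = jcol x (F1 i) c" if "i \<le> n" for i c
    using jcol_image[OF h(1,2,5) W(2,1) GW x, of i c] hG[of i] that by simp
  have sp: "same_profile x n F0 G" using pr clG by (simp add: same_profile_def)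
  obtain u where u: "\<And>j. pvec (range poly) (\<lambda>s. u s j)"
    "\<forall>\<^sub>F s in cofinite. cflag x n (\<lambda>i. fspan (u s) (dim (F0 i))) ?B \<and> same_profile x n (\<lambda>i. fspan (u s) (dim (F0 i))) F0"
    "\<And>i. i \<le> n \<Longrightarrow> fspan (u 0) (dim (F0 i)) = F0 i" "\<And>i. i \<le> n \<Longrightarrow> fspan (u 1) (dim (F0 i)) = G i"
    using Suc.IH[OF F0n G sp] by blast
  obtain es where es: "length es = dim W - dim ?B" "span (?B \<union> set es) = W"
    using exists_complement_list[OF B(1) W(1) B(3)] by blast
  have dB: "dim ?B \<le> dim W" using B(3) by (rule dim_subset)
  \<comment> \<open>the frame of \<open>B\<close> is completed by constant vectors\<close>
  define v where "v s j = (if j < dim ?B then u s j else if j < dim W then es ! (j - dim ?B) else 0)" for s j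
  \<comment> \<open>\<open>hs s = (1 - s) + s h\<close>\<close>
  define y where "y w = h w - w" for w
  define hs where "hs s w = w + s \<cdot> y w" for s w
  have ey: "endo y" unfolding y_def Vector_Spaces.linear_iff
    by (simp add: vector_space_axioms endo_add[OF h(1)] endo_scale[OF h(1)] scale_right_diff_distrib)
  have ehs: "endo (hs s)" for s unfolding hs_def using ey by (rule endo_move)
  have yW: "y ` W \<subseteq> W" using h(3) W(1) unfolding y_def by (auto intro!: subspace_diff)
  have com: "hs s (x w) = x (hs s w)" if "w \<in> W" for s w
    using h(5)[OF that] by (simp add: hs_def y_def endo_add[OF x] endo_diff[OF x] endo_scale[OF x])
  have hs01: "hs 0 = (\<lambda>w. w)" "hs 1 = h" by (auto simp: hs_def y_def fun_eq_iff)
  have vlow: "fspan (v s) (dim (F0 i)) = fspan (u s) (dim (F0 i))" if "i \<le> n" for s i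
  proof (rule fspan_cong)
    fix j assume "j < dim (F0 i)"
    moreover have "dim (F0 i) \<le> dim ?B" using cflag_mono[OF F0n that order_refl] by (rule dim_subset)
    ultimately show "v s j = u s j" by (simp add: v_def)
  qed
  have vtop: "fspan (v s) (dim W) = W" if "fspan (u s) (dim ?B) = ?B" for s
  proof -
    have "v s ` {..<dim W} = u s ` {..<dim ?B} \<union> set es"
    proof -
      have "{..<dim W} = {..<dim ?B} \<union> {dim ?B..<dim W}" using dB by auto
      moreover have "v s ` {..<dim ?B} = u s ` {..<dim ?B}" by (rule image_cong) (auto simp: v_def)
      moreover have "v s ` {dim ?B..<dim W} = set es"
      proof -
        have "v s ` {dim ?B..<dim W} = (\<lambda>j. es ! (j - dim ?B)) ` {dim ?B..<dim W}"
          by (rule image_cong) (auto simp: v_def)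
        also have "\<dots> = (\<lambda>j. es ! j) ` {0..<length es}"
        proof -
          have "{dim ?B..<dim W} = (\<lambda>j. j + dim ?B) ` {0..<length es}" using es(1) dB by (simp add: image_add_atLeastLessThan')
          then show ?thesis by (simp only: image_image) simp
        qed
        also have "\<dots> = set es" by (simp add: set_conv_nth image_def atLeast0LessThan Bex_def) blast
        finally show ?thesis .
      qed
      ultimately show ?thesis by (simp add: image_Un)
    qed
    then have "fspan (v s) (dim W) = span (u s ` {..<dim ?B} \<union> set es)" by (simp add: fspan_def)
    also have "\<dots> = span (span (u s ` {..<dim ?B}) \<union> set es)"
      by (simp only: span_Un span_span)
    also have "\<dots> = W" using that es(2) by (simp add: fspan_def)
    finally show ?thesis .
  qed
  have pv: "pvec (range poly) (\<lambda>s. hs s (v s j))" for j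
  proof -
    have "pvec (range poly) (\<lambda>s. v s j)"
      unfolding v_def by (cases "j < dim ?B") (simp_all add: u(1) pvec_const palg_poly)
    then show ?thesis unfolding hs_def
      by (intro pvec_add pvec_scale palg_poly poly_id pvec_endo[OF ey])
  qed
  have val: "fspan (\<lambda>j. hs s (v s j)) (dim (F0 i)) = hs s ` (if i \<le> n then fspan (u s) (dim (F0 i)) else W)"
    if "i \<le> Suc n" "fspan (u s) (dim ?B) = ?B" for s i
    using that vlow[of i s] vtop[of s] FS by (auto simp: fspan_image[OF ehs] le_Suc_eq)
  have good: "cflag x (Suc n) (\<lambda>i. fspan (\<lambda>j. hs s (v s j)) (dim (F0 i))) W
           \<and> same_profile x (Suc n) (\<lambda>i. fspan (\<lambda>j. hs s (v s j)) (dim (F0 i))) F0"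
    if s: "cflag x n (\<lambda>i. fspan (u s) (dim (F0 i))) ?B \<and> same_profile x n (\<lambda>i. fspan (u s) (dim (F0 i))) F0"
      "inj_on (hs s) W \<and> hs s ` W = W" for s
  proof -
    let ?U = "\<lambda>i. if i \<le> n then fspan (u s) (dim (F0 i)) else W"
    have UB: "fspan (u s) (dim ?B) = ?B" using s(1) by (simp add: cflag_def)
    have U: "cflag x (Suc n) ?U W"
      unfolding cflag_def
    proof (intro conjI allI impI)
      have c: "cflag x n (\<lambda>i. fspan (u s) (dim (F0 i))) ?B" using s(1) by simp
      show "?U 0 = {0}" "?U (Suc n) = W" using c by (simp_all add: cflag_def)
      show "subspace (?U i)" if "i \<le> Suc n" for i using W(1) by (simp add: fspan_def)
      fix i assume i: "i < Suc n"
      have "?U i \<subseteq> ?U (Suc i) \<and> x ` ?U (Suc i) \<subseteq> ?U i"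
      proof (cases "i = n")
        case True
        then show ?thesis using UB B by simp
      next
        case False
        then show ?thesis using cflag_step(1,2)[OF c, of i] i by simp
      qed
      then show "?U i \<subseteq> ?U (Suc i)" "x ` ?U (Suc i) \<subseteq> ?U i" by blast+
    qed
    have hU: "cflag x (Suc n) (\<lambda>i. hs s ` ?U i) (hs s ` W)"
      by (rule cflag_image[OF U ehs order_refl com x])
    have eq: "fspan (\<lambda>j. hs s (v s j)) (dim (F0 i)) = hs s ` ?U i" if "i \<le> Suc n" for i
      using val[OF that UB] .
    have "cflag x (Suc n) (\<lambda>i. fspan (\<lambda>j. hs s (v s j)) (dim (F0 i))) W"
      using hU s(2) unfolding cflag_def by (simp add: eq del: if_split)
    moreover have "jcol x (hs s ` ?U i) c = jcol x (F0 i) c" if i: "i \<le> Suc n" for i c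
    proof -
      have "jcol x (hs s ` ?U i) c = jcol x (?U i) c"
        using jcol_image[OF ehs conjunct1[OF s(2)] com W(2,1) cflag_top(4)[OF U x i] x] .
      also have "\<dots> = jcol x (F0 i) c" using s(1) i FS by (auto simp: same_profile_def le_Suc_eq)
      finally show ?thesis .
    qed
    ultimately show ?thesis by (auto simp: same_profile_def eq simp del: if_split)
  qed
  have bij: "\<forall>\<^sub>F s in cofinite. inj_on (hs s) W \<and> hs s ` W = W"
    unfolding hs_def by (rule move_bij_cofinite[OF ey yW W(1)])
  show ?case
  proof (intro exI[of _ "\<lambda>s j. hs s (v s j)"] conjI allI impI)
    show "pvec (range poly) (\<lambda>s. hs s (v s j))" for j by (rule pv)
    show "\<forall>\<^sub>F s in cofinite. cflag x (Suc n) (\<lambda>i. fspan (\<lambda>j. hs s (v s j)) (dim (F0 i))) W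
           \<and> same_profile x (Suc n) (\<lambda>i. fspan (\<lambda>j. hs s (v s j)) (dim (F0 i))) F0"
      using eventually_conj[OF u(2) bij] by (rule eventually_mono) (use good in blast)
    fix i assume i: "i \<le> Suc n"
    show "fspan (\<lambda>j. hs 0 (v 0 j)) (dim (F0 i)) = F0 i"
      using val[OF i, of 0] u(3)[of n] u(3)[of i] i FS by (auto simp: hs01 le_Suc_eq)
    have "fspan (u 1) (dim ?B) = ?B" using u(4)[of n] Gn by simp
    then show "fspan (\<lambda>j. hs 1 (v 1 j)) (dim (F0 i)) = F1 i"
      using val[OF i, of 1] u(4)[of i] i FS hG[of i] h(3) by (auto simp: hs01 le_Suc_eq)
  qed
qed

lemma ind_fspan:
  assumes "dim (fspan u m) = m"
  shows "ind (map u [0..<m])"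
proof -
  have s: "set (map u [0..<m]) = u ` {..<m}" by auto
  have "dim (u ` {..<m}) = m" using assms by (simp add: fspan_def)
  moreover have "dim (u ` {..<m}) \<le> card (u ` {..<m})" by (rule dim_le_card') simp
  moreover have le: "card (u ` {..<m}) \<le> m" using card_image_le[of "{..<m}" u] by simp
  ultimately have c: "card (u ` {..<m}) = m" by simp
  then have "distinct (map u [0..<m])" by (intro card_distinct) (simp add: s del: set_map)
  moreover have "independent (u ` {..<m})"
    by (rule card_le_dim_spanning[of _ "span (u ` {..<m})"])
      (use c \<open>dim (u ` {..<m}) = m\<close> in \<open>auto intro: span_base\<close>)
  ultimately show ?thesis by (simp add: ind_def atLeast0LessThan)
qed

text \<open>
  Semicontinuity along a curve of frames.
\<close>

lemma cofinite_dim_le: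
  assumes u: "\<And>j. pvec (range poly) (\<lambda>s. u s j)" and S: "subspace S" and m: "dim (fspan (u s0) m) = m"
  shows "\<forall>\<^sub>F s in cofinite. dim (S \<inter> fspan (u s) m) \<le> dim (S \<inter> fspan (u s0) m)"
proof -
  let ?fs = "map (\<lambda>j s. u s j) [0..<m]"
  have e: "map (\<lambda>f. f s) ?fs = map (u s) [0..<m]" for s by simp
  have s: "span (set (map (\<lambda>f. f s) ?fs)) = fspan (u s) m" for s
    unfolding e fspan_def by (rule arg_cong[of _ _ span]) auto
  have "ind (map (\<lambda>f. f s0) ?fs)" unfolding e by (rule ind_fspan[OF m])
  then obtain q where q: "q \<in> range poly" "q s0 \<noteq> 0" and
    "\<forall>s. q s \<noteq> 0 \<longrightarrow> dim (S \<inter> span (set (map (\<lambda>f. f s) ?fs))) \<le> dim (S \<inter> span (set (map (\<lambda>f. f s0) ?fs)))"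
    using dim_Int_span_open[OF palg_poly, of ?fs S s0] u S by auto
  then have "dim (S \<inter> fspan (u s) m) \<le> dim (S \<inter> fspan (u s0) m)" if "q s \<noteq> 0" for s
    unfolding s using that by blast
  with cofinite_poly[OF q] show ?thesis by (rule eventually_mono)
qed

section \<open>The lower bound for relative positions\<close>

text \<open>
  Induction on the word, with \<open>A\<close> the hyperplane \<open>F'\<close> of index \<open>length w\<close>. Join \<open>F\<close> by a curve to a flag
  \<open>F1\<close> in the best position with respect to \<open>A\<close>. A general point \<open>G\<close> of the curve is also in the best
  position, so the induction hypothesis applies to \<open>G \<inter> A\<close>; and \<open>G\<^sub>i \<inter> F'\<^sub>k\<close> is no larger than
  \<open>F\<^sub>i \<inter> F'\<^sub>k\<close>.
\<close>

lemma lower_bound: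
  assumes inf: "infinite (UNIV :: 'a set)" and x: "endo x"
  shows "letters n w \<Longrightarrow> cflag x n F W \<Longrightarrow> has_profile x n F (ins w) \<Longrightarrow> word_flag x w F' W \<Longrightarrow>
     i \<le> n \<Longrightarrow> k \<le> length w \<Longrightarrow> cnt w k i \<le> dim (F i \<inter> F' k)"
proof (induction w arbitrary: F F' W i k rule: rev_induct)
  case Nil
  then show ?case by (simp add: cnt_def)
next
  case (snoc z w)
  note F = snoc.prems(2)
  have lw: "letters n w" and z: "1 \<le> z" "z \<le> n" using snoc.prems(1) by (auto simp: letters_snoc)
  let ?P = "ins w" and ?d = "length w"
  let ?A = "F' ?d"
  have P: "tableau ?P" by (rule tableau_ins)
  have prof: "has_profile x n F (row_insert z ?P)" using snoc.prems(3) by simp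
  have F': "cflag x (Suc ?d) F' W" and F'cl: "\<And>k c. k \<le> Suc ?d \<Longrightarrow> jcol x (F' k) c = shape_col (ins (take k (w @ [z]))) c"
    using snoc.prems(4) by (simp_all add: word_flag_def)
  have F'W: "F' (Suc ?d) = W" using F' by (simp add: cflag_def)
  show ?case
  proof (cases "k = Suc ?d")
    case True
    have "F i \<inter> W = F i" using cflag_top(4)[OF F x snoc.prems(5)] by (rule Int_absorb2)
    then show ?thesis
      using dim_profile[OF x snoc.prems(1) F snoc.prems(3,5)] True F'W by (simp add: cnt_def)
  next
    case False
    then have k: "k \<le> ?d" using snoc.prems(6) by simp
    have A: "subspace ?A" "?A \<subseteq> W" "x ` W \<subseteq> ?A"
      using cflag_subspace[OF F', of ?d] cflag_step(1,2)[OF F', of ?d] F'W by simp_all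
    have W: "subspace W" "W \<subseteq> K x n" using cflag_top[OF F x] by auto
    have FA: "cflag x ?d F' ?A" using F' by (simp add: cflag_def)
    have clA: "jcol x ?A c = col_upto ?P n c" for c using F'cl[of ?d c] col_upto_shape[OF lw order_refl] by simp
    have clW: "jcol x W c = col_upto (row_insert z ?P) n c" for c
    proof -
      have "F n = W" using F by (simp add: cflag_def)
      then show ?thesis using prof unfolding has_profile_def by blast
    qed
    have clWA: "jcol x W c = jcol x ?A c + (if c = new_col z ?P n then 1 else 0)" for c
      unfolding clA clW using col_upto_row_insert_ge[OF P z(2)] by simp
    have dimn: "dim U = (\<Sum>c<n. jcol x U c)" if "subspace U" "U \<subseteq> W" for U
    proof -
      have "U \<inter> K x n = U" using order.trans[OF that(2) W(2)] by (rule Int_absorb2)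
      then show ?thesis using dim_Int_K[OF x that(1), of n] by simp
    qed
    have hyp: "dim W \<le> Suc (dim ?A)"
    proof -
      have "dim W = dim ?A + (\<Sum>c<n. if c = new_col z ?P n then 1 else 0)"
        using dimn[OF W(1) order_refl] dimn[OF A(1,2)] by (simp add: clWA sum.distrib)
      moreover have "(\<Sum>c<n. if c = new_col z ?P n then 1 else 0 :: nat) \<le> 1" by (simp add: sum.delta)
      ultimately show ?thesis by linarith
    qed
    have top: "J x W ?A = Jins z ?P n"
      using J_from_jcol[OF x A(1) W(1) A(2) hyp clWA] z by (simp add: Jins_def)
    \<comment> \<open>a flag in the best position, and a curve from \<open>F\<close> to it\<close>
    obtain F1 where F1: "cflag x n F1 W" "has_profile x n F1 (row_insert z ?P)" "\<And>i. i \<le> n \<Longrightarrow> J x (F1 i) ?A = Jins z ?P i"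
      using exists_reverse_insertion_flag[OF inf x F A(1,2) hyp A(3) P _ prof top] z(1) by auto
    have sp: "same_profile x n F F1" using prof F1(2) by (simp add: same_profile_def has_profile_def)
    obtain u where u: "\<And>j. pvec (range poly) (\<lambda>s. u s j)"
      "\<forall>\<^sub>F s in cofinite. cflag x n (\<lambda>i. fspan (u s) (dim (F i))) W \<and> same_profile x n (\<lambda>i. fspan (u s) (dim (F i))) F"
      "\<And>i. i \<le> n \<Longrightarrow> fspan (u 0) (dim (F i)) = F i" "\<And>i. i \<le> n \<Longrightarrow> fspan (u 1) (dim (F i)) = F1 i"
      using connect[OF x F F1(1) sp] by blast
    let ?G = "\<lambda>s i. fspan (u s) (dim (F i))"
    have d1: "dim (F1 i) = dim (F i)" if "i \<le> n" for i
      using dim_profile[OF x snoc.prems(1) F snoc.prems(3) that] dim_profile[OF x snoc.prems(1) F1(1) _ that] F1(2) by simp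
    have o1: "\<forall>\<^sub>F s in cofinite. dim (F' k \<inter> ?G s i) \<le> dim (F' k \<inter> ?G 0 i)"
      by (rule cofinite_dim_le[OF u(1)]) (use cflag_subspace[OF F', of k] k u(3) snoc.prems(5) in simp_all)
    \<comment> \<open>best position means that these intersections with \<open>A\<close> are as small as possible\<close>
    let ?S = "\<lambda>j. ?A \<inter> K x (Suc (new_col z ?P j))"
    have o2: "\<forall>\<^sub>F s in cofinite. \<forall>j\<in>{..n}. dim (?S j \<inter> ?G s j) \<le> dim (?S j \<inter> ?G 1 j)"
    proof (rule eventually_ball_finite, simp, rule ballI)
      fix j assume "j \<in> {..n}"
      then show "\<forall>\<^sub>F s in cofinite. dim (?S j \<inter> ?G s j) \<le> dim (?S j \<inter> ?G 1 j)"
        by (intro cofinite_dim_le[OF u(1)] subspace_inter A(1) subspace_K[OF x]) (simp add: u(4) d1)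
    qed
    have "\<exists>s. (cflag x n (?G s) W \<and> same_profile x n (?G s) F) \<and>
        dim (F' k \<inter> ?G s i) \<le> dim (F' k \<inter> ?G 0 i) \<and> (\<forall>j\<in>{..n}. dim (?S j \<inter> ?G s j) \<le> dim (?S j \<inter> ?G 1 j))"
      by (rule cofinite_ex[OF inf]) (intro eventually_conj u(2) o1 o2)
    then obtain s where s: "cflag x n (?G s) W" "same_profile x n (?G s) F"
      "dim (F' k \<inter> ?G s i) \<le> dim (F' k \<inter> F i)" "\<And>j. j \<le> n \<Longrightarrow> dim (?S j \<inter> ?G s j) \<le> dim (?S j \<inter> F1 j)"
      using u(3)[OF snoc.prems(5)] u(4) by auto
    have sprof: "has_profile x n (?G s) (row_insert z ?P)" using s(2) prof by (simp add: same_profile_def has_profile_def)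
    have J: "J x (?G s j) ?A = Jins z ?P j" if j: "j \<le> n" for j
    proof
      show "J x (?G s j) ?A \<subseteq> Jins z ?P j"
        using profile_J_bound[OF x s(1) A(1,2) hyp A(3) P sprof _ j] top by simp
      show "Jins z ?P j \<subseteq> J x (?G s j) ?A"
      proof
        fix c assume c: "c \<in> Jins z ?P j"
        let ?g = "new_col z ?P j"
        have g: "?g \<in> J x (F1 j) ?A" "?g \<le> c" using c F1(3)[OF j] by (auto simp: Jins_def)
        have eqA: "?S j \<inter> U = U \<inter> ?A \<inter> K x (Suc ?g)" for U by blast
        have FW: "F1 j \<subseteq> W" "?G s j \<subseteq> W" using cflag_top(4)[OF F1(1) x j] cflag_top(4)[OF s(1) x j] .
        have "dim (?G s j \<inter> K x (Suc ?g)) = (\<Sum>c<Suc ?g. jcol x (?G s j) c)"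
          by (rule dim_Int_K[OF x cflag_subspace[OF s(1) j]])
        also have "\<dots> = (\<Sum>c<Suc ?g. jcol x (F1 j) c)"
          using sprof F1(2) j by (simp add: has_profile_def)
        also have "\<dots> = dim (F1 j \<inter> K x (Suc ?g))"
          by (rule dim_Int_K[OF x cflag_subspace[OF F1(1) j], symmetric])
        finally have "dim (?G s j \<inter> K x (Suc ?g)) = dim (F1 j \<inter> ?A \<inter> K x (Suc ?g)) + 1"
          using dim_Int_K_hyperplane[OF x A(1) W(1) A(2) hyp cflag_subspace[OF F1(1) j] FW(1), of ?g] g(1) by simp
        moreover have "dim (?G s j \<inter> ?A \<inter> K x (Suc ?g)) \<le> dim (F1 j \<inter> ?A \<inter> K x (Suc ?g))"
          using s(4)[OF j] unfolding eqA .
        ultimately have "?g \<in> J x (?G s j) ?A"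
          using dim_Int_K_hyperplane[OF x A(1) W(1) A(2) hyp cflag_subspace[OF s(1) j] FW(2), of ?g]
          by (auto split: if_splits)
        then show "c \<in> J x (?G s j) ?A" using J_up[OF x] g(2) by blast
      qed
    qed
    \<comment> \<open>the induction hypothesis on the hyperplane\<close>
    have "cnt w k i \<le> dim (?G s i \<inter> ?A \<inter> F' k)"
    proof (rule snoc.IH[OF lw _ _ _ snoc.prems(5) k])
      show "cflag x n (\<lambda>i. ?G s i \<inter> ?A) ?A" by (rule cflag_Int[OF s(1) A x])
      show "has_profile x n (\<lambda>i. ?G s i \<inter> ?A) (ins w)"
        by (rule profile_hyperplane[OF x s(1) A(1,2) hyp P sprof J])
      show "word_flag x w F' ?A" unfolding word_flag_def using FA F'cl by simp
    qed
    also have "?G s i \<inter> ?A \<inter> F' k = F' k \<inter> ?G s i"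
    proof -
      have "F' k \<subseteq> ?A" using cflag_mono[OF F' k] by simp
      then show ?thesis by blast
    qed
    also have "dim (F' k \<inter> ?G s i) \<le> dim (F i \<inter> F' k)" using s(3) by (simp add: Int_commute)
    finally show ?thesis using cnt_snoc[OF k] by simp
  qed
qed

section \<open>Pairs of flags in minimal position\<close>

text \<open>
  Operators that differ from \<open>x\<close> by one new value outside a hyperplane.
\<close>

lemma endo_border:
  assumes "endo x" "functional \<phi>"
  shows "endo (\<lambda>w. x w + \<phi> w \<cdot> v)"
  unfolding Vector_Spaces.linear_iff
  by (simp add: vector_space_axioms endo_add[OF assms(1)] endo_scale[OF assms(1)] functional_add[OF assms(2)]
      functional_scale[OF assms(2)] scale_left_distrib scale_right_distrib)

text \<open>
  A flag on the hyperplane \<open>A\<close> is extended by a vector \<open>e\<close> that enters at step \<open>z\<close>. It is compatible with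
  an operator \<open>x'\<close> extending \<open>x\<close> from \<open>A\<close> as soon as \<open>x' e\<close> lies in the member before.
\<close>

lemma bordered_flag:
  assumes x: "endo x" and G: "cflag x n G A" and z: "1 \<le> z" "z \<le> n" and v: "v \<in> G (z - 1)"
    and x': "endo x'" "\<And>a. a \<in> A \<Longrightarrow> x' a = x a" "x' e = v"
  shows "cflag x' n (\<lambda>i. if z \<le> i then span (insert e (G i)) else G i) (span (insert e A))"
  unfolding cflag_def
proof (intro conjI allI impI)
  let ?F = "\<lambda>i. if z \<le> i then span (insert e (G i)) else G i"
  show "?F 0 = {0}" using G z by (simp add: cflag_def)
  show "?F n = span (insert e A)" using G z by (simp add: cflag_def)
  show "subspace (?F i)" if "i \<le> n" for i using cflag_subspace[OF G that] by simp
  fix i assume i: "i < n"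
  have GA: "G (Suc i) \<subseteq> A" "G i \<subseteq> A" using cflag_top(4)[OF G x, of "Suc i"] cflag_top(4)[OF G x, of i] i by auto
  have sG: "subspace (G i)" using cflag_subspace[OF G, of i] i by simp
  have sG': "subspace (G (Suc i))" using cflag_subspace[OF G, of "Suc i"] i by simp
  have step: "G i \<subseteq> G (Suc i)" "\<And>g. g \<in> G (Suc i) \<Longrightarrow> x g \<in> G i" using cflag_step(1,3)[OF G i] by auto
  have xG: "x' g \<in> G i" if "g \<in> G (Suc i)" for g
  proof -
    have "g \<in> A" using GA(1) that by blast
    then show ?thesis using step(2)[OF that] x'(2) by simp
  qed
  show "?F i \<subseteq> ?F (Suc i)"
  proof (cases "z \<le> i")
    case True
    then have "z \<le> Suc i" by simp
    have "span (insert e (G i)) \<subseteq> span (insert e (G (Suc i)))" using step(1) by (intro span_mono) blast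
    then show ?thesis using True \<open>z \<le> Suc i\<close> by simp
  next
    case False
    have "G i \<subseteq> span (insert e (G (Suc i)))" using step(1) by (intro order.trans[OF _ span_superset]) blast
    then show ?thesis using False step(1) by simp
  qed
  show "x' ` ?F (Suc i) \<subseteq> ?F i"
  proof
    fix y assume "y \<in> x' ` ?F (Suc i)"
    then obtain w where w: "w \<in> ?F (Suc i)" "y = x' w" by blast
    have Gi: "G i \<subseteq> ?F i" by (cases "z \<le> i") (simp_all add: span_superset[THEN order.trans[OF subset_insertI]])
    show "y \<in> ?F i"
    proof (cases "z \<le> Suc i")
      case True
      then have "w \<in> span (insert e (G (Suc i)))" using w(1) by simp
      then obtain k b where b: "b \<in> G (Suc i)" "w = k \<cdot> e + b" using span_insert_elim[OF _ sG'] by blast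
      have "y = k \<cdot> v + x' b" using w(2) b(2) x'(3) endo_add[OF x'(1)] endo_scale[OF x'(1)] by simp
      moreover have "v \<in> G i"
      proof -
        have "z - 1 \<le> i" "i \<le> n" using True i by auto
        then show ?thesis using cflag_mono[OF G] v by blast
      qed
      ultimately have "y \<in> G i" using subspace_add[OF sG subspace_scale[OF sG]] xG[OF b(1)] by simp
      then show ?thesis using Gi by blast
    next
      case False
      then have "w \<in> G (Suc i)" using w(1) by simp
      then show ?thesis using xG Gi w(2) by blast
    qed
  qed
qed

text \<open>
  A vector \<open>k e + b\<close> with \<open>k \<noteq> 0\<close>, \<open>b \<in> G\<close>, that is killed by \<open>x'\<^sup>g\<close> would exhibit \<open>x\<^sup>g\<^sup>-\<^sup>1 (x' e)\<close> as
  an element of \<open>x\<^sup>g G\<close>. Stated through \<open>x' e\<close>, the condition makes sense for all points of a curve.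
\<close>

lemma bordered_J:
  assumes x: "endo x" "x ` A \<subseteq> A" and A: "subspace A" "e \<notin> A" and G: "subspace G" "G \<subseteq> A"
    and x': "endo x'" "\<And>a. a \<in> A \<Longrightarrow> x' a = x a" "x' e \<in> A"
    and n: "0 < g" "(x ^^ (g - 1)) (x' e) \<notin> (x ^^ g) ` G"
    and c: "c \<in> J x' (span (insert e G)) A"
  shows "g \<le> c"
proof (rule ccontr)
  assume "\<not> g \<le> c"
  then have "c \<le> g - 1" by simp
  then have "g - 1 \<in> J x' (span (insert e G)) A" by (rule J_up[OF x'(1) c])
  then obtain w where w: "w \<in> span (insert e G)" "w \<in> K x' (Suc (g - 1))" "w \<notin> A" unfolding J_def by blast
  obtain k b where b: "b \<in> G" "w = k \<cdot> e + b" using span_insert_elim[OF w(1) G(1)] by blast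
  have bA: "b \<in> A" using b G by blast
  have "k \<noteq> 0" using w(3) b(2) bA by auto
  have pw: "(x' ^^ m) a = (x ^^ m) a \<and> (x ^^ m) a \<in> A" if "a \<in> A" for a m
  proof (induction m)
    case (Suc m)
    then show ?case using x(2) x'(2) by auto
  qed (use that in simp)
  have xw: "x' w = k \<cdot> x' e + x b" using b(2) endo_add[OF x'(1)] endo_scale[OF x'(1)] x'(2)[OF bA] by simp
  have "x b \<in> A" using x(2) bA by blast
  then have "x' w \<in> A" unfolding xw by (intro subspace_add[OF A(1)] subspace_scale[OF A(1)] x'(3))
  have "0 = (x' ^^ Suc (g - 1)) w" using w(2) by (simp add: K_def)
  also have "\<dots> = (x' ^^ (g - 1)) (x' w)" by (rule funpow_Suc_right_app)
  also have "\<dots> = (x ^^ (g - 1)) (x' w)" using pw[OF \<open>x' w \<in> A\<close>] by blast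
  also have "\<dots> = k \<cdot> (x ^^ (g - 1)) (x' e) + (x ^^ (g - 1)) (x b)"
    unfolding xw using endo_add[OF endo_funpow[OF x(1)]] endo_scale[OF endo_funpow[OF x(1)]] by simp
  also have "(x ^^ (g - 1)) (x b) = (x ^^ g) b" using funpow_Suc_right_app[of "g - 1" x b] n(1) by simp
  finally have "k \<cdot> (x ^^ (g - 1)) (x' e) = - ((x ^^ g) b)" by (simp add: eq_neg_iff_add_eq_0)
  then have "(1/k) \<cdot> (k \<cdot> (x ^^ (g - 1)) (x' e)) = (- (1/k)) \<cdot> (x ^^ g) b" by simp
  then have "(x ^^ (g - 1)) (x' e) = (x ^^ g) ((- (1/k)) \<cdot> b)"
    using \<open>k \<noteq> 0\<close> endo_scale[OF endo_funpow[OF x(1), of g], of "- (1/k)" b] by simp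
  then show False using n(2) subspace_scale[OF G(1) b(1)] by blast
qed

text \<open>
  The condition of \<open>bordered_J\<close> is open along a curve of frames on which the dimension of
  \<open>x\<^sup>g G\<close> is constant, which is the case within a stratum.
\<close>

lemma bordered_condition_open:
  assumes x: "endo x" and u: "\<And>j. pvec (range poly) (\<lambda>s. u s j)" and v: "pvec (range poly) v"
    and n: "(x ^^ (g - 1)) (v s0) \<notin> (x ^^ g) ` fspan (u s0) m"
  shows "\<forall>\<^sub>F s in cofinite. dim ((x ^^ g) ` fspan (u s) m) = dim ((x ^^ g) ` fspan (u s0) m)
           \<longrightarrow> (x ^^ (g - 1)) (v s) \<notin> (x ^^ g) ` fspan (u s) m"
proof -
  let ?f = "\<lambda>s. (x ^^ (g - 1)) (v s)" and ?fs = "map (\<lambda>j s. (x ^^ g) (u s j)) [0..<m]"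
  have X: "set (map (\<lambda>h. h s) ?fs) = (\<lambda>j. (x ^^ g) (u s j)) ` {..<m}" for s by auto
  have sp: "span (set (map (\<lambda>h. h s) ?fs)) = (x ^^ g) ` fspan (u s) m" for s
    unfolding X by (rule fspan_funpow[OF x])
  have d: "dim (set (map (\<lambda>h. h s) ?fs)) = dim ((x ^^ g) ` fspan (u s) m)" for s
    using sp[of s] by (metis dim_span)
  have pf: "pvec (range poly) ?f" by (rule pvec_endo[OF endo_funpow[OF x] v])
  have pfs: "\<And>h. h \<in> set ?fs \<Longrightarrow> pvec (range poly) h" using pvec_endo[OF endo_funpow[OF x] u] by auto
  have "\<exists>q\<in>range poly. q s0 \<noteq> 0 \<and> (\<forall>s. q s \<noteq> 0 \<longrightarrow>
     dim (set (map (\<lambda>h. h s) ?fs)) \<le> dim (set (map (\<lambda>h. h s0) ?fs)) \<longrightarrow> ?f s \<notin> span (set (map (\<lambda>h. h s) ?fs)))"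
    by (rule not_in_span_open[OF palg_poly pf pfs]) (use n in \<open>simp_all only: sp not_False_eq_True\<close>)
  then obtain q where q: "q \<in> range poly" "q s0 \<noteq> 0" and
    Q: "\<forall>s. q s \<noteq> 0 \<longrightarrow> dim ((x ^^ g) ` fspan (u s) m) \<le> dim ((x ^^ g) ` fspan (u s0) m)
          \<longrightarrow> ?f s \<notin> (x ^^ g) ` fspan (u s) m"
    unfolding sp d by (elim bexE conjE)
  show ?thesis using cofinite_poly[OF q] by (rule eventually_mono) (use Q in simp)
qed

text \<open>
  Pairs in minimal position. The last condition is carried along so that the complete flag \<open>F'\<close>, when
  only the members at the ends of weakly decreasing blocks are kept, is still compatible with \<open>x\<close>.
\<close>

definition generic_pair :: "('b \<Rightarrow> 'b) \<Rightarrow> nat \<Rightarrow> nat list \<Rightarrow> 'b set \<Rightarrow> (nat \<Rightarrow> 'b set) \<Rightarrow> (nat \<Rightarrow> 'b set) \<Rightarrow> bool" where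
  "generic_pair x n w W F F' \<longleftrightarrow> cflag x n F W \<and> has_profile x n F (ins w) \<and> word_flag x w F' W
     \<and> (\<forall>i\<le>n. \<forall>k\<le>length w. dim (F i \<inter> F' k) \<le> cnt w k i)
     \<and> (\<forall>k\<le>length w. \<forall>l<k. descending w l k \<longrightarrow> x ` F' k \<subseteq> F' l)"

lemma generic_pair_image:
  assumes x: "endo x" and gp: "generic_pair x n w W F F'" and h: "endo h" "inj_on h W" "\<And>a. a \<in> W \<Longrightarrow> h (x a) = x' (h a)"
  shows "generic_pair x' n w (h ` W) (\<lambda>i. h ` F i) (\<lambda>k. h ` F' k)"
proof -
  have F: "cflag x n F W" and p: "has_profile x n F (ins w)" and wf: "word_flag x w F' W"
    and d: "\<And>i k. i \<le> n \<Longrightarrow> k \<le> length w \<Longrightarrow> dim (F i \<inter> F' k) \<le> cnt w k i"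
    and ch: "\<And>k l. k \<le> length w \<Longrightarrow> l < k \<Longrightarrow> descending w l k \<Longrightarrow> x ` F' k \<subseteq> F' l"
    using gp by (auto simp: generic_pair_def)
  have F': "cflag x (length w) F' W" using wf by (simp add: word_flag_def)
  have W: "subspace W" "x ` W \<subseteq> W" using cflag_top[OF F x] by auto
  have FW: "F i \<subseteq> W" if "i \<le> n" for i using cflag_top(4)[OF F x that] .
  have F'W: "F' k \<subseteq> W" if "k \<le> length w" for k using cflag_top(4)[OF F' x that] .
  have jcol: "jcol x' (h ` U) c = jcol x U c" if "U \<subseteq> W" for U c by (rule jcol_image[OF h W(2,1) that x])
  have "cflag x' n (\<lambda>i. h ` F i) (h ` W)" by (rule cflag_image[OF F h(1) order_refl h(3) x])
  moreover have "has_profile x' n (\<lambda>i. h ` F i) (ins w)"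
    using p jcol[OF FW] by (simp add: has_profile_def)
  moreover have "word_flag x' w (\<lambda>k. h ` F' k) (h ` W)"
    unfolding word_flag_def using cflag_image[OF F' h(1) order_refl h(3) x] wf jcol[OF F'W] by (simp add: word_flag_def)
  moreover have "dim (h ` F i \<inter> h ` F' k) \<le> cnt w k i" if "i \<le> n" "k \<le> length w" for i k
  proof -
    have "h ` F i \<inter> h ` F' k = h ` (F i \<inter> F' k)" using inj_on_image_Int[OF h(2) FW[OF that(1)] F'W[OF that(2)]] by simp
    also have "dim \<dots> \<le> dim (F i \<inter> F' k)" by (rule self.dim_image_le[OF h(1)])
    finally show ?thesis using d[OF that] by simp
  qed
  moreover have "x' ` h ` F' k \<subseteq> h ` F' l" if k: "k \<le> length w" "l < k" "descending w l k" for k l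
  proof
    fix y assume "y \<in> x' ` h ` F' k"
    then obtain a where a: "a \<in> F' k" "y = x' (h a)" by blast
    then have "a \<in> W" using F'W[OF k(1)] by blast
    then have "y = h (x a)" using h(3) a by simp
    then show "y \<in> h ` F' l" using ch[OF k] a by blast
  qed
  ultimately show ?thesis by (simp add: generic_pair_def)
qed

text \<open>
  Induction on the word. Choose a hyperplane \<open>A\<close> of \<open>W\<close> whose type is the shape for the shortened word \<open>w\<close>,
  and a minimal pair \<open>G\<close>, \<open>G'\<close> on \<open>A\<close>. On the other hand there is a flag \<open>F1\<close> on \<open>W\<close> in the stratum of the
  whole word and in the best position with respect to \<open>A\<close>; so \<open>F1 \<inter> A\<close> lies in the stratum of \<open>G\<close>, and
  \<open>F1\<close> arises from it by adding a vector \<open>e\<close> at step \<open>z\<close>. Join \<open>G\<close> to \<open>F1 \<inter> A\<close> by a curve. A general point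
  \<open>H\<close> of it is as good as \<open>G\<close> with respect to \<open>G'\<close> and as good as \<open>F1 \<inter> A\<close> with respect to adding \<open>e\<close>.
  The image of \<open>e\<close> has to move along with \<open>H\<close>, since it must lie in the member before step \<open>z\<close>. The
  result is a minimal pair for an operator \<open>x'\<close> that agrees with \<open>x\<close> on \<open>A\<close>; on \<open>W\<close> it has the same
  type as \<open>x\<close>, hence is conjugate to it.
\<close>

lemma exists_generic_pair:
  assumes inf: "infinite (UNIV :: 'a set)" and x: "endo x"
  shows "letters n w \<Longrightarrow> subspace W \<Longrightarrow> x ` W \<subseteq> W \<Longrightarrow> W \<subseteq> K x N \<Longrightarrow>
    (\<And>c. jcol x W c = shape_col (ins w) c) \<Longrightarrow> \<exists>F F'. generic_pair x n w W F F'"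
proof (induction w arbitrary: W rule: rev_induct)
  case Nil
  have "W \<inter> K x N = W" using Nil.prems(4) by (rule Int_absorb2)
  then have "dim W = (\<Sum>c<N. jcol x W c)" using dim_Int_K[OF x Nil.prems(2), of N] by simp
  also have "\<dots> = 0" using Nil.prems(5) by (simp add: shape_col_def)
  finally have "W \<subseteq> {0}" by (simp add: dim_eq_0)
  then have W: "W = {0}" using subspace_0[OF Nil.prems(2)] by blast
  have cl0: "jcol x {0} c = 0" for c using Nil.prems(5)[of c] unfolding W by (simp add: shape_col_def)
  have "generic_pair x n [] W (\<lambda>_. {0}) (\<lambda>_. {0})"
    unfolding W generic_pair_def word_flag_def has_profile_def cflag_def
    using endo_0[OF x] by (simp add: cl0 shape_col_def cnt_def)
  then show ?case by blast
next
  case (snoc z w)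
  let ?P = "ins w" and ?d = "length w" and ?Q = "row_insert z (ins w)"
  have lw: "letters n w" and z: "1 \<le> z" "z \<le> n" using snoc.prems(1) by (auto simp: letters_snoc)
  have P: "tableau ?P" by (rule tableau_ins)
  note W = snoc.prems(2,3,4)
  have clW: "jcol x W c = col_upto ?Q n c" for c using snoc.prems(5)[of c] col_upto_shape[OF snoc.prems(1) order_refl, of c] by simp
  define g where "g = new_col z ?P n"
  have Qn: "col_upto ?Q n c = col_upto ?P n c + (if c = g then 1 else 0)" for c
    unfolding g_def by (rule col_upto_row_insert_ge[OF P z(2)])
  have "jcol x W (Suc g) < jcol x W g"
  proof -
    have "col_upto ?Q n (Suc g) = col_upto ?Q (Suc n) (Suc g)"
      using col_upto_shape[OF snoc.prems(1), of n "Suc g"] col_upto_shape[OF snoc.prems(1), of "Suc n" "Suc g"] by simp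
    also have "\<dots> \<le> col_upto ?P n g" using z(1) by (intro col_upto_row_insert_Suc[OF P]) simp
    also have "\<dots> < col_upto ?Q n g" using Qn[of g] by simp
    finally show ?thesis unfolding clW .
  qed
  then obtain A where A: "subspace A" "A \<subseteq> W" "x ` W \<inter> W \<subseteq> A" "dim W = Suc (dim A)" "J x W A = {c. g \<le> c}"
    using exists_hyperplane_of_type[OF x W(1), of g] by blast
  have xWA: "x ` W \<subseteq> A" using A(3) W(2) by blast
  have hyp: "dim W \<le> Suc (dim A)" using A(4) by simp
  have top: "J x W A = Jins z ?P n" unfolding A(5) Jins_def g_def using z by simp
  have clA: "jcol x A c = shape_col ?P c" for c
  proof -
    have WA: "W \<inter> A = A" using A(2) by (rule Int_absorb1)
    have "jcol x W c = jcol x A c + (if c = g then 1 else 0)"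
    proof -
      have "(c \<in> J x W A \<and> (c = 0 \<or> c - 1 \<notin> J x W A)) = (c = g)" unfolding A(5) by auto
      then show ?thesis using jcol_hyperplane[OF x A(1) W(1) A(2) hyp W(1) order_refl, of c] by (simp only: WA)
    qed
    then have "jcol x A c = col_upto ?P n c" using clW[of c] Qn[of c] by simp
    then show ?thesis using col_upto_shape[OF lw order_refl] by simp
  qed
  have xA: "x ` A \<subseteq> A" using xWA A(2) by blast
  have AK: "A \<subseteq> K x N" using A(2) W(3) by blast
  obtain G G' where gp: "generic_pair x n w A G G'" using snoc.IH[OF lw A(1) xA AK clA] by blast
  have G: "cflag x n G A" and Gp: "has_profile x n G ?P" and wf: "word_flag x w G' A"
    and Gd: "\<And>i k. i \<le> n \<Longrightarrow> k \<le> ?d \<Longrightarrow> dim (G i \<inter> G' k) \<le> cnt w k i"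
    and Gch: "\<And>k l. k \<le> ?d \<Longrightarrow> l < k \<Longrightarrow> descending w l k \<Longrightarrow> x ` G' k \<subseteq> G' l"
    using gp by (auto simp: generic_pair_def)
  have G': "cflag x ?d G' A" using wf by (simp add: word_flag_def)
  have G'A: "G' k \<subseteq> A" if "k \<le> ?d" for k using cflag_top(4)[OF G' x that] .
  \<comment> \<open>a flag on \<open>W\<close> whose restriction to \<open>A\<close> has the profile of \<open>w\<close>\<close>
  have Qent: "\<forall>y\<in>set (concat ?Q). 1 \<le> y \<and> y \<le> n"
    using set_ins[of "w @ [z]"] snoc.prems(1) unfolding letters_def ins_snoc by (simp only:)
  obtain F0 where F0: "cflag x n F0 W" "has_profile x n F0 ?Q"
    using exists_flag[OF x W tableau_row_insert[OF P] Qent] snoc.prems(5) by auto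
  obtain F1 where F1: "cflag x n F1 W" "has_profile x n F1 ?Q" "\<And>i. i \<le> n \<Longrightarrow> J x (F1 i) A = Jins z ?P i"
    using exists_reverse_insertion_flag[OF inf x F0(1) A(1,2) hyp xWA P _ F0(2) top] z(1) by auto
  have G1: "cflag x n (\<lambda>i. F1 i \<inter> A) A" by (rule cflag_Int[OF F1(1) A(1,2) xWA x])
  have G1p: "has_profile x n (\<lambda>i. F1 i \<inter> A) ?P" by (rule profile_hyperplane[OF x F1(1) A(1,2) hyp P F1(2,3)])
  have sp: "same_profile x n G (\<lambda>i. F1 i \<inter> A)" using Gp G1p by (simp add: same_profile_def has_profile_def)
  have "\<exists>u. (\<forall>j. pvec (range poly) (\<lambda>s. u s j))
      \<and> (\<forall>\<^sub>F s in cofinite. cflag x n (\<lambda>i. fspan (u s) (dim (G i))) A \<and> same_profile x n (\<lambda>i. fspan (u s) (dim (G i))) G)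
      \<and> (\<forall>i\<le>n. fspan (u 0) (dim (G i)) = G i) \<and> (\<forall>i\<le>n. fspan (u 1) (dim (G i)) = F1 i \<inter> A)"
    by (rule connect[OF x G G1 sp])
  then obtain u where u: "\<And>j. pvec (range poly) (\<lambda>s. u s j)"
      "\<forall>\<^sub>F s in cofinite. cflag x n (\<lambda>i. fspan (u s) (dim (G i))) A \<and> same_profile x n (\<lambda>i. fspan (u s) (dim (G i))) G"
      "\<And>i. i \<le> n \<Longrightarrow> fspan (u 0) (dim (G i)) = G i" "\<And>i. i \<le> n \<Longrightarrow> fspan (u 1) (dim (G i)) = F1 i \<inter> A"
    by blast
  let ?H = "\<lambda>s i. fspan (u s) (dim (G i))"
  \<comment> \<open>the image of \<open>e\<close> is extended to a curve inside the members before step \<open>z\<close>, with constant coefficients\<close>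
  have "new_col z ?P z \<in> J x (F1 z) A" using F1(3)[OF z(2)] by (simp add: Jins_def)
  then obtain e where e: "e \<in> F1 z" "e \<notin> A" unfolding J_def by blast
  have eW: "e \<in> W" using e(1) cflag_top(4)[OF F1(1) x z(2)] by blast
  obtain y where y: "z = Suc y" using z(1) by (cases z) auto
  have yn: "y < n" "y \<le> n" using z y by auto
  have xe: "x e \<in> F1 y \<inter> A" using cflag_step(3)[OF F1(1) yn(1)] e(1) y xWA eW by blast
  obtain a where a: "x e = (\<Sum>j<dim (G y). a j \<cdot> u 1 j)"
    using fspan_coeffs[of "x e" "u 1" "dim (G y)"] xe u(4)[OF yn(2)] by auto
  define v where "v s = (\<Sum>j<dim (G y). a j \<cdot> u s j)" for s
  have v1: "v 1 = x e" by (simp add: v_def a)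
  have pv: "pvec (range poly) v"
    unfolding v_def by (intro pvec_sum pvec_scale palg_poly u(1) palg_const[OF palg_poly])
  have vH: "v s \<in> ?H s y" for s
    unfolding v_def fspan_def by (intro span_sum span_scale span_base) auto
  \<comment> \<open>at \<open>s = 1\<close> the flag is \<open>F1\<close>, for which the condition of \<open>bordered_J\<close> holds\<close>
  have cond1: "(x ^^ (new_col z ?P i - 1)) (v 1) \<notin> (x ^^ new_col z ?P i) ` ?H 1 i" if i: "i \<le> n" "z \<le> i" and g0: "0 < new_col z ?P i" for i
  proof
    let ?g = "new_col z ?P i"
    assume "(x ^^ (?g - 1)) (v 1) \<in> (x ^^ ?g) ` ?H 1 i"
    then obtain b where b: "b \<in> F1 i \<inter> A" "(x ^^ (?g - 1)) (x e) = (x ^^ ?g) b" unfolding v1 u(4)[OF i(1)] by blast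
    have "(x ^^ (?g - 1)) (x e) = (x ^^ ?g) e" using funpow_Suc_right_app[of "?g - 1" x e] g0 by simp
    then have "(x ^^ ?g) (e - b) = 0" using b(2) endo_diff[OF endo_funpow[OF x]] by simp
    then have k: "e - b \<in> K x (Suc (?g - 1))" using g0 by (simp add: K_def)
    have "e \<in> F1 i" using cflag_mono[OF F1(1) i(2,1)] e(1) by blast
    moreover have "b \<in> F1 i" using b(1) by blast
    ultimately have m: "e - b \<in> F1 i" by (rule subspace_diff[OF cflag_subspace[OF F1(1) i(1)]])
    have "e - b \<notin> A"
    proof
      assume "e - b \<in> A"
      then have "(e - b) + b \<in> A" using b(1) by (intro subspace_add[OF A(1)]) auto
      then show False using e(2) by simp
    qed
    then have "?g - 1 \<in> J x (F1 i) A" using k m unfolding J_def by blast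
    then have "?g \<le> ?g - 1" unfolding F1(3)[OF i(1)] Jins_def by simp
    then show False using g0 by simp
  qed
  let ?E = "\<lambda>s i. dim ((x ^^ new_col z ?P i) ` ?H s i) = dim ((x ^^ new_col z ?P i) ` ?H 1 i)
           \<longrightarrow> (x ^^ (new_col z ?P i - 1)) (v s) \<notin> (x ^^ new_col z ?P i) ` ?H s i"
  have o1: "\<forall>\<^sub>F s in cofinite. \<forall>i\<in>{i \<in> {..n}. z \<le> i \<and> 0 < new_col z ?P i}. ?E s i"
  proof (rule eventually_ball_finite)
    show "finite {i \<in> {..n}. z \<le> i \<and> 0 < new_col z ?P i}" by simp
    show "\<forall>i\<in>{i \<in> {..n}. z \<le> i \<and> 0 < new_col z ?P i}. \<forall>\<^sub>F s in cofinite. ?E s i"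
    proof
      fix i assume "i \<in> {i \<in> {..n}. z \<le> i \<and> 0 < new_col z ?P i}"
      then have "i \<le> n" "z \<le> i" "0 < new_col z ?P i" by auto
      then show "\<forall>\<^sub>F s in cofinite. ?E s i" by (intro bordered_condition_open[OF x u(1) pv] cond1)
    qed
  qed
  have o2: "\<forall>\<^sub>F s in cofinite. \<forall>p\<in>{..n} \<times> {..?d}. dim (G' (snd p) \<inter> ?H s (fst p)) \<le> dim (G' (snd p) \<inter> ?H 0 (fst p))"
  proof (rule eventually_ball_finite)
    show "\<forall>p\<in>{..n} \<times> {..?d}. \<forall>\<^sub>F s in cofinite. dim (G' (snd p) \<inter> ?H s (fst p)) \<le> dim (G' (snd p) \<inter> ?H 0 (fst p))"
    proof
      fix p assume "p \<in> {..n} \<times> {..?d}"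
      then have p: "fst p \<le> n" "snd p \<le> ?d" by auto
      show "\<forall>\<^sub>F s in cofinite. dim (G' (snd p) \<inter> ?H s (fst p)) \<le> dim (G' (snd p) \<inter> ?H 0 (fst p))"
        by (rule cofinite_dim_le[OF u(1) cflag_subspace[OF G' p(2)]]) (simp add: u(3)[OF p(1)])
    qed
  qed simp
  have "\<exists>s. (cflag x n (?H s) A \<and> same_profile x n (?H s) G)
      \<and> (\<forall>i\<in>{i \<in> {..n}. z \<le> i \<and> 0 < new_col z ?P i}. ?E s i)
      \<and> (\<forall>p\<in>{..n} \<times> {..?d}. dim (G' (snd p) \<inter> ?H s (fst p)) \<le> dim (G' (snd p) \<inter> ?H 0 (fst p)))"
    by (rule cofinite_ex[OF inf]) (intro eventually_conj u(2) o1 o2)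
  then obtain s where s: "cflag x n (?H s) A" "same_profile x n (?H s) G"
    and sE: "\<forall>i\<in>{i \<in> {..n}. z \<le> i \<and> 0 < new_col z ?P i}. ?E s i"
    and sd: "\<forall>p\<in>{..n} \<times> {..?d}. dim (G' (snd p) \<inter> ?H s (fst p)) \<le> dim (G' (snd p) \<inter> ?H 0 (fst p))"
    by (elim exE conjE)
  have Hp: "has_profile x n (?H s) ?P" using s(2) Gp by (simp add: same_profile_def has_profile_def)
  have Hd: "dim (?H s i \<inter> G' k) \<le> cnt w k i" if "i \<le> n" "k \<le> ?d" for i k
  proof -
    have "(i, k) \<in> {..n} \<times> {..?d}" using that by simp
    then have "dim (G' k \<inter> ?H s i) \<le> dim (G' k \<inter> ?H 0 i)" using sd by fastforce
    then show ?thesis using Gd[OF that] u(3)[OF that(1)] by (simp add: Int_commute)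
  qed
  have HA: "?H s i \<subseteq> A" if "i \<le> n" for i using cflag_top(4)[OF s(1) x that] .
  \<comment> \<open>a perturbation of rank one that vanishes on \<open>A\<close>, so types inside \<open>A\<close> do not change\<close>
  obtain \<phi> where \<phi>: "functional \<phi>" "\<forall>u\<in>A. \<phi> u = 0" "\<phi> e = 1" using exists_functional[OF A(1) e(2)] by blast
  define x' where "x' w = x w + \<phi> w \<cdot> (v s - x e)" for w
  have x': "endo x'" unfolding x'_def by (rule endo_border[OF x \<phi>(1)])
  have x'A: "x' b = x b" if "b \<in> A" for b using \<phi>(2) that by (simp add: x'_def)
  have x'e: "x' e = v s" using \<phi>(3) by (simp add: x'_def)
  have vA: "v s \<in> A" using vH[of s] HA[OF yn(2)] by blast
  have We: "W = span (insert e A)"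
  proof (rule subspace_dim_equal[symmetric])
    show "span (insert e A) \<subseteq> W" using eW A(2) W(1) by (intro span_minimal) auto
    show "dim W \<le> dim (span (insert e A))" using A e by (simp add: dim_insert_subspace)
  qed (use W(1) in auto)
  let ?F = "\<lambda>i. if z \<le> i then span (insert e (?H s i)) else ?H s i"
  have F: "cflag x' n ?F W"
    unfolding We by (rule bordered_flag[OF x s(1) z _ x' x'A x'e]) (use vH[of s] y in simp_all)
  have FA: "?F i \<inter> A = ?H s i" if "i \<le> n" for i
    using span_insert_Int[OF cflag_subspace[OF s(1) that] HA[OF that] A(1) e(2)] HA[OF that] by auto
  have x'W: "x' ` W \<subseteq> A"
  proof
    fix b assume "b \<in> x' ` W"
    then obtain k c where "c \<in> A" "b = x' (k \<cdot> e + c)" using span_insert_elim[OF _ A(1), of _ e] unfolding We by (metis imageE)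
    then have "b = k \<cdot> v s + x c" using endo_add[OF x'] endo_scale[OF x'] x'e x'A by simp
    then show "b \<in> A" using vA \<open>c \<in> A\<close> xA by (auto intro!: subspace_add[OF A(1)] subspace_scale[OF A(1)])
  qed
  have clx': "jcol x' U c = jcol x U c" if "U \<subseteq> A" for U c
  proof -
    have "jcol x' ((\<lambda>b. b) ` U) c = jcol x U c"
      by (rule jcol_image[OF endo_id _ _ xA A(1) that x]) (simp_all add: x'A)
    then show ?thesis by simp
  qed
  have Fprof: "has_profile x' n ?F ?Q"
  proof (rule profile_of_insertion[OF x' F A(1,2) hyp x'W P z(1)])
    show "has_profile x' n (\<lambda>i. ?F i \<inter> A) ?P"
      unfolding has_profile_def
    proof (intro allI impI)
      fix i c assume i: "i \<le> n"
      show "jcol x' (?F i \<inter> A) c = col_upto ?P i c"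
        unfolding FA[OF i] clx'[OF HA[OF i]] using Hp i by (simp add: has_profile_def)
    qed
    show "\<not> ?F i \<subseteq> A" if "i \<le> n" "z \<le> i" for i
    proof
      assume "?F i \<subseteq> A"
      moreover have "e \<in> ?F i" using that(2) by (auto intro: span_base)
      ultimately show False using e(2) by blast
    qed
    show "J x' (?F i) A \<subseteq> Jins z ?P i" if i: "i \<le> n" for i
    proof (cases "z \<le> i")
      case False
      then have "J x' (?F i) A = {}" using HA[OF i] by (auto simp: J_def)
      then show ?thesis by blast
    next
      case True
      let ?g = "new_col z ?P i"
      show ?thesis
      proof (cases "?g = 0")
        case False
        have "dim ((x ^^ ?g) ` ?H s i) + (\<Sum>c<?g. jcol x (?H s i) c) = dim (?H s i)"
          by (rule dim_funpow_image[OF x cflag_subspace[OF s(1) i]])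
        moreover have "dim ((x ^^ ?g) ` (F1 i \<inter> A)) + (\<Sum>c<?g. jcol x (F1 i \<inter> A) c) = dim (F1 i \<inter> A)"
          by (rule dim_funpow_image[OF x cflag_subspace[OF G1 i]])
        moreover have "jcol x (?H s i) c = jcol x (F1 i \<inter> A) c" for c using Hp G1p i by (simp add: has_profile_def)
        moreover have "dim (?H s i) = dim (F1 i \<inter> A)"
          using dim_profile[OF x lw s(1) Hp i] dim_profile[OF x lw G1 G1p i] by simp
        ultimately have "dim ((x ^^ ?g) ` ?H s i) = dim ((x ^^ ?g) ` ?H 1 i)" unfolding u(4)[OF i] by simp
        moreover have "?E s i" using sE i True False by blast
        ultimately have ns: "(x ^^ (?g - 1)) (x' e) \<notin> (x ^^ ?g) ` ?H s i" unfolding x'e by blast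
        have "0 < ?g" using False by simp
        then have "?g \<le> c" if "c \<in> J x' (span (insert e (?H s i))) A" for c
          using bordered_J[OF x xA A(1) e(2) cflag_subspace[OF s(1) i] HA[OF i] x' x'A _ _ ns that] vA unfolding x'e by blast
        then show ?thesis using True by (auto simp: Jins_def)
      qed (use True in \<open>auto simp: Jins_def\<close>)
    qed
  qed
  let ?F' = "G'(Suc ?d := W)"
  have G'd: "G' ?d = A" using G' by (simp add: cflag_def)
  have F': "cflag x' (Suc ?d) ?F' W"
    unfolding cflag_def
  proof (intro conjI allI impI)
    show "?F' 0 = {0}" using G' by (simp add: cflag_def)
    show "subspace (?F' k)" if "k \<le> Suc ?d" for k using cflag_subspace[OF G', of k] W(1) that by (cases "k = Suc ?d") auto
    fix k assume k: "k < Suc ?d"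
    have "?F' k \<subseteq> ?F' (Suc k) \<and> x' ` ?F' (Suc k) \<subseteq> ?F' k"
    proof (cases "k = ?d")
      case True
      then show ?thesis using A(2) x'W G'd by simp
    next
      case False
      then have kd: "k < ?d" using k by simp
      have "x' ` G' (Suc k) = x ` G' (Suc k)" using G'A[of "Suc k"] kd by (intro image_cong refl x'A) auto
      then show ?thesis using cflag_step(1,2)[OF G' kd] kd by simp
    qed
    then show "?F' k \<subseteq> ?F' (Suc k)" "x' ` ?F' (Suc k) \<subseteq> ?F' k" by blast+
  qed simp
  have Fn: "?F n = W" using F by (simp only: cflag_def)
  have clx'W: "jcol x' W c = col_upto ?Q n c" for c
  proof -
    have "jcol x' (?F n) c = col_upto ?Q n c" using Fprof unfolding has_profile_def by blast
    then show ?thesis unfolding Fn .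
  qed
  have wf': "word_flag x' (w @ [z]) ?F' W"
    unfolding word_flag_def
  proof (intro conjI allI impI)
    show "cflag x' (length (w @ [z])) ?F' W" using F' by simp
    fix k c assume k: "k \<le> length (w @ [z])"
    show "jcol x' (?F' k) c = shape_col (ins (take k (w @ [z]))) c"
    proof (cases "k = Suc ?d")
      case True
      then show ?thesis using clx'W[of c] col_upto_shape[OF snoc.prems(1) order_refl, of c] by simp
    next
      case False
      then have kd: "k \<le> ?d" using k by simp
      have "jcol x (G' k) c = shape_col (ins (take k w)) c" using wf kd by (simp add: word_flag_def)
      then show ?thesis using clx'[OF G'A[OF kd]] kd False by simp
    qed
  qed
  have gp': "generic_pair x' n (w @ [z]) W ?F ?F'"
    unfolding generic_pair_def
  proof (intro conjI allI impI)
    show "cflag x' n ?F W" "word_flag x' (w @ [z]) ?F' W" by fact+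
    show p': "has_profile x' n ?F (ins (w @ [z]))" using Fprof by simp
    fix k assume k: "k \<le> length (w @ [z])"
    show "dim (?F i \<inter> ?F' k) \<le> cnt (w @ [z]) k i" if i: "i \<le> n" for i
    proof (cases "k = Suc ?d")
      case True
      have "?F i \<inter> W = ?F i" using cflag_top(4)[OF F x' i] by (rule Int_absorb2)
      then have "dim (?F i \<inter> ?F' k) = dim (?F i)" using True by simp
      also have "\<dots> = length (filter (\<lambda>y. y \<le> i) (w @ [z]))" by (rule dim_profile[OF x' snoc.prems(1) F p' i])
      finally show ?thesis using True by (simp add: cnt_def)
    next
      case False
      then have kd: "k \<le> ?d" using k by simp
      have "?F i \<inter> G' k = ?F i \<inter> A \<inter> G' k" using G'A[OF kd] by blast
      also have "\<dots> = ?H s i \<inter> G' k" unfolding FA[OF i] ..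
      finally have "?F i \<inter> ?F' k = ?H s i \<inter> G' k" using False by simp
      then show ?thesis using Hd[OF i kd] cnt_snoc[OF kd] by simp
    qed
    fix l assume l: "l < k" and desc: "descending (w @ [z]) l k"
    show "x' ` ?F' k \<subseteq> ?F' l"
    proof (cases "k = Suc ?d")
      case False
      then have kd: "k \<le> ?d" using k by simp
      have "descending w l k" using desc kd by (simp add: descending_def)
      then have "x ` G' k \<subseteq> G' l" by (rule Gch[OF kd l])
      moreover have "x' ` G' k = x ` G' k" using G'A[OF kd] by (intro image_cong refl x'A) auto
      ultimately show ?thesis using kd l by simp
    next
      case True
      then have ld: "l \<le> ?d" using l by simp
      have sG: "subspace (G' l)" by (rule cflag_subspace[OF G' ld])
      have xAl: "x ` A \<subseteq> G' l"
      proof (cases "l = ?d")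
        case True
        then show ?thesis using xA G'd by simp
      next
        case False
        then have "l < ?d" using ld by simp
        moreover have "descending w l ?d"
        proof -
          have "drop l (take k (w @ [z])) = drop l w @ [z]" using True ld by simp
          then show ?thesis using desc by (simp add: descending_def sorted_wrt_append)
        qed
        ultimately have "x ` G' ?d \<subseteq> G' l" by (intro Gch) auto
        then show ?thesis by (simp add: G'd)
      qed
      \<comment> \<open>all letters smaller than \<open>z\<close> occur before position \<open>l\<close>, so \<open>H\<close> up to step \<open>z - 1\<close> lies in \<open>G' l\<close>\<close>
      have "v s \<in> G' l"
      proof -
        have "cnt w l y \<le> dim (?H s y \<inter> G' l)" by (rule lower_bound[OF inf x lw s(1) Hp wf yn(2) ld])
        moreover have "cnt w l (z - 1) = cnt w ?d (z - 1)"
          using cnt_descending[OF _ ld z(1)] desc True by simp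
        moreover have "dim (?H s y) = cnt w ?d y" using dim_profile[OF x lw s(1) Hp yn(2)] by (simp add: cnt_def)
        ultimately have "dim (?H s y) \<le> dim (?H s y \<inter> G' l)" using y by simp
        then have "?H s y \<inter> G' l = ?H s y"
          by (intro subspace_dim_equal subspace_inter cflag_subspace[OF s(1) yn(2)] sG) auto
        then show ?thesis using vH[of s] by blast
      qed
      have "x' ` W \<subseteq> G' l"
      proof
        fix b assume "b \<in> x' ` W"
        then obtain k c where c: "c \<in> A" "b = x' (k \<cdot> e + c)" using span_insert_elim[OF _ A(1), of _ e] unfolding We by (metis imageE)
        then have "b = k \<cdot> v s + x c" using endo_add[OF x'] endo_scale[OF x'] x'e x'A by simp
        moreover have "x c \<in> G' l" using xAl c(1) by blast
        ultimately show "b \<in> G' l" using \<open>v s \<in> G' l\<close> by (simp add: subspace_add[OF sG] subspace_scale[OF sG])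
      qed
      then show ?thesis using True ld by simp
    qed
  qed
  \<comment> \<open>\<open>x'\<close> and \<open>x\<close> have the same type on \<open>W\<close>, so the pair can be transported from one to the other\<close>
  have W': "x' ` W \<subseteq> W" "W \<subseteq> K x' n" using cflag_top[OF F x'] by auto
  have cle: "jcol x' W c = jcol x W c" for c by (simp only: clx'W clW)
  obtain h where h: "endo h" "inj_on h W" "h ` W = W" "\<And>w. w \<in> W \<Longrightarrow> h (x' w) = x (h w)"
    using exists_iso[OF x' x W(1) W(1) W'(1) order_refl W'(2) W(1) W(1) W(2) order_refl W(3) cle cle] by blast
  have "generic_pair x n (w @ [z]) (h ` W) (\<lambda>i. h ` ?F i) (\<lambda>k. h ` ?F' k)"
    by (rule generic_pair_image[OF x' gp' h(1,2,4)])
  then show ?case unfolding h(3) by blast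
qed

section \<open>Strata of flags and tableaux\<close>

text \<open>
  The last vectors of the rows generate the chains of a Jordan basis in the sense of \<open>xbasis\<close>.
\<close>

lemma jcol_jordan_basis:
  assumes x: "endo x" and pos: "\<forall>l\<in>set lam. 0 < l" and jb: "jordan_basis scale x W lam b"
  shows "jcol x W c = col_len lam c"
proof -
  have inj: "inj_on (\<lambda>(r, c). b r c) (boxes lam)" and indb: "independent ((\<lambda>(r, c). b r c) ` boxes lam)"
    and sp: "span ((\<lambda>(r, c). b r c) ` boxes lam) = W"
    and xb: "\<And>r c. (r, c) \<in> boxes lam \<Longrightarrow> x (b r c) = (if c = 0 then 0 else b r (c - 1))"
    using jb by (auto simp: jordan_basis_def)
  define t where "t r = b r (lam ! r - 1)" for r
  have posr: "0 < lam ! r" if "r < length lam" for r using pos that by simp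
  have tinj: "inj_on t {..<length lam}"
  proof (rule inj_onI)
    fix r s assume "r \<in> {..<length lam}" "s \<in> {..<length lam}" "t r = t s"
    then show "r = s" using inj_onD[OF inj, of "(r, lam ! r - 1)" "(s, lam ! s - 1)"] posr by (auto simp: t_def boxes_def)
  qed
  define I where "I = t ` {..<length lam}"
  define l where "l s = lam ! (inv_into {..<length lam} t s)" for s
  have lt: "l (t r) = lam ! r" if "r < length lam" for r using tinj that by (simp add: l_def)
  have pw: "k < lam ! r \<Longrightarrow> (x ^^ k) (t r) = b r (lam ! r - 1 - k)" if "r < length lam" for r k
  proof (induction k)
    case (Suc k)
    have "(r, lam ! r - 1 - k) \<in> boxes lam" using that Suc.prems by (auto simp: boxes_def)
    moreover have "lam ! r - 1 - k \<noteq> 0" using Suc.prems by simp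
    ultimately have "x (b r (lam ! r - 1 - k)) = b r (lam ! r - 1 - k - 1)" using xb by simp
    then show ?case using Suc by simp
  qed (simp add: t_def)
  have pw0: "(x ^^ (lam ! r)) (t r) = 0" if r: "r < length lam" for r
  proof -
    obtain k where k: "lam ! r = Suc k" using posr[OF r] by (cases "lam ! r") auto
    have "(r, 0) \<in> boxes lam" using r k by (simp add: boxes_def)
    then have "x (b r 0) = 0" using xb by simp
    then show ?thesis using pw[OF r, of k] k by simp
  qed
  have img: "cvec x ` chains I l = (\<lambda>(r, c). b r c) ` boxes lam"
  proof
    show "cvec x ` chains I l \<subseteq> (\<lambda>(r, c). b r c) ` boxes lam"
    proof
      fix v assume "v \<in> cvec x ` chains I l"
      then obtain r k where r: "r < length lam" "k < lam ! r" "v = (x ^^ k) (t r)"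
        using lt by (auto simp: chains_def cvec_def I_def)
      then have "v = b r (lam ! r - 1 - k)" using pw by simp
      then show "v \<in> (\<lambda>(r, c). b r c) ` boxes lam"
        using r by (intro image_eqI[of _ _ "(r, lam ! r - 1 - k)"]) (auto simp: boxes_def)
    qed
    show "(\<lambda>(r, c). b r c) ` boxes lam \<subseteq> cvec x ` chains I l"
    proof
      fix v assume "v \<in> (\<lambda>(r, c). b r c) ` boxes lam"
      then obtain r c where r: "r < length lam" "c < lam ! r" "v = b r c" by (auto simp: boxes_def)
      then have "v = (x ^^ (lam ! r - 1 - c)) (t r)" using pw[OF r(1), of "lam ! r - 1 - c"] by simp
      then show "v \<in> cvec x ` chains I l"
        using r lt[OF r(1)] by (intro image_eqI[of _ _ "(t r, lam ! r - 1 - c)"]) (auto simp: chains_def cvec_def I_def)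
    qed
  qed
  have "dim W = card ((\<lambda>(r, c). b r c) ` boxes lam)" using indb sp by (metis dim_span_eq_card_independent)
  also have "\<dots> = sum_list lam" using inj by (simp add: card_image card_boxes)
  also have "\<dots> = (\<Sum>r<length lam. lam ! r)" by (simp add: sum_list_sum_nth atLeast0LessThan)
  also have "\<dots> = sum l I" unfolding I_def using tinj lt by (simp add: sum.reindex)
  finally have dW: "sum l I = dim W" by simp
  have "xbasis x W I l"
    unfolding xbasis_def using img sp dW lt pw0 posr by (auto simp: I_def)
  then have "jcol x W c = card {s \<in> I. c < l s \<and> (s, l s - 1 - c) \<in> chains I l}"
    using jcol_span_chains[OF x _ order_refl, of W I l c] img sp by simp
  also have "{s \<in> I. c < l s \<and> (s, l s - 1 - c) \<in> chains I l} = t ` {r. r < length lam \<and> c < lam ! r}"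
    using lt by (auto simp: chains_def I_def)
  also have "card \<dots> = card {r. r < length lam \<and> c < lam ! r}"
    by (rule card_image, rule inj_on_subset[OF tinj]) auto
  also have "\<dots> = col_len lam c" by (simp add: col_len_def length_filter_conv_card)
  finally show ?thesis .
qed

lemma exists_jordan_basis:
  assumes x: "endo x" and W: "subspace W" "x ` W \<subseteq> W" "W \<subseteq> K x N"
  shows "\<exists>lam b. partition_shape lam \<and> jordan_basis scale x W lam b"
proof -
  obtain I l where b: "xbasis x W I l"
    using exists_adapted_xbasis[OF x W(1) W(1) W(2) order_refl W(3)] by blast
  have finI: "finite I" and pos: "\<And>t. t \<in> I \<Longrightarrow> 0 < l t" and zero: "\<And>t. t \<in> I \<Longrightarrow> (x ^^ l t) t = 0"
    and sp: "span (cvec x ` chains I l) = W" using b by (auto simp: xbasis_def)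
  note ind = xbasis_independent[OF b]
  obtain ts0 where ts0: "set ts0 = I" "distinct ts0" using finite_distinct_list[OF finI] by blast
  define ts where "ts = rev (sort_key l ts0)"
  have ts: "set ts = I" "distinct ts" using ts0 by (simp_all add: ts_def)
  have "sorted (map l (sort_key l ts0))" by simp
  then have srt: "sorted_wrt (\<ge>) (map l ts)"
    by (simp only: ts_def rev_map[symmetric] sorted_wrt_rev)
  define lam where "lam = map l ts"
  define bb where "bb r c = (x ^^ (l (ts ! r) - 1 - c)) (ts ! r)" for r c
  have lam: "partition_shape lam" using srt pos ts by (auto simp: partition_shape_def lam_def)
  define f where "f = (\<lambda>(r, c). (ts ! r, l (ts ! r) - 1 - c))"
  have tsI: "ts ! r \<in> I" if "r < length ts" for r using ts(1) that nth_mem by blast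
  have fimg: "f ` boxes lam = chains I l"
  proof
    show "f ` boxes lam \<subseteq> chains I l" using tsI by (auto simp: f_def boxes_def lam_def chains_def)
    show "chains I l \<subseteq> f ` boxes lam"
    proof
      fix p assume "p \<in> chains I l"
      then obtain t k where p: "p = (t, k)" "t \<in> I" "k < l t" by (auto simp: chains_def)
      then obtain r where r: "r < length ts" "ts ! r = t" using ts(1) by (metis in_set_conv_nth)
      then show "p \<in> f ` boxes lam"
        using p by (intro image_eqI[of _ _ "(r, l t - 1 - k)"]) (auto simp: f_def boxes_def lam_def)
    qed
  qed
  have finj: "inj_on f (boxes lam)"
    using ts(2) by (auto simp: inj_on_def f_def boxes_def lam_def nth_eq_iff_index_eq)
  have comp: "(\<lambda>(r, c). bb r c) = cvec x \<circ> f" by (auto simp: bb_def cvec_def f_def)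
  have "inj_on (\<lambda>(r, c). bb r c) (boxes lam)"
    unfolding comp by (rule comp_inj_on[OF finj]) (simp add: fimg ind(1))
  moreover have img: "(\<lambda>(r, c). bb r c) ` boxes lam = cvec x ` chains I l"
    unfolding comp image_comp[symmetric] fimg ..
  moreover have "x (bb r c) = (if c = 0 then 0 else bb r (c - 1))" if "(r, c) \<in> boxes lam" for r c
  proof -
    have rc: "r < length ts" "c < l (ts ! r)" using that by (auto simp: boxes_def lam_def)
    have "x (bb r c) = (x ^^ Suc (l (ts ! r) - 1 - c)) (ts ! r)" by (simp add: bb_def)
    also have "Suc (l (ts ! r) - 1 - c) = l (ts ! r) - c" using rc(2) by simp
    finally have e: "x (bb r c) = (x ^^ (l (ts ! r) - c)) (ts ! r)" .
    show ?thesis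
    proof (cases "c = 0")
      case True
      then show ?thesis using e zero[OF tsI[OF rc(1)]] by simp
    next
      case False
      then have "l (ts ! r) - c = l (ts ! r) - 1 - (c - 1)" by simp
      then show ?thesis using e False by (simp add: bb_def)
    qed
  qed
  ultimately have "jordan_basis scale x W lam bb"
    unfolding jordan_basis_def using ind(2) sp by auto
  then show ?thesis using lam by blast
qed

lemma jordan_type_correct:
  assumes x: "endo x" and W: "subspace W" "x ` W \<subseteq> W" "W \<subseteq> K x N"
  shows "partition_shape (jordan_type scale x W)" "col_len (jordan_type scale x W) c = jcol x W c"
proof -
  obtain lam b where lam: "partition_shape lam" "jordan_basis scale x W lam b" using exists_jordan_basis[OF x W] by blast
  have pos: "\<forall>l\<in>set lam. 0 < l" if "partition_shape lam" for lam using that by (simp add: partition_shape_def)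
  have "jordan_type scale x W = lam"
    unfolding jordan_type_def
  proof (rule the_equality)
    show "partition_shape lam \<and> (\<exists>b. jordan_basis scale x W lam b)" using lam by blast
    fix lam' assume "partition_shape lam' \<and> (\<exists>b. jordan_basis scale x W lam' b)"
    then obtain b' where l': "partition_shape lam'" "jordan_basis scale x W lam' b'" by blast
    show "lam' = lam"
      by (rule partition_eqI[OF l'(1) lam(1)])
        (simp add: jcol_jordan_basis[OF x pos l'(2), symmetric] jcol_jordan_basis[OF x pos lam(2), symmetric] l' lam)
  qed
  then show "partition_shape (jordan_type scale x W)" "col_len (jordan_type scale x W) c = jcol x W c"
    using lam jcol_jordan_basis[OF x pos lam(2)] by simp_all
qed

lemma boxes_jordan_type:
  assumes "endo x" "subspace W" "x ` W \<subseteq> W" "W \<subseteq> K x N"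
  shows "(r, c) \<in> boxes (jordan_type scale x W) \<longleftrightarrow> r < jcol x W c"
  using boxes_col_len[OF jordan_type_correct(1)[OF assms], of r c] jordan_type_correct(2)[OF assms, of c] by simp

lemma spaltenstein_cflag:
  assumes "F \<in> spaltenstein scale x \<mu>"
  shows "cflag x (length \<mu>) (\<lambda>i. F ! i) UNIV"
proof -
  have F: "F ! 0 = {0}" "F ! length \<mu> = UNIV" "\<forall>i\<le>length \<mu>. subspace (F ! i)"
    "\<forall>i\<in>{1..length \<mu>}. F ! (i - 1) \<subseteq> F ! i" "\<forall>i\<in>{1..length \<mu>}. x ` (F ! i) \<subseteq> F ! (i - 1)"
    using assms by (auto simp: spaltenstein_def flags_def)
  have "F ! i \<subseteq> F ! Suc i \<and> x ` (F ! Suc i) \<subseteq> F ! i" if "i < length \<mu>" for i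
  proof -
    have "Suc i \<in> {1..length \<mu>}" using that by simp
    then show ?thesis using F(4,5) by fastforce
  qed
  then show ?thesis using F by (simp add: cflag_def)
qed

text \<open>
  The entry of \<open>flag_tableau\<close> in a box is \<open>\<le> i\<close> if and only if the box belongs to the type on \<open>F\<^sub>i\<close>, as
  these types increase with \<open>i\<close>.
\<close>

lemma flag_tableau_iff:
  assumes x: "endo x" and F: "F \<in> spaltenstein scale x \<mu>" and T: "T \<in> ssyt lam \<mu>"
  shows "flag_tableau scale x F = T \<longleftrightarrow> has_profile x (length \<mu>) (\<lambda>i. F ! i) T"
proof -
  let ?n = "length \<mu>"
  note t = tableau_ssyt[OF T]
  have c: "cflag x ?n (\<lambda>i. F ! i) UNIV" by (rule spaltenstein_cflag[OF F])
  have lF: "length F = Suc ?n" using F by (simp add: spaltenstein_def flags_def)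
  then have last: "last F = F ! ?n" by (metis last_conv_nth length_0_conv nat.distinct(1) diff_Suc_1)
  have inv: "subspace (F ! i)" "x ` (F ! i) \<subseteq> F ! i" "F ! i \<subseteq> K x i" if "i \<le> ?n" for i
  proof -
    show "subspace (F ! i)" "F ! i \<subseteq> K x i" using cflag_subspace[OF c that] cflag_K[OF c that] .
    show "x ` (F ! i) \<subseteq> F ! i"
    proof (cases i)
      case 0
      then show ?thesis using c endo_0[OF x] by (simp add: cflag_def)
    next
      case (Suc j)
      then show ?thesis using cflag_step(1,2)[OF c, of j] that by auto
    qed
  qed
  have bx: "(r, c) \<in> boxes (jordan_type scale x (F ! i)) \<longleftrightarrow> r < jcol x (F ! i) c" if "i \<le> ?n" for i r c
    by (rule boxes_jordan_type[OF x inv[OF that]])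
  have mono: "jcol x (F ! i) c \<le> jcol x (F ! j) c" if "i \<le> j" "j \<le> ?n" for i j c
    by (rule jcol_mono, rule cflag_mono[OF c that])
  define lam' where "lam' = jordan_type scale x (F ! ?n)"
  have lam': "partition_shape lam'" "\<And>c. col_len lam' c = jcol x (F ! ?n) c"
    unfolding lam'_def by (rule jordan_type_correct[OF x inv[OF order_refl]])+
  have ft: "flag_tableau scale x F = map (\<lambda>r. map (\<lambda>c. LEAST i. (r, c) \<in> boxes (jordan_type scale x (F ! i))) [0..<lam' ! r]) [0..<length lam']"
    by (simp add: flag_tableau_def last lam'_def Let_def)
  have boxn: "r < jcol x (F ! ?n) c \<longleftrightarrow> (r, c) \<in> boxes lam'" for r c
    using bx[OF order_refl] by (simp add: lam'_def)
  have inbox: "(r, c) \<in> boxes lam'" if "r < jcol x (F ! i) c" "i \<le> ?n" for r c i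
    using mono[OF that(2) order_refl, of c] that(1) boxn[of r c] by simp
  have entry: "(LEAST i. (r, c) \<in> boxes (jordan_type scale x (F ! i))) \<le> i \<longleftrightarrow> r < jcol x (F ! i) c"
    if i: "i \<le> ?n" and box: "(r, c) \<in> boxes lam'" for i r c
  proof
    let ?P = "\<lambda>i. (r, c) \<in> boxes (jordan_type scale x (F ! i))"
    { assume "r < jcol x (F ! i) c"
      then show "(LEAST i. ?P i) \<le> i" using bx[OF i] by (intro Least_le) simp }
    assume L: "(LEAST i. ?P i) \<le> i"
    have "?P ?n" using box by (simp add: lam'_def)
    then have "?P (LEAST i. ?P i)" by (rule LeastI)
    then have "r < jcol x (F ! (LEAST i. ?P i)) c" using bx[of "LEAST i. ?P i" r c] L i by simp
    also have "\<dots> \<le> jcol x (F ! i) c" by (rule mono[OF L i])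
    finally show "r < jcol x (F ! i) c" .
  qed
  have box: "(r, c) \<in> boxes (map length T) \<longleftrightarrow> r < length T \<and> c < length (T ! r)" for r c by (auto simp: boxes_def)
  have nat_eqI: "a = b" if "\<And>r. r < a \<longleftrightarrow> r < b" for a b :: nat using that by (metis linorder_neqE_nat less_irrefl)
  show ?thesis
  proof
    assume eq: "flag_tableau scale x F = T"
    have ml: "map length T = lam'"
    proof -
      have "map length T = map (\<lambda>r. lam' ! r) [0..<length lam']" unfolding eq[symmetric] ft by simp
      then show ?thesis by (simp add: map_nth)
    qed
    have nth: "T ! r ! c = (LEAST i. (r, c) \<in> boxes (jordan_type scale x (F ! i)))" if "(r, c) \<in> boxes lam'" for r c
      using that unfolding eq[symmetric] ft by (simp add: boxes_def)
    show "has_profile x ?n (\<lambda>i. F ! i) T"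
      unfolding has_profile_def
    proof (intro allI impI nat_eqI)
      fix i c r assume i: "i \<le> ?n"
      have "r < col_upto T i c \<longleftrightarrow> (r, c) \<in> boxes lam' \<and> T ! r ! c \<le> i"
        unfolding less_col_upto_iff[OF t(1)] ml[symmetric] box by blast
      also have "\<dots> \<longleftrightarrow> (r, c) \<in> boxes lam' \<and> r < jcol x (F ! i) c" using nth[of r c] entry[OF i, of r c] by auto
      also have "\<dots> \<longleftrightarrow> r < jcol x (F ! i) c" using inbox[OF _ i] by blast
      finally show "r < jcol x (F ! i) c \<longleftrightarrow> r < col_upto T i c" by blast
    qed
  next
    assume "has_profile x ?n (\<lambda>i. F ! i) T"
    then have prof: "\<And>i c. i \<le> ?n \<Longrightarrow> jcol x (F ! i) c = col_upto T i c" by (simp add: has_profile_def)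
    have "\<forall>y\<in>set (concat T). y \<le> ?n" using t(2) by blast
    then have "col_len lam' c = col_len lam c" for c
      using lam'(2)[of c] prof[OF order_refl, of c] col_upto_all[of T ?n c] t(4) by (simp add: shape_col_col_len)
    then have ll: "lam' = lam" by (rule partition_eqI[OF lam'(1) t(3)])
    have lens: "length lam' = length T" "\<And>r. r < length T \<Longrightarrow> lam' ! r = length (T ! r)" using t(4) by (auto simp: ll)
    show "flag_tableau scale x F = T"
      unfolding ft
    proof (rule nth_equalityI)
      fix r assume "r < length (map (\<lambda>r. map (\<lambda>c. LEAST i. (r, c) \<in> boxes (jordan_type scale x (F ! i))) [0..<lam' ! r]) [0..<length lam'])"
      then have r: "r < length T" using lens(1) by simp
      have "map (\<lambda>c. LEAST i. (r, c) \<in> boxes (jordan_type scale x (F ! i))) [0..<lam' ! r] = T ! r"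
      proof (rule nth_equalityI)
        fix c assume "c < length (map (\<lambda>c. LEAST i. (r, c) \<in> boxes (jordan_type scale x (F ! i))) [0..<lam' ! r])"
        then have c: "c < length (T ! r)" "c < lam' ! r" using lens(2)[OF r] by simp_all
        have bxr: "(r, c) \<in> boxes lam'" using r c lens(1) by (simp add: boxes_def)
        let ?L = "LEAST i. (r, c) \<in> boxes (jordan_type scale x (F ! i))"
        have iff: "?L \<le> i \<longleftrightarrow> T ! r ! c \<le> i" if "i \<le> ?n" for i
          using entry[OF that bxr] prof[OF that, of c] less_col_upto_iff[OF t(1), of r i c] r c by simp
        have "T ! r ! c \<in> set (concat T)" using r c by (auto intro!: nth_mem bexI[of _ "T ! r"])
        then have Tn: "T ! r ! c \<le> ?n" using t(2) by blast
        then have "?L \<le> T ! r ! c" using iff by simp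
        moreover have "T ! r ! c \<le> ?L" using iff[of ?L] calculation Tn by simp
        ultimately have "?L = T ! r ! c" by simp
        then show "map (\<lambda>c. LEAST i. (r, c) \<in> boxes (jordan_type scale x (F ! i))) [0..<lam' ! r] ! c = T ! r ! c" using c by simp
      qed (simp add: lens(2)[OF r])
      then show "map (\<lambda>r. map (\<lambda>c. LEAST i. (r, c) \<in> boxes (jordan_type scale x (F ! i))) [0..<lam' ! r]) [0..<length lam'] ! r = T ! r"
        using r lens(1) by simp
    qed (simp add: lens(1))
  qed
qed

text \<open>
  The dimensions of the members follow from their types and the content of \<open>T\<close>.
\<close>

lemma cflag_spaltenstein:
  assumes x: "endo x" and F: "cflag x (length \<mu>) F UNIV" and T: "T \<in> ssyt lam \<mu>" and prof: "has_profile x (length \<mu>) F T"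
  shows "map F [0..<Suc (length \<mu>)] \<in> tableau_stratum scale x \<mu> T"
proof -
  let ?n = "length \<mu>" and ?F = "map F [0..<Suc (length \<mu>)]"
  note t = tableau_ssyt[OF T]
  have nth: "?F ! i = F i" if "i \<le> ?n" for i using that by (simp only: nth_map length_upt nth_upt) (simp add: less_Suc_eq_le nth_append)
  have d: "dim (F i) = length (filter (\<lambda>y. y \<le> i) (concat T))" if "i \<le> ?n" for i
    using cflag_dim[OF F x that] prof that sum_col_upto[OF tableau_rows[OF t(1)] t(2)] by (simp add: has_profile_def)
  have step: "dim (F i) = dim (F (i - 1)) + \<mu> ! (i - 1)" if i: "i \<in> {1..?n}" for i
  proof -
    have "length (filter (\<lambda>y. y \<le> i) xs) = length (filter (\<lambda>y. y \<le> i - 1) xs) + count_list xs i" for xs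
      using i by (induction xs) auto
    moreover have "i \<le> ?n" "i - 1 \<le> ?n" using i by auto
    ultimately show ?thesis using d[of i] d[of "i - 1"] t(5)[OF i] by simp
  qed
  have "?F \<in> flags scale \<mu>"
    unfolding flags_def
  proof (intro CollectI conjI allI impI ballI)
    show "length ?F = Suc ?n" by simp
    show "?F ! 0 = {0}" "?F ! ?n = UNIV" using F nth by (simp_all add: cflag_def del: upt_Suc)
    show "subspace (?F ! i)" if "i \<le> ?n" for i using cflag_subspace[OF F that] nth[OF that] by simp
    fix i assume i: "i \<in> {1..?n}"
    then obtain j where j: "i = Suc j" "j < ?n" by (cases i) auto
    have n: "?F ! i = F i" "?F ! (i - 1) = F (i - 1)" using nth i by (auto simp del: upt_Suc)
    show "?F ! (i - 1) \<subseteq> ?F ! i" unfolding n using cflag_step(1)[OF F j(2)] j(1) by simp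
    show "dim (?F ! i) = dim (?F ! (i - 1)) + \<mu> ! (i - 1)" unfolding n by (rule step[OF i])
  qed
  moreover have "x ` (?F ! i) \<subseteq> ?F ! (i - 1)" if i: "i \<in> {1..?n}" for i
  proof -
    obtain j where j: "i = Suc j" "j < ?n" using i by (cases i) auto
    have n: "?F ! i = F i" "?F ! (i - 1) = F (i - 1)" using nth i by (auto simp del: upt_Suc)
    show ?thesis unfolding n using cflag_step(2)[OF F j(2)] j(1) by simp
  qed
  ultimately have sp: "?F \<in> spaltenstein scale x \<mu>" by (simp add: spaltenstein_def del: upt_Suc)
  have "has_profile x ?n (\<lambda>i. ?F ! i) T" using prof nth by (simp add: has_profile_def del: upt_Suc)
  then have "flag_tableau scale x ?F = T" using flag_tableau_iff[OF x sp T] by blast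
  then show ?thesis using sp by (simp add: tableau_stratum_def del: upt_Suc)
qed

lemma flags_eq_map: "F \<in> flags scale \<mu> \<Longrightarrow> map ((!) F) [0..<Suc (length \<mu>)] = F"
  using map_nth[of F] by (simp add: flags_def)

lemma stratum_profile:
  assumes "endo x" "T \<in> ssyt lam \<mu>" "F \<in> tableau_stratum scale x \<mu> T"
  shows "F \<in> flags scale \<mu>" "cflag x (length \<mu>) ((!) F) UNIV" "has_profile x (length \<mu>) ((!) F) T"
  using assms spaltenstein_cflag[of F x \<mu>] flag_tableau_iff[OF assms(1) _ assms(2), of F]
  by (auto simp: tableau_stratum_def spaltenstein_def)

section \<open>Refinement of partial flags along blocks of an array\<close>

lemma word_flag_snoc:
  assumes F: "word_flag x w F H" and W: "subspace W" "H \<subseteq> W" "x ` W \<subseteq> H"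
    and jcol: "\<And>c. jcol x W c = shape_col (ins (w @ [z])) c"
  shows "word_flag x (w @ [z]) (F(Suc (length w) := W)) W"
proof -
  have "cflag x (Suc (length w)) (F(Suc (length w) := W)) W"
    using F W unfolding word_flag_def cflag_def by (auto simp: less_Suc_eq le_Suc_eq)
  then show ?thesis
    using F jcol unfolding word_flag_def by (auto simp: le_Suc_eq)
qed

text \<open>
  The hyperplanes are chosen from the top down, always containing \<open>B\<close>. If the last letter of the block
  adds its box in column \<open>g\<close>, then by \<open>columns_before_block\<close> the types of \<open>W\<close> and \<open>B\<close> agree to the left
  of \<open>g\<close>, but not in \<open>g\<close>; so \<open>W \<inter> ker x\<^sup>g\<close> lies in \<open>B\<close> and \<open>W \<inter> ker x\<^sup>g\<^sup>+\<^sup>1\<close> does not. Every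
  hyperplane that contains \<open>B\<close> and misses a vector of the latter loses its box in column \<open>g\<close>.
\<close>

lemma refine_descending_block:
  assumes x: "endo x" and F: "word_flag x v F B"
  shows "letters n (v @ b) \<Longrightarrow> sorted_wrt (\<ge>) b \<Longrightarrow> subspace W \<Longrightarrow> B \<subseteq> W \<Longrightarrow> x ` W \<subseteq> B \<Longrightarrow> W \<subseteq> K x N \<Longrightarrow>
    (\<And>c. jcol x W c = shape_col (ins (v @ b)) c) \<Longrightarrow>
    \<exists>F'. word_flag x (v @ b) F' W \<and> (\<forall>k\<le>length v. F' k = F k)"
proof (induction b arbitrary: W rule: rev_induct)
  case Nil
  have B: "subspace B" using F cflag_top(1)[OF _ x] by (auto simp: word_flag_def)
  have clB: "jcol x B c = shape_col (ins v) c" for c using F by (auto simp: word_flag_def cflag_def)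
  have "dim (W \<inter> K x N) = dim (B \<inter> K x N)"
    using dim_Int_K[OF x Nil.prems(3), of N] dim_Int_K[OF x B, of N] Nil.prems(7) clB by simp
  moreover have "W \<inter> K x N = W" "B \<inter> K x N = B" using Nil.prems by blast+
  ultimately have "B = W" using B Nil.prems by (intro subspace_dim_equal) auto
  then show ?case using F by auto
next
  case (snoc z b)
  let ?g = "new_col z (ins (v @ b)) n" and ?w = "v @ b @ [z]"
  have B: "subspace B" using F cflag_top(1)[OF _ x] by (auto simp: word_flag_def)
  have lv: "letters n v" "letters n (v @ b)" "z \<le> n" using snoc.prems(1) by (auto simp: letters_def)
  have clB: "jcol x B c = col_upto (ins v) n c" for c
    using F col_upto_shape[OF lv(1) order_refl] by (auto simp: word_flag_def cflag_def)
  have clW: "jcol x W c = col_upto (ins ?w) n c" for c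
    using snoc.prems(7) col_upto_shape[OF snoc.prems(1) order_refl] by simp
  have step: "col_upto (ins ?w) n c = col_upto (ins (v @ b)) n c + (if c = ?g then 1 else 0)" for c
    using ins_snoc[of "v @ b" z] col_upto_row_insert_ge[OF tableau_ins[of "v @ b"] lv(3), of c] by simp
  have sb: "sorted_wrt (\<ge>) b" using snoc.prems(2) by (simp add: sorted_wrt_append)
  have eq: "jcol x B c = jcol x W c" if "c < ?g" for c
    using columns_before_block[OF snoc.prems(2) snoc.prems(1) that] clB clW by simp
  have "dim (W \<inter> K x ?g) = dim (B \<inter> K x ?g)"
    using dim_Int_K[OF x snoc.prems(3), of ?g] dim_Int_K[OF x B, of ?g] eq by simp
  moreover have sub: "subspace (W \<inter> K x c)" "subspace (B \<inter> K x c)" for c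
    using subspace_K[OF x] snoc.prems(3) B by (auto intro: subspace_inter)
  moreover have "B \<inter> K x ?g \<subseteq> W \<inter> K x ?g" using snoc.prems(4) by blast
  ultimately have "B \<inter> K x ?g = W \<inter> K x ?g" by (intro subspace_dim_equal) auto
  then have below: "W \<inter> K x ?g \<subseteq> B" by blast
  have "\<not> W \<inter> K x (Suc ?g) \<subseteq> B"
  proof
    assume "W \<inter> K x (Suc ?g) \<subseteq> B"
    then have "W \<inter> K x (Suc ?g) = B \<inter> K x (Suc ?g)" using snoc.prems(4) by blast
    then have "jcol x W ?g = jcol x B ?g" by (simp add: jcol_def)
    then show False using clB clW step[of ?g] col_upto_ins_mono[OF lv(2), of ?g] by simp
  qed
  then obtain s where s: "s \<in> W" "s \<in> K x (Suc ?g)" "s \<notin> B" by blast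
  obtain H where H: "subspace H" "B \<subseteq> H" "H \<subseteq> W" "s \<notin> H" "dim W = Suc (dim H)"
    using exists_hyperplane[OF B snoc.prems(3,4) s(1,3)] by blast
  have J: "J x W H = {c. ?g \<le> c}"
  proof -
    have "?g \<in> J x W H" using s H(4) by (auto simp: J_def)
    then have "c \<in> J x W H" if "?g \<le> c" for c using J_up[OF x _ that] by blast
    moreover have "c \<notin> J x W H" if "c < ?g" for c
      using K_mono[OF x, of "Suc c" ?g] that below H(2) by (auto simp: J_def)
    ultimately show ?thesis by (auto simp: not_le[symmetric])
  qed
  have WH: "W \<inter> H = H" using H(3) by blast
  have clH: "jcol x H c = shape_col (ins (v @ b)) c" for c
  proof -
    have "jcol x W c = jcol x H c + (if c \<in> J x W H \<and> (c = 0 \<or> c - 1 \<notin> J x W H) then 1 else 0)"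
      using jcol_hyperplane[OF x H(1) snoc.prems(3) H(3) _ snoc.prems(3) order_refl, of c] H(5) WH by simp
    moreover have "(c \<in> J x W H \<and> (c = 0 \<or> c - 1 \<notin> J x W H)) \<longleftrightarrow> c = ?g" unfolding J by auto
    ultimately show ?thesis using clW step[of c] col_upto_shape[OF lv(2) order_refl] by simp
  qed
  have "x ` H \<subseteq> B" "H \<subseteq> K x N" using H(3) snoc.prems(5,6) by blast+
  then obtain G where G: "word_flag x (v @ b) G H" "\<forall>k\<le>length v. G k = F k"
    using snoc.IH[OF lv(2) sb H(1,2) _ _ clH] by blast
  have "x ` W \<subseteq> H" using snoc.prems(5) H(2) by blast
  then have "word_flag x ((v @ b) @ [z]) (G(Suc (length (v @ b)) := W)) W"
    by (rule word_flag_snoc[OF G(1) snoc.prems(3) H(3)]) (use snoc.prems(7) in simp_all)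
  moreover have "\<forall>k\<le>length v. (G(Suc (length (v @ b)) := W)) k = F k" using G(2) by simp
  ultimately show ?case by (metis append_assoc)
qed

lemma refine_flag:
  assumes x: "endo x" and a: "sorted_wrt array_order a" "letters n (map snd a)" "\<And>p. p \<in> set a \<Longrightarrow> 1 \<le> fst p \<and> fst p \<le> m"
    and F: "cflag x m F W" "\<And>j c. j \<le> m \<Longrightarrow> jcol x (F j) c = shape_col (ins (word_upto a j)) c"
  shows "\<exists>G. word_flag x (map snd a) G W \<and> (\<forall>j\<le>m. G (length (word_upto a j)) = F j)"
proof -
  have "j \<le> m \<Longrightarrow> \<exists>G. word_flag x (word_upto a j) G (F j) \<and> (\<forall>j'\<le>j. G (length (word_upto a j')) = F j')" for j
  proof (induction j)
    case 0
    have p: "word_upto a 0 = []" by (rule word_upto_0) (use a(3) in blast)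
    have "word_flag x [] (\<lambda>_. {0}) {0}"
      using F(2)[of 0] F(1) p by (simp add: word_flag_def cflag_def)
    then show ?case using F(1) p by (auto simp: cflag_def)
  next
    case (Suc j)
    then obtain G where G: "word_flag x (word_upto a j) G (F j)" "\<forall>j'\<le>j. G (length (word_upto a j')) = F j'" by auto
    let ?b = "map snd (filter (\<lambda>p. fst p = Suc j) a)"
    have ps: "word_upto a (Suc j) = word_upto a j @ ?b" by (rule word_upto_Suc[OF a(1)])
    have "letters n (word_upto a (Suc j))" using a(2) by (auto simp: letters_def word_upto_def)
    then have l: "letters n (word_upto a j @ ?b)" unfolding ps .
    have jm: "j < m" "Suc j \<le> m" using Suc.prems by simp_all
    have "F (Suc j) \<subseteq> K x (Suc j)" by (rule cflag_K[OF F(1) jm(2)])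
    moreover have "jcol x (F (Suc j)) c = shape_col (ins (word_upto a j @ ?b)) c" for c
      using F(2)[OF jm(2), of c] unfolding ps .
    ultimately obtain G' where G': "word_flag x (word_upto a j @ ?b) G' (F (Suc j))" "\<forall>k\<le>length (word_upto a j). G' k = G k"
      using refine_descending_block[OF x G(1) l block_descending[OF a(1)] cflag_subspace[OF F(1) jm(2)]
          cflag_step(1,2)[OF F(1) jm(1)]] by blast
    have "G' (length (word_upto a j')) = F j'" if "j' \<le> Suc j" for j'
    proof (cases "j' = Suc j")
      case True
      then show ?thesis using G'(1) ps by (simp add: word_flag_def cflag_def)
    next
      case False
      then have "j' \<le> j" using that by simp
      then show ?thesis using G(2) G'(2) length_word_upto_mono[OF a(1) \<open>j' \<le> j\<close>] by simp
    qed
    then show ?case using G'(1) ps by auto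
  qed
  from this[OF order_refl] obtain G where G: "word_flag x (word_upto a m) G (F m)" "\<forall>j'\<le>m. G (length (word_upto a j')) = F j'" by blast
  moreover have "word_upto a m = map snd a" by (rule word_upto_full) (use a(3) in blast)
  moreover have "F m = W" using F(1) by (simp add: cflag_def)
  ultimately show ?thesis by auto
qed

section \<open>Relative positions of strata and the correspondence\<close>

lemma strata_lower_bound:
  assumes inf: "infinite (UNIV :: 'a set)" and x: "endo x"
    and T: "T \<in> ssyt lam \<mu>" "T' \<in> ssyt lam \<nu>" and a: "sorted_wrt array_order a" "rsk a = (T, T')"
    and F: "F \<in> tableau_stratum scale x \<mu> T" "F' \<in> tableau_stratum scale x \<nu> T'"
    and i: "i \<le> length \<mu>" and j: "j \<le> length \<nu>"
  shows "corner a i j \<le> dim (F ! i \<inter> F' ! j)"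
proof -
  note r = rsk_letters[OF T a(2)]
  note p = stratum_profile[OF x T(1) F(1)] and p' = stratum_profile[OF x T(2) F(2)]
  have "\<exists>G. word_flag x (map snd a) G UNIV \<and> (\<forall>j\<le>length \<nu>. G (length (word_upto a j)) = F' ! j)"
    by (rule refine_flag[OF x a(1) r(1) _ p'(2)])
      (use r(2) p'(3) recording_profile[OF a] in \<open>auto simp: has_profile_def\<close>)
  then obtain G where G: "word_flag x (map snd a) G UNIV" "\<forall>j\<le>length \<nu>. G (length (word_upto a j)) = F' ! j" by blast
  have "length (word_upto a j) \<le> length (map snd a)" by (simp add: word_upto_def)
  then have "cnt (map snd a) (length (word_upto a j)) i \<le> dim (F ! i \<inter> G (length (word_upto a j)))"
    using p(3) by (intro lower_bound[OF inf x r(1) p(2) _ G(1) i]) (simp add: r(3))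
  then show ?thesis using G(2) j cnt_word_upto[OF a(1)] by simp
qed

text \<open>
  The member of index \<open>j\<close> of the second flag is the member of the complete flag reached after the
  letters below the upper entries \<open>\<le> j\<close>.
\<close>

lemma strata_generic_pair:
  assumes inf: "infinite (UNIV :: 'a set)" and x: "endo x" and N: "(UNIV :: 'b set) \<subseteq> K x N"
    and T: "T \<in> ssyt lam \<mu>" "T' \<in> ssyt lam \<nu>" and lam: "\<And>c. jcol x UNIV c = col_len lam c"
    and a: "sorted_wrt array_order a" "rsk a = (T, T')"
  shows "\<exists>F\<in>tableau_stratum scale x \<mu> T. \<exists>F'\<in>tableau_stratum scale x \<nu> T'.
     \<forall>i\<le>length \<mu>. \<forall>j\<le>length \<nu>. dim (F ! i \<inter> F' ! j) \<le> corner a i j"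
proof -
  let ?n = "length \<mu>" and ?m = "length \<nu>" and ?w = "map snd a" and ?t = "\<lambda>j. length (word_upto a j)"
  note r = rsk_letters[OF T a(2)]
  have "jcol x UNIV c = shape_col (ins ?w) c" for c
    using lam tableau_ssyt(4)[OF T(1)] r(3) by (simp add: shape_col_col_len)
  then obtain F F' where gp: "generic_pair x ?n ?w UNIV F F'"
    using exists_generic_pair[OF inf x r(1) subspace_UNIV _ N] by blast
  then have g: "cflag x ?n F UNIV" "has_profile x ?n F T" "cflag x (length ?w) F' UNIV"
      "\<And>k c. k \<le> length ?w \<Longrightarrow> jcol x (F' k) c = shape_col (ins (take k ?w)) c"
      "\<And>i k. i \<le> ?n \<Longrightarrow> k \<le> length ?w \<Longrightarrow> dim (F i \<inter> F' k) \<le> cnt ?w k i"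
      "\<And>k l. k \<le> length ?w \<Longrightarrow> l < k \<Longrightarrow> descending ?w l k \<Longrightarrow> x ` F' k \<subseteq> F' l"
    by (simp_all add: generic_pair_def word_flag_def r(3))
  have tl: "?t j \<le> length ?w" for j by (simp add: word_upto_def)
  define H where "H j = F' (?t j)" for j
  have p0: "word_upto a 0 = []" by (rule word_upto_0) (use r(2) in force)
  have pm: "word_upto a ?m = ?w" by (rule word_upto_full) (use r(2) in force)
  have stable: "x ` F' k \<subseteq> F' k" if "k \<le> length ?w" for k
  proof (cases k)
    case 0
    then show ?thesis using g(3) endo_0[OF x] by (simp add: cflag_def)
  next
    case (Suc k')
    then show ?thesis using cflag_step(1,2)[OF g(3), of k'] that by fastforce
  qed
  \<comment> \<open>within a block the letters decrease weakly\<close>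
  have st: "x ` H (Suc j) \<subseteq> H j" for j
  proof (cases "?t j = ?t (Suc j)")
    case True
    then show ?thesis using stable[OF tl] by (simp add: H_def)
  next
    case False
    have "descending ?w (?t j) (?t (Suc j))"
      unfolding descending_def word_upto_prefix[OF a(1)] using block_descending[OF a(1), of j]
      by (simp add: word_upto_Suc[OF a(1)])
    moreover have "?t j < ?t (Suc j)" using False length_word_upto_mono[OF a(1), of j "Suc j"] by simp
    ultimately show ?thesis using g(6)[OF tl] by (simp add: H_def)
  qed
  have cH: "cflag x ?m H UNIV"
    unfolding cflag_def
  proof (intro conjI allI impI)
    show "H 0 = {0}" "H ?m = UNIV" using g(3) p0 pm by (simp_all add: H_def cflag_def)
    show "subspace (H j)" for j unfolding H_def by (rule cflag_subspace[OF g(3) tl])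
    show "H j \<subseteq> H (Suc j)" for j
      unfolding H_def by (rule cflag_mono[OF g(3) length_word_upto_mono[OF a(1)] tl]) simp
  qed (rule st)
  have pH: "has_profile x ?m H T'"
    using g(4)[OF tl] recording_profile[OF a] word_upto_prefix[OF a(1)] by (simp add: has_profile_def H_def)
  have L: "map F [0..<Suc ?n] \<in> tableau_stratum scale x \<mu> T" "map H [0..<Suc ?m] \<in> tableau_stratum scale x \<nu> T'"
    by (rule cflag_spaltenstein[OF x g(1) T(1) g(2)], rule cflag_spaltenstein[OF x cH T(2) pH])
  have nth: "map G [0..<Suc l] ! i = G i" if "i \<le> l" for G :: "nat \<Rightarrow> 'b set" and i l
    using that nth_map[of i "[0..<Suc l]" G] by (simp del: upt_Suc)
  have "dim (map F [0..<Suc ?n] ! i \<inter> map H [0..<Suc ?m] ! j) \<le> corner a i j" if "i \<le> ?n" "j \<le> ?m" for i j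
    using g(5)[OF that(1) tl[of j]] nth[OF that(1)] nth[OF that(2)] cnt_word_upto[OF a(1), of j i] by (simp add: H_def del: upt_Suc)
  then show ?thesis using L by blast
qed

text \<open>
  The relative position is obtained from the dimensions of the intersections by the same inclusion and
  exclusion as the matrix from its corner sums.
\<close>

lemma rel_position_corner:
  assumes F: "F \<in> flags scale \<mu>" "F' \<in> flags scale \<nu>"
    and a: "\<And>p. p \<in> set a \<Longrightarrow> fst p \<in> {1..length \<nu>} \<and> snd p \<in> {1..length \<mu>}"
    and d: "\<And>i j. i \<le> length \<mu> \<Longrightarrow> j \<le> length \<nu> \<Longrightarrow> dim (F ! i \<inter> F' ! j) = corner a i j"
  shows "rel_position scale F F' = (\<lambda>i j. count_list a (j, i))"
proof (intro ext)
  fix i j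
  have len: "length F = Suc (length \<mu>)" "length F' = Suc (length \<nu>)" using F by (simp_all add: flags_def)
  show "rel_position scale F F' i j = count_list a (j, i)"
  proof (cases "i \<in> {1..length \<mu>} \<and> j \<in> {1..length \<nu>}")
    case False
    then have "(j, i) \<notin> set a" using a by force
    then show ?thesis using False len by (auto simp: rel_position_def count_list_0_iff)
  next
    case True
    then obtain i' j' where ij: "i = Suc i'" "j = Suc j'" "i' < length \<mu>" "j' < length \<nu>"
      by (cases i; cases j) auto
    have sub: "subspace (F ! k \<inter> F' ! l)" if "k \<le> length \<mu>" "l \<le> length \<nu>" for k l
      using F that by (auto simp: flags_def intro: subspace_inter)
    have mono: "F ! i' \<subseteq> F ! i" "F' ! j' \<subseteq> F' ! j"
    proof -
      have "\<forall>i\<in>{1..length \<mu>}. F ! (i - 1) \<subseteq> F ! i" "\<forall>j\<in>{1..length \<nu>}. F' ! (j - 1) \<subseteq> F' ! j"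
        using F by (auto simp: flags_def)
      then show "F ! i' \<subseteq> F ! i" "F' ! j' \<subseteq> F' ! j" using True ij by force+
    qed
    have "dim {s + t |s t. s \<in> F ! i \<inter> F' ! j' \<and> t \<in> F ! i' \<inter> F' ! j} + dim ((F ! i \<inter> F' ! j') \<inter> (F ! i' \<inter> F' ! j))
        = dim (F ! i \<inter> F' ! j') + dim (F ! i' \<inter> F' ! j)"
      using dim_sums_Int[OF sub[of i j'] sub[of i' j]] ij by simp
    moreover have "(F ! i \<inter> F' ! j') \<inter> (F ! i' \<inter> F' ! j) = F ! i' \<inter> F' ! j'" using mono by blast
    ultimately have "dim {s + t |s t. s \<in> F ! i \<inter> F' ! j' \<and> t \<in> F ! i' \<inter> F' ! j} + corner a i' j'
        = corner a i j' + corner a i' j"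
      using d[of i' j'] d[of i j'] d[of i' j] ij by simp
    moreover have "corner a i j + corner a i' j' = corner a i j' + corner a i' j + count_list a (j, i)"
      unfolding ij by (rule corner_count)
    moreover have "rel_position scale F F' i j = corner a i j - dim {s + t |s t. s \<in> F ! i \<inter> F' ! j' \<and> t \<in> F ! i' \<inter> F' ! j}"
      using d[of i j] ij len by (simp add: rel_position_def)
    ultimately show ?thesis by linarith
  qed
qed

text \<open>
  Minimal position for \<open>b\<close> compared with the lower bound for \<open>a\<close>. By symmetry, all ordered arrays of a
  pair of tableaux have the same corner sums.
\<close>

lemma corner_le_unique:
  assumes inf: "infinite (UNIV :: 'a set)" and x: "endo x" and N: "(UNIV :: 'b set) \<subseteq> K x N"
    and T: "T \<in> ssyt lam \<mu>" "T' \<in> ssyt lam \<nu>" and lam: "\<And>c. jcol x UNIV c = col_len lam c"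
    and a: "sorted_wrt array_order a" "rsk a = (T, T')" and b: "sorted_wrt array_order b" "rsk b = (T, T')"
    and i: "i \<le> length \<mu>" and j: "j \<le> length \<nu>"
  shows "corner a i j \<le> corner b i j"
proof -
  obtain F F' where F: "F \<in> tableau_stratum scale x \<mu> T" "F' \<in> tableau_stratum scale x \<nu> T'"
    "\<forall>i\<le>length \<mu>. \<forall>j\<le>length \<nu>. dim (F ! i \<inter> F' ! j) \<le> corner b i j"
    using strata_generic_pair[OF inf x N T lam b] by blast
  have "corner a i j \<le> dim (F ! i \<inter> F' ! j)" by (rule strata_lower_bound[OF inf x T a F(1,2) i j])
  then show ?thesis using F(3) i j by fastforce
qed

lemma rsk_matrix_count:
  assumes inf: "infinite (UNIV :: 'a set)" and x: "endo x" and N: "(UNIV :: 'b set) \<subseteq> K x N"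
    and T: "T \<in> ssyt lam \<mu>" "T' \<in> ssyt lam \<nu>" and lam: "\<And>c. jcol x UNIV c = col_len lam c"
    and a: "sorted_wrt array_order a" "rsk a = (T, T')"
  shows "rsk_matrix (length \<mu>) (length \<nu>) T T' = (\<lambda>i j. count_list a (j, i))"
  unfolding rsk_matrix_def
proof (rule the_equality)
  let ?n = "length \<mu>" and ?m = "length \<nu>"
  note r = rsk_letters(2)[OF T a(2)]
  have z: "count_list a (j, i) = 0" if "\<not> (i \<in> {1..?n} \<and> j \<in> {1..?m})" for i j
    using r[of "(j, i)"] that by (auto simp: count_list_0_iff)
  then show "(\<forall>i j. \<not> (i \<in> {1..?n} \<and> j \<in> {1..?m}) \<longrightarrow> count_list a (j, i) = 0)
     \<and> rsk (matrix_array ?n ?m (\<lambda>i j. count_list a (j, i))) = (T, T')"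
    using matrix_array_eq[OF a(1) r] a(2) by simp
  fix M assume M: "(\<forall>i j. \<not> (i \<in> {1..?n} \<and> j \<in> {1..?m}) \<longrightarrow> M i j = 0) \<and> rsk (matrix_array ?n ?m M) = (T, T')"
  let ?b = "matrix_array ?n ?m M"
  have b: "sorted_wrt array_order ?b" "rsk ?b = (T, T')" using M sorted_matrix_array by blast+
  have cnt: "count_list ?b (j, i) = M i j" for i j by (rule count_matrix_array) (use M in blast)
  have eq: "corner a i j = corner ?b i j" if "i \<le> ?n" "j \<le> ?m" for i j
    by (rule antisym[OF corner_le_unique[OF inf x N T lam a b that] corner_le_unique[OF inf x N T lam b a that]])
  show "M = (\<lambda>i j. count_list a (j, i))"
  proof (intro ext)
    fix i j
    show "M i j = count_list a (j, i)"
    proof (cases "i \<in> {1..?n} \<and> j \<in> {1..?m}")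
      case True
      then obtain i' j' where ij: "i = Suc i'" "j = Suc j'" "i' < ?n" "j' < ?m" by (cases i; cases j) auto
      show ?thesis
        using corner_count[of a i' j'] corner_count[of ?b i' j'] eq[of i j] eq[of i' j] eq[of i j'] eq[of i' j'] ij cnt[of j i]
        by simp
    qed (use M z in auto)
  qed
qed

section \<open>The Zariski topology and generic flags\<close>

lemma topology_generated_by_products:
  assumes base: "\<And>p q. p \<in> B \<Longrightarrow> q \<in> B \<Longrightarrow> f p \<inter> f q = f (m p q) \<and> m p q \<in> B"
    and G: "openin (topology_generated_by (f ` B)) G" and v: "v \<in> G"
  shows "\<exists>p\<in>B. v \<in> f p \<and> f p \<subseteq> G"
proof -
  have "generate_topology_on (f ` B) G" using G by (simp add: openin_topology_generated_by_iff)
  then show ?thesis using v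
  proof (induction G)
    case (Int a b)
    then obtain p q where p: "p \<in> B" "v \<in> f p" "f p \<subseteq> a" and q: "q \<in> B" "v \<in> f q" "f q \<subseteq> b" by blast
    have "v \<in> f (m p q)" "f (m p q) \<subseteq> a \<inter> b" "m p q \<in> B" using base[OF p(1) q(1)] p q by blast+
    then show ?case by blast
  qed blast+
qed

lemma palg_polyfun: "palg {p. polyfun scale d p}"
  unfolding palg_def by (auto intro: polyfun.intros)

lemma pvec_nth: "j < d \<Longrightarrow> pvec {p. polyfun scale d p} (\<lambda>vs. vs ! j)"
  unfolding pvec_def by (auto intro: polyfun.coord)

text \<open>
  The generating sets are closed under intersection, since polynomial functions can be multiplied.
\<close>

lemma frame_topology_base:
  assumes "openin (frame_topology scale d) G" "v \<in> G"
  shows "\<exists>p. polyfun scale d p \<and> p v \<noteq> 0 \<and> v \<in> frames scale d \<and> {vs \<in> frames scale d. p vs \<noteq> 0} \<subseteq> G"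
proof -
  let ?f = "\<lambda>p. {vs \<in> frames scale d. p vs \<noteq> 0}"
  have e: "{{vs \<in> frames scale d. p vs \<noteq> 0} |p. polyfun scale d p} = ?f ` {p. polyfun scale d p}" by blast
  have "\<exists>p\<in>{p. polyfun scale d p}. v \<in> ?f p \<and> ?f p \<subseteq> G"
  proof (rule topology_generated_by_products[where m = "\<lambda>p q vs. p vs * q vs"])
    show "openin (topology_generated_by (?f ` {p. polyfun scale d p})) G"
      using assms(1) unfolding frame_topology_def e .
    show "?f p \<inter> ?f q = ?f (\<lambda>vs. p vs * q vs) \<and> (\<lambda>vs. p vs * q vs) \<in> {p. polyfun scale d p}"
      if "p \<in> {p. polyfun scale d p}" "q \<in> {p. polyfun scale d p}" for p q
      using that by (auto intro: polyfun.mult)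
  qed (rule assms(2))
  then show ?thesis by blast
qed

lemma openin_frameI:
  assumes "\<And>v. v \<in> G \<Longrightarrow> \<exists>p. polyfun scale d p \<and> p v \<noteq> 0 \<and> v \<in> frames scale d \<and> {vs \<in> frames scale d. p vs \<noteq> 0} \<subseteq> G"
  shows "openin (frame_topology scale d) G"
proof (subst openin_subopen, rule ballI)
  fix v assume "v \<in> G"
  then obtain p where p: "polyfun scale d p" "p v \<noteq> 0" "v \<in> frames scale d" "{vs \<in> frames scale d. p vs \<noteq> 0} \<subseteq> G"
    using assms by blast
  have "openin (frame_topology scale d) {vs \<in> frames scale d. p vs \<noteq> 0}"
    unfolding frame_topology_def using p(1) by (intro topology_generated_by_Basis) blast
  then show "\<exists>T. openin (frame_topology scale d) T \<and> v \<in> T \<and> T \<subseteq> G" using p by blast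
qed

lemma polyfun_curve:
  assumes "polyfun scale d p" "\<And>j. pvec (range poly) (\<lambda>s. u s j)"
  shows "(\<lambda>s. p (map (u s) [0..<d])) \<in> range poly"
  using assms(1)
proof (induction p)
  case (const a)
  then show ?case by (rule palg_const[OF palg_poly])
next
  case (coord \<phi> i)
  then show ?case using assms(2)[of i] by (simp add: pvec_def)
next
  case (add p q)
  then show ?case by (intro palg_add[OF palg_poly])
next
  case (mult p q)
  then show ?case by (intro palg_mult[OF palg_poly])
qed

lemma sum_list_take_le: "sum_list (take i \<mu>) \<le> sum_list (\<mu> :: nat list)"
  by (metis append_take_drop_id le_add1 sum_list_append)

lemma frame_flag_nth: "i \<le> length \<mu> \<Longrightarrow> frame_flag scale \<mu> vs ! i = span (set (take (sum_list (take i \<mu>)) vs))"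
  unfolding frame_flag_def by (simp only: nth_map length_upt nth_upt) (simp add: nth_append less_Suc_eq_le)

lemma ind_take: "vs \<in> frames scale d \<Longrightarrow> ind (take m vs)"
  using independent_mono[of "set vs" "set (take m vs)"] by (auto simp: frames_def ind_def set_take_subset)

lemma frame_flag_flags:
  assumes vs: "vs \<in> frames scale (sum_list \<mu>)"
  shows "frame_flag scale \<mu> vs \<in> flags scale \<mu>"
proof -
  let ?n = "length \<mu>"
  have len: "length vs = sum_list \<mu>" and spn: "span (set vs) = UNIV" using vs by (auto simp: frames_def)
  have d: "dim (frame_flag scale \<mu> vs ! i) = sum_list (take i \<mu>)" if "i \<le> ?n" for i
  proof -
    let ?t = "take (sum_list (take i \<mu>)) vs"
    have "dim (span (set ?t)) = card (set ?t)" using ind_take[OF vs] by (simp add: ind_def dim_eq_card_independent)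
    also have "\<dots> = length ?t" using ind_take[OF vs] by (intro distinct_card) (simp add: ind_def)
    also have "\<dots> = sum_list (take i \<mu>)" using len sum_list_take_le by simp
    finally show ?thesis using frame_flag_nth[OF that] by simp
  qed
  show ?thesis
    unfolding flags_def
  proof (intro CollectI conjI allI impI ballI)
    show "length (frame_flag scale \<mu> vs) = Suc ?n" by (simp add: frame_flag_def)
    show "frame_flag scale \<mu> vs ! 0 = {0}" by (simp add: frame_flag_nth)
    show "frame_flag scale \<mu> vs ! ?n = UNIV" using len spn by (simp add: frame_flag_nth)
    show "subspace (frame_flag scale \<mu> vs ! i)" if "i \<le> ?n" for i using that by (simp add: frame_flag_nth)
    fix i assume i: "i \<in> {1..?n}"
    then obtain j where j: "i = Suc j" "j < ?n" by (cases i) auto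
    have st: "sum_list (take i \<mu>) = sum_list (take (i - 1) \<mu>) + \<mu> ! (i - 1)" using j by (simp add: take_Suc_conv_app_nth)
    show "frame_flag scale \<mu> vs ! (i - 1) \<subseteq> frame_flag scale \<mu> vs ! i"
      using j st by (auto simp: frame_flag_nth intro!: span_mono set_take_subset_set_take)
    show "dim (frame_flag scale \<mu> vs ! i) = dim (frame_flag scale \<mu> vs ! (i - 1)) + \<mu> ! (i - 1)"
      using d[of i] d[of "i - 1"] i st by auto
  qed
qed

lemma dim_flags: "F \<in> flags scale \<mu> \<Longrightarrow> i \<le> length \<mu> \<Longrightarrow> dim (F ! i) = sum_list (take i \<mu>)"
proof (induction i)
  case (Suc i)
  have "\<forall>i\<in>{1..length \<mu>}. dim (F ! i) = dim (F ! (i - 1)) + \<mu> ! (i - 1)" using Suc.prems by (auto simp: flags_def)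
  moreover have "Suc i \<in> {1..length \<mu>}" using Suc.prems by simp
  ultimately have "dim (F ! Suc i) = dim (F ! i) + \<mu> ! i" by fastforce
  then show ?case using Suc by (simp add: take_Suc_conv_app_nth)
qed (simp add: flags_def)

lemma openin_dim_Int:
  assumes S: "subspace S" and i: "i \<le> length \<mu>"
  shows "openin (flag_topology scale \<mu>) {F \<in> flags scale \<mu>. dim (S \<inter> F ! i) \<le> k}"
  unfolding openin_flag_topology
proof (intro conjI openin_frameI)
  let ?d = "sum_list \<mu>" and ?m = "sum_list (take i \<mu>)"
  show "{F \<in> flags scale \<mu>. dim (S \<inter> F ! i) \<le> k} \<subseteq> flags scale \<mu>" by blast
  let ?G = "{vs \<in> frames scale ?d. frame_flag scale \<mu> vs \<in> {F \<in> flags scale \<mu>. dim (S \<inter> F ! i) \<le> k}}"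
  fix v assume "v \<in> ?G"
  then have v: "v \<in> frames scale ?d" "dim (S \<inter> frame_flag scale \<mu> v ! i) \<le> k" by auto
  let ?fs = "map (\<lambda>j vs. vs ! j) [0..<?m] :: ('b list \<Rightarrow> 'b) list"
  have m: "?m \<le> ?d" by (rule sum_list_take_le)
  have tk: "map (\<lambda>f. f vs) ?fs = take ?m vs" if "vs \<in> frames scale ?d" for vs
    using that m by (intro nth_equalityI) (auto simp: frames_def)
  have "\<exists>q\<in>{p. polyfun scale ?d p}. q v \<noteq> 0 \<and> (\<forall>p. q p \<noteq> 0 \<longrightarrow>
     dim (S \<inter> span (set (map (\<lambda>f. f p) ?fs))) \<le> dim (S \<inter> span (set (map (\<lambda>f. f v) ?fs))))"
  proof (rule dim_Int_span_open[OF palg_polyfun _ S])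
    show "pvec {p. polyfun scale ?d p} f" if "f \<in> set ?fs" for f using that m pvec_nth by auto
    show "ind (map (\<lambda>f. f v) ?fs)" unfolding tk[OF v(1)] by (rule ind_take[OF v(1)])
  qed
  then obtain q where q: "polyfun scale ?d q" "q v \<noteq> 0" and Q: "\<forall>p. q p \<noteq> 0 \<longrightarrow>
     dim (S \<inter> span (set (map (\<lambda>f. f p) ?fs))) \<le> dim (S \<inter> span (set (map (\<lambda>f. f v) ?fs)))" by (elim bexE conjE) simp
  have "vs \<in> ?G" if vs: "vs \<in> frames scale ?d" "q vs \<noteq> 0" for vs
  proof -
    have "dim (S \<inter> span (set (take ?m vs))) \<le> dim (S \<inter> span (set (take ?m v)))"
      using Q vs(2) tk[OF vs(1)] tk[OF v(1)] by metis
    then show ?thesis using v(2) vs(1) frame_flag_flags[OF vs(1)] by (simp add: frame_flag_nth[OF i])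
  qed
  then have "{vs \<in> frames scale ?d. q vs \<noteq> 0} \<subseteq> ?G" by blast
  then show "\<exists>p. polyfun scale ?d p \<and> p v \<noteq> 0 \<and> v \<in> frames scale ?d \<and> {vs \<in> frames scale ?d. p vs \<noteq> 0} \<subseteq> ?G"
    using q v(1) by blast
qed

text \<open>
  Identifies a curve of frames in the sense of \<open>fspan\<close> with a curve in the space of frames.
\<close>

lemma frame_of_curve:
  assumes H: "\<And>i. i \<le> length \<mu> \<Longrightarrow> fspan u (sum_list (take i \<mu>)) = H i" and top: "H (length \<mu>) = UNIV"
    and d: "sum_list \<mu> = dim (UNIV :: 'b set)"
  shows "map u [0..<sum_list \<mu>] \<in> frames scale (sum_list \<mu>)"
    and "frame_flag scale \<mu> (map u [0..<sum_list \<mu>]) = map H [0..<Suc (length \<mu>)]"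
proof -
  let ?d = "sum_list \<mu>" and ?vs = "map u [0..<sum_list \<mu>]"
  have U: "fspan u ?d = UNIV" using H[of "length \<mu>"] top by simp
  then have "ind ?vs" using d by (intro ind_fspan) (simp only:)
  moreover have "span (set ?vs) = UNIV" using U by (simp add: fspan_def atLeast0LessThan)
  ultimately show "?vs \<in> frames scale ?d" by (simp add: frames_def ind_def)
  show "frame_flag scale \<mu> ?vs = map H [0..<Suc (length \<mu>)]"
    unfolding frame_flag_def
  proof (rule map_cong[OF refl])
    fix i assume "i \<in> set [0..<Suc (length \<mu>)]"
    then have i: "i \<le> length \<mu>" by auto
    have "take (sum_list (take i \<mu>)) ?vs = map u [0..<sum_list (take i \<mu>)]"
      using sum_list_take_le[of i \<mu>] by (simp add: take_map)
    then show "span (set (take (sum_list (take i \<mu>)) ?vs)) = H i"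
      using H[OF i] by (simp add: fspan_def atLeast0LessThan)
  qed
qed

text \<open>
  The pullback to a curve of a polynomial function on frames is a polynomial in one variable. Hence
  two open sets that contain two points of the stratum both contain almost all points of a curve
  joining them.
\<close>

lemma stratum_irreducible:
  assumes inf: "infinite (UNIV :: 'a set)" and x: "endo x" and d: "sum_list \<mu> = dim (UNIV :: 'b set)"
    and T: "T \<in> ssyt lam \<mu>"
    and F0: "F0 \<in> tableau_stratum scale x \<mu> T" and F1: "F1 \<in> tableau_stratum scale x \<mu> T"
    and O0: "openin (flag_topology scale \<mu>) O0" "F0 \<in> O0" and O1: "openin (flag_topology scale \<mu>) O1" "F1 \<in> O1"
  shows "\<exists>F \<in> tableau_stratum scale x \<mu> T. F \<in> O0 \<and> F \<in> O1"
proof -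
  let ?n = "length \<mu>" and ?d = "sum_list \<mu>"
  note p0 = stratum_profile[OF x T F0] and p1 = stratum_profile[OF x T F1]
  have sp: "same_profile x ?n ((!) F0) ((!) F1)" using p0(3) p1(3) by (simp add: same_profile_def has_profile_def)
  have "\<exists>u. (\<forall>j. pvec (range poly) (\<lambda>s. u s j))
      \<and> (\<forall>\<^sub>F s in cofinite. cflag x ?n (\<lambda>i. fspan (u s) (dim (F0 ! i))) UNIV
           \<and> same_profile x ?n (\<lambda>i. fspan (u s) (dim (F0 ! i))) ((!) F0))
      \<and> (\<forall>i\<le>?n. fspan (u 0) (dim (F0 ! i)) = F0 ! i) \<and> (\<forall>i\<le>?n. fspan (u 1) (dim (F0 ! i)) = F1 ! i)"
    by (rule connect[OF x p0(2) p1(2) sp])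
  then obtain u where u: "\<And>j. pvec (range poly) (\<lambda>s. u s j)"
    and good: "\<forall>\<^sub>F s in cofinite. cflag x ?n (\<lambda>i. fspan (u s) (dim (F0 ! i))) UNIV
           \<and> same_profile x ?n (\<lambda>i. fspan (u s) (dim (F0 ! i))) ((!) F0)"
    and u0: "\<And>i. i \<le> ?n \<Longrightarrow> fspan (u 0) (dim (F0 ! i)) = F0 ! i"
    and u1: "\<And>i. i \<le> ?n \<Longrightarrow> fspan (u 1) (dim (F0 ! i)) = F1 ! i"
    by blast
  have dm: "dim (F0 ! i) = sum_list (take i \<mu>)" if "i \<le> ?n" for i by (rule dim_flags[OF p0(1) that])
  define v where "v s = map (u s) [0..<?d]" for s
  have U: "F0 ! ?n = UNIV" "F1 ! ?n = UNIV" using p0(1) p1(1) by (auto simp: flags_def)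
  have v0: "v 0 \<in> frames scale ?d" "frame_flag scale \<mu> (v 0) = F0"
  proof -
    have h: "fspan (u 0) (sum_list (take i \<mu>)) = F0 ! i" if "i \<le> ?n" for i using u0[OF that] dm[OF that] by simp
    show "v 0 \<in> frames scale ?d" unfolding v_def using h U(1) d by (rule frame_of_curve(1))
    have "frame_flag scale \<mu> (v 0) = map ((!) F0) [0..<Suc ?n]" unfolding v_def using h U(1) d by (rule frame_of_curve(2))
    then show "frame_flag scale \<mu> (v 0) = F0" unfolding flags_eq_map[OF p0(1)] .
  qed
  have v1: "v 1 \<in> frames scale ?d" "frame_flag scale \<mu> (v 1) = F1"
  proof -
    have h: "fspan (u 1) (sum_list (take i \<mu>)) = F1 ! i" if "i \<le> ?n" for i using u1[OF that] dm[OF that] by simp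
    show "v 1 \<in> frames scale ?d" unfolding v_def using h U(2) d by (rule frame_of_curve(1))
    have "frame_flag scale \<mu> (v 1) = map ((!) F1) [0..<Suc ?n]" unfolding v_def using h U(2) d by (rule frame_of_curve(2))
    then show "frame_flag scale \<mu> (v 1) = F1" unfolding flags_eq_map[OF p1(1)] .
  qed
  have ev: "\<forall>\<^sub>F s in cofinite. v s \<in> frames scale ?d \<longrightarrow> frame_flag scale \<mu> (v s) \<in> Q"
    if Q: "openin (flag_topology scale \<mu>) Q" "v s0 \<in> frames scale ?d" "frame_flag scale \<mu> (v s0) \<in> Q" for Q s0
  proof -
    have "openin (frame_topology scale ?d) {vs \<in> frames scale ?d. frame_flag scale \<mu> vs \<in> Q}"
      using Q(1) by (simp add: openin_flag_topology)
    moreover have "v s0 \<in> {vs \<in> frames scale ?d. frame_flag scale \<mu> vs \<in> Q}" using Q by blast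
    ultimately obtain p where p: "polyfun scale ?d p" "p (v s0) \<noteq> 0"
      "{vs \<in> frames scale ?d. p vs \<noteq> 0} \<subseteq> {vs \<in> frames scale ?d. frame_flag scale \<mu> vs \<in> Q}"
      using frame_topology_base by blast
    have "(\<lambda>s. p (v s)) \<in> range poly" unfolding v_def by (rule polyfun_curve[OF p(1) u])
    then have "\<forall>\<^sub>F s in cofinite. p (v s) \<noteq> 0" using p(2) by (rule cofinite_poly)
    then show ?thesis by (rule eventually_mono) (use p(3) in blast)
  qed
  have "\<exists>s. (cflag x ?n (\<lambda>i. fspan (u s) (dim (F0 ! i))) UNIV \<and> same_profile x ?n (\<lambda>i. fspan (u s) (dim (F0 ! i))) ((!) F0))
     \<and> (v s \<in> frames scale ?d \<longrightarrow> frame_flag scale \<mu> (v s) \<in> O0) \<and> (v s \<in> frames scale ?d \<longrightarrow> frame_flag scale \<mu> (v s) \<in> O1)"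
    by (rule cofinite_ex[OF inf], intro eventually_conj good)
      (rule ev[OF O0(1) v0(1)], simp add: v0(2) O0(2), rule ev[OF O1(1) v1(1)], simp add: v1(2) O1(2))
  then obtain s where s: "cflag x ?n (\<lambda>i. fspan (u s) (dim (F0 ! i))) UNIV" "same_profile x ?n (\<lambda>i. fspan (u s) (dim (F0 ! i))) ((!) F0)"
    and o: "v s \<in> frames scale ?d \<longrightarrow> frame_flag scale \<mu> (v s) \<in> O0" "v s \<in> frames scale ?d \<longrightarrow> frame_flag scale \<mu> (v s) \<in> O1"
    by (elim exE conjE)
  let ?H = "\<lambda>i. fspan (u s) (dim (F0 ! i))"
  have h: "fspan (u s) (sum_list (take i \<mu>)) = ?H i" if "i \<le> ?n" for i using dm[OF that] by simp
  have Hn: "?H ?n = UNIV" using s(1) by (simp add: cflag_def)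
  have vs: "v s \<in> frames scale ?d" unfolding v_def using h Hn d by (rule frame_of_curve(1))
  have "frame_flag scale \<mu> (v s) = map ?H [0..<Suc ?n]" unfolding v_def using h Hn d by (rule frame_of_curve(2))
  moreover have "map ?H [0..<Suc ?n] \<in> tableau_stratum scale x \<mu> T"
    by (rule cflag_spaltenstein[OF x s(1) T]) (use s(2) p0(3) in \<open>simp add: same_profile_def has_profile_def\<close>)
  ultimately show ?thesis using o vs by metis
qed

lemma topspace_flag: "topspace (flag_topology scale \<mu>) = flags scale \<mu>"
proof
  show "topspace (flag_topology scale \<mu>) \<subseteq> flags scale \<mu>"
    unfolding topspace_def by (auto simp: openin_flag_topology)
  have "openin (flag_topology scale \<mu>) {F \<in> flags scale \<mu>. dim ({0} \<inter> F ! 0) \<le> dim (UNIV :: 'b set)}"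
    by (rule openin_dim_Int) simp_all
  moreover have "{F \<in> flags scale \<mu>. dim ({0} \<inter> F ! 0) \<le> dim (UNIV :: 'b set)} = flags scale \<mu>"
    using dim_subset[of _ UNIV] by blast
  ultimately show "flags scale \<mu> \<subseteq> topspace (flag_topology scale \<mu>)" by (metis openin_subset)
qed

lemma openin_dims:
  assumes "finite A" "\<And>a. a \<in> A \<Longrightarrow> subspace (S a) \<and> i a \<le> length \<mu>"
  shows "openin (flag_topology scale \<mu>) {F \<in> flags scale \<mu>. \<forall>a\<in>A. dim (S a \<inter> F ! i a) \<le> k a}"
  using assms
proof (induction A rule: finite_induct)
  case empty
  have "openin (flag_topology scale \<mu>) (topspace (flag_topology scale \<mu>))" by simp
  then show ?case by (simp add: topspace_flag)
next
  case (insert a A)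
  have "{F \<in> flags scale \<mu>. \<forall>a\<in>insert a A. dim (S a \<inter> F ! i a) \<le> k a} =
    {F \<in> flags scale \<mu>. dim (S a \<inter> F ! i a) \<le> k a} \<inter> {F \<in> flags scale \<mu>. \<forall>a\<in>A. dim (S a \<inter> F ! i a) \<le> k a}" by blast
  then show ?case using insert openin_dim_Int[of "S a" "i a" \<mu> "k a"] by (simp add: openin_Int)
qed

text \<open>
  A property that holds on a nonempty open part of a stratum holds generically on the component: the
  stratum is open in its closure, being cut out there by the upper semicontinuous dimensions of
  \<open>F\<^sub>i \<inter> ker x\<^sup>c\<close> taking their least values, and by irreducibility a nonempty open subset is dense.
\<close>

lemma generically_component:
  assumes inf: "infinite (UNIV :: 'a set)" and x: "endo x" and d: "sum_list \<mu> = dim (UNIV :: 'b set)"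
    and T: "T \<in> ssyt lam \<mu>" and F0: "F0 \<in> tableau_stratum scale x \<mu> T"
    and Q: "openin (flag_topology scale \<mu>) Q" "F0 \<in> Q"
    and good: "\<And>F. F \<in> tableau_stratum scale x \<mu> T \<Longrightarrow> F \<in> Q \<Longrightarrow> R F"
  shows "generically (flag_topology scale \<mu>) (component scale x \<mu> T) R"
proof -
  let ?X = "flag_topology scale \<mu>" and ?Y = "spaltenstein scale x \<mu>" and ?S = "tableau_stratum scale x \<mu> T"
  let ?C = "component scale x \<mu> T" and ?n = "length \<mu>"
  have SY: "?S \<subseteq> ?Y" by (auto simp: tableau_stratum_def)
  have Yfl: "?Y \<subseteq> flags scale \<mu>" by (auto simp: spaltenstein_def)
  have C: "F \<in> ?C \<longleftrightarrow> F \<in> ?Y \<and> (\<forall>V. openin ?X V \<longrightarrow> F \<in> V \<longrightarrow> (\<exists>F'\<in>?S. F' \<in> V))" for F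
  proof -
    have "F \<in> ?C \<longleftrightarrow> F \<in> ?Y \<and> (\<forall>V. F \<in> V \<and> openin (subtopology ?X ?Y) V \<longrightarrow> (\<exists>y. y \<in> ?S \<and> y \<in> V))"
      using Yfl by (auto simp: component_def in_closure_of topspace_flag)
    also have "\<dots> \<longleftrightarrow> F \<in> ?Y \<and> (\<forall>V. openin ?X V \<longrightarrow> F \<in> V \<longrightarrow> (\<exists>F'\<in>?S. F' \<in> V))"
      unfolding openin_subtopology using SY by blast
    finally show ?thesis .
  qed
  have SC: "?S \<subseteq> ?C" using C SY by blast
  note p0 = stratum_profile[OF x T F0]
  \<comment> \<open>the dimensions that characterize the stratum\<close>
  define N where "N p = dim (K x (snd p) \<inter> F0 ! (fst p))" for p :: "nat \<times> nat"
  have SN: "dim (K x (snd p) \<inter> F ! (fst p)) = N p" if "F \<in> ?S" "fst p \<le> ?n" for F p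
  proof -
    note p = stratum_profile[OF x T that(1)]
    have "dim (F ! (fst p) \<inter> K x (snd p)) = dim (F0 ! (fst p) \<inter> K x (snd p))"
      using dim_Int_K[OF x cflag_subspace[OF p(2) that(2)]] dim_Int_K[OF x cflag_subspace[OF p0(2) that(2)]] p(3) p0(3) that(2)
      by (simp add: has_profile_def)
    then show ?thesis by (simp add: N_def Int_commute)
  qed
  define Q1 where "Q1 = {F \<in> flags scale \<mu>. \<forall>p\<in>{..?n} \<times> {..?n}. dim (K x (snd p) \<inter> F ! (fst p)) \<le> N p}"
  have Q1: "openin ?X Q1" unfolding Q1_def by (rule openin_dims) (auto simp: subspace_K[OF x])
  have F0Q1: "F0 \<in> Q1" using p0(1) by (simp add: Q1_def N_def)
  \<comment> \<open>members of the closure cannot have smaller dimensions, members of \<open>Q1\<close> cannot have larger ones\<close>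
  have CS: "F \<in> ?S" if F: "F \<in> ?C" "F \<in> Q1" for F
  proof -
    have FY: "F \<in> ?Y" using F(1) C by blast
    have cF: "cflag x ?n ((!) F) UNIV" using spaltenstein_cflag[OF FY] .
    have eq: "dim (F ! i \<inter> K x c) = dim (F0 ! i \<inter> K x c)" if ic: "i \<le> ?n" "c \<le> ?n" for i c
    proof -
      have le: "dim (K x c \<inter> F ! i) \<le> N (i, c)" using F(2) ic unfolding Q1_def by fastforce
      have "\<not> dim (K x c \<inter> F ! i) < N (i, c)"
      proof
        assume lt: "dim (K x c \<inter> F ! i) < N (i, c)"
        let ?V = "{F \<in> flags scale \<mu>. dim (K x c \<inter> F ! i) \<le> N (i, c) - 1}"
        have "openin ?X ?V" by (rule openin_dim_Int[OF subspace_K[OF x] ic(1)])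
        moreover have "F \<in> ?V" using lt FY Yfl by auto
        ultimately obtain F' where "F' \<in> ?S" "F' \<in> ?V" using C F(1) by blast
        then have "N (i, c) \<le> N (i, c) - 1" using SN[of F' "(i, c)"] ic by simp
        then show False using lt by linarith
      qed
      then show ?thesis using le by (simp add: N_def Int_commute)
    qed
    have eq': "dim (F ! i \<inter> K x c) = dim (F0 ! i \<inter> K x c)" if i: "i \<le> ?n" for i c
    proof (cases "c \<le> ?n")
      case False
      then have "K x ?n \<subseteq> K x c" by (intro K_mono[OF x]) simp
      moreover have "F ! i \<subseteq> K x ?n" "F0 ! i \<subseteq> K x ?n"
        using cflag_top(3)[OF cF x] cflag_top(3)[OF p0(2) x] by auto
      ultimately have "F ! i \<inter> K x c = F ! i \<inter> K x ?n" "F0 ! i \<inter> K x c = F0 ! i \<inter> K x ?n" by blast+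
      then show ?thesis using eq[OF i order_refl] by simp
    qed (use eq i in simp)
    have "jcol x (F ! i) c = jcol x (F0 ! i) c" if i: "i \<le> ?n" for i c
      using dim_K_Suc[OF x cflag_subspace[OF cF i], of c] dim_K_Suc[OF x cflag_subspace[OF p0(2) i], of c]
        eq'[OF i, of c] eq'[OF i, of "Suc c"] by simp
    then have "has_profile x ?n ((!) F) T" using p0(3) by (simp add: has_profile_def)
    then have "flag_tableau scale x F = T" using flag_tableau_iff[OF x FY T] by simp
    then show ?thesis using FY by (simp add: tableau_stratum_def)
  qed
  let ?U = "?C \<inter> (Q \<inter> Q1)"
  have opU: "openin (subtopology ?X ?C) ?U"
    using openin_Int[OF Q(1) Q1] by (rule openin_subtopology_Int2)
  have CX: "?C \<subseteq> topspace ?X" using C Yfl by (auto simp: topspace_flag)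
  have "subtopology ?X ?C closure_of ?U = ?C"
  proof
    show "subtopology ?X ?C closure_of ?U \<subseteq> ?C"
      using closure_of_subset_topspace[of "subtopology ?X ?C" ?U] CX by auto
    show "?C \<subseteq> subtopology ?X ?C closure_of ?U"
    proof
      fix F assume F: "F \<in> ?C"
      have "\<exists>y. y \<in> ?U \<and> y \<in> V" if V: "F \<in> V" "openin (subtopology ?X ?C) V" for V
      proof -
        obtain V' where V': "openin ?X V'" "V = V' \<inter> ?C" using V(2) by (auto simp: openin_subtopology)
        then obtain F' where F': "F' \<in> ?S" "F' \<in> V'" using C F V(1) by blast
        obtain G where "G \<in> ?S" "G \<in> V'" "G \<in> Q \<inter> Q1"
          using stratum_irreducible[OF inf x d T F'(1) F0 V'(1) F'(2) openin_Int[OF Q(1) Q1]] Q(2) F0Q1 by blast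
        then show ?thesis using SC V' by blast
      qed
      then show "F \<in> subtopology ?X ?C closure_of ?U" using F CX by (auto simp: in_closure_of)
    qed
  qed
  moreover have "\<forall>F\<in>?U. R F" using CS good by blast
  ultimately show ?thesis using opU unfolding generically_def by blast
qed

end

theorem theorem4p1:
  fixes smul :: "'k::field \<Rightarrow> 'v::ab_group_add \<Rightarrow> 'v"
    and Basis :: "'v set"
    and x :: "'v \<Rightarrow> 'v"
    and d :: nat
    and lam \<mu> \<nu> :: "nat list"
    and T T' :: "nat list list"
  assumes "infinite (UNIV :: 'k set)"
    and "finite_dimensional_vector_space smul Basis"
    and "vector_space.dim smul (UNIV :: 'v set) = d"
    and "nilpotent_endo smul x"
    and "jordan_type smul x UNIV = lam"
    and "composition d \<mu>"
    and "composition d \<nu>"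
    and "T \<in> ssyt lam \<mu>"
    and "T' \<in> ssyt lam \<nu>"
  shows "generically (flag_topology smul \<mu>) (component smul x \<mu> T) (\<lambda>F.
           generically (flag_topology smul \<nu>) (component smul x \<nu> T') (\<lambda>F'.
             rel_position smul F F' = rsk_matrix (length \<mu>) (length \<nu>) T T'))"
proof -
  interpret fdvs smul Basis using assms(2) by (simp add: fdvs_def)
  let ?n = "length \<mu>" and ?m = "length \<nu>"
  note inf = assms(1) and T = assms(8,9)
  have x: "endo x" using assms(4) by (simp add: nilpotent_endo_def)
  obtain N where N: "(UNIV :: 'v set) \<subseteq> K x N" using assms(4) by (auto simp: nilpotent_endo_def K_def)
  have lam: "jcol x UNIV c = col_len lam c" for c
    using jordan_type_correct(2)[OF x subspace_UNIV _ N, of c] assms(5) by simp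
  have d: "sum_list \<mu> = dim (UNIV :: 'v set)" "sum_list \<nu> = dim (UNIV :: 'v set)"
    using assms(3,6,7) by (auto simp: composition_def)
  have "map length T = map length T'" using tableau_ssyt(4)[OF T(1)] tableau_ssyt(4)[OF T(2)] by simp
  then obtain a where a: "rsk a = (T, T')" "sorted_wrt array_order a"
    using rsk_surj[OF tableau_ssyt(1)[OF T(1)] tableau_ssyt(1)[OF T(2)]] by blast
  obtain F0 F0' where F0: "F0 \<in> tableau_stratum smul x \<mu> T" and F0': "F0' \<in> tableau_stratum smul x \<nu> T'"
    and min0: "\<And>i j. i \<le> ?n \<Longrightarrow> j \<le> ?m \<Longrightarrow> dim (F0 ! i \<inter> F0' ! j) \<le> corner a i j"
    using strata_generic_pair[OF inf x N T lam a(2,1)] by blast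
  have rel: "rel_position smul F F' = rsk_matrix ?n ?m T T'"
    if F: "F \<in> tableau_stratum smul x \<mu> T" "F' \<in> tableau_stratum smul x \<nu> T'"
      and le: "\<And>i j. i \<le> ?n \<Longrightarrow> j \<le> ?m \<Longrightarrow> dim (F ! i \<inter> F' ! j) \<le> corner a i j" for F F'
    unfolding rsk_matrix_count[OF inf x N T lam a(2,1)]
  proof (rule rel_position_corner[OF stratum_profile(1)[OF x T(1) F(1)] stratum_profile(1)[OF x T(2) F(2)]])
    show "dim (F ! i \<inter> F' ! j) = corner a i j" if "i \<le> ?n" "j \<le> ?m" for i j
      using le[OF that] strata_lower_bound[OF inf x T a(2,1) F that] by (rule antisym)
  qed (rule rsk_letters(2)[OF T a(1)])
  \<comment> \<open>for fixed \<open>F\<close>, the inner open set bounds the position of \<open>F'\<close> with respect to \<open>F\<close>; the outer one ensures that it is nonempty, as witnessed by \<open>F0'\<close>\<close>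
  let ?A = "{..?n} \<times> {..?m}"
  let ?Q = "{F \<in> flags smul \<mu>. \<forall>p\<in>?A. dim (F0' ! snd p \<inter> F ! fst p) \<le> corner a (fst p) (snd p)}"
  note st = stratum_profile[OF x T(1)] and st' = stratum_profile[OF x T(2)]
  show ?thesis
  proof (rule generically_component[OF inf x d(1) T(1) F0, of ?Q])
    show "openin (flag_topology smul \<mu>) ?Q"
      by (rule openin_dims) (use cflag_subspace[OF st'(2)[OF F0']] in auto)
    show "F0 \<in> ?Q" using st(1)[OF F0] min0 by (auto simp: Int_commute)
    fix F assume F: "F \<in> tableau_stratum smul x \<mu> T" "F \<in> ?Q"
    let ?Q' = "{F' \<in> flags smul \<nu>. \<forall>p\<in>?A. dim (F ! fst p \<inter> F' ! snd p) \<le> corner a (fst p) (snd p)}"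
    show "generically (flag_topology smul \<nu>) (component smul x \<nu> T') (\<lambda>F'. rel_position smul F F' = rsk_matrix ?n ?m T T')"
    proof (rule generically_component[OF inf x d(2) T(2) F0', of ?Q'])
      show "openin (flag_topology smul \<nu>) ?Q'"
        by (rule openin_dims) (use cflag_subspace[OF st(2)[OF F(1)]] in auto)
      show "F0' \<in> ?Q'" using st'(1)[OF F0'] F(2) by (auto simp: Int_commute)
      show "rel_position smul F F' = rsk_matrix ?n ?m T T'"
        if "F' \<in> tableau_stratum smul x \<nu> T'" "F' \<in> ?Q'" for F'
        using that by (intro rel[OF F(1)]) auto
    qed
  qed
qed

end
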